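(* Let $\mathbf{k}$ be a commutative ring, $C$ a categorical $\mathbf{k}$-coalgebra, $\mathbf{\Omega}(C)$ its cobar dg category, and $\mathsf{M}$, $\mathsf{N}$ a right and a left dg module over $\mathbf{\Omega}(C)$. Let $(\mathrm{Bar}_{C_0}(\mathsf{M},\mathbf{\Omega}(C),\mathsf{N}),\partial)$ be the normalized two-sided bar construction and $\mathcal{Q}(\mathsf{M},C,\mathsf{N})=\mathsf{M}\,\square_{C_0}\,C\,\square_{C_0}\,\mathsf{N}$ with the degree $-1$ map $\partial_{\mathcal{Q}}$. Then the maps $$\pi:\mathrm{Bar}_{C_0}(\mathsf{M},\mathbf{\Omega}(C),\mathsf{N})\to\mathcal{Q}(\mathsf{M},C,\mathsf{N}),\quad \alpha:\mathcal{Q}(\mathsf{M},C,\mathsf{N})\to\mathrm{Bar}_{C_0}(\mathsf{M},\mathbf{\Omega}(C),\mathsf{N}),$$ of degree $0$ and $H:\mathrm{Bar}_{C_0}(\mathsf{M},\mathbf{\Omega}(C),\mathsf{N})\to\mathrm{Bar}_{C_0}(\mathsf{M},\mathbf{\Omega}(C),\mathsf{N})$ of degree $+1$, defined in the context, satisfy $$\pi\circ\partial=\partial_{\mathcal{Q}}\circ\pi,\qquad \alpha\circ\partial_{\mathcal{Q}}=\partial\circ\alpha,\qquad H\circ\partial+\partial\circ H=\alpha\circ\pi-\mathrm{id}.$$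
   Context: **Conventions.** $\otimes=\otimes_{\mathbf{k}}$, differentials have degree $-1$. For a set $S$, $\mathbf{k}[S]$ is the coalgebra freely generated by $S$ with $\Delta(s)=s\otimes s$, $\varepsilon(s)=1$. A $\mathbf{k}[S]$-bicomodule $V$ amounts to a decomposition $V=\bigoplus_{x,y\in S}V(x,y)$ (source $x$, target $y$), and the cotensor product is $(V\square W)(x,z)=\bigoplus_yV(x,y)\otimes W(y,z)$. **Categorical coalgebra.** $C=(C,\Delta,d,h)$ where: $C=\bigoplus_{i\ge0}C_i$ is a graded flat $\mathbf{k}$-module; $\Delta:C\to C\otimes C$ is a degree $0$ coassociative coproduct with counit $\varepsilon$, written $\Delta c=\sum c'\otimes c''$; the set $\mathcal{S}(C)=\{x\in C:\Delta x=x\otimes x,\varepsilon(x)=1\}$ is non-empty and $C_0\cong\mathbf{k}[\mathcal{S}(C)]$; $d:C\to C$ is a degree $-1$ graded coderivation with $d|_{C_1}=0$; $h:C\to\mathbf{k}$ is linear of degree $-2$ (supported on $C_2$) with $h\circ d=0$ and $d^2(c)=\sum h(c')c''-\sum c'h(c'')$. $C$ is a $C_0$-bicomodule by composing $\Delta$ with the projection $C\to C_0$ on either side, and $\Delta$ lands in $C\,\square_{C_0}\,C$. Put $\overline C=\bigoplus_{i\ge1}C_i$ and let $\overline\Delta:\overline C\to\overline C\,\square\,\overline C$ be the induced reduced coproduct, with $(k-1)$-fold iterate $\overline\Delta^{(k-1)}(c)=\sum c^{(1)}\otimes\cdots\otimes c^{(k)}$ (identity for $k=1$; zero for $k>|c|$).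 **Cobar dg category $\mathbf{\Omega}(C)$.** Objects $\mathcal{S}(C)$; $\mathbf{\Omega}(C)(x,y)=\bigoplus_{p\ge0}(s^{-1}\overline C)^{\square p}(x,y)$ (the $p=0$ term is $\mathbf{k}\,\mathrm{id}_x$ if $x=y$, else $0$), with monomials $\{c_1|\cdots|c_p\}$ of degree $\sum(|c_i|-1)$; $\{c\}:=0$ for $c\in C_0$; composition is concatenation; the differential is the derivation with $D\{c\}=-h(c)\,\mathrm{id}-\{dc\}+\sum(-1)^{|c'|}\{c'|c''\}$ (sum over the terms of $\overline\Delta c$). **Modules.** A right (left) dg module $\mathsf{M}$ ($\mathsf{N}$) over $\mathbf{\Omega}(C)$ is a $\mathbf{k}$-flat dg $C_0$-bicomodule with an associative unital dg action $\mathsf{M}\square_{C_0}\mathcal{M}\to\mathsf{M}$ (resp. $\mathcal{M}\square_{C_0}\mathsf{N}\to\mathsf{N}$) by bicomodule maps, where $\mathcal{M}=\bigoplus_{x,y}\mathbf{\Omega}(C)(x,y)$. **Bar construction.** Let $\overline{\mathcal{M}}=\mathcal{M}/\langle\mathrm{id}_x\rangle_{x\in\mathcal{S}(C)}$. $\mathrm{Bar}_{C_0}(\mathsf{M},\mathbf{\Omega}(C),\mathsf{N})=\bigoplus_{p\ge0}\mathsf{M}\square(s^{+1}\overline{\mathcal{M}})^{\square p}\square\mathsf{N}$, with generators $m[a_1|\cdots|a_p]n$. With $\eta_i=|m|+\sum_{j\le i}(|a_j|+1)$, $$\partial(m[a_1|\cdots|a_p]n)=d_{\mathsf{M}}m[a_1|\cdots|a_p]n-\sum_{i}(-1)^{\eta_{i-1}}m[\cdots|Da_i|\cdots]n+(-1)^{\eta_p}m[a_1|\cdots|a_p]d_{\mathsf{N}}n+\theta,$$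 where for $p\ge1$ $\theta=(-1)^{|m|}ma_1[a_2|\cdots|a_p]n+\sum_{i=1}^{p-1}(-1)^{\eta_i}m[\cdots|a_ia_{i+1}|\cdots]n-(-1)^{\eta_{p-1}}m[a_1|\cdots|a_{p-1}]a_pn$, and $\theta=0$ for $p=0$. **$\mathcal{Q}$.** $\partial_{\mathcal{Q}}(m\square c\square n)=d_{\mathsf{M}}m\square c\square n+(-1)^{|m|}m\square dc\square n+(-1)^{|m|+|c|}m\square c\square d_{\mathsf{N}}n+\sum(-1)^{|m|}m\{c'\}\square c''\square n-\sum(-1)^{|m|+|c'|}m\square c'\square\{c''\}n$ (sums over the full coproduct $\Delta c$). **The maps.** (1) $\pi(m[a_1|\cdots|a_p]n)=0$ for $p>1$; for $p=1$, $q\ge1$, $\pi(m[\{c_1|\cdots|c_q\}]n)=\sum_{i=1}^q(-1)^{\sum_{j<i}(|c_j|-1)}\,m\{c_1|\cdots|c_{i-1}\}\square c_i\square\{c_{i+1}|\cdots|c_q\}n$; for $p=0$ and $m,n$ meeting at $x\in\mathcal{S}(C)$ (i.e. $x$ is the target of $m$ and the source of $n$), $\pi(m[\,]n)=m\square x\square n$. (2) $\alpha(m\square x\square n)=m[\,]n$ for $x\in\mathcal{S}(C)$, and $\alpha(m\square c\square n)=\sum_{k\ge1}\sum m[\{c^{(1)}\}|\cdots|\{c^{(k)}\}]n$ for $c\in\overline C$. (3) $H(m[\,]n)=0$; writing $a_1=\{c_1|\cdots|c_r\}$, $H(m[a_1|\cdots|a_p]n)=0$ if $r<2$, and for $r\ge2$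 $$H(m[a_1|\cdots|a_p]n)=\sum_{i=1}^{r-1}(-1)^{|m|+|c_i|-1}\sum_{k\ge1}\sum m\{c_1|\cdots|c_{i-1}\}\bigl[\{c_i^{(1)}\}|\cdots|\{c_i^{(k)}\}|\{c_{i+1}|\cdots|c_r\}|a_2|\cdots|a_p\bigr]n .$$ *)

theory Defs
  imports Complex_Main "HOL-Library.Poly_Mapping"
begin

text \<open>
  The type \<open>'g \<Rightarrow>\<^sub>0 'k\<close> is the free module on \<open>'g\<close>.  Tensor products are presented as formal sums
  modulo a submodule of multilinearity relations.
\<close>

abbreviation gen :: "'g \<Rightarrow> ('g \<Rightarrow>\<^sub>0 'k::comm_ring_1)" where
  "gen g \<equiv> Poly_Mapping.single g 1"

definition fscale :: "'k::comm_ring_1 \<Rightarrow> ('g \<Rightarrow>\<^sub>0 'k) \<Rightarrow> ('g \<Rightarrow>\<^sub>0 'k)" where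
  "fscale r = Poly_Mapping.map ((*) r)"

lemma lookup_fscale: "Poly_Mapping.lookup (fscale r t) g = r * Poly_Mapping.lookup t g"
  unfolding fscale_def by (simp add: Poly_Mapping.map.rep_eq when_def)

lemma module_fscale: "module fscale"
  unfolding module_def
  by (auto intro!: poly_mapping_eqI simp: lookup_fscale lookup_add algebra_simps)

definition lext ::
    "('k::comm_ring_1 \<Rightarrow> 'b::ab_group_add \<Rightarrow> 'b) \<Rightarrow> ('g \<Rightarrow> 'b) \<Rightarrow> ('g \<Rightarrow>\<^sub>0 'k) \<Rightarrow> 'b" where
  "lext s f t = (\<Sum>g\<in>Poly_Mapping.keys t. s (Poly_Mapping.lookup t g) (f g))"

abbreviation fext :: "('g \<Rightarrow> ('h \<Rightarrow>\<^sub>0 'k::comm_ring_1)) \<Rightarrow> ('g \<Rightarrow>\<^sub>0 'k) \<Rightarrow> ('h \<Rightarrow>\<^sub>0 'k)" where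
  "fext \<equiv> lext fscale"

definition fsums :: "'g set \<Rightarrow> ('g \<Rightarrow>\<^sub>0 'k::comm_ring_1) set" where
  "fsums G = {t. Poly_Mapping.keys t \<subseteq> G}"

definition eqmod :: "'a::ab_group_add set \<Rightarrow> 'a \<Rightarrow> 'a \<Rightarrow> bool" where
  "eqmod U a b \<longleftrightarrow> a - b \<in> U"

text \<open>Relations making \<open>u \<mapsto> f u\<close> linear on the submodule \<open>V\<close>; \<open>f\<close> fills one tensor slot.\<close>

definition lin_rels ::
    "('k::comm_ring_1 \<Rightarrow> 'v::ab_group_add \<Rightarrow> 'v) \<Rightarrow> 'v set \<Rightarrow> ('v \<Rightarrow> 'g) \<Rightarrow> ('g \<Rightarrow>\<^sub>0 'k) set" where
  "lin_rels s V f =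
     {gen (f (u + v)) - gen (f u) - gen (f v) | u v. u \<in> V \<and> v \<in> V}
   \<union> {gen (f (s r u)) - fscale r (gen (f u)) | r u. u \<in> V}"

definition tensor_rel ::
    "('k::comm_ring_1 \<Rightarrow> 'v::ab_group_add \<Rightarrow> 'v) \<Rightarrow> 'v set \<Rightarrow>
     ('k \<Rightarrow> 'w::ab_group_add \<Rightarrow> 'w) \<Rightarrow> 'w set \<Rightarrow> ('v \<times> 'w \<Rightarrow>\<^sub>0 'k) set" where
  "tensor_rel s V s' W = module.span fscale
     ((\<Union>w\<in>W. lin_rels s V (\<lambda>v. (v, w))) \<union> (\<Union>v\<in>V. lin_rels s' W (\<lambda>w. (v, w))))"

definition tensor3_rel ::
    "('k::comm_ring_1 \<Rightarrow> 'v::ab_group_add \<Rightarrow> 'v) \<Rightarrow> ('v \<times> 'v \<times> 'v \<Rightarrow>\<^sub>0 'k) set" where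
  "tensor3_rel s = module.span fscale
     ((\<Union>b c. lin_rels s UNIV (\<lambda>a. (a, b, c)))
    \<union> (\<Union>a c. lin_rels s UNIV (\<lambda>b. (a, b, c)))
    \<union> (\<Union>a b. lin_rels s UNIV (\<lambda>c. (a, b, c))))"

text \<open>
  Flatness: tensoring preserves injectivity.  HOL cannot quantify over all modules (types), so the
  injections are the inclusions \<open>A/R \<rightarrow> F/R\<close> with \<open>F\<close> free of countable rank and \<open>R \<subseteq> A \<subseteq> F\<close>.
  Every injection of finitely generated modules is of this form up to isomorphism, and such
  injections suffice for flatness.
\<close>

definition flat :: "('k::comm_ring_1 \<Rightarrow> 'v::ab_group_add \<Rightarrow> 'v) \<Rightarrow> bool" where
  "flat s \<longleftrightarrow>
    (\<forall>(R :: (nat \<Rightarrow>\<^sub>0 'k) set) A.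
       module.subspace fscale R \<and> module.subspace fscale A \<and> R \<subseteq> A \<longrightarrow>
       (let Z = {gen (r, v) | r v. r \<in> R} in
        \<forall>t \<in> fsums (A \<times> UNIV).
          t \<in> module.span fscale (tensor_rel fscale UNIV s UNIV \<union> Z) \<longrightarrow>
          t \<in> module.span fscale (tensor_rel fscale A s UNIV \<union> Z)))"

definition decomposes :: "('i \<Rightarrow> 'v::ab_group_add set) \<Rightarrow> 'i set \<Rightarrow> 'v \<Rightarrow> ('i \<Rightarrow>\<^sub>0 'v) \<Rightarrow> bool" where
  "decomposes V I v p \<longleftrightarrow>
     Poly_Mapping.keys p \<subseteq> I \<and> (\<forall>i\<in>I. Poly_Mapping.lookup p i \<in> V i)
     \<and> v = (\<Sum>i\<in>Poly_Mapping.keys p. Poly_Mapping.lookup p i)"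

definition direct_sum ::
    "('k::comm_ring_1 \<Rightarrow> 'v::ab_group_add \<Rightarrow> 'v) \<Rightarrow> ('i \<Rightarrow> 'v set) \<Rightarrow> 'i set \<Rightarrow> bool" where
  "direct_sum s V I \<longleftrightarrow>
     (\<forall>i\<in>I. module.subspace s (V i)) \<and> (\<forall>v. \<exists>!p. decomposes V I v p)"

definition ksign :: "int \<Rightarrow> 'k::comm_ring_1" where
  "ksign i = (if even i then 1 else - 1)"

text \<open>Graded modules presented by generators and relations; their elements are classes of formal sums.\<close>

record (overloaded) ('k, 'g) presented =
  gens :: "'g set"
  gdeg :: "'g \<Rightarrow> int"
  rels :: "('g \<Rightarrow>\<^sub>0 'k::comm_ring_1) set"

definition qclass :: "('k::comm_ring_1, 'g) presented \<Rightarrow> ('g \<Rightarrow>\<^sub>0 'k) \<Rightarrow> ('g \<Rightarrow>\<^sub>0 'k) set" where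
  "qclass P t = {t'. eqmod (rels P) t' t}"

definition qcarrier :: "('k::comm_ring_1, 'g) presented \<Rightarrow> ('g \<Rightarrow>\<^sub>0 'k) set set" where
  "qcarrier P = qclass P ` fsums (gens P)"

definition qgrade :: "('k::comm_ring_1, 'g) presented \<Rightarrow> int \<Rightarrow> ('g \<Rightarrow>\<^sub>0 'k) set set" where
  "qgrade P i = qclass P ` fsums {g \<in> gens P. gdeg P g = i}"

definition qadd :: "('g \<Rightarrow>\<^sub>0 'k::comm_ring_1) set \<Rightarrow> ('g \<Rightarrow>\<^sub>0 'k) set \<Rightarrow> ('g \<Rightarrow>\<^sub>0 'k) set" where
  "qadd X Y = {x + y | x y. x \<in> X \<and> y \<in> Y}"

definition qdiff :: "('g \<Rightarrow>\<^sub>0 'k::comm_ring_1) set \<Rightarrow> ('g \<Rightarrow>\<^sub>0 'k) set \<Rightarrow> ('g \<Rightarrow>\<^sub>0 'k) set" where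
  "qdiff X Y = {x - y | x y. x \<in> X \<and> y \<in> Y}"

text \<open>
  The linear map given on generators by \<open>f\<close>.  The union is a single class exactly when
  \<open>f\<close> is compatible with the relations, so membership of its values in \<open>qcarrier P'\<close> expresses
  well-definedness.
\<close>

definition qmap ::
    "('k::comm_ring_1, 'h) presented \<Rightarrow> ('g \<Rightarrow> ('h \<Rightarrow>\<^sub>0 'k)) \<Rightarrow> ('g \<Rightarrow>\<^sub>0 'k) set \<Rightarrow> ('h \<Rightarrow>\<^sub>0 'k) set" where
  "qmap P' f X = (\<Union>t\<in>X. qclass P' (fext f t))"

definition map_of_degree ::
    "int \<Rightarrow> ('k::comm_ring_1, 'g) presented \<Rightarrow> ('k, 'h) presented \<Rightarrow>
     (('g \<Rightarrow>\<^sub>0 'k) set \<Rightarrow> ('h \<Rightarrow>\<^sub>0 'k) set) \<Rightarrow> bool" where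
  "map_of_degree r P P' F \<longleftrightarrow>
     (\<forall>X \<in> qcarrier P. F X \<in> qcarrier P') \<and> (\<forall>i. \<forall>X \<in> qgrade P i. F X \<in> qgrade P' (i + r))"

text \<open>
  \<open>cop C c\<close> is a representative in the free module on pairs of the element \<open>\<Delta> c\<close> of \<open>C \<otimes> C\<close>; every
  condition on it is imposed in \<open>C \<otimes> C\<close> or \<open>C \<otimes> C \<otimes> C\<close>, i.e. modulo the tensor relations.
\<close>

record (overloaded) ('k, 'c) coalg =
  smul :: "'k::comm_ring_1 \<Rightarrow> 'c::ab_group_add \<Rightarrow> 'c"
  gr :: "nat \<Rightarrow> 'c set"
  cop :: "'c \<Rightarrow> ('c \<times> 'c \<Rightarrow>\<^sub>0 'k)"
  counit :: "'c \<Rightarrow> 'k"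
  codiff :: "'c \<Rightarrow> 'c"
  curv :: "'c \<Rightarrow> 'k"

definition eq2 ::
    "('k::comm_ring_1, 'c::ab_group_add) coalg \<Rightarrow> ('c \<times> 'c \<Rightarrow>\<^sub>0 'k) \<Rightarrow> ('c \<times> 'c \<Rightarrow>\<^sub>0 'k) \<Rightarrow> bool" where
  "eq2 C = eqmod (tensor_rel (smul C) UNIV (smul C) UNIV)"

definition points :: "('k::comm_ring_1, 'c::ab_group_add) coalg \<Rightarrow> 'c set" where
  "points C = {x. eq2 C (cop C x) (gen (x, x)) \<and> counit C x = 1}"

definition homog_parts :: "('k::comm_ring_1, 'c::ab_group_add) coalg \<Rightarrow> 'c \<Rightarrow> (nat \<Rightarrow>\<^sub>0 'c)" where
  "homog_parts C c = (THE p. decomposes (gr C) UNIV c p)"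

definition proj0 :: "('k::comm_ring_1, 'c::ab_group_add) coalg \<Rightarrow> 'c \<Rightarrow> 'c" where
  "proj0 C c = Poly_Mapping.lookup (homog_parts C c) 0"

text \<open>\<open>c \<mapsto> (-1)\<^bsup>|c|\<^esup> c\<close>, extended linearly to inhomogeneous elements.\<close>

definition sgn_inv :: "('k::comm_ring_1, 'c::ab_group_add) coalg \<Rightarrow> 'c \<Rightarrow> 'c" where
  "sgn_inv C c = (\<Sum>i\<in>Poly_Mapping.keys (homog_parts C c).
     smul C (ksign (int i)) (Poly_Mapping.lookup (homog_parts C c) i))"

locale categorical_coalgebra =
  fixes C :: "('k::comm_ring_1, 'c::ab_group_add) coalg"
  assumes module_C: "module (smul C)"
    and graded: "direct_sum (smul C) (gr C) UNIV"
    and flat_C: "flat (smul C)"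
    and cop_add: "\<And>c c'. eq2 C (cop C (c + c')) (cop C c + cop C c')"
    and cop_scale: "\<And>r c. eq2 C (cop C (smul C r c)) (fscale r (cop C c))"
    and cop_degree: "\<And>n c. c \<in> gr C n \<Longrightarrow>
          \<exists>t \<in> fsums (\<Union>i\<le>n. gr C i \<times> gr C (n - i)). eq2 C (cop C c) t"
    and coassoc: "\<And>c. eqmod (tensor3_rel (smul C))
          (fext (\<lambda>(a, b). fext (\<lambda>(a', a''). gen (a', a'', b)) (cop C a)) (cop C c))
          (fext (\<lambda>(a, b). fext (\<lambda>(b', b''). gen (a, b', b'')) (cop C b)) (cop C c))"
    and counit_linear: "module_hom (smul C) (*) (counit C)"
    and counit_left: "\<And>c. lext (smul C) (\<lambda>(a, b). smul C (counit C a) b) (cop C c) = c"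
    and counit_right: "\<And>c. lext (smul C) (\<lambda>(a, b). smul C (counit C b) a) (cop C c) = c"
    and points_nonempty: "points C \<noteq> {}"
    and points_independent: "\<not> module.dependent (smul C) (points C)"
    and points_span: "module.span (smul C) (points C) = gr C 0"
    and codiff_linear: "module_hom (smul C) (smul C) (codiff C)"
    and codiff_degree: "\<And>n c. c \<in> gr C (Suc n) \<Longrightarrow> codiff C c \<in> gr C n"
    and codiff_0: "\<And>c. c \<in> gr C 0 \<Longrightarrow> codiff C c = 0"
    and codiff_1: "\<And>c. c \<in> gr C 1 \<Longrightarrow> codiff C c = 0"
    and coderivation: "\<And>c. eq2 C (cop C (codiff C c))
          (fext (\<lambda>(a, b). gen (codiff C a, b) + gen (sgn_inv C a, codiff C b)) (cop C c))"
    and curv_linear: "module_hom (smul C) (*) (curv C)"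
    and curv_degree: "\<And>n c. c \<in> gr C n \<Longrightarrow> n \<noteq> 2 \<Longrightarrow> curv C c = 0"
    and curv_codiff: "\<And>c. curv C (codiff C c) = 0"
    and codiff_squared: "\<And>c. codiff C (codiff C c) =
          lext (smul C) (\<lambda>(a, b). smul C (curv C a) b) (cop C c)
        - lext (smul C) (\<lambda>(a, b). smul C (curv C b) a) (cop C c)"

text \<open>\<open>C(x,y)\<close>: left coaction \<open>x \<otimes> c\<close>, right coaction \<open>c \<otimes> y\<close>.\<close>

definition bihom :: "('k::comm_ring_1, 'c::ab_group_add) coalg \<Rightarrow> 'c \<Rightarrow> 'c \<Rightarrow> 'c set" where
  "bihom C x y = {c.
     eq2 C (fext (\<lambda>(a, b). gen (proj0 C a, b)) (cop C c)) (gen (x, c))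
   \<and> eq2 C (fext (\<lambda>(a, b). gen (a, proj0 C b)) (cop C c)) (gen (c, y))}"

definition coalg_piece ::
    "('k::comm_ring_1, 'c::ab_group_add) coalg \<Rightarrow> 'c \<Rightarrow> 'c \<Rightarrow> nat \<Rightarrow> 'c set" where
  "coalg_piece C x y n = gr C n \<inter> bihom C x y"

text \<open>
  A bihomogeneous element of \<open>\<Oplus>V(x,y)\<^sub>i\<close> together with its source, degree and target (which the
  element alone does not determine when it vanishes).  A cotensor product, being a direct sum of
  tensor products \<open>V(x,y)\<^sub>i \<otimes> W(y,z)\<^sub>j\<close>, is generated by composable tuples of such elements, with
  multilinearity imposed for fixed labels.
\<close>

datatype ('o, 'e) arr = Arr (src: 'o) (deg: int) (elt: 'e) (tgt: 'o)

definition arr_map :: "('e \<Rightarrow> 'f) \<Rightarrow> int \<Rightarrow> ('o, 'e) arr \<Rightarrow> ('o, 'f) arr" where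
  "arr_map f r a = Arr (src a) (deg a + r) (f (elt a)) (tgt a)"

definition arr_comp :: "('e \<Rightarrow> 'f \<Rightarrow> 'g) \<Rightarrow> ('o, 'e) arr \<Rightarrow> ('o, 'f) arr \<Rightarrow> ('o, 'g) arr" where
  "arr_comp f a b = Arr (src a) (deg a + deg b) (f (elt a) (elt b)) (tgt b)"

fun chain :: "'o \<Rightarrow> ('o, 'e) arr list \<Rightarrow> 'o \<Rightarrow> bool" where
  "chain x [] y \<longleftrightarrow> x = y"
| "chain x (a # as) y \<longleftrightarrow> src a = x \<and> chain (tgt a) as y"

definition coalg_arrs :: "('k::comm_ring_1, 'c::ab_group_add) coalg \<Rightarrow> ('c, 'c) arr set" where
  "coalg_arrs C = {c. src c \<in> points C \<and> tgt c \<in> points C \<and> 0 \<le> deg c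
     \<and> elt c \<in> coalg_piece C (src c) (tgt c) (nat (deg c))}"

text \<open>
  Sweedler notation \<open>\<Delta> c = \<Sum> c' \<otimes> c''\<close> with bihomogeneous composable factors: a representative of
  \<open>\<Delta> c\<close> in \<open>C \<box> C\<close>.
\<close>

definition sweedler ::
    "('k::comm_ring_1, 'c::ab_group_add) coalg \<Rightarrow> ('c, 'c) arr \<Rightarrow> (('c, 'c) arr \<times> ('c, 'c) arr \<Rightarrow>\<^sub>0 'k)" where
  "sweedler C c = (SOME t.
     t \<in> fsums {(a, b). a \<in> coalg_arrs C \<and> b \<in> coalg_arrs C \<and> src a = src c \<and> tgt a = src b
                  \<and> tgt b = tgt c \<and> deg a + deg b = deg c}
     \<and> eq2 C (cop C (elt c)) (fext (\<lambda>(a, b). gen (elt a, elt b)) t))"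

definition red_cop ::
    "('k::comm_ring_1, 'c::ab_group_add) coalg \<Rightarrow> ('c, 'c) arr \<Rightarrow> (('c, 'c) arr \<times> ('c, 'c) arr \<Rightarrow>\<^sub>0 'k)" where
  "red_cop C c = fext (\<lambda>(a, b). if 1 \<le> deg a \<and> 1 \<le> deg b then gen (a, b) else 0) (sweedler C c)"

text \<open>\<open>red_iter C k\<close> is the \<open>k\<close>-fold iterate, with \<open>k + 1\<close> tensor factors.\<close>

fun red_iter ::
    "('k::comm_ring_1, 'c::ab_group_add) coalg \<Rightarrow> nat \<Rightarrow> ('c, 'c) arr \<Rightarrow> (('c, 'c) arr list \<Rightarrow>\<^sub>0 'k)" where
  "red_iter C 0 c = gen [c]"
| "red_iter C (Suc k) c =
     fext (\<lambda>(a, b). fext (\<lambda>cs. gen (a # cs)) (red_iter C k b)) (red_cop C c)"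

text \<open>
  The word \<open>(x, [c\<^sub>1, \<dots>, c\<^sub>p])\<close> is the monomial \<open>{c\<^sub>1|\<dots>|c\<^sub>p}\<close> with source \<open>x\<close>, and \<open>(x, [])\<close> is
  the identity of \<open>x\<close>.  Morphisms are represented by formal sums of words, modulo \<open>cobar_rel\<close>.
\<close>

type_synonym 'c cobar_word = "'c \<times> ('c, 'c) arr list"
type_synonym ('k, 'c) cobar = "'c cobar_word \<Rightarrow>\<^sub>0 'k"

definition cobar_words ::
    "('k::comm_ring_1, 'c::ab_group_add) coalg \<Rightarrow> 'c \<Rightarrow> 'c \<Rightarrow> 'c cobar_word set" where
  "cobar_words C x y = {(z, cs). z = x \<and> x \<in> points C \<and> y \<in> points C \<and> chain x cs y
     \<and> (\<forall>c\<in>set cs. c \<in> coalg_arrs C \<and> 1 \<le> deg c)}"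

definition letters_deg :: "('c, 'c) arr list \<Rightarrow> int" where
  "letters_deg cs = (\<Sum>c\<leftarrow>cs. deg c - 1)"

definition cobar_hom ::
    "('k::comm_ring_1, 'c::ab_group_add) coalg \<Rightarrow> 'c \<Rightarrow> 'c \<Rightarrow> int \<Rightarrow> ('k, 'c) cobar set" where
  "cobar_hom C x y j = fsums {w \<in> cobar_words C x y. letters_deg (snd w) = j}"

definition cobar_rel :: "('k::comm_ring_1, 'c::ab_group_add) coalg \<Rightarrow> ('k, 'c) cobar set" where
  "cobar_rel C = module.span fscale
     (\<Union>{lin_rels (smul C) (coalg_piece C s t (nat n)) (\<lambda>u. (x, cs @ [Arr s n u t] @ ds))
        | x y cs s n t ds. (x, cs @ [Arr s n 0 t] @ ds) \<in> cobar_words C x y})"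

definition cobar_comp :: "('k::comm_ring_1, 'c) cobar \<Rightarrow> ('k, 'c) cobar \<Rightarrow> ('k, 'c) cobar" where
  "cobar_comp a b = fext (\<lambda>(x, cs). fext (\<lambda>(y, ds). gen (x, cs @ ds)) b) a"

definition brace :: "('c, 'c) arr \<Rightarrow> ('k::comm_ring_1, 'c) cobar" where
  "brace c = (if deg c = 0 then 0 else gen (src c, [c]))"

definition cobar_diff_letter ::
    "('k::comm_ring_1, 'c::ab_group_add) coalg \<Rightarrow> ('c, 'c) arr \<Rightarrow> ('k, 'c) cobar" where
  "cobar_diff_letter C c =
     - fscale (curv C (elt c)) (gen (src c, []))
     - brace (arr_map (codiff C) (-1) c)
     + fext (\<lambda>(a, b). fscale (ksign (deg a)) (gen (src a, [a, b]))) (red_cop C c)"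

definition cobar_diff ::
    "('k::comm_ring_1, 'c::ab_group_add) coalg \<Rightarrow> ('k, 'c) cobar \<Rightarrow> ('k, 'c) cobar" where
  "cobar_diff C = fext (\<lambda>(x, cs). \<Sum>i<length cs. fscale (ksign (letters_deg (take i cs)))
     (cobar_comp (gen (x, take i cs))
       (cobar_comp (cobar_diff_letter C (cs ! i)) (gen (tgt (cs ! i), drop (Suc i) cs)))))"

definition cobar_arrs ::
    "('k::comm_ring_1, 'c::ab_group_add) coalg \<Rightarrow> ('c, ('k, 'c) cobar) arr set" where
  "cobar_arrs C = {a. src a \<in> points C \<and> tgt a \<in> points C
     \<and> elt a \<in> cobar_hom C (src a) (tgt a) (deg a)}"

definition mono_arr :: "'c \<Rightarrow> ('c, 'c) arr list \<Rightarrow> 'c \<Rightarrow> ('c, ('k::comm_ring_1, 'c) cobar) arr" where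
  "mono_arr x cs y = Arr x (letters_deg cs) (gen (x, cs)) y"

definition brace_arr :: "('c, 'c) arr \<Rightarrow> ('c, ('k::comm_ring_1, 'c) cobar) arr" where
  "brace_arr c = Arr (src c) (deg c - 1) (brace c) (tgt c)"

text \<open>Relations of \<open>\<M>\<close> modulo the span of the identities.\<close>

definition normal_rel :: "('k::comm_ring_1, 'c::ab_group_add) coalg \<Rightarrow> ('k, 'c) cobar set" where
  "normal_rel C = module.span fscale (cobar_rel C \<union> {gen (x, []) | x. x \<in> points C})"

record (overloaded) ('k, 'c, 'm) bicomod =
  bmul :: "'k::comm_ring_1 \<Rightarrow> 'm::ab_group_add \<Rightarrow> 'm"
  piece :: "'c::ab_group_add \<Rightarrow> 'c \<Rightarrow> int \<Rightarrow> 'm set"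
  bdiff :: "'m \<Rightarrow> 'm"

record (overloaded) ('k, 'c, 'm) rmod = "('k::comm_ring_1, 'c::ab_group_add, 'm::ab_group_add) bicomod" +
  ract :: "'m \<Rightarrow> ('k, 'c) cobar \<Rightarrow> 'm"

record (overloaded) ('k, 'c, 'm) lmod = "('k::comm_ring_1, 'c::ab_group_add, 'm::ab_group_add) bicomod" +
  lact :: "('k, 'c) cobar \<Rightarrow> 'm \<Rightarrow> 'm"

locale dg_bicomodule =
  fixes C :: "('k::comm_ring_1, 'c::ab_group_add) coalg"
    and M :: "('k, 'c, 'm::ab_group_add, 'z) bicomod_scheme"
  assumes module_M: "module (bmul M)"
    and flat_M: "flat (bmul M)"
    and pieces: "direct_sum (bmul M) (\<lambda>(x, y, i). piece M x y i) (points C \<times> points C \<times> UNIV)"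
    and bdiff_linear: "module_hom (bmul M) (bmul M) (bdiff M)"
    and bdiff_piece: "\<And>x y i m. x \<in> points C \<Longrightarrow> y \<in> points C \<Longrightarrow> m \<in> piece M x y i \<Longrightarrow>
          bdiff M m \<in> piece M x y (i - 1)"
    and bdiff_squared: "\<And>m. bdiff M (bdiff M m) = 0"

locale right_dg_module = dg_bicomodule C M
  for C :: "('k::comm_ring_1, 'c::ab_group_add) coalg"
    and M :: "('k, 'c, 'm::ab_group_add) rmod" +
  assumes ract_piece: "\<And>x y z i j m a. \<lbrakk>x \<in> points C; y \<in> points C; z \<in> points C;
          m \<in> piece M x y i; a \<in> cobar_hom C y z j\<rbrakk> \<Longrightarrow> ract M m a \<in> piece M x z (i + j)"
    and ract_add_left: "\<And>x y z i j m m' a. \<lbrakk>x \<in> points C; y \<in> points C; z \<in> points C;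
          m \<in> piece M x y i; m' \<in> piece M x y i; a \<in> cobar_hom C y z j\<rbrakk> \<Longrightarrow>
          ract M (m + m') a = ract M m a + ract M m' a"
    and ract_scale_left: "\<And>x y z i j r m a. \<lbrakk>x \<in> points C; y \<in> points C; z \<in> points C;
          m \<in> piece M x y i; a \<in> cobar_hom C y z j\<rbrakk> \<Longrightarrow>
          ract M (bmul M r m) a = bmul M r (ract M m a)"
    and ract_add_right: "\<And>x y z i j m a a'. \<lbrakk>x \<in> points C; y \<in> points C; z \<in> points C;
          m \<in> piece M x y i; a \<in> cobar_hom C y z j; a' \<in> cobar_hom C y z j\<rbrakk> \<Longrightarrow>
          ract M m (a + a') = ract M m a + ract M m a'"
    and ract_scale_right: "\<And>x y z i j r m a. \<lbrakk>x \<in> points C; y \<in> points C; z \<in> points C;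
          m \<in> piece M x y i; a \<in> cobar_hom C y z j\<rbrakk> \<Longrightarrow>
          ract M m (fscale r a) = bmul M r (ract M m a)"
    and ract_rel: "\<And>x y z i j m a. \<lbrakk>x \<in> points C; y \<in> points C; z \<in> points C;
          m \<in> piece M x y i; a \<in> cobar_hom C y z j; a \<in> cobar_rel C\<rbrakk> \<Longrightarrow> ract M m a = 0"
    and ract_assoc: "\<And>w x y z i j l m a b. \<lbrakk>w \<in> points C; x \<in> points C; y \<in> points C; z \<in> points C;
          m \<in> piece M w x i; a \<in> cobar_hom C x y j; b \<in> cobar_hom C y z l\<rbrakk> \<Longrightarrow>
          ract M (ract M m a) b = ract M m (cobar_comp a b)"
    and ract_unit: "\<And>x y i m. \<lbrakk>x \<in> points C; y \<in> points C; m \<in> piece M x y i\<rbrakk> \<Longrightarrow>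
          ract M m (gen (y, [])) = m"
    and ract_leibniz: "\<And>x y z i j m a. \<lbrakk>x \<in> points C; y \<in> points C; z \<in> points C;
          m \<in> piece M x y i; a \<in> cobar_hom C y z j\<rbrakk> \<Longrightarrow>
          bdiff M (ract M m a) = ract M (bdiff M m) a + bmul M (ksign i) (ract M m (cobar_diff C a))"

locale left_dg_module = dg_bicomodule C N
  for C :: "('k::comm_ring_1, 'c::ab_group_add) coalg"
    and N :: "('k, 'c, 'n::ab_group_add) lmod" +
  assumes lact_piece: "\<And>x y z i j n a. \<lbrakk>x \<in> points C; y \<in> points C; z \<in> points C;
          a \<in> cobar_hom C x y j; n \<in> piece N y z i\<rbrakk> \<Longrightarrow> lact N a n \<in> piece N x z (j + i)"
    and lact_add_left: "\<And>x y z i j n a a'. \<lbrakk>x \<in> points C; y \<in> points C; z \<in> points C;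
          a \<in> cobar_hom C x y j; a' \<in> cobar_hom C x y j; n \<in> piece N y z i\<rbrakk> \<Longrightarrow>
          lact N (a + a') n = lact N a n + lact N a' n"
    and lact_scale_left: "\<And>x y z i j r n a. \<lbrakk>x \<in> points C; y \<in> points C; z \<in> points C;
          a \<in> cobar_hom C x y j; n \<in> piece N y z i\<rbrakk> \<Longrightarrow>
          lact N (fscale r a) n = bmul N r (lact N a n)"
    and lact_add_right: "\<And>x y z i j n n' a. \<lbrakk>x \<in> points C; y \<in> points C; z \<in> points C;
          a \<in> cobar_hom C x y j; n \<in> piece N y z i; n' \<in> piece N y z i\<rbrakk> \<Longrightarrow>
          lact N a (n + n') = lact N a n + lact N a n'"
    and lact_scale_right: "\<And>x y z i j r n a. \<lbrakk>x \<in> points C; y \<in> points C; z \<in> points C;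
          a \<in> cobar_hom C x y j; n \<in> piece N y z i\<rbrakk> \<Longrightarrow>
          lact N a (bmul N r n) = bmul N r (lact N a n)"
    and lact_rel: "\<And>x y z i j n a. \<lbrakk>x \<in> points C; y \<in> points C; z \<in> points C;
          a \<in> cobar_hom C x y j; a \<in> cobar_rel C; n \<in> piece N y z i\<rbrakk> \<Longrightarrow> lact N a n = 0"
    and lact_assoc: "\<And>w x y z i j l n a b. \<lbrakk>w \<in> points C; x \<in> points C; y \<in> points C; z \<in> points C;
          a \<in> cobar_hom C w x j; b \<in> cobar_hom C x y l; n \<in> piece N y z i\<rbrakk> \<Longrightarrow>
          lact N a (lact N b n) = lact N (cobar_comp a b) n"
    and lact_unit: "\<And>x y i n. \<lbrakk>x \<in> points C; y \<in> points C; n \<in> piece N x y i\<rbrakk> \<Longrightarrow>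
          lact N (gen (x, [])) n = n"
    and lact_leibniz: "\<And>x y z i j n a. \<lbrakk>x \<in> points C; y \<in> points C; z \<in> points C;
          a \<in> cobar_hom C x y j; n \<in> piece N y z i\<rbrakk> \<Longrightarrow>
          bdiff N (lact N a n) = lact N (cobar_diff C a) n + bmul N (ksign j) (lact N a (bdiff N n))"

definition mod_arrs ::
    "('k::comm_ring_1, 'c::ab_group_add) coalg \<Rightarrow> ('k, 'c, 'm::ab_group_add, 'z) bicomod_scheme \<Rightarrow>
     ('c, 'm) arr set" where
  "mod_arrs C M = {m. src m \<in> points C \<and> tgt m \<in> points C \<and> elt m \<in> piece M (src m) (tgt m) (deg m)}"

text \<open>The triple \<open>(m, [a\<^sub>1, \<dots>, a\<^sub>p], n)\<close> is the generator \<open>m[a\<^sub>1|\<dots>|a\<^sub>p]n\<close>.\<close>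

type_synonym ('k, 'c, 'm, 'n) bar_gen =
  "('c, 'm) arr \<times> ('c, ('k, 'c) cobar) arr list \<times> ('c, 'n) arr"

definition bar_gens ::
    "('k::comm_ring_1, 'c::ab_group_add) coalg \<Rightarrow> ('k, 'c, 'm::ab_group_add) rmod \<Rightarrow>
     ('k, 'c, 'n::ab_group_add) lmod \<Rightarrow> ('k, 'c, 'm, 'n) bar_gen set" where
  "bar_gens C M N = {(m, as, n). m \<in> mod_arrs C M \<and> n \<in> mod_arrs C N \<and> set as \<subseteq> cobar_arrs C
     \<and> chain (tgt m) as (src n)}"

definition bar_rels ::
    "('k::comm_ring_1, 'c::ab_group_add) coalg \<Rightarrow> ('k, 'c, 'm::ab_group_add) rmod \<Rightarrow>
     ('k, 'c, 'n::ab_group_add) lmod \<Rightarrow> (('k, 'c, 'm, 'n) bar_gen \<Rightarrow>\<^sub>0 'k) set" where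
  "bar_rels C M N = module.span fscale
     (\<Union>{lin_rels (bmul M) (piece M x y i) (\<lambda>u. (Arr x i u y, as, n))
        | x y i as n. (Arr x i 0 y, as, n) \<in> bar_gens C M N}
    \<union> \<Union>{lin_rels (bmul N) (piece N x y i) (\<lambda>u. (m, as, Arr x i u y))
        | x y i as m. (m, as, Arr x i 0 y) \<in> bar_gens C M N}
    \<union> \<Union>{lin_rels fscale (cobar_hom C x y i) (\<lambda>u. (m, as @ [Arr x i u y] @ bs, n))
        | x y i as bs m n. (m, as @ [Arr x i 0 y] @ bs, n) \<in> bar_gens C M N}
    \<union> {gen (m, as @ [a] @ bs, n)
        | m as a bs n. (m, as @ [a] @ bs, n) \<in> bar_gens C M N \<and> elt a \<in> normal_rel C})"

definition Bar ::
    "('k::comm_ring_1, 'c::ab_group_add) coalg \<Rightarrow> ('k, 'c, 'm::ab_group_add) rmod \<Rightarrow>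
     ('k, 'c, 'n::ab_group_add) lmod \<Rightarrow> ('k, ('k, 'c, 'm, 'n) bar_gen) presented" where
  "Bar C M N = \<lparr>gens = bar_gens C M N,
     gdeg = (\<lambda>(m, as, n). deg m + (\<Sum>a\<leftarrow>as. deg a + 1) + deg n),
     rels = bar_rels C M N\<rparr>"

text \<open>Lists are indexed from \<open>0\<close>: the entry \<open>as ! i\<close> is \<open>a\<^sub>i\<^sub>+\<^sub>1\<close>.\<close>

definition bar_eta :: "('c, 'm) arr \<Rightarrow> ('c, 'a) arr list \<Rightarrow> nat \<Rightarrow> int" where
  "bar_eta m as i = deg m + (\<Sum>a\<leftarrow>take i as. deg a + 1)"

definition bar_theta ::
    "('k::comm_ring_1, 'c::ab_group_add, 'm::ab_group_add) rmod \<Rightarrow>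
     ('k, 'c, 'n::ab_group_add) lmod \<Rightarrow> ('k, 'c, 'm, 'n) bar_gen \<Rightarrow> (('k, 'c, 'm, 'n) bar_gen \<Rightarrow>\<^sub>0 'k)" where
  "bar_theta M N = (\<lambda>(m, as, n). if as = [] then 0 else
       fscale (ksign (deg m)) (gen (arr_comp (ract M) m (hd as), tl as, n))
     + (\<Sum>i<length as - 1. fscale (ksign (bar_eta m as (Suc i)))
          (gen (m, take i as @ [arr_comp cobar_comp (as ! i) (as ! Suc i)] @ drop (i + 2) as, n)))
     - fscale (ksign (bar_eta m as (length as - 1)))
          (gen (m, butlast as, arr_comp (lact N) (last as) n)))"

definition bar_diff_gen ::
    "('k::comm_ring_1, 'c::ab_group_add) coalg \<Rightarrow> ('k, 'c, 'm::ab_group_add) rmod \<Rightarrow>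
     ('k, 'c, 'n::ab_group_add) lmod \<Rightarrow> ('k, 'c, 'm, 'n) bar_gen \<Rightarrow> (('k, 'c, 'm, 'n) bar_gen \<Rightarrow>\<^sub>0 'k)" where
  "bar_diff_gen C M N = (\<lambda>(m, as, n).
       gen (arr_map (bdiff M) (-1) m, as, n)
     - (\<Sum>i<length as. fscale (ksign (bar_eta m as i))
          (gen (m, as[i := arr_map (cobar_diff C) (-1) (as ! i)], n)))
     + fscale (ksign (bar_eta m as (length as))) (gen (m, as, arr_map (bdiff N) (-1) n))
     + bar_theta M N (m, as, n))"

definition bar_diff ::
    "('k::comm_ring_1, 'c::ab_group_add) coalg \<Rightarrow> ('k, 'c, 'm::ab_group_add) rmod \<Rightarrow>
     ('k, 'c, 'n::ab_group_add) lmod \<Rightarrow>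
     (('k, 'c, 'm, 'n) bar_gen \<Rightarrow>\<^sub>0 'k) set \<Rightarrow> (('k, 'c, 'm, 'n) bar_gen \<Rightarrow>\<^sub>0 'k) set" where
  "bar_diff C M N = qmap (Bar C M N) (bar_diff_gen C M N)"

type_synonym ('c, 'm, 'n) q_gen = "('c, 'm) arr \<times> ('c, 'c) arr \<times> ('c, 'n) arr"

definition q_gens ::
    "('k::comm_ring_1, 'c::ab_group_add) coalg \<Rightarrow> ('k, 'c, 'm::ab_group_add) rmod \<Rightarrow>
     ('k, 'c, 'n::ab_group_add) lmod \<Rightarrow> ('c, 'm, 'n) q_gen set" where
  "q_gens C M N = {(m, c, n). m \<in> mod_arrs C M \<and> c \<in> coalg_arrs C \<and> n \<in> mod_arrs C N
     \<and> tgt m = src c \<and> tgt c = src n}"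

definition q_rels ::
    "('k::comm_ring_1, 'c::ab_group_add) coalg \<Rightarrow> ('k, 'c, 'm::ab_group_add) rmod \<Rightarrow>
     ('k, 'c, 'n::ab_group_add) lmod \<Rightarrow> (('c, 'm, 'n) q_gen \<Rightarrow>\<^sub>0 'k) set" where
  "q_rels C M N = module.span fscale
     (\<Union>{lin_rels (bmul M) (piece M x y i) (\<lambda>u. (Arr x i u y, c, n))
        | x y i c n. (Arr x i 0 y, c, n) \<in> q_gens C M N}
    \<union> \<Union>{lin_rels (smul C) (coalg_piece C x y (nat i)) (\<lambda>u. (m, Arr x i u y, n))
        | x y i m n. (m, Arr x i 0 y, n) \<in> q_gens C M N}
    \<union> \<Union>{lin_rels (bmul N) (piece N x y i) (\<lambda>u. (m, c, Arr x i u y))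
        | x y i m c. (m, c, Arr x i 0 y) \<in> q_gens C M N})"

definition Qcx ::
    "('k::comm_ring_1, 'c::ab_group_add) coalg \<Rightarrow> ('k, 'c, 'm::ab_group_add) rmod \<Rightarrow>
     ('k, 'c, 'n::ab_group_add) lmod \<Rightarrow> ('k, ('c, 'm, 'n) q_gen) presented" where
  "Qcx C M N = \<lparr>gens = q_gens C M N, gdeg = (\<lambda>(m, c, n). deg m + deg c + deg n),
     rels = q_rels C M N\<rparr>"

text \<open>
  A term \<open>{c}\<close> with \<open>|c| = 0\<close> vanishes because \<open>brace_arr c\<close> is then the zero morphism.  Likewise
  \<open>d c\<close> is \<open>0\<close> for \<open>|c| = 0\<close>; that summand, whose label would have degree \<open>-1\<close>, is left out.
\<close>

definition q_diff_gen ::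
    "('k::comm_ring_1, 'c::ab_group_add) coalg \<Rightarrow> ('k, 'c, 'm::ab_group_add) rmod \<Rightarrow>
     ('k, 'c, 'n::ab_group_add) lmod \<Rightarrow> ('c, 'm, 'n) q_gen \<Rightarrow> (('c, 'm, 'n) q_gen \<Rightarrow>\<^sub>0 'k)" where
  "q_diff_gen C M N = (\<lambda>(m, c, n).
       gen (arr_map (bdiff M) (-1) m, c, n)
     + (if deg c = 0 then 0 else fscale (ksign (deg m)) (gen (m, arr_map (codiff C) (-1) c, n)))
     + fscale (ksign (deg m + deg c)) (gen (m, c, arr_map (bdiff N) (-1) n))
     + fext (\<lambda>(a, b). fscale (ksign (deg m))
          (gen (arr_comp (ract M) m (brace_arr a), b, n))) (sweedler C c)
     - fext (\<lambda>(a, b). fscale (ksign (deg m + deg a))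
          (gen (m, a, arr_comp (lact N) (brace_arr b) n))) (sweedler C c))"

definition q_diff ::
    "('k::comm_ring_1, 'c::ab_group_add) coalg \<Rightarrow> ('k, 'c, 'm::ab_group_add) rmod \<Rightarrow>
     ('k, 'c, 'n::ab_group_add) lmod \<Rightarrow>
     (('c, 'm, 'n) q_gen \<Rightarrow>\<^sub>0 'k) set \<Rightarrow> (('c, 'm, 'n) q_gen \<Rightarrow>\<^sub>0 'k) set" where
  "q_diff C M N = qmap (Qcx C M N) (q_diff_gen C M N)"

definition pi_word ::
    "('k::comm_ring_1, 'c::ab_group_add, 'm::ab_group_add) rmod \<Rightarrow>
     ('k, 'c, 'n::ab_group_add) lmod \<Rightarrow> ('c, 'm) arr \<Rightarrow> ('c, 'n) arr \<Rightarrow> 'c cobar_word \<Rightarrow>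
     (('c, 'm, 'n) q_gen \<Rightarrow>\<^sub>0 'k)" where
  "pi_word M N m n = (\<lambda>(x, cs). \<Sum>i<length cs. fscale (ksign (letters_deg (take i cs)))
     (gen (arr_comp (ract M) m (mono_arr x (take i cs) (src (cs ! i))),
           cs ! i,
           arr_comp (lact N) (mono_arr (tgt (cs ! i)) (drop (Suc i) cs) (src n)) n)))"

definition pi_gen ::
    "('k::comm_ring_1, 'c::ab_group_add, 'm::ab_group_add) rmod \<Rightarrow>
     ('k, 'c, 'n::ab_group_add) lmod \<Rightarrow> ('k, 'c, 'm, 'n) bar_gen \<Rightarrow> (('c, 'm, 'n) q_gen \<Rightarrow>\<^sub>0 'k)" where
  "pi_gen M N = (\<lambda>(m, as, n). case as of
       [] \<Rightarrow> gen (m, Arr (tgt m) 0 (tgt m) (tgt m), n)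
     | [a] \<Rightarrow> fext (pi_word M N m n) (elt a)
     | _ \<Rightarrow> 0)"

definition pi_map ::
    "('k::comm_ring_1, 'c::ab_group_add) coalg \<Rightarrow> ('k, 'c, 'm::ab_group_add) rmod \<Rightarrow>
     ('k, 'c, 'n::ab_group_add) lmod \<Rightarrow>
     (('k, 'c, 'm, 'n) bar_gen \<Rightarrow>\<^sub>0 'k) set \<Rightarrow> (('c, 'm, 'n) q_gen \<Rightarrow>\<^sub>0 'k) set" where
  "pi_map C M N = qmap (Qcx C M N) (pi_gen M N)"

text \<open>
  A degree \<open>0\<close> element of \<open>C(x,y)\<close> is \<open>\<epsilon>(c) x\<close> if \<open>x = y\<close> and \<open>0\<close> otherwise, so the first branch is
  the linear extension of \<open>m \<box> x \<box> n \<mapsto> m[]n\<close>.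
\<close>

definition alpha_gen ::
    "('k::comm_ring_1, 'c::ab_group_add) coalg \<Rightarrow> ('c, 'm, 'n) q_gen \<Rightarrow>
     (('k, 'c, 'm, 'n) bar_gen \<Rightarrow>\<^sub>0 'k)" where
  "alpha_gen C = (\<lambda>(m, c, n).
     if deg c = 0 then fscale (counit C (elt c)) (gen (m, [], n))
     else (\<Sum>k=1..nat (deg c). fext (\<lambda>cs. gen (m, map brace_arr cs, n)) (red_iter C (k - 1) c)))"

definition alpha_map ::
    "('k::comm_ring_1, 'c::ab_group_add) coalg \<Rightarrow> ('k, 'c, 'm::ab_group_add) rmod \<Rightarrow>
     ('k, 'c, 'n::ab_group_add) lmod \<Rightarrow>
     (('c, 'm, 'n) q_gen \<Rightarrow>\<^sub>0 'k) set \<Rightarrow> (('k, 'c, 'm, 'n) bar_gen \<Rightarrow>\<^sub>0 'k) set" where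
  "alpha_map C M N = qmap (Bar C M N) (alpha_gen C)"

definition H_word ::
    "('k::comm_ring_1, 'c::ab_group_add) coalg \<Rightarrow> ('k, 'c, 'm::ab_group_add) rmod \<Rightarrow>
     ('c, 'm) arr \<Rightarrow> 'c \<Rightarrow> ('c, ('k, 'c) cobar) arr list \<Rightarrow> ('c, 'n) arr \<Rightarrow> 'c cobar_word \<Rightarrow>
     (('k, 'c, 'm, 'n) bar_gen \<Rightarrow>\<^sub>0 'k)" where
  "H_word C M m y as n = (\<lambda>(x, cs). \<Sum>i<length cs - 1.
     fscale (ksign (deg m + deg (cs ! i) - 1))
       (\<Sum>k=1..nat (deg (cs ! i)).
          fext (\<lambda>bs. gen (arr_comp (ract M) m (mono_arr x (take i cs) (src (cs ! i))),
                          map brace_arr bs @ [mono_arr (tgt (cs ! i)) (drop (Suc i) cs) y] @ as,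
                          n))
               (red_iter C (k - 1) (cs ! i))))"

definition H_gen ::
    "('k::comm_ring_1, 'c::ab_group_add) coalg \<Rightarrow> ('k, 'c, 'm::ab_group_add) rmod \<Rightarrow>
     ('k, 'c, 'm, 'n) bar_gen \<Rightarrow> (('k, 'c, 'm, 'n) bar_gen \<Rightarrow>\<^sub>0 'k)" where
  "H_gen C M = (\<lambda>(m, as, n). case as of
       [] \<Rightarrow> 0
     | a # as' \<Rightarrow> fext (H_word C M m (tgt a) as' n) (elt a))"

definition H_map ::
    "('k::comm_ring_1, 'c::ab_group_add) coalg \<Rightarrow> ('k, 'c, 'm::ab_group_add) rmod \<Rightarrow>
     ('k, 'c, 'n::ab_group_add) lmod \<Rightarrow>
     (('k, 'c, 'm, 'n) bar_gen \<Rightarrow>\<^sub>0 'k) set \<Rightarrow> (('k, 'c, 'm, 'n) bar_gen \<Rightarrow>\<^sub>0 'k) set" where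
  "H_map C M N = qmap (Bar C M N) (H_gen C M)"

end

theory Submission
  imports Defs
begin

text \<open>
  A linear map out of \<open>Bar\<close> or \<open>\<Q>\<close> is a function \<open>B\<close> on generators that is multilinear and kills the
  normalized relations, so every identity between composites is an identity of such functions.
  Words of the cobar category are built by multiplying brackets \<open>{c}\<close> on the left, and all the maps
  have simple recursions along this: \<open>\<pi>(m[{c}v]n) = m \<box> c \<box> vn \<plusminus> \<pi>(m{c}[v]n)\<close>, and likewise
  \<open>H(m[{c}v|W]n) = \<plusminus>\<alpha>\<^sub>c[v|W]n \<plusminus> H(m{c}[v|W]n)\<close>, where \<open>\<alpha>\<^sub>c\<close> denotes the sum of the
  \<open>m[{c\<^sup>1}|\<dots>|{c\<^sup>k}|\<close>.  The identities for \<open>\<pi>\<close> and \<open>H\<close> therefore follow by induction on the length of the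
  first word; both sides vanish on the empty word.  The essential computation is that of \<open>\<partial>\<close> on \<open>\<alpha>\<^sub>c\<close>:
  the products of neighbouring brackets cancel against the quadratic part of \<open>D{c}\<close>, which leaves
  \<open>\<alpha>\<close> of \<open>dc\<close> and the two boundary terms in which \<open>c'\<close> acts on the left and \<open>c''\<close> on the right.
  The curvature terms cancel because \<open>h(c) id\<close> gives the same generator in \<open>m{c}\<close> and in \<open>{c}v\<close>.
\<close>

section \<open>Linear maps out of presented modules\<close>

text \<open>The obstacle is the coproduct. \<open>sweedler\<close> picks a representative of
  \<Delta>c in C \<box> C by choice, so it is neither linear in c nor coassociative as a formal sum;
  only its values under functions linear in each factor are. Such a function is defined label by
  label, on pieces C(x,y)_n, while the axioms of C concern bilinear maps on all of C. The bridge is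
  to extend a labelled function to C by composing with the projections onto the pieces, apply the
  axiom there, and return. These projections are not part of the data: they are built from the
  coordinates of C_0 at its points, which are orthogonal idempotents under convolution. There may be
  infinitely many points, so each comparison fixes a finite set of middle points large enough for
  all elements involved. Two facts hidden in the notions have to be derived: the counit vanishes in
  positive degree, and h vanishes on C(x,y) for x \<noteq> y, without which D{c} would not be a
  morphism from x to y. Target modules stay arbitrary until the end, where the classes of generators
  of Bar and of \<Q> serve as universal test functions.\<close>

interpretation fs: module fscale
  by (rule module_fscale)

text \<open>The graded pieces are submodules of a type rather than types, and a function of labelled
  elements is linear only while the labels are fixed. Linearity is therefore taken relative to a
  set.\<close>

definition lin_on ::
    "('k::comm_ring_1 \<Rightarrow> 'v::ab_group_add \<Rightarrow> 'v) \<Rightarrow> 'v set \<Rightarrow>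
     ('k \<Rightarrow> 'w::ab_group_add \<Rightarrow> 'w) \<Rightarrow> ('v \<Rightarrow> 'w) \<Rightarrow> bool" where
  "lin_on t V s f \<longleftrightarrow>
     (\<forall>u\<in>V. \<forall>v\<in>V. f (u + v) = f u + f v) \<and> (\<forall>r. \<forall>u\<in>V. f (t r u) = s r (f u))"

lemma lin_onI:
  assumes "\<And>u v. u \<in> V \<Longrightarrow> v \<in> V \<Longrightarrow> f (u + v) = f u + f v"
    and "\<And>r u. u \<in> V \<Longrightarrow> f (t r u) = s r (f u)"
  shows "lin_on t V s f"
  using assms by (auto simp: lin_on_def)

lemma lin_on_addD: "lin_on t V s f \<Longrightarrow> u \<in> V \<Longrightarrow> v \<in> V \<Longrightarrow> f (u + v) = f u + f v"
  by (auto simp: lin_on_def)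

lemma lin_on_scaleD: "lin_on t V s f \<Longrightarrow> u \<in> V \<Longrightarrow> f (t r u) = s r (f u)"
  by (auto simp: lin_on_def)

lemma lin_on_cong:
  assumes "\<And>u. u \<in> V \<Longrightarrow> f u = g u" and "module t" and "module.subspace t V"
  shows "lin_on t V s f \<longleftrightarrow> lin_on t V s g"
proof -
  have "u + v \<in> V" "t r u \<in> V" if "u \<in> V" "v \<in> V" for u v r
    using that assms(2,3) by (auto simp: module.subspace_add module.subspace_scale)
  then show ?thesis
    using assms(1) by (simp add: lin_on_def)
qed

lemma lin_on_comp:
  assumes "lin_on t' W s f" and "lin_on t V t' g" and "\<And>u. u \<in> V \<Longrightarrow> g u \<in> W"
  shows "lin_on t V s (\<lambda>u. f (g u))"
  using assms by (auto simp: lin_on_def)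

lemma lin_on_ident: "lin_on t V t (\<lambda>u. u)"
  by (simp add: lin_on_def)

lemma lin_on_subset: "lin_on t V s f \<Longrightarrow> W \<subseteq> V \<Longrightarrow> lin_on t W s f"
  unfolding lin_on_def by blast

lemma lin_on_hom: "module_hom t s f \<Longrightarrow> lin_on t V s f"
  by (simp add: lin_on_def module_hom.add module_hom.scale)

lemma hom_iff_lin_on: "module t \<Longrightarrow> module s \<Longrightarrow> module_hom t s f \<longleftrightarrow> lin_on t UNIV s f"
  by (simp add: module_hom_iff lin_on_def)

text \<open>This says that the linear extension of \<open>B\<close> to formal sums descends to the
  quotient by the submodule that \<open>R\<close> generates; see \<open>kills_eqmod\<close>.\<close>

definition kills ::
    "('k::comm_ring_1 \<Rightarrow> 'v::ab_group_add \<Rightarrow> 'v) \<Rightarrow> ('g \<Rightarrow>\<^sub>0 'k) set \<Rightarrow> ('g \<Rightarrow> 'v) \<Rightarrow> bool" where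
  "kills s R B \<longleftrightarrow> (\<forall>r\<in>R. lext s B r = 0)"

context module
begin

lemma lin_on_zero: "lin_on t V scale (\<lambda>u. 0)"
  by (simp add: lin_on_def)

lemma lin_on_add: "lin_on t V scale f \<Longrightarrow> lin_on t V scale g \<Longrightarrow> lin_on t V scale (\<lambda>u. f u + g u)"
  by (simp add: lin_on_def scale_right_distrib algebra_simps)

lemma lin_on_uminus: "lin_on t V scale f \<Longrightarrow> lin_on t V scale (\<lambda>u. - f u)"
  by (simp add: lin_on_def algebra_simps)

lemma lin_on_diff: "lin_on t V scale f \<Longrightarrow> lin_on t V scale g \<Longrightarrow> lin_on t V scale (\<lambda>u. f u - g u)"
  by (simp add: lin_on_def scale_right_diff_distrib algebra_simps)

lemma lin_on_scale: "lin_on t V scale f \<Longrightarrow> lin_on t V scale (\<lambda>u. scale r (f u))"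
  by (simp add: lin_on_def scale_right_distrib scale_left_commute del: scale_scale)

lemma lin_on_scale_left: "lin_on t V (*) f \<Longrightarrow> lin_on t V scale (\<lambda>u. scale (f u) b)"
  by (simp add: lin_on_def scale_left_distrib)

lemma lin_on_sum: "(\<And>i. i \<in> I \<Longrightarrow> lin_on t V scale (f i)) \<Longrightarrow> lin_on t V scale (\<lambda>u. \<Sum>i\<in>I. f i u)"
  by (simp add: lin_on_def sum.distrib scale_sum_right)

lemma lin_on_if: "(b \<Longrightarrow> lin_on t V scale f) \<Longrightarrow> (\<not> b \<Longrightarrow> lin_on t V scale g) \<Longrightarrow>
    lin_on t V scale (\<lambda>u. if b then f u else g u)"
  by (cases b) simp_all

lemma lin_on_lext: "(\<And>g. g \<in> Poly_Mapping.keys x \<Longrightarrow> lin_on t V scale (f g)) \<Longrightarrow>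
    lin_on t V scale (\<lambda>u. lext scale (\<lambda>g. f g u) x)"
  unfolding lext_def by (intro lin_on_sum lin_on_scale)

lemma lin_on_0:
  assumes "lin_on t V scale f" and "module t" and "0 \<in> V"
  shows "f 0 = 0"
  using lin_on_scaleD[OF assms(1,3), of 0] module.scale_zero_left[OF assms(2)] by simp

lemma lin_on_neg:
  assumes "lin_on t V scale f" and "module t" and "u \<in> V"
  shows "f (- u) = - f u"
  using lin_on_scaleD[OF assms(1,3), of "-1"] module.scale_minus_left[OF assms(2)]
  by (simp add: module.scale_one[OF assms(2)])

lemma lin_on_sumD:
  assumes "lin_on t V scale f" and "module t" and "module.subspace t V" and "\<And>i. i \<in> I \<Longrightarrow> g i \<in> V"
  shows "f (\<Sum>i\<in>I. g i) = (\<Sum>i\<in>I. f (g i))"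
  using assms(4)
proof (induction I rule: infinite_finite_induct)
  case (insert i I)
  then have "sum g I \<in> V" using assms(2,3) by (auto intro: module.subspace_sum)
  with insert show ?case by (simp add: lin_on_addD[OF assms(1)])
qed (use lin_on_0[OF assms(1,2)] module.subspace_0[OF assms(2,3)] in auto)

lemma lext_eq_sum:
  assumes "finite A" and "Poly_Mapping.keys x \<subseteq> A"
  shows "lext scale f x = (\<Sum>g\<in>A. Poly_Mapping.lookup x g *s f g)"
  unfolding lext_def using assms
  by (intro sum.mono_neutral_left) (auto simp: in_keys_iff)

lemma lext_0 [simp]: "lext scale f 0 = 0"
  by (simp add: lext_def)

lemma lext_gen [simp]: "lext scale f (gen g) = f g"
proof (cases "(1::'a) = 0")
  \<comment> \<open>Over the zero ring \<open>gen g\<close> is the zero sum and has no keys, so the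
    sum defining \<open>lext\<close> is empty. Every module over that ring is trivial, and the
    equation still holds.\<close>
  case True
  then have "x = 0" for x :: 'b by (metis scale_one scale_zero_left)
  then show ?thesis by metis
qed (simp add: lext_def)

lemma lext_add: "lext scale f (x + y) = lext scale f x + lext scale f y"
proof -
  let ?A = "Poly_Mapping.keys x \<union> Poly_Mapping.keys y"
  have "Poly_Mapping.keys (x + y) \<subseteq> ?A" by (rule keys_add)
  then show ?thesis
    by (simp add: lext_eq_sum[of ?A] lookup_add scale_left_distrib sum.distrib)
qed

lemma lext_fscale: "lext scale f (fscale r x) = r *s lext scale f x"
proof -
  have "Poly_Mapping.keys (fscale r x) \<subseteq> Poly_Mapping.keys x"
    by (auto simp: in_keys_iff lookup_fscale)
  then show ?thesis
    by (simp add: lext_eq_sum[of "Poly_Mapping.keys x"] lookup_fscale scale_sum_right)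
qed

lemma lext_hom: "module_hom fscale scale (lext scale f)"
  by (simp add: module_hom_iff module_fscale module_axioms lext_add lext_fscale)

lemmas lext_uminus = module_hom.neg[OF lext_hom]
lemmas lext_diff = module_hom.diff[OF lext_hom]
lemmas lext_sum = module_hom.sum[OF lext_hom]
lemmas lext_simps = lext_add lext_fscale lext_uminus lext_diff lext_sum

lemma lext_cong:
  assumes "\<And>g. g \<in> Poly_Mapping.keys x \<Longrightarrow> f g = f' g"
  shows "lext scale f x = lext scale f' x"
  unfolding lext_def using assms by (intro sum.cong) auto

lemma lext_fun_0 [simp]: "lext scale (\<lambda>g. 0) x = 0"
  by (simp add: lext_def)

lemma lext_fun_add: "lext scale (\<lambda>g. f g + f' g) x = lext scale f x + lext scale f' x"
  by (simp add: lext_def scale_right_distrib sum.distrib)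

lemma lext_fun_diff: "lext scale (\<lambda>g. f g - f' g) x = lext scale f x - lext scale f' x"
  by (simp add: lext_def scale_right_diff_distrib sum_subtractf)

lemma lext_fun_uminus: "lext scale (\<lambda>g. - f g) x = - lext scale f x"
  by (simp add: lext_def sum_negf)

lemma lext_fun_scale: "lext scale (\<lambda>g. r *s f g) x = r *s lext scale f x"
  by (simp add: lext_def scale_sum_right mult.commute)

lemma lext_fun_sum: "lext scale (\<lambda>g. \<Sum>i\<in>I. f i g) x = (\<Sum>i\<in>I. lext scale (f i) x)"
  by (simp add: lext_def scale_sum_right sum.swap[of _ I])

lemma hom_lext:
  assumes "module_hom s' scale \<phi>"
  shows "\<phi> (lext s' f x) = lext scale (\<lambda>g. \<phi> (f g)) x"
  using assms by (simp add: lext_def module_hom.sum module_hom.scale)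

lemma lext_lext: "lext scale f (lext fscale h x) = lext scale (\<lambda>g. lext scale f (h g)) x"
  by (rule hom_lext[OF lext_hom])

lemma lext_swap:
  "lext scale (\<lambda>g. lext scale (\<lambda>h. f g h) y) x = lext scale (\<lambda>h. lext scale (\<lambda>g. f g h) x) y"
  by (simp add: lext_def scale_sum_right sum.swap[of _ "Poly_Mapping.keys x"] mult.commute)

lemma lin_on_lext_arg: "lin_on fscale V scale (lext scale f)"
  by (rule lin_on_hom[OF lext_hom])

lemma lin_on_lext_word:
  assumes "lin_on t V scale f" and "module t" and "module.subspace t V"
    and "\<And>g. g \<in> Poly_Mapping.keys x \<Longrightarrow> h g \<in> V"
  shows "f (lext t h x) = lext scale (\<lambda>g. f (h g)) x"
  unfolding lext_def
  using assms by (subst lin_on_sumD[OF assms(1-3)]) (auto simp: lin_on_scaleD module.subspace_scale)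

text \<open>The kernel of a linear extension is a submodule, so relations only need to be checked on
  generators.\<close>

lemma kills_span: "kills scale (fs.span R) B \<longleftrightarrow> kills scale R B"
proof
  assume "kills scale R B"
  then have "R \<subseteq> {r. lext scale B r = 0}" by (auto simp: kills_def)
  moreover have "fs.subspace {r. lext scale B r = 0}"
    by (rule module_hom.subspace_kernel[OF lext_hom])
  ultimately show "kills scale (fs.span R) B"
    using fs.span_minimal by (auto simp: kills_def)
qed (auto simp: kills_def fs.span_base)

lemma kills_Un: "kills scale (R \<union> R') B \<longleftrightarrow> kills scale R B \<and> kills scale R' B"
  by (auto simp: kills_def)

lemma kills_Union: "kills scale (\<Union>X) B \<longleftrightarrow> (\<forall>R\<in>X. kills scale R B)"
  by (auto simp: kills_def)

text \<open>This is the universal property of one tensor slot: the formal relations imposed for that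
  slot translate into linearity of the test function there.\<close>

lemma kills_lin_rels: "kills scale (lin_rels t V f) B \<longleftrightarrow> lin_on t V scale (\<lambda>u. B (f u))"
proof -
  have "kills scale (lin_rels t V f) B \<longleftrightarrow>
      (\<forall>u\<in>V. \<forall>v\<in>V. lext scale B (gen (f (u + v)) - gen (f u) - gen (f v)) = 0) \<and>
      (\<forall>r. \<forall>u\<in>V. lext scale B (gen (f (t r u)) - fscale r (gen (f u))) = 0)"
    unfolding kills_def lin_rels_def by blast
  then show ?thesis
    by (simp add: lin_on_def lext_simps diff_diff_eq)
qed

lemma kills_eqmod: "kills scale R B \<Longrightarrow> eqmod (fs.span R) x y \<Longrightarrow> lext scale B x = lext scale B y"
  using kills_span[of R B] by (auto simp: kills_def eqmod_def lext_diff)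

end

section \<open>Formal sums supported on a set of generators\<close>

lemma fsums_zero [simp]: "0 \<in> fsums G"
  by (simp add: fsums_def)

lemma fsums_gen [simp]: "g \<in> G \<Longrightarrow> gen g \<in> fsums G"
  by (auto simp: fsums_def)

lemma subspace_fsums: "fs.subspace (fsums G)"
proof (rule fs.subspaceI)
  show "x + y \<in> fsums G" if "x \<in> fsums G" "y \<in> fsums G" for x y
    using that keys_add[of x y] by (auto simp: fsums_def)
  show "fscale r x \<in> fsums G" if "x \<in> fsums G" for r x
    using that by (auto simp: fsums_def subset_eq in_keys_iff lookup_fscale)
qed simp

lemmas fsums_add [simp] = fs.subspace_add[OF subspace_fsums]
lemmas fsums_diff [simp] = fs.subspace_diff[OF subspace_fsums]
lemmas fsums_fscale [simp] = fs.subspace_scale[OF subspace_fsums]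
lemmas fsums_sum = fs.subspace_sum[OF subspace_fsums]

lemma fsums_mono: "x \<in> fsums G \<Longrightarrow> G \<subseteq> G' \<Longrightarrow> x \<in> fsums G'"
  by (auto simp: fsums_def)

lemma fsums_lext:
  assumes "\<And>g. g \<in> Poly_Mapping.keys x \<Longrightarrow> f g \<in> fsums G"
  shows "fext f x \<in> fsums G"
  unfolding lext_def using assms by (intro fsums_sum) auto

lemma fsums_keysD: "x \<in> fsums G \<Longrightarrow> g \<in> Poly_Mapping.keys x \<Longrightarrow> g \<in> G"
  by (auto simp: fsums_def)

lemma lext_gen_id: "fext gen x = x"
proof (rule poly_mapping_eqI)
  fix g
  have "Poly_Mapping.lookup (fext gen x) g
      = (\<Sum>h\<in>Poly_Mapping.keys x. if h = g then Poly_Mapping.lookup x h else 0)"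
    unfolding lext_def lookup_sum by (intro sum.cong) (auto simp: lookup_fscale lookup_single when_def)
  then show "Poly_Mapping.lookup (fext gen x) g = Poly_Mapping.lookup x g"
    by (simp add: in_keys_iff)
qed

text \<open>
  HOL has no quotient type by a submodule that depends on parameters.  This type is the product of
  the quotients of the free module by all its submodules \<open>span U\<close>; \<open>cls U\<close> embeds the factor of
  \<open>U\<close>, so that congruences become equations.
\<close>

definition fam_rel ::
    "(('g \<Rightarrow>\<^sub>0 'k::comm_ring_1) set \<Rightarrow> ('g \<Rightarrow>\<^sub>0 'k)) \<Rightarrow> (('g \<Rightarrow>\<^sub>0 'k) set \<Rightarrow> ('g \<Rightarrow>\<^sub>0 'k)) \<Rightarrow> bool" where
  "fam_rel f g \<longleftrightarrow> (\<forall>U. f U - g U \<in> fs.span U)"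

lemma fam_relI: "(\<And>U. f U - g U \<in> fs.span U) \<Longrightarrow> fam_rel f g"
  by (simp add: fam_rel_def)

lemma fam_relD: "fam_rel f g \<Longrightarrow> f U - g U \<in> fs.span U"
  by (simp add: fam_rel_def)

quotient_type (overloaded) ('g, 'k) quot = "('g \<Rightarrow>\<^sub>0 'k::comm_ring_1) set \<Rightarrow> ('g \<Rightarrow>\<^sub>0 'k)" / fam_rel
proof (rule equivpI)
  show "reflp fam_rel"
    by (intro reflpI fam_relI) (simp add: fs.span_zero)
  show "symp fam_rel"
  proof (intro sympI fam_relI)
    fix f g :: "('c \<Rightarrow>\<^sub>0 'd::comm_ring_1) set \<Rightarrow> ('c \<Rightarrow>\<^sub>0 'd)" and U
    assume "fam_rel f g"
    from fs.span_neg[OF fam_relD[OF this]] show "g U - f U \<in> fs.span U" by simp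
  qed
  show "transp fam_rel"
  proof (intro transpI fam_relI)
    fix f g h :: "('c \<Rightarrow>\<^sub>0 'd::comm_ring_1) set \<Rightarrow> ('c \<Rightarrow>\<^sub>0 'd)" and U
    assume "fam_rel f g" "fam_rel g h"
    from fs.span_add[OF this[THEN fam_relD]] show "f U - h U \<in> fs.span U" by simp
  qed
qed

instantiation quot :: (type, comm_ring_1) ab_group_add
begin

lift_definition zero_quot :: "('a, 'b) quot" is "\<lambda>U. 0" .

lift_definition plus_quot :: "('a, 'b) quot \<Rightarrow> ('a, 'b) quot \<Rightarrow> ('a, 'b) quot" is "\<lambda>f g U. f U + g U"
  using fs.span_add[OF fam_relD fam_relD] by (auto intro!: fam_relI simp: add_diff_add)

lift_definition uminus_quot :: "('a, 'b) quot \<Rightarrow> ('a, 'b) quot" is "\<lambda>f U. - f U"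
  using fs.span_neg[OF fam_relD] by (auto intro!: fam_relI)

lift_definition minus_quot :: "('a, 'b) quot \<Rightarrow> ('a, 'b) quot \<Rightarrow> ('a, 'b) quot" is "\<lambda>f g U. f U - g U"
proof (rule fam_relI)
  fix f f' g g' :: "('a \<Rightarrow>\<^sub>0 'b) set \<Rightarrow> ('a \<Rightarrow>\<^sub>0 'b)" and U
  assume "fam_rel f f'" "fam_rel g g'"
  from fs.span_diff[OF this[THEN fam_relD], of U]
  show "(f U - g U) - (f' U - g' U) \<in> fs.span U"
    by (simp add: algebra_simps)
qed

instance
proof
  fix a b c :: "('a, 'b) quot"
  show "a + b + c = a + (b + c)"
    by transfer (rule fam_relI, simp add: fs.span_zero add.assoc)
  show "a + b = b + a"
    by transfer (rule fam_relI, simp add: fs.span_zero add.commute)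
  show "0 + a = a"
    by transfer (rule fam_relI, simp add: fs.span_zero)
  show "- a + a = 0"
    by transfer (rule fam_relI, simp add: fs.span_zero)
  show "a - b = a + - b"
    by transfer (rule fam_relI, simp add: fs.span_zero)
qed

end

lift_definition qscale :: "'k::comm_ring_1 \<Rightarrow> ('g, 'k) quot \<Rightarrow> ('g, 'k) quot"
  is "\<lambda>r f U. fscale r (f U)"
  using fs.span_scale[OF fam_relD] by (auto intro!: fam_relI simp: fs.scale_right_diff_distrib[symmetric])

lift_definition cls ::
    "('g \<Rightarrow>\<^sub>0 'k::comm_ring_1) set \<Rightarrow> ('g \<Rightarrow>\<^sub>0 'k) \<Rightarrow> ('g, 'k) quot"
  is "\<lambda>(U :: ('g \<Rightarrow>\<^sub>0 'k) set) (x :: 'g \<Rightarrow>\<^sub>0 'k) V. if V = U then x else 0" .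

interpretation qs: module qscale
proof
  fix a b :: "'k::comm_ring_1" and x y :: "('g, 'k) quot"
  show "qscale a (x + y) = qscale a x + qscale a y"
    by transfer (rule fam_relI, simp add: fs.span_zero fs.scale_right_distrib)
  show "qscale (a + b) x = qscale a x + qscale b x"
    by transfer (rule fam_relI, simp add: fs.span_zero fs.scale_left_distrib)
  show "qscale a (qscale b x) = qscale (a * b) x"
    by transfer (rule fam_relI, simp add: fs.span_zero)
  show "qscale 1 x = x"
    by transfer (rule fam_relI, simp add: fs.span_zero)
qed

lemma cls_hom: "module_hom fscale qscale (cls U)"
proof -
  have "cls U (x + y) = cls U x + cls U y" for x y
    by transfer (rule fam_relI, simp add: fs.span_zero)
  moreover have "cls U (fscale r x) = qscale r (cls U x)" for r x
    by transfer (rule fam_relI, simp add: fs.span_zero)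
  ultimately show ?thesis
    by (simp add: module_hom_iff module_fscale qs.module_axioms)
qed

text \<open>Both families are zero in every coordinate other than \<open>U\<close>, so only the
  congruence modulo \<open>span U\<close> is compared.\<close>

lemma cls_eq_iff: "cls U x = cls U y \<longleftrightarrow> eqmod (fs.span U) x y"
proof -
  let ?f = "\<lambda>x V. if V = U then x else 0"
  have "cls U x = cls U y \<longleftrightarrow> fam_rel (?f x) (?f y)"
    by (simp add: cls_def quot.abs_eq_iff cong: if_cong)
  also have "\<dots> \<longleftrightarrow> x - y \<in> fs.span U"
  proof
    assume "fam_rel (?f x) (?f y)"
    from fam_relD[OF this, of U] show "x - y \<in> fs.span U" by simp
  qed (auto intro!: fam_relI simp: fs.span_zero)
  finally show ?thesis by (simp add: eqmod_def)
qed

text \<open>The universal test function: an identity valid for every function that kills the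
  relations, applied to this one, becomes an identity of classes.\<close>

lemma kills_cls: "kills qscale U (\<lambda>g. cls U (gen g))"
proof -
  have "lext qscale (\<lambda>g. cls U (gen g)) r = 0" if "r \<in> U" for r
  proof -
    have "cls U r = cls U 0"
      using that by (simp add: cls_eq_iff eqmod_def fs.span_base)
    then show ?thesis
      by (simp add: qs.hom_lext[OF cls_hom, symmetric] lext_gen_id module_hom.zero[OF cls_hom])
  qed
  then show ?thesis by (auto simp: kills_def)
qed

lemma cls_lext: "cls U x = lext qscale (\<lambda>g. cls U (gen g)) x"
  by (simp add: qs.hom_lext[OF cls_hom, symmetric] lext_gen_id)

section \<open>Classes of formal sums and the maps induced on them\<close>

lemma qclass_iff: "rels P = fs.span R \<Longrightarrow> y \<in> qclass P x \<longleftrightarrow> cls R y = cls R x"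
  by (simp add: qclass_def cls_eq_iff)

lemma qclass_eqI: "rels P = fs.span R \<Longrightarrow> cls R x = cls R y \<Longrightarrow> qclass P x = qclass P y"
  by (auto simp: qclass_iff)

text \<open>Since the relations are killed, all representatives of the class have congruent images,
  and the union defining \<open>qmap\<close> is a union of one and the same class.\<close>

lemma qmap_qclass:
  assumes "rels P = fs.span R" and "rels P' = fs.span R'"
    and "kills qscale R (\<lambda>g. cls R' (f g))"
  shows "qmap P' f (qclass P x) = qclass P' (fext f x)"
proof -
  have "qclass P' (fext f y) = qclass P' (fext f x)" if "y \<in> qclass P x" for y
  proof -
    have "cls R' (fext f y) = cls R' (fext f x)"
      using that qs.kills_eqmod[OF assms(3), of y x]
      by (simp add: qclass_def assms(1) qs.hom_lext[OF cls_hom])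
    then show ?thesis by (rule qclass_eqI[OF assms(2)])
  qed
  moreover have "x \<in> qclass P x"
    by (simp add: qclass_def eqmod_def assms(1) fs.span_zero)
  ultimately show ?thesis unfolding qmap_def by (intro UN_constant_eq ballI)
qed

text \<open>Once the relations are respected, both the range and the degree of the induced map can
  be read off from the images of the generators.\<close>

lemma map_of_degreeI:
  assumes "rels P = fs.span R" and "rels P' = fs.span R'"
    and "kills qscale R (\<lambda>g. cls R' (f g))"
    and "\<And>g. g \<in> gens P \<Longrightarrow> f g \<in> fsums {h \<in> gens P'. gdeg P' h = gdeg P g + r}"
  shows "map_of_degree r P P' (qmap P' f)"
  unfolding map_of_degree_def
proof (intro conjI ballI allI)
  fix X assume "X \<in> qcarrier P"
  then obtain x where x: "x \<in> fsums (gens P)" "X = qclass P x" by (auto simp: qcarrier_def)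
  have "fext f x \<in> fsums (gens P')"
    using x(1) by (intro fsums_lext fsums_mono[OF assms(4)]) (auto dest: fsums_keysD)
  then show "qmap P' f X \<in> qcarrier P'"
    using x(2) qmap_qclass[OF assms(1-3)] by (auto simp: qcarrier_def)
next
  fix i X assume "X \<in> qgrade P i"
  then obtain x where x: "x \<in> fsums {g \<in> gens P. gdeg P g = i}" "X = qclass P x"
    by (auto simp: qgrade_def)
  have "fext f x \<in> fsums {h \<in> gens P'. gdeg P' h = i + r}"
    using x(1) by (intro fsums_lext) (auto dest!: fsums_keysD intro!: fsums_mono[OF assms(4)])
  then show "qmap P' f X \<in> qgrade P' (i + r)"
    using x(2) qmap_qclass[OF assms(1-3)] by (auto simp: qgrade_def)
qed

lemma qadd_qclass:
  assumes "rels P = fs.span R"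
  shows "qadd (qclass P x) (qclass P y) = qclass P (x + y)"
proof (intro set_eqI iffI)
  fix z
  note iff = qclass_iff[OF assms] module_hom.add[OF cls_hom] module_hom.diff[OF cls_hom]
  show "z \<in> qclass P (x + y)" if "z \<in> qadd (qclass P x) (qclass P y)"
    using that by (auto simp: qadd_def iff)
  assume "z \<in> qclass P (x + y)"
  then have "z - y \<in> qclass P x" "y \<in> qclass P y" by (simp_all add: iff)
  moreover have "z = (z - y) + y" by simp
  ultimately show "z \<in> qadd (qclass P x) (qclass P y)" unfolding qadd_def by blast
qed

lemma qdiff_qclass:
  assumes "rels P = fs.span R"
  shows "qdiff (qclass P x) (qclass P y) = qclass P (x - y)"
proof (intro set_eqI iffI)
  fix z
  note iff = qclass_iff[OF assms] module_hom.add[OF cls_hom] module_hom.diff[OF cls_hom]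
  show "z \<in> qclass P (x - y)" if "z \<in> qdiff (qclass P x) (qclass P y)"
    using that by (auto simp: qdiff_def iff)
  assume "z \<in> qclass P (x - y)"
  then have "z + y \<in> qclass P x" "y \<in> qclass P y" by (simp_all add: iff)
  moreover have "z = (z + y) - y" by simp
  ultimately show "z \<in> qdiff (qclass P x) (qclass P y)" unfolding qdiff_def by blast
qed

section \<open>Coalgebras graded by pairs of points\<close>

interpretation rm: module "(*) :: 'k::comm_ring_1 \<Rightarrow> 'k \<Rightarrow> 'k"
  by standard (simp_all add: algebra_simps)

text \<open>Summing over any finite set that contains the support lets decompositions of different
  elements be added over a common index set.\<close>

lemma decomposes_alt:
  assumes "finite A" and "Poly_Mapping.keys p \<subseteq> A"
  shows "decomposes V UNIV v p \<longleftrightarrow>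
    (\<forall>i. Poly_Mapping.lookup p i \<in> V i) \<and> v = (\<Sum>i\<in>A. Poly_Mapping.lookup p i)"
proof -
  have "(\<Sum>i\<in>A. Poly_Mapping.lookup p i) = (\<Sum>i\<in>Poly_Mapping.keys p. Poly_Mapping.lookup p i)"
    using assms by (intro sum.mono_neutral_right) (auto simp: in_keys_iff)
  then show ?thesis by (simp add: decomposes_def)
qed

context categorical_coalgebra
begin

sublocale cm: module "smul C"
  by (rule module_C)

abbreviation lin :: "('k \<Rightarrow> 'q::ab_group_add \<Rightarrow> 'q) \<Rightarrow> ('c \<Rightarrow> 'q) \<Rightarrow> bool" where
  "lin \<equiv> lin_on (smul C) UNIV"

lemma lin_add: "lin s f \<Longrightarrow> f (u + v) = f u + f v"
  and lin_scale: "lin s f \<Longrightarrow> f (smul C r u) = s r (f u)"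
  by (simp_all add: lin_on_def)

lemma lin_0: "module s \<Longrightarrow> lin s f \<Longrightarrow> f 0 = 0"
  by (rule module.lin_on_0[OF _ _ module_C]) auto

lemma lin_sum: "module s \<Longrightarrow> lin s f \<Longrightarrow> f (\<Sum>i\<in>I. g i) = (\<Sum>i\<in>I. f (g i))"
  by (rule module.lin_on_sumD[OF _ _ module_C]) auto

lemma lin_hom: "module s \<Longrightarrow> lin s f \<Longrightarrow> module_hom (smul C) s f"
  by (simp add: hom_iff_lin_on module_C)

lemmas codiff_lin = lin_on_hom[OF codiff_linear]
lemmas curv_lin = lin_on_hom[OF curv_linear]
lemmas counit_lin = lin_on_hom[OF counit_linear]

definition pr :: "nat \<Rightarrow> 'c \<Rightarrow> 'c" where
  "pr n c = Poly_Mapping.lookup (homog_parts C c) n"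

lemma subspace_gr: "cm.subspace (gr C n)"
  using graded by (simp add: direct_sum_def)

lemma homog_parts_decomposes: "decomposes (gr C) UNIV c (homog_parts C c)"
  unfolding homog_parts_def by (rule theI') (use graded in \<open>simp add: direct_sum_def\<close>)

lemma homog_parts_eqI: "decomposes (gr C) UNIV c p \<Longrightarrow> homog_parts C c = p"
  using graded homog_parts_decomposes unfolding direct_sum_def by blast

lemma pr_gr [simp]: "pr n c \<in> gr C n"
  using homog_parts_decomposes[of c] by (simp add: decomposes_def pr_def)

lemma sum_pr:
  assumes "finite A" and "Poly_Mapping.keys (homog_parts C c) \<subseteq> A"
  shows "c = (\<Sum>i\<in>A. pr i c)"
  using homog_parts_decomposes[of c] unfolding decomposes_alt[OF assms] by (simp add: pr_def)

text \<open>Sums and multiples of homogeneous decompositions are again decompositions, and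
  decompositions are unique.\<close>

lemma pr_lin: "lin (smul C) (pr n)"
proof (rule lin_onI)
  fix u v :: 'c and r
  let ?p = "homog_parts C u" and ?q = "homog_parts C v"
  let ?A = "Poly_Mapping.keys ?p \<union> Poly_Mapping.keys ?q"
  have keys: "Poly_Mapping.keys (?p + ?q) \<subseteq> ?A" by (rule keys_add)
  have "homog_parts C (u + v) = ?p + ?q"
  proof (rule homog_parts_eqI)
    have "u + v = (\<Sum>i\<in>?A. Poly_Mapping.lookup ?p i) + (\<Sum>i\<in>?A. Poly_Mapping.lookup ?q i)"
      using sum_pr[of ?A u] sum_pr[of ?A v] by (simp add: pr_def)
    moreover have "Poly_Mapping.lookup ?p i + Poly_Mapping.lookup ?q i \<in> gr C i" for i
      using pr_gr[of i u] pr_gr[of i v] by (simp add: pr_def cm.subspace_add[OF subspace_gr])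
    ultimately show "decomposes (gr C) UNIV (u + v) (?p + ?q)"
      by (simp add: decomposes_alt[OF _ keys] lookup_add sum.distrib)
  qed
  then show "pr n (u + v) = pr n u + pr n v" by (simp add: pr_def lookup_add)
  let ?r = "Poly_Mapping.map (smul C r) ?p"
  have look: "Poly_Mapping.lookup ?r i = smul C r (Poly_Mapping.lookup ?p i)" for i
    by (simp add: Poly_Mapping.map.rep_eq when_def)
  have keys: "Poly_Mapping.keys ?r \<subseteq> Poly_Mapping.keys ?p"
    by (auto simp: in_keys_iff look)
  have "homog_parts C (smul C r u) = ?r"
  proof (rule homog_parts_eqI)
    have "smul C r u = (\<Sum>i\<in>Poly_Mapping.keys ?p. Poly_Mapping.lookup ?r i)"
      using sum_pr[of "Poly_Mapping.keys ?p" u] by (simp add: pr_def look cm.scale_sum_right[symmetric])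
    moreover have "smul C r (Poly_Mapping.lookup ?p i) \<in> gr C i" for i
      using pr_gr[of i u] by (simp add: pr_def cm.subspace_scale[OF subspace_gr])
    ultimately show "decomposes (gr C) UNIV (smul C r u) ?r"
      by (simp add: decomposes_alt[OF _ keys] look)
  qed
  then show "pr n (smul C r u) = smul C r (pr n u)" by (simp add: pr_def look)
qed

lemma pr_of_gr:
  assumes "c \<in> gr C n"
  shows "homog_parts C c = Poly_Mapping.single n c" and "pr m c = (if m = n then c else 0)"
proof -
  have "decomposes (gr C) UNIV c (Poly_Mapping.single n c)"
    using assms cm.subspace_0[OF subspace_gr]
    by (subst decomposes_alt[of "{n}"]) (auto simp: lookup_single when_def)
  then show "homog_parts C c = Poly_Mapping.single n c" by (rule homog_parts_eqI)
  then show "pr m c = (if m = n then c else 0)" by (simp add: pr_def lookup_single when_def)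
qed

lemma lin_eqI_graded:
  assumes "module s" and "lin s f" and "lin s g" and "\<And>n c. c \<in> gr C n \<Longrightarrow> f c = g c"
  shows "f c = g c"
proof -
  have "f (\<Sum>i\<in>Poly_Mapping.keys (homog_parts C c). pr i c)
      = g (\<Sum>i\<in>Poly_Mapping.keys (homog_parts C c). pr i c)"
    using assms(4)[OF pr_gr] by (simp add: lin_sum[OF assms(1,2)] lin_sum[OF assms(1,3)])
  then show ?thesis using sum_pr[of "Poly_Mapping.keys (homog_parts C c)" c] by simp
qed

lemma sgn_inv_gr: "c \<in> gr C n \<Longrightarrow> sgn_inv C c = smul C (ksign (int n)) c"
  by (simp add: sgn_inv_def pr_of_gr)

lemma sgn_inv_lin: "lin (smul C) (sgn_inv C)"
proof -
  \<comment> \<open>Enlarging the index set costs nothing and gives u, v, u + v and r u a common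
    one.\<close>
  have *: "sgn_inv C c = (\<Sum>i\<in>A. smul C (ksign (int i)) (pr i c))"
    if "finite A" "Poly_Mapping.keys (homog_parts C c) \<subseteq> A" for A c
    unfolding sgn_inv_def pr_def using that
    by (intro sum.mono_neutral_left) (auto simp: in_keys_iff)
  show ?thesis
  proof (rule lin_onI)
    fix u v r
    let ?A = "Poly_Mapping.keys (homog_parts C u) \<union> Poly_Mapping.keys (homog_parts C v)
      \<union> Poly_Mapping.keys (homog_parts C (u + v)) \<union> Poly_Mapping.keys (homog_parts C (smul C r u))"
    have fin: "finite ?A" by simp
    show "sgn_inv C (u + v) = sgn_inv C u + sgn_inv C v"
      by (subst (1 2 3) *[OF fin])
        (auto simp: lin_add[OF pr_lin] cm.scale_right_distrib sum.distrib)
    show "sgn_inv C (smul C r u) = smul C r (sgn_inv C u)"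
      by (subst (1 2) *[OF fin])
        (auto simp: lin_scale[OF pr_lin] cm.scale_sum_right mult.commute)
  qed
qed

section \<open>Bilinear and trilinear maps evaluated on the coproduct\<close>

definition bil :: "('k \<Rightarrow> 'q::ab_group_add \<Rightarrow> 'q) \<Rightarrow> ('c \<Rightarrow> 'c \<Rightarrow> 'q) \<Rightarrow> bool" where
  "bil s \<beta> \<longleftrightarrow> module s \<and> (\<forall>b. lin s (\<lambda>a. \<beta> a b)) \<and> (\<forall>a. lin s (\<beta> a))"

lemma bilI: "module s \<Longrightarrow> (\<And>b. lin s (\<lambda>a. \<beta> a b)) \<Longrightarrow> (\<And>a. lin s (\<lambda>b. \<beta> a b)) \<Longrightarrow> bil s \<beta>"
  by (simp add: bil_def)

lemma bil_module: "bil s \<beta> \<Longrightarrow> module s"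
  and bil_left: "bil s \<beta> \<Longrightarrow> lin s (\<lambda>a. \<beta> a b)"
  and bil_right: "bil s \<beta> \<Longrightarrow> lin s (\<lambda>b. \<beta> a b)"
  by (simp_all add: bil_def)

lemma lin_comp: "lin s f \<Longrightarrow> lin (smul C) g \<Longrightarrow> lin s (\<lambda>u. f (g u))"
  by (rule lin_on_comp[where W = UNIV]) auto

lemma bil_comp: "bil s \<beta> \<Longrightarrow> lin (smul C) f \<Longrightarrow> lin (smul C) g \<Longrightarrow> bil s (\<lambda>a b. \<beta> (f a) (g b))"
  unfolding bil_def by (auto intro: lin_comp)

text \<open>The universal property of C \<otimes> C. It makes \<open>dl\<close> below independent of
  the representative \<open>cop C c\<close> and allows any congruent sum to be used in its
  place.\<close>

lemma lext_eq2:
  assumes "bil s \<beta>" and "eq2 C t t'"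
  shows "lext s (\<lambda>(a, b). \<beta> a b) t = lext s (\<lambda>(a, b). \<beta> a b) t'"
proof -
  interpret s: module s by (rule bil_module[OF assms(1)])
  show ?thesis
  proof (rule s.kills_eqmod[OF _ assms(2)[unfolded eq2_def tensor_rel_def]])
    show "kills s ((\<Union>w\<in>UNIV. lin_rels (smul C) UNIV (\<lambda>v. (v, w)))
        \<union> (\<Union>v\<in>UNIV. lin_rels (smul C) UNIV (\<lambda>w. (v, w)))) (\<lambda>(a, b). \<beta> a b)"
      using assms(1) by (auto simp: s.kills_Un s.kills_Union s.kills_lin_rels bil_def)
  qed
qed

definition dl :: "('k \<Rightarrow> 'q::ab_group_add \<Rightarrow> 'q) \<Rightarrow> ('c \<Rightarrow> 'c \<Rightarrow> 'q) \<Rightarrow> 'c \<Rightarrow> 'q" where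
  "dl s \<beta> c = lext s (\<lambda>(a, b). \<beta> a b) (cop C c)"

lemma dl_eq2: "bil s \<beta> \<Longrightarrow> eq2 C (cop C c) t \<Longrightarrow> dl s \<beta> c = lext s (\<lambda>(a, b). \<beta> a b) t"
  unfolding dl_def by (rule lext_eq2)

lemma dl_lin:
  assumes "bil s \<beta>"
  shows "lin s (dl s \<beta>)"
proof -
  interpret s: module s by (rule bil_module[OF assms(1)])
  show ?thesis
    using dl_eq2[OF assms cop_add] dl_eq2[OF assms cop_scale]
    by (simp add: lin_on_def dl_def s.lext_simps)
qed

lemma dl_cong:
  "(\<And>a b. (a, b) \<in> Poly_Mapping.keys (cop C c) \<Longrightarrow> \<beta> a b = \<beta>' a b) \<Longrightarrow> module s \<Longrightarrow>
    dl s \<beta> c = dl s \<beta>' c"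
  unfolding dl_def by (rule module.lext_cong) auto

lemma hom_dl: "module_hom s s' f \<Longrightarrow> f (dl s \<beta> c) = dl s' (\<lambda>a b. f (\<beta> a b)) c"
  unfolding dl_def using module.hom_lext[of s' s f] by (simp add: module_hom_iff split_def)

lemma lin_dl: "module s \<Longrightarrow> lin s f \<Longrightarrow> f (dl (smul C) \<beta> c) = dl s (\<lambda>a b. f (\<beta> a b)) c"
  by (rule hom_dl[OF lin_hom])

text \<open>The coproduct preserves degree, so \<Delta>c has a representative whose pairs have
  degrees i and n - i; agreement on such pairs is enough.\<close>

lemma dl_graded:
  assumes "bil s \<beta>" and "bil s \<beta>'" and "c \<in> gr C n"
    and "\<And>i a b. i \<le> n \<Longrightarrow> a \<in> gr C i \<Longrightarrow> b \<in> gr C (n - i) \<Longrightarrow> \<beta> a b = \<beta>' a b"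
  shows "dl s \<beta> c = dl s \<beta>' c"
proof -
  obtain t where t: "t \<in> fsums (\<Union>i\<le>n. gr C i \<times> gr C (n - i))" "eq2 C (cop C c) t"
    using cop_degree[OF assms(3)] by blast
  have "lext s (\<lambda>(a, b). \<beta> a b) t = lext s (\<lambda>(a, b). \<beta>' a b) t"
    by (rule module.lext_cong[OF bil_module[OF assms(1)]])
      (use fsums_keysD[OF t(1)] assms(4) in fastforce)
  then show ?thesis by (simp add: dl_eq2[OF assms(1) t(2)] dl_eq2[OF assms(2) t(2)])
qed

definition tril :: "('k \<Rightarrow> 'q::ab_group_add \<Rightarrow> 'q) \<Rightarrow> ('c \<Rightarrow> 'c \<Rightarrow> 'c \<Rightarrow> 'q) \<Rightarrow> bool" where
  "tril s \<gamma> \<longleftrightarrow> module s \<and> (\<forall>b c. lin s (\<lambda>a. \<gamma> a b c)) \<and> (\<forall>a c. lin s (\<lambda>b. \<gamma> a b c))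
     \<and> (\<forall>a b. lin s (\<gamma> a b))"

lemma trilI:
  "module s \<Longrightarrow> (\<And>b c. lin s (\<lambda>a. \<gamma> a b c)) \<Longrightarrow> (\<And>a c. lin s (\<lambda>b. \<gamma> a b c)) \<Longrightarrow>
    (\<And>a b. lin s (\<lambda>c. \<gamma> a b c)) \<Longrightarrow> tril s \<gamma>"
  by (simp add: tril_def)

text \<open>Coassociativity is a congruence modulo the relations of the triple tensor product, and a
  trilinear map kills these.\<close>

lemma dl_coassoc:
  assumes "tril s \<gamma>"
  shows "dl s (\<lambda>a b. dl s (\<lambda>a' a''. \<gamma> a' a'' b) a) c = dl s (\<lambda>a b. dl s (\<lambda>b' b''. \<gamma> a b' b'') b) c"
proof -
  interpret s: module s using assms by (simp add: tril_def)
  let ?R = "(\<Union>b c. lin_rels (smul C) UNIV (\<lambda>a. (a, b, c)))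
    \<union> (\<Union>a c. lin_rels (smul C) UNIV (\<lambda>b. (a, b, c)))
    \<union> (\<Union>a b. lin_rels (smul C) UNIV (\<lambda>c. (a, b, c)))"
  have "kills s ?R (\<lambda>(a, b, c). \<gamma> a b c)"
    using assms by (auto simp: s.kills_Un s.kills_Union s.kills_lin_rels tril_def)
  from s.kills_eqmod[OF this coassoc[unfolded tensor3_rel_def]] show ?thesis
    by (simp add: dl_def s.lext_lext split_def)
qed

lemma bil_dl_left: "tril s \<gamma> \<Longrightarrow> bil s (\<lambda>a b. dl s (\<lambda>a' a''. \<gamma> a' a'' b) a)"
  unfolding tril_def bil_def
  by (auto intro!: dl_lin bilI) (auto simp: dl_def split_def intro!: module.lin_on_lext)

lemma bil_dl_right: "tril s \<gamma> \<Longrightarrow> bil s (\<lambda>a b. dl s (\<lambda>b' b''. \<gamma> a b' b'') b)"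
  unfolding tril_def bil_def
  by (auto intro!: dl_lin bilI) (auto simp: dl_def split_def intro!: module.lin_on_lext)

lemma dl_coder:
  assumes "bil s \<beta>"
  shows "dl s \<beta> (codiff C c) = dl s (\<lambda>a b. \<beta> (codiff C a) b + \<beta> (sgn_inv C a) (codiff C b)) c"
proof -
  interpret s: module s by (rule bil_module[OF assms(1)])
  show ?thesis
    using dl_eq2[OF assms coderivation, of c]
    by (simp add: dl_def s.lext_lext split_def s.lext_add)
qed

lemma dl_counit_left: "module s \<Longrightarrow> lin s f \<Longrightarrow> dl s (\<lambda>a b. s (counit C a) (f b)) c = f c"
  using lin_dl[of s f "\<lambda>a b. smul C (counit C a) b" c] counit_left[of c]
  by (simp add: dl_def lin_scale)

lemma dl_counit_right: "module s \<Longrightarrow> lin s f \<Longrightarrow> dl s (\<lambda>a b. s (counit C b) (f a)) c = f c"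
  using lin_dl[of s f "\<lambda>a b. smul C (counit C b) a" c] counit_right[of c]
  by (simp add: dl_def lin_scale)

lemma bil_mult:
  assumes "module s" and "lin (*) f" and "lin s g"
  shows "bil s (\<lambda>a b. s (f a) (g b))" and "bil s (\<lambda>a b. s (f b) (g a))"
proof -
  interpret s: module s by fact
  show "bil s (\<lambda>a b. s (f a) (g b))" "bil s (\<lambda>a b. s (f b) (g a))"
    using assms(2,3) by (auto intro!: bilI s.lin_on_scale s.lin_on_scale_left s.module_axioms)
qed

text \<open>The counit is not assumed to be homogeneous. Evaluate \<epsilon> \<otimes> (\<epsilon>
  \<circ> \<open>pr n\<close>) and (\<epsilon> \<circ> \<open>pr 0\<close>) \<otimes> \<epsilon> on
  \<Delta>c: on pairs of degrees i and n - i both can be nonzero only for i = 0, where they agree.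
  By the counit axioms the first gives \<epsilon>(c), the second \<epsilon>(\<open>pr 0 c\<close>),
  which is zero for n > 0.\<close>

lemma counit_pos:
  assumes "c \<in> gr C n" and "0 < n"
  shows "counit C c = 0"
proof -
  have "dl (*) (\<lambda>a b. counit C a * counit C (pr n b)) c
      = dl (*) (\<lambda>a b. counit C (pr 0 a) * counit C b) c"
  proof (rule dl_graded[OF _ _ assms(1)])
    show "counit C a * counit C (pr n b) = counit C (pr 0 a) * counit C b"
      if "i \<le> n" "a \<in> gr C i" "b \<in> gr C (n - i)" for i a b
      using that assms(2) lin_0[OF rm.module_axioms counit_lin]
      by (cases "i = 0") (auto simp: pr_of_gr)
  qed (auto intro!: bil_mult counit_lin rm.module_axioms lin_comp[OF counit_lin] pr_lin)
  also have "\<dots> = counit C (pr 0 c)"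
    using dl_counit_right[OF rm.module_axioms lin_comp[OF counit_lin pr_lin], of 0 c]
    by (simp add: mult.commute)
  also have "dl (*) (\<lambda>a b. counit C a * counit C (pr n b)) c = counit C (pr n c)"
    by (rule dl_counit_left[OF rm.module_axioms lin_comp[OF counit_lin pr_lin]])
  finally show ?thesis
    using assms lin_0[OF rm.module_axioms counit_lin] by (simp add: pr_of_gr)
qed

subsection \<open>The point components\<close>

text \<open>\<open>lam x\<close> is the coordinate at the point \<open>x\<close> of the degree \<open>0\<close> part; \<open>Lp x\<close> and \<open>Rp x\<close> are the
  idempotents of the left and right coaction of \<open>C\<^sub>0\<close> at \<open>x\<close>.\<close>

definition lam :: "'c \<Rightarrow> 'c \<Rightarrow> 'k" where
  "lam x c = cm.representation (points C) (pr 0 c) x"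

lemma pr_0_span: "pr 0 c \<in> cm.span (points C)"
  by (simp add: points_span)

lemma lam_lin: "lin (*) (lam x)"
  unfolding lam_def
  by (rule lin_onI)
    (simp_all add: lin_add[OF pr_lin] lin_scale[OF pr_lin] pr_0_span cm.representation_add[OF points_independent]
      cm.representation_scale[OF points_independent])

lemma lam_pos: "c \<in> gr C n \<Longrightarrow> 0 < n \<Longrightarrow> lam x c = 0"
  by (simp add: lam_def pr_of_gr cm.representation_zero)

lemma point_gr: "x \<in> points C \<Longrightarrow> x \<in> gr C 0"
  using cm.span_base[of x "points C"] by (simp add: points_span)

lemma lam_point: "y \<in> points C \<Longrightarrow> lam x y = (if x = y then 1 else 0)"
  using cm.representation_basis[OF points_independent, of y]
  by (simp add: lam_def pr_of_gr[OF point_gr])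

lemma finite_lam: "finite {x. lam x c \<noteq> 0}"
  unfolding lam_def by (rule cm.finite_representation)

lemma lam_ne_0: "lam x c \<noteq> 0 \<Longrightarrow> x \<in> points C"
  unfolding lam_def by (rule cm.representation_ne_zero)

lemma pr_0_lam:
  assumes "finite Z" and "{x. lam x c \<noteq> 0} \<subseteq> Z"
  shows "pr 0 c = (\<Sum>x\<in>Z. smul C (lam x c) x)"
proof -
  have "pr 0 c = (\<Sum>x | lam x c \<noteq> 0. smul C (lam x c) x)"
    using cm.sum_nonzero_representation_eq[OF points_independent pr_0_span, of c]
    by (simp add: lam_def)
  also have "\<dots> = (\<Sum>x\<in>Z. smul C (lam x c) x)"
    using assms by (intro sum.mono_neutral_left) auto
  finally show ?thesis .
qed

lemma counit_pr_0: "counit C c = counit C (pr 0 c)"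
  by (rule lin_eqI_graded[OF rm.module_axioms counit_lin lin_comp[OF counit_lin pr_lin]])
    (auto simp: pr_of_gr counit_pos lin_0[OF rm.module_axioms counit_lin])

lemma counit_lam:
  assumes "finite Z" and "{x. lam x c \<noteq> 0} \<subseteq> Z"
  shows "counit C c = (\<Sum>x\<in>Z. lam x c)"
proof -
  have "counit C c = (\<Sum>x\<in>Z. lam x c * counit C x)"
    by (subst counit_pr_0)
      (simp add: pr_0_lam[OF assms] lin_sum[OF rm.module_axioms counit_lin] lin_scale[OF counit_lin])
  also have "\<dots> = (\<Sum>x\<in>Z. lam x c)"
  proof (rule sum.cong)
    show "lam x c * counit C x = lam x c" for x
      using lam_ne_0[of x c] by (cases "lam x c = 0") (auto simp: points_def)
  qed simp
  finally show ?thesis .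
qed

lemma lam_zero: "a \<in> gr C i \<Longrightarrow> b \<in> gr C (n - i) \<Longrightarrow> 0 < n \<Longrightarrow> lam x a * lam y b = 0"
  using lam_pos[of a i x] lam_pos[of b "n - i" y] by (cases "i = 0") auto

text \<open>Dual to \<Delta>x = x \<otimes> x: the point coordinates are orthogonal idempotents for
  convolution. In positive degree one of the two factors always has positive degree, where the
  coordinates vanish; in degree 0 it suffices to test on the points, which span.\<close>

lemma lam_mult:
  assumes "x \<in> points C" and "y \<in> points C"
  shows "dl (*) (\<lambda>a b. lam x a * lam y b) c = (if x = y then lam x c else 0)"
proof (rule lin_eqI_graded[OF rm.module_axioms])
  have bil: "bil (*) (\<lambda>a b. lam x a * lam y b)"
    by (intro bil_mult rm.module_axioms lam_lin)
  then show L: "lin (*) (dl (*) (\<lambda>a b. lam x a * lam y b))" by (rule dl_lin)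
  show R: "lin (*) (\<lambda>c. if x = y then lam x c else 0)"
    by (cases "x = y") (simp_all add: lam_lin rm.lin_on_zero)
  fix n c assume c: "c \<in> gr C n"
  show "dl (*) (\<lambda>a b. lam x a * lam y b) c = (if x = y then lam x c else 0)"
  proof (cases "n = 0")
    case False
    have "dl (*) (\<lambda>a b. lam x a * lam y b) c = dl (*) (\<lambda>a b. 0) c"
      by (rule dl_graded[OF bil _ c])
        (use False in \<open>auto simp: bil_def rm.module_axioms rm.lin_on_zero lam_zero\<close>)
    also have "\<dots> = 0" by (simp add: dl_def split_def)
    finally show ?thesis using lam_pos[OF c, of x] False by auto
  next
    case True
    then have "c \<in> cm.span (points C)" using c by (simp add: points_span)
    then show ?thesis
    proof (induction rule: cm.span_induct_alt)
      case base
      show ?case using lin_0[OF rm.module_axioms L] lin_0[OF rm.module_axioms R] by simp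
    next
      case (step r z d)
      have "dl (*) (\<lambda>a b. lam x a * lam y b) z = lam x z * lam y z"
        using step(1) by (subst dl_eq2[OF bil, of _ "gen (z, z)"]) (auto simp: points_def)
      also have "\<dots> = (if x = y then lam x z else 0)"
        using step(1) by (simp add: lam_point)
      finally show ?case
        using step(2) by (simp only: lin_add[OF L] lin_scale[OF L] lin_add[OF lam_lin] lin_scale[OF lam_lin])
          (simp split: if_splits)
    qed
  qed
qed

definition Lp :: "'c \<Rightarrow> 'c \<Rightarrow> 'c" where
  "Lp x c = dl (smul C) (\<lambda>a b. smul C (lam x a) b) c"

definition Rp :: "'c \<Rightarrow> 'c \<Rightarrow> 'c" where
  "Rp y c = dl (smul C) (\<lambda>a b. smul C (lam y b) a) c"

lemma bil_lam:
  assumes "module s" and "lin s f"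
  shows "bil s (\<lambda>a b. s (lam x a) (f b))" and "bil s (\<lambda>a b. s (lam x b) (f a))"
  by (rule bil_mult[OF assms(1) lam_lin assms(2)])+

lemma Lp_lin: "lin (smul C) (Lp x)" and Rp_lin: "lin (smul C) (Rp x)"
  unfolding Lp_def[abs_def] Rp_def[abs_def]
  by (intro dl_lin bil_lam module_C lin_on_ident)+

lemma lin_Lp: "module s \<Longrightarrow> lin s f \<Longrightarrow> f (Lp x c) = dl s (\<lambda>a b. s (lam x a) (f b)) c"
  and lin_Rp: "module s \<Longrightarrow> lin s f \<Longrightarrow> f (Rp x c) = dl s (\<lambda>a b. s (lam x b) (f a)) c"
  by (simp_all add: Lp_def Rp_def lin_dl lin_scale)

lemma tril_lam:
  assumes "bil s \<beta>"
  shows "tril s (\<lambda>a b c. s (lam x a) (\<beta> b c))" "tril s (\<lambda>a b c. s (lam x b) (\<beta> a c))"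
    "tril s (\<lambda>a b c. s (lam x c) (\<beta> a b))"
proof -
  interpret s: module s by (rule bil_module[OF assms(1)])
  show "tril s (\<lambda>a b c. s (lam x a) (\<beta> b c))" "tril s (\<lambda>a b c. s (lam x b) (\<beta> a c))"
    "tril s (\<lambda>a b c. s (lam x c) (\<beta> a b))"
    using assms by (auto intro!: trilI s.module_axioms s.lin_on_scale s.lin_on_scale_left lam_lin simp: bil_def)
qed

lemma dl_scale: "module s \<Longrightarrow> dl s (\<lambda>a b. s r (\<beta> a b)) c = s r (dl s \<beta> c)"
  unfolding dl_def split_def by (rule module.lext_fun_scale)

text \<open>Coassociativity with \<open>lam x\<close> inserted in the outer left factor. In comodule
  terms, the coproduct is a map of left C_0-comodules.\<close>

lemma dl_Lp:
  assumes "bil s \<beta>"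
  shows "dl s \<beta> (Lp x c) = dl s (\<lambda>a b. \<beta> (Lp x a) b) c"
  using dl_coassoc[OF tril_lam(1)[OF assms], of x c]
  by (simp add: lin_Lp[OF bil_module[OF assms] dl_lin[OF assms]] dl_scale[OF bil_module[OF assms]]
      lin_Lp[OF bil_module[OF assms] bil_left[OF assms]])

lemma dl_Rp:
  assumes "bil s \<beta>"
  shows "dl s \<beta> (Rp x c) = dl s (\<lambda>a b. \<beta> a (Rp x b)) c"
  using dl_coassoc[OF tril_lam(3)[OF assms], of x c]
  by (simp add: lin_Rp[OF bil_module[OF assms] dl_lin[OF assms]] dl_scale[OF bil_module[OF assms]]
      lin_Rp[OF bil_module[OF assms] bil_right[OF assms]])

text \<open>Coassociativity with \<open>lam x\<close> in the middle factor, read once with each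
  neighbour. This is the statement that \<Delta> lands in the cotensor product C \<box> C.\<close>

lemma dl_Rp_Lp:
  assumes "bil s \<beta>"
  shows "dl s (\<lambda>a b. \<beta> a (Lp x b)) c = dl s (\<lambda>a b. \<beta> (Rp x a) b) c"
  using dl_coassoc[OF tril_lam(2)[OF assms], of x c]
  by (simp add: lin_Lp[OF bil_module[OF assms] bil_right[OF assms]]
      lin_Rp[OF bil_module[OF assms] bil_left[OF assms]])

lemma Lp_Lp:
  assumes "x \<in> points C" and "y \<in> points C"
  shows "Lp x (Lp y c) = (if x = y then Lp x c else 0)"
proof -
  have "Lp x (Lp y c) = dl (smul C) (\<lambda>a b. smul C (lam x (Lp y a)) b) c"
    unfolding Lp_def[of x] by (rule dl_Lp[OF bil_lam(1)[OF module_C lin_on_ident]])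
  also have "\<dots> = dl (smul C) (\<lambda>a b. smul C (if x = y then lam x a else 0) b) c"
    using lam_mult[OF assms(2,1)]
    by (cases "x = y") (simp_all add: lin_Lp[OF rm.module_axioms lam_lin])
  finally show ?thesis by (cases "x = y") (simp_all add: Lp_def dl_def split_def)
qed

lemma Rp_Rp:
  assumes "x \<in> points C" and "y \<in> points C"
  shows "Rp x (Rp y c) = (if x = y then Rp x c else 0)"
proof -
  have "Rp x (Rp y c) = dl (smul C) (\<lambda>a b. smul C (lam x (Rp y b)) a) c"
    unfolding Rp_def[of x] by (rule dl_Rp[OF bil_lam(2)[OF module_C lin_on_ident]])
  also have "\<dots> = dl (smul C) (\<lambda>a b. smul C (if x = y then lam x b else 0) a) c"
    using lam_mult[OF assms]
    by (cases "x = y") (simp_all add: lin_Rp[OF rm.module_axioms lam_lin] mult.commute)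
  finally show ?thesis by (cases "x = y") (simp_all add: Rp_def dl_def split_def)
qed

lemma Lp_Rp: "Lp x (Rp y c) = Rp y (Lp x c)"
proof -
  have "Lp x (Rp y c) = dl (smul C) (\<lambda>a b. smul C (lam x a) (Rp y b)) c"
    unfolding Lp_def[of x] by (rule dl_Rp[OF bil_lam(1)[OF module_C lin_on_ident]])
  then show ?thesis
    by (simp add: Lp_def lin_dl[OF module_C Rp_lin] lin_scale[OF Rp_lin])
qed

text \<open>There may be infinitely many points. This finite set contains all that the chosen
  representative of \<Delta>c can see, and sums over points are restricted to it.\<close>

definition supp :: "'c \<Rightarrow> 'c set" where
  "supp c = (\<Union>(a, b)\<in>Poly_Mapping.keys (cop C c). {x. lam x a \<noteq> 0} \<union> {x. lam x b \<noteq> 0})"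

lemma finite_supp: "finite (supp c)"
  unfolding supp_def by (auto simp: finite_lam)

lemma supp_points: "supp c \<subseteq> points C"
  unfolding supp_def using lam_ne_0 by auto

text \<open>The counit is the sum of the point coordinates, so this is the right counit axiom,
  decomposed over the points.\<close>

lemma sum_Rp:
  assumes "finite Z" and "supp c \<subseteq> Z"
  shows "(\<Sum>z\<in>Z. Rp z c) = c"
proof -
  have "(\<Sum>z\<in>Z. Rp z c) = dl (smul C) (\<lambda>a b. smul C (\<Sum>z\<in>Z. lam z b) a) c"
    by (simp add: Rp_def dl_def split_def cm.lext_fun_sum[symmetric] cm.scale_sum_left)
  also have "\<dots> = dl (smul C) (\<lambda>a b. smul C (counit C b) a) c"
  proof (rule dl_cong)
    fix a b assume "(a, b) \<in> Poly_Mapping.keys (cop C c)"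
    then have "{x. lam x b \<noteq> 0} \<subseteq> Z" using assms(2) by (auto simp: supp_def)
    then show "smul C (\<Sum>z\<in>Z. lam z b) a = smul C (counit C b) a"
      by (simp add: counit_lam[OF assms(1)])
  qed (rule module_C)
  also have "\<dots> = c" by (rule dl_counit_right[OF module_C lin_on_ident])
  finally show ?thesis .
qed

text \<open>A point coordinate vanishes in positive degree, so only the part of \<Delta>c whose
  projected-out factor has degree 0 contributes, and the other factor then carries the full degree
  n.\<close>

lemma Lp_gr: "c \<in> gr C n \<Longrightarrow> Lp x c \<in> gr C n" and Rp_gr: "c \<in> gr C n \<Longrightarrow> Rp x c \<in> gr C n"
proof -
  assume c: "c \<in> gr C n"
  have "pr n (Lp x c) = Lp x c"
    unfolding Lp_def lin_dl[OF module_C pr_lin] lin_scale[OF pr_lin]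
  proof (rule dl_graded[OF _ _ c])
    show "smul C (lam x a) (pr n b) = smul C (lam x a) b"
      if "i \<le> n" "a \<in> gr C i" "b \<in> gr C (n - i)" for i a b
      using that lam_pos[of a i x] by (cases "i = 0") (auto simp: pr_of_gr)
  qed (intro bil_lam module_C pr_lin lin_on_ident)+
  then show "Lp x c \<in> gr C n" using pr_gr by metis
  have "pr n (Rp x c) = Rp x c"
    unfolding Rp_def lin_dl[OF module_C pr_lin] lin_scale[OF pr_lin]
  proof (rule dl_graded[OF _ _ c])
    show "smul C (lam x b) (pr n a) = smul C (lam x b) a"
      if "i \<le> n" "a \<in> gr C i" "b \<in> gr C (n - i)" for i a b
      using that lam_pos[of b "n - i" x] by (cases "i = n") (auto simp: pr_of_gr)
  qed (intro bil_lam module_C pr_lin lin_on_ident)+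
  then show "Rp x c \<in> gr C n" using pr_gr by metis
qed

lemma proj0_eq: "proj0 C c = pr 0 c"
  by (simp add: proj0_def pr_def)

lemma lam_pr_0: "lam x (pr 0 c) = lam x c"
  by (simp add: lam_def pr_of_gr(2)[OF pr_gr])

text \<open>The universal bilinear map into C \<otimes> C. It turns the congruence
  \<open>eq2\<close> into an equation of values of a single bilinear map, see
  \<open>eq2_iff\<close>.\<close>

definition tens :: "'c \<Rightarrow> 'c \<Rightarrow> ('c \<times> 'c, 'k) quot" where
  "tens a b = cls ((\<Union>w\<in>UNIV. lin_rels (smul C) UNIV (\<lambda>v. (v, w)))
    \<union> (\<Union>v\<in>UNIV. lin_rels (smul C) UNIV (\<lambda>w. (v, w)))) (gen (a, b))"

lemma bil_tens: "bil qscale tens"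
  using kills_cls[of "(\<Union>w\<in>UNIV. lin_rels (smul C) UNIV (\<lambda>v. (v, w)))
    \<union> (\<Union>v\<in>UNIV. lin_rels (smul C) UNIV (\<lambda>w. (v, w)))"]
  unfolding bil_def tens_def[abs_def]
  by (auto simp: qs.kills_Un qs.kills_Union qs.kills_lin_rels qs.module_axioms)

lemma eq2_iff: "eq2 C t t' \<longleftrightarrow> lext qscale (\<lambda>(a, b). tens a b) t = lext qscale (\<lambda>(a, b). tens a b) t'"
  unfolding eq2_def tensor_rel_def cls_eq_iff[symmetric] tens_def
  by (subst (1 2) cls_lext) (simp add: split_def)

text \<open>Expanding the degree 0 factor in points writes the left coaction as the sum of z
  \<otimes> \<open>Lp z c\<close>. If \<open>Lp x c = c\<close>, orthogonality leaves only z = x;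
  conversely, applying \<open>lam x\<close> to the left factor of the coaction equation recovers
  \<open>Lp x c = c\<close>. The right side is symmetric.\<close>

lemma bihom_iff:
  assumes "x \<in> points C" and "y \<in> points C"
  shows "c \<in> bihom C x y \<longleftrightarrow> Lp x c = c \<and> Rp y c = c"
proof -
  have sum_tens: "(\<Sum>z\<in>supp c. tens (smul C (lam z a) z) b) = tens (pr 0 a) b"
    "(\<Sum>z\<in>supp c. tens a (smul C (lam z b) z)) = tens a (pr 0 b)"
    if "(a, b) \<in> Poly_Mapping.keys (cop C c)" for a b
  proof -
    have "{x. lam x a \<noteq> 0} \<subseteq> supp c" "{x. lam x b \<noteq> 0} \<subseteq> supp c"
      using that by (auto simp: supp_def)
    then show "(\<Sum>z\<in>supp c. tens (smul C (lam z a) z) b) = tens (pr 0 a) b"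
      "(\<Sum>z\<in>supp c. tens a (smul C (lam z b) z)) = tens a (pr 0 b)"
      by (simp_all add: pr_0_lam[OF finite_supp] lin_sum[OF qs.module_axioms bil_left[OF bil_tens]]
          lin_sum[OF qs.module_axioms bil_right[OF bil_tens]])
  qed
  have *: "dl qscale (\<lambda>a b. tens (pr 0 a) b) c = (\<Sum>z\<in>supp c. tens z (Lp z c))"
    "dl qscale (\<lambda>a b. tens a (pr 0 b)) c = (\<Sum>z\<in>supp c. tens (Rp z c) z)"
  proof -
    have "dl qscale (\<lambda>a b. tens (pr 0 a) b) c = dl qscale (\<lambda>a b. \<Sum>z\<in>supp c. tens (smul C (lam z a) z) b) c"
      by (rule dl_cong) (simp_all add: sum_tens qs.module_axioms)
    then show "dl qscale (\<lambda>a b. tens (pr 0 a) b) c = (\<Sum>z\<in>supp c. tens z (Lp z c))"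
      by (simp add: lin_Lp[OF qs.module_axioms bil_right[OF bil_tens]] lin_scale[OF bil_left[OF bil_tens]])
        (simp add: dl_def split_def qs.lext_fun_sum)
    have "dl qscale (\<lambda>a b. tens a (pr 0 b)) c = dl qscale (\<lambda>a b. \<Sum>z\<in>supp c. tens a (smul C (lam z b) z)) c"
      by (rule dl_cong) (simp_all add: sum_tens qs.module_axioms)
    then show "dl qscale (\<lambda>a b. tens a (pr 0 b)) c = (\<Sum>z\<in>supp c. tens (Rp z c) z)"
      by (simp add: lin_Rp[OF qs.module_axioms bil_left[OF bil_tens]] lin_scale[OF bil_right[OF bil_tens]])
        (simp add: dl_def split_def qs.lext_fun_sum)
  qed
  have L: "eq2 C (fext (\<lambda>(a, b). gen (proj0 C a, b)) (cop C c)) (gen (x, c)) \<longleftrightarrow> Lp x c = c"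
  proof
    assume "eq2 C (fext (\<lambda>(a, b). gen (proj0 C a, b)) (cop C c)) (gen (x, c))"
    from lext_eq2[OF bil_lam(1)[OF module_C lin_on_ident, of x] this] show "Lp x c = c"
      using assms by (simp add: cm.lext_lext split_def proj0_eq lam_pr_0 Lp_def dl_def lam_point)
  next
    assume Lc: "Lp x c = c"
    have z: "tens z (Lp z c) = (if z = x then tens x c else 0)" if "z \<in> points C" for z
      using Lp_Lp[OF that assms(1), of c] Lc
      by (auto simp: lin_0[OF qs.module_axioms bil_right[OF bil_tens]])
    have "(\<Sum>z\<in>supp c. tens z (Lp z c)) = (\<Sum>z\<in>supp c. if z = x then tens x c else 0)"
      by (rule sum.cong[OF refl]) (rule z[OF subsetD[OF supp_points]])
    also have "\<dots> = tens x c"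
    \<comment> \<open>The sum runs over \<open>supp c\<close>, which might miss \<open>x\<close>. In
      that case \<open>Lp x c\<close> is zero, hence so is \<open>c\<close>, and both sides
      vanish.\<close>
    proof (cases "x \<in> supp c")
      case False
      then have "lam x a = 0" if "(a, b) \<in> Poly_Mapping.keys (cop C c)" for a b
        using that by (auto simp: supp_def)
      then have "dl (smul C) (\<lambda>a b. smul C (lam x a) b) c = dl (smul C) (\<lambda>a b. 0) c"
        by (intro dl_cong) (auto simp: module_C)
      then have "c = 0" using Lc by (simp add: Lp_def dl_def split_def)
      then show ?thesis
        using False lin_0[OF qs.module_axioms bil_right[OF bil_tens]] by (simp add: finite_supp)
    qed (simp add: finite_supp)
    finally show "eq2 C (fext (\<lambda>(a, b). gen (proj0 C a, b)) (cop C c)) (gen (x, c))"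
      using *(1) by (simp add: eq2_iff qs.lext_lext split_def proj0_eq dl_def)
  qed
  have R: "eq2 C (fext (\<lambda>(a, b). gen (a, proj0 C b)) (cop C c)) (gen (c, y)) \<longleftrightarrow> Rp y c = c"
  proof
    assume "eq2 C (fext (\<lambda>(a, b). gen (a, proj0 C b)) (cop C c)) (gen (c, y))"
    from lext_eq2[OF bil_lam(2)[OF module_C lin_on_ident, of y] this] show "Rp y c = c"
      using assms by (simp add: cm.lext_lext split_def proj0_eq lam_pr_0 Rp_def dl_def lam_point)
  next
    assume Rc: "Rp y c = c"
    have z: "tens (Rp z c) z = (if z = y then tens c y else 0)" if "z \<in> points C" for z
      using Rp_Rp[OF that assms(2), of c] Rc
      by (auto simp: lin_0[OF qs.module_axioms bil_left[OF bil_tens]])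
    have "(\<Sum>z\<in>supp c. tens (Rp z c) z) = (\<Sum>z\<in>supp c. if z = y then tens c y else 0)"
      by (rule sum.cong[OF refl]) (rule z[OF subsetD[OF supp_points]])
    also have "\<dots> = tens c y"
    proof (cases "y \<in> supp c")
      case False
      then have "lam y b = 0" if "(a, b) \<in> Poly_Mapping.keys (cop C c)" for a b
        using that by (auto simp: supp_def)
      then have "dl (smul C) (\<lambda>a b. smul C (lam y b) a) c = dl (smul C) (\<lambda>a b. 0) c"
        by (intro dl_cong) (auto simp: module_C)
      then have "c = 0" using Rc by (simp add: Rp_def dl_def split_def)
      then show ?thesis
        using False lin_0[OF qs.module_axioms bil_left[OF bil_tens]] by (simp add: finite_supp)
    qed (simp add: finite_supp)
    finally show "eq2 C (fext (\<lambda>(a, b). gen (a, proj0 C b)) (cop C c)) (gen (c, y))"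
      using *(2) by (simp add: eq2_iff qs.lext_lext split_def proj0_eq dl_def)
  qed
  show ?thesis using L R by (simp add: bihom_def)
qed

section \<open>Point components, the codifferential and the curvature\<close>

text \<open>Apply \<open>lam x\<close> to the left factor of the coderivation identity. The term
  with d on the left dies because d has no component in degree 0 (this uses d = 0 on C_1), and the
  Koszul sign of the other term is trivial where \<open>lam x\<close> is nonzero, namely in degree
  0.\<close>

lemma Lp_codiff: "Lp x (codiff C c) = codiff C (Lp x c)"
proof -
  have lam0: "lam x (codiff C a) = 0" "lam x (sgn_inv C a) = lam x a" for a
  proof -
    show "lam x (codiff C a) = 0"
    proof (rule lin_eqI_graded[OF rm.module_axioms lin_comp[OF lam_lin codiff_lin] rm.lin_on_zero])
      show "lam x (codiff C a) = 0" if "a \<in> gr C n" for n a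
        using that lam_pos[OF codiff_degree, of a "n - 1" x] codiff_0[of a] codiff_1[of a]
        by (cases "n \<le> 1") (auto simp: le_Suc_eq lin_0[OF rm.module_axioms lam_lin])
    qed
    show "lam x (sgn_inv C a) = lam x a"
    proof (rule lin_eqI_graded[OF rm.module_axioms lin_comp[OF lam_lin sgn_inv_lin] lam_lin])
      show "lam x (sgn_inv C a) = lam x a" if "a \<in> gr C n" for n a
        using that lam_pos[of a n x] by (cases "n = 0") (auto simp: sgn_inv_gr lin_scale[OF lam_lin] ksign_def)
    qed
  qed
  show ?thesis
    unfolding Lp_def dl_coder[OF bil_lam(1)[OF module_C lin_on_ident]]
    by (simp add: lam0 lin_dl[OF module_C codiff_lin] lin_scale[OF codiff_lin])
qed

lemma Rp_codiff: "Rp x (codiff C c) = codiff C (Rp x c)"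
proof (rule lin_eqI_graded[OF module_C lin_comp[OF Rp_lin codiff_lin] lin_comp[OF codiff_lin Rp_lin]])
  fix n c assume c: "c \<in> gr C n"
  let ?\<beta> = "\<lambda>a b. smul C (lam x b) (codiff C a) + smul C (lam x (codiff C b)) (sgn_inv C a)"
  have bil1: "bil (smul C) (\<lambda>a b. smul C (lam x b) (codiff C a))"
    by (intro bil_lam module_C codiff_lin)
  have lam0: "lam x (codiff C b) = 0" for b
  proof (rule lin_eqI_graded[OF rm.module_axioms lin_comp[OF lam_lin codiff_lin] rm.lin_on_zero])
    show "lam x (codiff C a) = 0" if "a \<in> gr C n" for n a
      using that lam_pos[OF codiff_degree, of a "n - 1" x] codiff_0[of a] codiff_1[of a]
      by (cases "n \<le> 1") (auto simp: le_Suc_eq lin_0[OF rm.module_axioms lam_lin])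
  qed
  show "Rp x (codiff C c) = codiff C (Rp x c)"
    unfolding Rp_def dl_coder[OF bil_lam(2)[OF module_C lin_on_ident]]
    by (simp add: lam0 lin_dl[OF module_C codiff_lin] lin_scale[OF codiff_lin])
qed

text \<open>For c in degree 2, dc lies in C_1, so d(dc) = 0 and the curvature formula gives
  \<Sum>h(c')c'' = \<Sum>c'h(c''). Applying the coordinate at y turns this into
  h(\<open>Rp y c\<close>) = h(\<open>Lp y c\<close>). The left side is h(c), and the right side is
  zero because c has source x \<noteq> y. This is what makes the term h(c) id of D{c} a morphism
  with the right endpoints.\<close>

lemma curv_off_diagonal:
  assumes "x \<in> points C" and "y \<in> points C" and "x \<noteq> y" and "c \<in> coalg_piece C x y n"
  shows "curv C c = 0"
proof (cases "n = 2")
  case False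
  then show ?thesis using assms(4) curv_degree by (auto simp: coalg_piece_def)
next
  case True
  have c: "c \<in> gr C 2" "Lp x c = c" "Rp y c = c"
    using assms True by (auto simp: coalg_piece_def bihom_iff)
  have "codiff C c \<in> gr C 1" using codiff_degree[of c 1] c(1) by (simp add: numeral_2_eq_2)
  then have "codiff C (codiff C c) = 0" by (rule codiff_1)
  then have "lam y (dl (smul C) (\<lambda>a b. smul C (curv C a) b) c)
      = lam y (dl (smul C) (\<lambda>a b. smul C (curv C b) a) c)"
    using codiff_squared[of c] by (simp add: dl_def)
  then have "curv C (Rp y c) = curv C (Lp y c)"
    by (simp add: lin_dl[OF rm.module_axioms lam_lin] lin_scale[OF lam_lin] mult.commute
        lin_Lp[OF rm.module_axioms curv_lin] lin_Rp[OF rm.module_axioms curv_lin])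
  moreover have "Lp y c = 0"
    using Lp_Lp[OF assms(2,1), of c] c(2) assms(3) by auto
  ultimately show ?thesis
    using c(3) lin_0[OF rm.module_axioms curv_lin] by simp
qed

subsection \<open>Bihomogeneous components\<close>

definition comp :: "'c \<Rightarrow> 'c \<Rightarrow> nat \<Rightarrow> 'c \<Rightarrow> 'c" where
  "comp x y n c = Lp x (Rp y (pr n c))"

lemma comp_lin: "lin (smul C) (comp x y n)"
  unfolding comp_def[abs_def] by (intro lin_comp[OF Lp_lin] lin_comp[OF Rp_lin] pr_lin)

lemma coalg_piece_iff:
  "x \<in> points C \<Longrightarrow> y \<in> points C \<Longrightarrow> c \<in> coalg_piece C x y n \<longleftrightarrow> c \<in> gr C n \<and> Lp x c = c \<and> Rp y c = c"
  by (simp add: coalg_piece_def bihom_iff)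

lemma comp_piece: "x \<in> points C \<Longrightarrow> y \<in> points C \<Longrightarrow> comp x y n c \<in> coalg_piece C x y n"
  unfolding coalg_piece_iff comp_def
  by (auto intro!: Lp_gr Rp_gr simp: Lp_Lp Lp_Rp[symmetric]) (simp add: Lp_Rp Rp_Rp)

lemma comp_of_piece:
  assumes "x \<in> points C" "y \<in> points C" "x' \<in> points C" "y' \<in> points C" "c \<in> coalg_piece C x y n"
  shows "comp x' y' m c = (if x' = x \<and> y' = y \<and> m = n then c else 0)"
proof -
  have c: "c \<in> gr C n" "Lp x c = c" "Rp y c = c"
    using assms by (auto simp: coalg_piece_iff)
  have "Rp y' c = (if y' = y then c else 0)" "Lp x' c = (if x' = x then c else 0)"
    using Rp_Rp[OF assms(4,2), of c] Lp_Lp[OF assms(3,1), of c] c by auto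
  then show ?thesis
    using c(1) by (auto simp: comp_def pr_of_gr lin_0[OF module_C Lp_lin] lin_0[OF module_C Rp_lin])
qed

lemma subspace_piece:
  assumes "x \<in> points C" and "y \<in> points C"
  shows "cm.subspace (coalg_piece C x y n)"
  by (rule cm.subspaceI)
    (simp_all add: coalg_piece_iff[OF assms] cm.subspace_0[OF subspace_gr] cm.subspace_add[OF subspace_gr]
      cm.subspace_scale[OF subspace_gr] lin_add[OF Lp_lin] lin_add[OF Rp_lin] lin_scale[OF Lp_lin]
      lin_scale[OF Rp_lin] lin_0[OF module_C Lp_lin] lin_0[OF module_C Rp_lin])

lemma codiff_piece:
  "x \<in> points C \<Longrightarrow> y \<in> points C \<Longrightarrow> c \<in> coalg_piece C x y (Suc n) \<Longrightarrow> codiff C c \<in> coalg_piece C x y n"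
  by (simp add: coalg_piece_iff Lp_codiff Rp_codiff codiff_degree)

text \<open>Expand c in the points. By \<open>lam_mult\<close>, being fixed by \<open>Lp x\<close>
  and \<open>Rp y\<close> kills every coordinate except the one at a point equal to both x and y;
  the counit then identifies that coordinate.\<close>

lemma degree_0_piece:
  assumes "x \<in> points C" and "y \<in> points C" and "c \<in> coalg_piece C x y 0"
  shows "c = (if x = y then smul C (counit C c) x else 0)"
proof -
  have c: "c \<in> gr C 0" "Lp x c = c" "Rp y c = c"
    using assms by (auto simp: coalg_piece_iff)
  have "c = pr 0 c" using c(1) by (simp add: pr_of_gr)
  also have "\<dots> = (\<Sum>z | lam z c \<noteq> 0. smul C (lam z c) z)"
    by (rule pr_0_lam) (simp_all add: finite_lam)
  also have "\<dots> = (\<Sum>z | lam z c \<noteq> 0. if z = x \<and> z = y then smul C (lam z c) z else 0)"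
  proof (rule sum.cong[OF refl])
    fix z assume "z \<in> {z. lam z c \<noteq> 0}"
    then have z: "z \<in> points C" by (auto dest: lam_ne_0)
    have "lam z c = 0" if "z \<noteq> x"
      using lam_mult[OF assms(1) z, of c] that arg_cong[OF c(2), of "lam z"]
      by (simp add: lin_Lp[OF rm.module_axioms lam_lin])
    moreover have "lam z c = 0" if "z \<noteq> y"
      using lam_mult[OF z assms(2), of c] that arg_cong[OF c(3), of "lam z"]
      by (simp add: lin_Rp[OF rm.module_axioms lam_lin] mult.commute)
    ultimately show "smul C (lam z c) z = (if z = x \<and> z = y then smul C (lam z c) z else 0)"
      by (cases "z = x") auto
  qed
  also have "\<dots> = (if x = y then smul C (lam x c) x else 0)"
    by (cases "x = y") (auto simp: finite_lam intro!: sum.neutral)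
  finally have *: "c = (if x = y then smul C (lam x c) x else 0)" .
  show ?thesis
  proof (cases "x = y")
    case True
    have "counit C c = lam x c"
      using arg_cong[OF *, of "counit C"] True assms(1)
      by (simp add: lin_scale[OF counit_lin] points_def)
    then show ?thesis using * by metis
  qed (use * in simp)
qed

subsection \<open>The coproduct on labelled elements\<close>

lemma coalg_arrsD:
  assumes "c \<in> coalg_arrs C"
  shows "src c \<in> points C" "tgt c \<in> points C" "0 \<le> deg c" "elt c \<in> coalg_piece C (src c) (tgt c) (nat (deg c))"
  using assms by (auto simp: coalg_arrs_def)

lemma Arr_coalg_arrs:
  "x \<in> points C \<Longrightarrow> y \<in> points C \<Longrightarrow> 0 \<le> n \<Longrightarrow> u \<in> coalg_piece C x y (nat n) \<Longrightarrow> Arr x n u y \<in> coalg_arrs C"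
  by (simp add: coalg_arrs_def)

text \<open>Linearity in the element while source, target and degree are held fixed; no condition
  links different labels, exactly as in the relations of Bar and \<Q>.\<close>

definition alin :: "('k \<Rightarrow> 'q::ab_group_add \<Rightarrow> 'q) \<Rightarrow> (('c, 'c) arr \<Rightarrow> 'q) \<Rightarrow> 'c \<Rightarrow> 'c \<Rightarrow> int \<Rightarrow> bool" where
  "alin s f x y n \<longleftrightarrow> lin_on (smul C) (coalg_piece C x y (nat n)) s (\<lambda>u. f (Arr x n u y))"

lemma alin_cong:
  assumes "x \<in> points C" "y \<in> points C" "0 \<le> n"
    and "\<And>c. c \<in> coalg_arrs C \<Longrightarrow> src c = x \<Longrightarrow> tgt c = y \<Longrightarrow> deg c = n \<Longrightarrow> f c = g c"
  shows "alin s f x y n \<longleftrightarrow> alin s g x y n"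
  unfolding alin_def using assms
  by (intro lin_on_cong[OF _ module_C subspace_piece]) (auto intro!: assms(4) Arr_coalg_arrs)

lemma alin_comp:
  assumes "alin s f x y n" and "x \<in> points C" "y \<in> points C"
  shows "lin s (\<lambda>a. f (Arr x n (comp x y (nat n) a) y))"
  by (rule lin_on_comp[OF assms(1)[unfolded alin_def] comp_lin])
    (rule comp_piece[OF assms(2,3)])

lemma alin_0: "module s \<Longrightarrow> alin s f x y n \<Longrightarrow> x \<in> points C \<Longrightarrow> y \<in> points C \<Longrightarrow> f (Arr x n 0 y) = 0"
  unfolding alin_def using module.lin_on_0[OF _ _ module_C, of s]
  by (metis cm.subspace_0[OF subspace_piece])

text \<open>Projecting a bihomogeneous element to a piece gives the element itself or zero. Sums
  over all labels therefore collapse to the one term with the labels of \<open>c\<close>.\<close>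

lemma alin_comp_arr:
  assumes "module s" and "alin s f x y n" and "x \<in> points C" "y \<in> points C" "0 \<le> n" and "c \<in> coalg_arrs C"
  shows "f (Arr x n (comp x y (nat n) (elt c)) y)
    = (if x = src c \<and> y = tgt c \<and> n = deg c then f c else 0)"
proof -
  have "nat n = nat (deg c) \<longleftrightarrow> n = deg c"
    using assms(5) coalg_arrsD(3)[OF assms(6)] by auto
  then show ?thesis
    using comp_of_piece[OF coalg_arrsD(1,2)[OF assms(6)] assms(3,4) coalg_arrsD(4)[OF assms(6)], of "nat n"]
      alin_0[OF assms(1-4)] by auto
qed

definition splits :: "('c, 'c) arr \<Rightarrow> (('c, 'c) arr \<times> ('c, 'c) arr) set" where
  "splits c = {(a, b). a \<in> coalg_arrs C \<and> b \<in> coalg_arrs C \<and> src a = src c \<and> tgt a = src b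
     \<and> tgt b = tgt c \<and> deg a + deg b = deg c}"

text \<open>What has to be shown is that some representative of \<Delta>c with composable
  bihomogeneous factors exists; then the choice in \<open>sweedler\<close> has these properties. It
  is obtained by cutting the factors of a homogeneous representative into components and checking
  that the discarded components contribute nothing.\<close>

lemma sweedler_spec:
  assumes "c \<in> coalg_arrs C"
  shows "sweedler C c \<in> fsums (splits c)"
    and "eq2 C (cop C (elt c)) (fext (\<lambda>(a, b). gen (elt a, elt b)) (sweedler C c))"
proof -
  define x y n where xyn: "x = src c" "y = tgt c" "n = nat (deg c)"
  have xy: "x \<in> points C" "y \<in> points C" and n: "deg c = int n"
    and c: "elt c \<in> gr C n" "Lp x (elt c) = elt c" "Rp y (elt c) = elt c"
    using coalg_arrsD[OF assms] by (auto simp: xyn coalg_piece_iff)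
  obtain t where t: "t \<in> fsums (\<Union>i\<le>n. gr C i \<times> gr C (n - i))" "eq2 C (cop C (elt c)) t"
    using cop_degree[OF c(1)] by blast
  \<comment> \<open>The middle points: every left factor \<open>a\<close> of the chosen
    representative must be the sum of its components \<open>Rp z a\<close> over \<open>Z\<close>, so
    \<open>Z\<close> collects the sets \<open>supp a\<close>.\<close>
  define Z where "Z = (\<Union>(a, b)\<in>Poly_Mapping.keys (cop C (elt c)). supp a)"
  have Z: "finite Z" "Z \<subseteq> points C"
    using finite_supp supp_points unfolding Z_def by (auto split: prod.splits)
  let ?A = "\<lambda>a i z. Arr x (int i) (comp x z i a) z" and ?B = "\<lambda>b i z. Arr z (int (n - i)) (comp z y (n - i) b) y"
  \<comment> \<open>The witness: each pair is replaced by its components from x to z and from z to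
    y. The sum over all degrees i picks out the actual degrees of the factors.\<close>
  define t' where "t' = fext (\<lambda>(a, b). \<Sum>z\<in>Z. \<Sum>i\<le>n. gen (?A a i z, ?B b i z)) t"
  have t'_in: "t' \<in> fsums (splits c)"
    unfolding t'_def
  proof (rule fsums_lext, clarify)
    fix a b
    have "(?A a i z, ?B b i z) \<in> splits c" if "z \<in> Z" "i \<le> n" for i z
      using that Z xy n
      by (auto simp: splits_def xyn[symmetric] of_nat_diff[symmetric] subset_eq
          simp del: of_nat_diff intro!: Arr_coalg_arrs comp_piece)
    then show "(\<Sum>z\<in>Z. \<Sum>i\<le>n. gen (?A a i z, ?B b i z)) \<in> fsums (splits c)"
      by (intro fsums_sum) auto
  qed
  have bil_T: "bil qscale (\<lambda>a b. tens (f a) (g b))" if "lin (smul C) f" "lin (smul C) g" for f g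
    using bil_comp[OF bil_tens that] .
  have bil_sum: "bil qscale (\<lambda>a b. \<Sum>z\<in>Z. \<beta> z a b)" if "\<And>z. bil qscale (\<beta> z)" for \<beta>
    using that by (auto simp: bil_def intro!: qs.lin_on_sum)
  have bil_sum': "bil qscale (\<lambda>a b. \<Sum>i\<le>n. \<beta> i a b)" if "\<And>z. bil qscale (\<beta> z)" for \<beta>
    using that by (auto simp: bil_def intro!: qs.lin_on_sum)
  have bil1: "bil qscale (\<lambda>a b. \<Sum>z\<in>Z. \<Sum>i\<le>n. tens (comp x z i a) (comp z y (n - i) b))"
    by (intro bil_sum bil_sum' bil_T comp_lin)
  have LR: "lin (smul C) (\<lambda>a. Lp x (Rp z a))" "lin (smul C) (\<lambda>a. Lp z (Rp y a))" for z
    by (intro lin_comp[OF Lp_lin] Rp_lin)+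
  have "lext qscale (\<lambda>(a, b). tens a b) (fext (\<lambda>(a, b). gen (elt a, elt b)) t')
      = lext qscale (\<lambda>(a, b). \<Sum>z\<in>Z. \<Sum>i\<le>n. tens (comp x z i a) (comp z y (n - i) b)) t"
    unfolding t'_def by (simp add: qs.lext_lext split_def qs.lext_sum)
  also have "\<dots> = dl qscale (\<lambda>a b. \<Sum>z\<in>Z. \<Sum>i\<le>n. tens (comp x z i a) (comp z y (n - i) b)) (elt c)"
    using dl_eq2[OF bil1 t(2)] by simp
  also have "\<dots> = dl qscale (\<lambda>a b. \<Sum>z\<in>Z. tens (Lp x (Rp z a)) (Lp z (Rp y b))) (elt c)"
  proof (rule dl_graded[OF bil1 _ c(1)])
    show "bil qscale (\<lambda>a b. \<Sum>z\<in>Z. tens (Lp x (Rp z a)) (Lp z (Rp y b)))"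
      by (intro bil_sum bil_T LR)
    fix i a b assume i: "i \<le> n" and ab: "a \<in> gr C i" "b \<in> gr C (n - i)"
    have "(\<Sum>j\<le>n. tens (comp x z j a) (comp z y (n - j) b)) = tens (Lp x (Rp z a)) (Lp z (Rp y b))" for z
    proof -
      have "(\<Sum>j\<le>n. tens (comp x z j a) (comp z y (n - j) b))
          = (\<Sum>j\<le>n. if j = i then tens (Lp x (Rp z a)) (Lp z (Rp y b)) else 0)"
        by (rule sum.cong[OF refl])
          (use ab in \<open>auto simp: comp_def pr_of_gr lin_0[OF module_C Lp_lin] lin_0[OF module_C Rp_lin]
            lin_0[OF qs.module_axioms bil_left[OF bil_tens]]\<close>)
      then show ?thesis using i by simp
    qed
    then show "(\<Sum>z\<in>Z. \<Sum>j\<le>n. tens (comp x z j a) (comp z y (n - j) b))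
        = (\<Sum>z\<in>Z. tens (Lp x (Rp z a)) (Lp z (Rp y b)))" by simp
  qed
  also have "\<dots> = (\<Sum>z\<in>Z. dl qscale (\<lambda>a b. tens (Lp x (Rp z a)) (Lp z (Rp y b))) (elt c))"
    by (simp add: dl_def split_def qs.lext_fun_sum)
  \<comment> \<open>The outer projections \<open>Lp x\<close> and \<open>Rp y\<close> pass to c,
    which they fix. The inner \<open>Lp z\<close> moves across the tensor sign by
    \<open>dl_Rp_Lp\<close> and is absorbed by the idempotent \<open>Rp z\<close>.\<close>
  also have "\<dots> = (\<Sum>z\<in>Z. dl qscale (\<lambda>a b. tens (Rp z a) b) (elt c))"
  proof (rule sum.cong[OF refl])
    fix z assume "z \<in> Z"
    then have z: "z \<in> points C" using Z by auto
    have "dl qscale (\<lambda>a b. tens (Lp x (Rp z a)) (Lp z (Rp y b))) (elt c)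
        = dl qscale (\<lambda>a b. tens (Rp z (Lp x a)) (Lp z b)) (Rp y (elt c))"
      using dl_Rp[OF bil_T[OF LR(1) Lp_lin], of z z y "elt c"] by (simp add: Lp_Rp)
    also have "\<dots> = dl qscale (\<lambda>a b. tens (Rp z a) (Lp z b)) (elt c)"
      using dl_Lp[OF bil_T[OF Rp_lin Lp_lin], of z z x "elt c"] c by simp
    also have "\<dots> = dl qscale (\<lambda>a b. tens (Rp z a) b) (elt c)"
      using dl_Rp_Lp[OF bil_T[OF Rp_lin lin_on_ident], of z z "elt c"] Rp_Rp[OF z z] by simp
    finally show "dl qscale (\<lambda>a b. tens (Lp x (Rp z a)) (Lp z (Rp y b))) (elt c)
        = dl qscale (\<lambda>a b. tens (Rp z a) b) (elt c)" .
  qed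
  also have "\<dots> = dl qscale (\<lambda>a b. tens (\<Sum>z\<in>Z. Rp z a) b) (elt c)"
    by (simp add: dl_def split_def qs.lext_fun_sum lin_sum[OF qs.module_axioms bil_left[OF bil_tens]])
  also have "\<dots> = dl qscale tens (elt c)"
  proof (rule dl_cong[OF _ qs.module_axioms])
    fix a b assume "(a, b) \<in> Poly_Mapping.keys (cop C (elt c))"
    then have "supp a \<subseteq> Z" by (auto simp: Z_def)
    then show "tens (\<Sum>z\<in>Z. Rp z a) b = tens a b" by (simp add: sum_Rp[OF Z(1)])
  qed
  finally have "eq2 C (cop C (elt c)) (fext (\<lambda>(a, b). gen (elt a, elt b)) t')"
    by (simp add: eq2_iff dl_def)
  with t'_in have ex: "\<exists>t. t \<in> fsums (splits c)
      \<and> eq2 C (cop C (elt c)) (fext (\<lambda>(a, b). gen (elt a, elt b)) t)" by blast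
  show "sweedler C c \<in> fsums (splits c)"
    "eq2 C (cop C (elt c)) (fext (\<lambda>(a, b). gen (elt a, elt b)) (sweedler C c))"
    using someI_ex[OF ex] unfolding sweedler_def splits_def by auto
qed

definition sw :: "('k \<Rightarrow> 'q::ab_group_add \<Rightarrow> 'q) \<Rightarrow> (('c, 'c) arr \<Rightarrow> ('c, 'c) arr \<Rightarrow> 'q) \<Rightarrow> ('c, 'c) arr \<Rightarrow> 'q" where
  "sw s F c = lext s (\<lambda>(a, b). F a b) (sweedler C c)"

lemma sw_cong:
  assumes "module s" and "c \<in> coalg_arrs C" and "\<And>a b. (a, b) \<in> splits c \<Longrightarrow> F a b = F' a b"
  shows "sw s F c = sw s F' c"
  unfolding sw_def using fsums_keysD[OF sweedler_spec(1)[OF assms(2)]] assms(3)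
  by (intro module.lext_cong[OF assms(1)]) auto

lemma sw_elt:
  assumes "bil s \<beta>" and "c \<in> coalg_arrs C"
  shows "sw s (\<lambda>a b. \<beta> (elt a) (elt b)) c = dl s \<beta> (elt c)"
  using dl_eq2[OF assms(1) sweedler_spec(2)[OF assms(2)]]
  by (simp add: sw_def split_def module.lext_lext[OF bil_module[OF assms(1)]]
      module.lext_gen[OF bil_module[OF assms(1)]])

text \<open>Linearity is demanded only for labels that can occur when an element of C(x,y)_n is
  split; a global requirement would fail for functions defined through composable actions.\<close>

definition abil :: "('k \<Rightarrow> 'q::ab_group_add \<Rightarrow> 'q) \<Rightarrow> (('c, 'c) arr \<Rightarrow> ('c, 'c) arr \<Rightarrow> 'q) \<Rightarrow> 'c \<Rightarrow> 'c \<Rightarrow> int \<Rightarrow> bool" where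
  "abil s F x y n \<longleftrightarrow> module s
     \<and> (\<forall>b\<in>coalg_arrs C. tgt b = y \<and> deg b \<le> n \<longrightarrow> alin s (\<lambda>a. F a b) x (src b) (n - deg b))
     \<and> (\<forall>a\<in>coalg_arrs C. src a = x \<and> deg a \<le> n \<longrightarrow> alin s (F a) (tgt a) y (n - deg a))"

lemma abilI:
  assumes "module s"
    and "\<And>b. b \<in> coalg_arrs C \<Longrightarrow> tgt b = y \<Longrightarrow> deg b \<le> n \<Longrightarrow> alin s (\<lambda>a. F a b) x (src b) (n - deg b)"
    and "\<And>a. a \<in> coalg_arrs C \<Longrightarrow> src a = x \<Longrightarrow> deg a \<le> n \<Longrightarrow> alin s (\<lambda>b. F a b) (tgt a) y (n - deg a)"
  shows "abil s F x y n"
  using assms by (simp add: abil_def)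

lemma abilD:
  assumes "abil s F x y n"
  shows "module s"
    and "\<And>b. b \<in> coalg_arrs C \<Longrightarrow> tgt b = y \<Longrightarrow> deg b \<le> n \<Longrightarrow> alin s (\<lambda>a. F a b) x (src b) (n - deg b)"
    and "\<And>a. a \<in> coalg_arrs C \<Longrightarrow> src a = x \<Longrightarrow> deg a \<le> n \<Longrightarrow> alin s (\<lambda>b. F a b) (tgt a) y (n - deg a)"
  using assms by (simp_all add: abil_def)

text \<open>A labelled bilinear map extends to \<open>C \<times> C\<close> by composing with the projections to the bihomogeneous
  components; for a fixed pair only finitely many middle points matter.\<close>

definition bext :: "'c set \<Rightarrow> (('c, 'c) arr \<Rightarrow> ('c, 'c) arr \<Rightarrow> 'q::ab_group_add) \<Rightarrow> 'c \<Rightarrow> 'c \<Rightarrow> int \<Rightarrow> 'c \<Rightarrow> 'c \<Rightarrow> 'q" where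
  "bext Z F x y n a b = (\<Sum>(i, z)\<in>{0..n} \<times> Z.
     F (Arr x i (comp x z (nat i) a) z) (Arr z (n - i) (comp z y (nat (n - i)) b) y))"

lemma bil_bext:
  assumes "abil s F x y n" and "x \<in> points C" "y \<in> points C" "Z \<subseteq> points C"
  shows "bil s (bext Z F x y n)"
proof -
  interpret s: module s by (rule abilD(1)[OF assms(1)])
  have A: "lin s (\<lambda>a. F (Arr x i (comp x z (nat i) a) z) (Arr z (n - i) (comp z y (nat (n - i)) b) y))"
    "lin s (\<lambda>b. F (Arr x i (comp x z (nat i) a) z) (Arr z (n - i) (comp z y (nat (n - i)) b) y))"
    if "0 \<le> i" "i \<le> n" "z \<in> Z" for i z a b
  proof -
    have z: "z \<in> points C" using that assms(4) by auto
    have a: "Arr x i (comp x z (nat i) a) z \<in> coalg_arrs C"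
      "Arr z (n - i) (comp z y (nat (n - i)) b) y \<in> coalg_arrs C"
      using that z assms by (auto intro!: Arr_coalg_arrs comp_piece)
    show "lin s (\<lambda>a. F (Arr x i (comp x z (nat i) a) z) (Arr z (n - i) (comp z y (nat (n - i)) b) y))"
      using alin_comp[OF abilD(2)[OF assms(1) a(2)]] that assms z by simp
    show "lin s (\<lambda>b. F (Arr x i (comp x z (nat i) a) z) (Arr z (n - i) (comp z y (nat (n - i)) b) y))"
      using alin_comp[OF abilD(3)[OF assms(1) a(1)]] that assms z by simp
  qed
  show ?thesis
    unfolding bext_def
    by (intro bilI s.lin_on_sum s.module_axioms; clarsimp simp: A)
qed

lemma bext_0:
  assumes "abil s F x y n" and "x \<in> points C" "y \<in> points C" "Z \<subseteq> points C"
  shows "bext Z F x y n 0 b = 0" and "bext Z F x y n a 0 = 0"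
  using bil_bext[OF assms] lin_0[OF abilD(1)[OF assms(1)]]
  by (auto intro: bil_left bil_right)

text \<open>Every summand with other labels evaluates \<open>F\<close> at a zero element in one of
  its slots, and linearity makes it vanish.\<close>

lemma bext_elt:
  assumes "abil s F x y n" and "(a, b) \<in> splits c" and "c \<in> coalg_arrs C" "src c = x" "tgt c = y" "deg c = n"
    and "finite Z" "Z \<subseteq> points C" "tgt a \<in> Z"
  shows "bext Z F x y n (elt a) (elt b) = F a b"
proof -
  have ab: "a \<in> coalg_arrs C" "b \<in> coalg_arrs C" "src a = x" "tgt a = src b" "tgt b = y" "deg a + deg b = n"
    using assms by (auto simp: splits_def)
  have xy: "x \<in> points C" "y \<in> points C" using coalg_arrsD[OF assms(3)] assms by auto
  have F_eq: "F (Arr x i (comp x z (nat i) (elt a)) z) (Arr z (n - i) (comp z y (nat (n - i)) (elt b)) y)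
      = (if (i, z) = (deg a, tgt a) then F a b else 0)"
    if "i \<in> {0..n}" "z \<in> Z" for i z
  proof -
    have z: "z \<in> points C" "0 \<le> i" "i \<le> n" using that assms(8) by auto
    let ?b = "Arr z (n - i) (comp z y (nat (n - i)) (elt b)) y"
    have b: "?b \<in> coalg_arrs C" using z xy by (auto intro!: Arr_coalg_arrs comp_piece)
    have "alin s (\<lambda>a. F a ?b) x z i" using abilD(2)[OF assms(1) b] z by simp
    then have "F (Arr x i (comp x z (nat i) (elt a)) z) ?b
        = (if x = src a \<and> z = tgt a \<and> i = deg a then F a ?b else 0)"
      using alin_comp_arr[OF abilD(1)[OF assms(1)], of "\<lambda>a. F a ?b" x z i a] xy z ab by simp
    moreover have "F a ?b = F a b" if "z = tgt a" "i = deg a"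
    proof -
      have "alin s (F a) z y (n - i)" using abilD(3)[OF assms(1) ab(1)] that z ab by simp
      from alin_comp_arr[OF abilD(1)[OF assms(1)] this z(1) xy(2) _ ab(2)] show ?thesis
        using that ab z by auto
    qed
    ultimately show ?thesis using ab by auto
  qed
  have "bext Z F x y n (elt a) (elt b)
      = (\<Sum>p\<in>{0..n} \<times> Z. if p = (deg a, tgt a) then F a b else 0)"
    unfolding bext_def by (intro sum.cong[OF refl]) (clarify, simp only: prod.case F_eq)
  also have "\<dots> = F a b"
    using assms(7,9) ab coalg_arrsD(3)[OF ab(1)] coalg_arrsD(3)[OF ab(2)] by simp
  finally show ?thesis .
qed

definition mids :: "('c, 'c) arr \<Rightarrow> 'c set" where
  "mids c = (\<lambda>(a, b). tgt a) ` Poly_Mapping.keys (sweedler C c)"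

lemma finite_mids: "finite (mids c)"
  by (simp add: mids_def)

lemma mids_points: "c \<in> coalg_arrs C \<Longrightarrow> mids c \<subseteq> points C"
  unfolding mids_def using fsums_keysD[OF sweedler_spec(1), of c]
  by (auto simp: splits_def coalg_arrs_def)

lemma sw_cong_mids:
  assumes "module s" and "c \<in> coalg_arrs C"
    and "\<And>a b. (a, b) \<in> splits c \<Longrightarrow> tgt a \<in> mids c \<Longrightarrow> (a, b) \<in> Poly_Mapping.keys (sweedler C c) \<Longrightarrow> F a b = F' a b"
  shows "sw s F c = sw s F' c"
  unfolding sw_def
proof (rule module.lext_cong[OF assms(1)])
  fix p assume p: "p \<in> Poly_Mapping.keys (sweedler C c)"
  then have "p \<in> splits c" by (rule fsums_keysD[OF sweedler_spec(1)[OF assms(2)]])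
  moreover have "tgt (fst p) \<in> mids c" using p unfolding mids_def by (cases p) force
  ultimately show "(\<lambda>(a, b). F a b) p = (\<lambda>(a, b). F' a b) p"
    using p assms(3) by (cases p) auto
qed

text \<open>The bridge between labelled and unlabelled evaluation. The right side mentions only
  \<Delta> itself, so the choice in \<open>sweedler\<close> disappears and all results on
  \<open>dl\<close> transfer to \<open>sw\<close>.\<close>

lemma sw_bext:
  assumes "abil s F x y n" and "c \<in> coalg_arrs C" "src c = x" "tgt c = y" "deg c = n"
    and "finite Z" "Z \<subseteq> points C" "mids c \<subseteq> Z"
  shows "sw s F c = dl s (bext Z F x y n) (elt c)"
proof -
  have xy: "x \<in> points C" "y \<in> points C" using coalg_arrsD[OF assms(2)] assms by auto
  have "sw s F c = sw s (\<lambda>a b. bext Z F x y n (elt a) (elt b)) c"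
    by (rule sw_cong_mids[OF abilD(1)[OF assms(1)] assms(2)])
      (use bext_elt[OF assms(1) _ assms(2-7)] assms(8) in auto)
  then show ?thesis using sw_elt[OF bil_bext[OF assms(1) xy assms(7)] assms(2)] by simp
qed

text \<open>\<open>sweedler\<close> is not linear in its argument. Through \<open>sw_bext\<close>
  the value is a composite of linear maps, provided that one set of middle points serves all
  elements compared, hence the union of their \<open>mids\<close>.\<close>

lemma sw_alin:
  assumes "abil s F x y n" and "x \<in> points C" "y \<in> points C" "0 \<le> n"
  shows "alin s (sw s F) x y n"
  unfolding alin_def
proof (rule lin_onI)
  fix u v r assume u: "u \<in> coalg_piece C x y (nat n)"
  let ?c = "\<lambda>u. Arr x n u y"
  have su: "smul C r u \<in> coalg_piece C x y (nat n)"
    by (intro cm.subspace_scale[OF subspace_piece] assms u)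
  have eq: "sw s F (?c w) = dl s (bext Z F x y n) w"
    if "w \<in> coalg_piece C x y (nat n)" "finite Z" "Z \<subseteq> points C" "mids (?c w) \<subseteq> Z" for w Z
    using sw_bext[OF assms(1), of "?c w" Z] that Arr_coalg_arrs[OF assms(2-4)] by simp
  note mp = mids_points[OF Arr_coalg_arrs[OF assms(2-4)]]
  let ?Z = "mids (?c u) \<union> mids (?c (smul C r u))"
  have Z: "finite ?Z" "?Z \<subseteq> points C" using mp[OF u] mp[OF su] by (auto simp: finite_mids)
  show "sw s F (?c (smul C r u)) = s r (sw s F (?c u))"
    using eq[OF su Z] eq[OF u Z] lin_scale[OF dl_lin[OF bil_bext[OF assms(1-3) Z(2)]]] by simp
  assume v: "v \<in> coalg_piece C x y (nat n)"
  have uv: "u + v \<in> coalg_piece C x y (nat n)"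
    by (intro cm.subspace_add[OF subspace_piece] assms u v)
  let ?Z = "mids (?c u) \<union> mids (?c v) \<union> mids (?c (u + v))"
  have Z: "finite ?Z" "?Z \<subseteq> points C" using mp[OF u] mp[OF v] mp[OF uv] by (auto simp: finite_mids)
  show "sw s F (?c (u + v)) = sw s F (?c u) + sw s F (?c v)"
    by (subst eq[OF uv Z], blast, subst eq[OF u Z], blast, subst eq[OF v Z], blast)
      (rule lin_add[OF dl_lin[OF bil_bext[OF assms(1-3) Z(2)]]])
qed

end

context categorical_coalgebra
begin

section \<open>Trilinear functions of labelled elements and coassociativity\<close>

definition atril ::
    "('k \<Rightarrow> 'q::ab_group_add \<Rightarrow> 'q) \<Rightarrow> (('c, 'c) arr \<Rightarrow> ('c, 'c) arr \<Rightarrow> ('c, 'c) arr \<Rightarrow> 'q) \<Rightarrow>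
     'c \<Rightarrow> 'c \<Rightarrow> int \<Rightarrow> bool" where
  "atril s G x y n \<longleftrightarrow> module s
     \<and> (\<forall>b\<in>coalg_arrs C. \<forall>c\<in>coalg_arrs C. tgt b = src c \<and> tgt c = y \<and> deg b + deg c \<le> n \<longrightarrow>
          alin s (\<lambda>a. G a b c) x (src b) (n - deg b - deg c))
     \<and> (\<forall>a\<in>coalg_arrs C. \<forall>c\<in>coalg_arrs C. src a = x \<and> tgt c = y \<and> deg a + deg c \<le> n \<longrightarrow>
          alin s (\<lambda>b. G a b c) (tgt a) (src c) (n - deg a - deg c))
     \<and> (\<forall>a\<in>coalg_arrs C. \<forall>b\<in>coalg_arrs C. src a = x \<and> tgt a = src b \<and> deg a + deg b \<le> n \<longrightarrow>
          alin s (\<lambda>c. G a b c) (tgt b) y (n - deg a - deg b))"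

text \<open>The third degree is n - i - j, so the pairs of degrees are cut off at i + j \<le> n to
  keep it nonnegative.\<close>

definition tri_index :: "'c set \<Rightarrow> int \<Rightarrow> (int \<times> int \<times> 'c \<times> 'c) set" where
  "tri_index Z n = {p \<in> {0..n} \<times> {0..n} \<times> Z \<times> Z. fst p + fst (snd p) \<le> n}"

definition tri_ext ::
    "'c set \<Rightarrow> (('c, 'c) arr \<Rightarrow> ('c, 'c) arr \<Rightarrow> ('c, 'c) arr \<Rightarrow> 'q::ab_group_add) \<Rightarrow>
     'c \<Rightarrow> 'c \<Rightarrow> int \<Rightarrow> 'c \<Rightarrow> 'c \<Rightarrow> 'c \<Rightarrow> 'q" where
  "tri_ext Z G x y n a b c = (\<Sum>(i, j, z, w)\<in>tri_index Z n.
     G (Arr x i (comp x z (nat i) a) z) (Arr z j (comp z w (nat j) b) w)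
       (Arr w (n - i - j) (comp w y (nat (n - i - j)) c) y))"

lemma tril_tri_ext:
  assumes "atril s G x y n" and "x \<in> points C" "y \<in> points C" "Z \<subseteq> points C"
  shows "tril s (tri_ext Z G x y n)"
proof -
  interpret s: module s using assms(1) by (simp add: atril_def)
  let ?A = "\<lambda>i z a. Arr x i (comp x z (nat i) a) z" and ?B = "\<lambda>j z w b. Arr z j (comp z w (nat j) b) w"
    and ?C = "\<lambda>i j w c. Arr w (n - i - j) (comp w y (nat (n - i - j)) c) y"
  have A: "lin s (\<lambda>a. G (?A i z a) (?B j z w b) (?C i j w c))"
    "lin s (\<lambda>b. G (?A i z a) (?B j z w b) (?C i j w c))"
    "lin s (\<lambda>c. G (?A i z a) (?B j z w b) (?C i j w c))"
    if "0 \<le> i" "0 \<le> j" "i + j \<le> n" "z \<in> Z" "w \<in> Z" for i j z w a b c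
  proof -
    have zw: "z \<in> points C" "w \<in> points C" using that assms(4) by auto
    have arrs: "?A i z a \<in> coalg_arrs C" "?B j z w b \<in> coalg_arrs C" "?C i j w c \<in> coalg_arrs C"
      using that zw assms by (auto intro!: Arr_coalg_arrs comp_piece)
    have "alin s (\<lambda>a. G a (?B j z w b) (?C i j w c)) x z i"
      using assms(1)[unfolded atril_def] arrs(2,3) that by fastforce
    then show "lin s (\<lambda>a. G (?A i z a) (?B j z w b) (?C i j w c))"
      by (rule alin_comp) (use assms zw in auto)
    have "alin s (\<lambda>b. G (?A i z a) b (?C i j w c)) z w j"
      using assms(1)[unfolded atril_def] arrs(1,3) that by fastforce
    then show "lin s (\<lambda>b. G (?A i z a) (?B j z w b) (?C i j w c))"
      by (rule alin_comp) (use assms zw in auto)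
    have "alin s (\<lambda>c. G (?A i z a) (?B j z w b) c) w y (n - i - j)"
      using assms(1)[unfolded atril_def] arrs(1,2) that by fastforce
    then show "lin s (\<lambda>c. G (?A i z a) (?B j z w b) (?C i j w c))"
      by (rule alin_comp) (use assms zw in auto)
  qed
  show ?thesis
    unfolding tri_ext_def
    by (intro trilI s.lin_on_sum s.module_axioms; clarsimp simp: A tri_index_def)
qed

lemma tri_ext_elt:
  assumes "atril s G x y n" and "x \<in> points C" "y \<in> points C" "finite Z" "Z \<subseteq> points C"
    and "a \<in> coalg_arrs C" "b \<in> coalg_arrs C" "c \<in> coalg_arrs C"
    and "src a = x" "tgt a = src b" "tgt b = src c" "tgt c = y" "deg a + deg b + deg c = n"
    and "tgt a \<in> Z" "tgt b \<in> Z"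
  shows "tri_ext Z G x y n (elt a) (elt b) (elt c) = G a b c"
proof -
  have s: "module s" using assms(1) by (simp add: atril_def)
  let ?A = "\<lambda>i z. Arr x i (comp x z (nat i) (elt a)) z" and ?B = "\<lambda>j z w. Arr z j (comp z w (nat j) (elt b)) w"
    and ?C = "\<lambda>i j w. Arr w (n - i - j) (comp w y (nat (n - i - j)) (elt c)) y"
  have G_eq: "G (?A i z) (?B j z w) (?C i j w)
      = (if (i, j, z, w) = (deg a, deg b, tgt a, tgt b) then G a b c else 0)"
    if "0 \<le> i" "0 \<le> j" "i + j \<le> n" "z \<in> Z" "w \<in> Z" for i j z w
  proof -
    have zw: "z \<in> points C" "w \<in> points C" using that assms(5) by auto
    have arrs: "?B j z w \<in> coalg_arrs C" "?C i j w \<in> coalg_arrs C"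
      using that zw assms by (auto intro!: Arr_coalg_arrs comp_piece)
    have "alin s (\<lambda>a. G a (?B j z w) (?C i j w)) x z i"
      using assms(1)[unfolded atril_def] arrs that by fastforce
    then have 1: "G (?A i z) (?B j z w) (?C i j w)
        = (if z = tgt a \<and> i = deg a then G a (?B j z w) (?C i j w) else 0)"
      using alin_comp_arr[OF s, of "\<lambda>a. G a (?B j z w) (?C i j w)" x z i a] zw that assms by simp
    have 2: "G a (?B j z w) (?C i j w) = (if w = tgt b \<and> j = deg b then G a b (?C i j w) else 0)"
      if za: "z = tgt a" "i = deg a"
    proof -
      have "alin s (\<lambda>b. G a b (?C i j w)) z w j"
        using assms(1)[unfolded atril_def] assms(6,9) arrs(2) that \<open>i + j \<le> n\<close> \<open>0 \<le> j\<close> by fastforce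
      then show ?thesis
        using alin_comp_arr[OF s, of "\<lambda>b. G a b (?C i j w)" z w j b] zw za assms \<open>0 \<le> j\<close> by simp
    qed
    have 3: "G a b (?C i j w) = G a b c" if za: "z = tgt a" "i = deg a" "w = tgt b" "j = deg b"
    proof -
      have "alin s (\<lambda>c. G a b c) w y (n - i - j)"
        using assms(1)[unfolded atril_def] assms(6,7,9,10) that \<open>i + j \<le> n\<close> by fastforce
      then show ?thesis
        using alin_comp_arr[OF s, of "\<lambda>c. G a b c" w y "n - i - j" c] zw za assms \<open>i + j \<le> n\<close> by simp
    qed
    show ?thesis using 1 2 3 by auto
  qed
  have "tri_ext Z G x y n (elt a) (elt b) (elt c)
      = (\<Sum>p\<in>tri_index Z n. if p = (deg a, deg b, tgt a, tgt b) then G a b c else 0)"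
    unfolding tri_ext_def
  proof (intro sum.cong[OF refl])
    fix p assume "p \<in> tri_index Z n"
    then show "(case p of (i, j, z, w) \<Rightarrow> G (?A i z) (?B j z w) (?C i j w))
        = (if p = (deg a, deg b, tgt a, tgt b) then G a b c else 0)"
      by (cases p) (simp only: tri_index_def prod.case G_eq mem_Collect_eq mem_Times_iff atLeastAtMost_iff fst_conv snd_conv)
  qed
  also have "\<dots> = G a b c"
  proof -
    have "finite (tri_index Z n)" by (simp add: tri_index_def assms(4))
    moreover have "(deg a, deg b, tgt a, tgt b) \<in> tri_index Z n"
      using assms coalg_arrsD(3)[OF assms(6)] coalg_arrsD(3)[OF assms(7)] coalg_arrsD(3)[OF assms(8)]
      by (simp add: tri_index_def)
    ultimately show ?thesis by simp
  qed
  finally show ?thesis .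
qed

text \<open>Both iterated labelled sums equal the evaluation of one trilinear map on C on an
  iterated coproduct, and there \<open>dl_coassoc\<close> applies.\<close>

lemma sw_coassoc:
  assumes "c \<in> coalg_arrs C" and "atril s G (src c) (tgt c) (deg c)"
  shows "sw s (\<lambda>a b. sw s (\<lambda>a' a''. G a' a'' b) a) c = sw s (\<lambda>a b. sw s (\<lambda>b' b''. G a b' b'') b) c"
proof -
  let ?x = "src c" and ?y = "tgt c" and ?n = "deg c" and ?K = "Poly_Mapping.keys (sweedler C c)"
  have s: "module s" using assms(2) by (simp add: atril_def)
  have spl: "(a, b) \<in> splits c" if "(a, b) \<in> ?K" for a b
    using that by (rule fsums_keysD[OF sweedler_spec(1)[OF assms(1)]])
  \<comment> \<open>Both ways of splitting twice must be seen, so the middle points of \<Delta>c and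
    those of all its left and right factors are collected.\<close>
  define Z where "Z = mids c \<union> (\<Union>(a, b)\<in>?K. mids a \<union> mids b)"
  have "mids a \<union> mids b \<subseteq> points C" if "(a, b) \<in> ?K" for a b
    using mids_points[of a] mids_points[of b] spl[OF that] by (auto simp: splits_def)
  then have Z: "finite Z" "Z \<subseteq> points C"
    using mids_points[OF assms(1)] unfolding Z_def by (auto simp: finite_mids)
  have Z_sub: "mids a \<subseteq> Z" "mids b \<subseteq> Z" "tgt a \<in> Z" if "(a, b) \<in> ?K" for a b
    using that unfolding Z_def by (fastforce simp: mids_def)+
  let ?G = "tri_ext Z G ?x ?y ?n"
  note T = tril_tri_ext[OF assms(2) coalg_arrsD(1,2)[OF assms(1)] Z(2)]
  note E = tri_ext_elt[OF assms(2) coalg_arrsD(1,2)[OF assms(1)] Z]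
  have "sw s (\<lambda>a b. sw s (\<lambda>a' a''. G a' a'' b) a) c
      = sw s (\<lambda>a b. sw s (\<lambda>a' a''. ?G (elt a') (elt a'') (elt b)) a) c"
  proof (rule sw_cong_mids[OF s assms(1)])
    fix a b assume ab: "(a, b) \<in> splits c" "tgt a \<in> mids c" "(a, b) \<in> ?K"
    show "sw s (\<lambda>a' a''. G a' a'' b) a = sw s (\<lambda>a' a''. ?G (elt a') (elt a'') (elt b)) a"
      by (rule sw_cong_mids[OF s]) (use ab Z_sub[OF ab(3)] in \<open>auto simp: splits_def intro!: E[symmetric]\<close>)
  qed
  also have "\<dots> = sw s (\<lambda>a b. dl s (\<lambda>p q. ?G p q (elt b)) (elt a)) c"
    by (intro sw_cong[OF s assms(1)] sw_elt) (use T in \<open>auto simp: splits_def tril_def bil_def\<close>)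
  also have "\<dots> = dl s (\<lambda>a b. dl s (\<lambda>p q. ?G p q b) a) (elt c)"
    by (rule sw_elt[OF bil_dl_left[OF T] assms(1)])
  also have "\<dots> = dl s (\<lambda>a b. dl s (\<lambda>p q. ?G a p q) b) (elt c)"
    by (rule dl_coassoc[OF T])
  also have "\<dots> = sw s (\<lambda>a b. dl s (\<lambda>p q. ?G (elt a) p q) (elt b)) c"
    by (rule sw_elt[OF bil_dl_right[OF T] assms(1), symmetric])
  also have "\<dots> = sw s (\<lambda>a b. sw s (\<lambda>b' b''. ?G (elt a) (elt b') (elt b'')) b) c"
    by (intro sw_cong[OF s assms(1)] sw_elt[symmetric]) (use T in \<open>auto simp: splits_def tril_def bil_def\<close>)
  also have "\<dots> = sw s (\<lambda>a b. sw s (\<lambda>b' b''. G a b' b'') b) c"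
  proof (rule sw_cong_mids[OF s assms(1)])
    fix a b assume ab: "(a, b) \<in> splits c" "tgt a \<in> mids c" "(a, b) \<in> ?K"
    show "sw s (\<lambda>b' b''. ?G (elt a) (elt b') (elt b'')) b = sw s (\<lambda>b' b''. G a b' b'') b"
      by (rule sw_cong_mids[OF s]) (use ab Z_sub[OF ab(3)] in \<open>auto simp: splits_def intro!: E\<close>)
  qed
  finally show ?thesis .
qed

section \<open>Counit and coderivation axioms for labelled elements\<close>

abbreviation pt :: "'c \<Rightarrow> ('c, 'c) arr" where
  "pt x \<equiv> Arr x 0 x x"

lemma pt_coalg_arrs: "x \<in> points C \<Longrightarrow> pt x \<in> coalg_arrs C"
proof -
  assume x: "x \<in> points C"
  have "Lp x x = x" "Rp x x = x"
    using dl_eq2[OF bil_lam(1)[OF module_C lin_on_ident], of x "gen (x, x)" x]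
      dl_eq2[OF bil_lam(2)[OF module_C lin_on_ident], of x "gen (x, x)" x] x
    by (auto simp: Lp_def Rp_def lam_point) (simp_all add: points_def)
  then show ?thesis using x by (auto intro!: Arr_coalg_arrs simp: coalg_piece_iff point_gr)
qed

lemma counit_pt: "x \<in> points C \<Longrightarrow> counit C x = 1"
  by (simp add: points_def)

lemma degree_0_arr:
  assumes "c \<in> coalg_arrs C" and "deg c = 0"
  shows "elt c = (if src c = tgt c then smul C (counit C (elt c)) (src c) else 0)"
  using degree_0_piece[of "src c" "tgt c" "elt c"] coalg_arrsD[OF assms(1)] assms(2) by simp

lemma alin_degree_0:
  assumes "module s" and "alin s f x y 0" and "c \<in> coalg_arrs C" "deg c = 0" "src c = x" "tgt c = y"
  shows "f c = (if x = y then s (counit C (elt c)) (f (pt x)) else 0)"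
proof -
  have xy: "x \<in> points C" "y \<in> points C" using coalg_arrsD[OF assms(3)] assms by auto
  have c: "c = Arr x 0 (elt c) y" using assms by (metis arr.collapse)
  show ?thesis
  proof (cases "x = y")
    case True
    have "x \<in> coalg_piece C x y 0"
      using coalg_arrsD(4)[OF pt_coalg_arrs[OF xy(1)]] True by simp
    then have "f (Arr x 0 (smul C (counit C (elt c)) x) y) = s (counit C (elt c)) (f (Arr x 0 x y))"
      using lin_on_scaleD[OF assms(2)[unfolded alin_def]] by simp
    moreover have "elt c = smul C (counit C (elt c)) x"
      using degree_0_arr[OF assms(3,4)] assms(5,6) True by simp
    ultimately show ?thesis using c True by metis
  next
    case False
    then have "elt c = 0" using degree_0_arr[OF assms(3,4)] assms(5,6) by simp
    then show ?thesis using c False alin_0[OF assms(1,2) xy] by metis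
  qed
qed

text \<open>Since the counit vanishes in positive degree, selecting the terms with left degree 0 is
  the same as weighting each term by the counit of its left factor, after the degree 0 factor has
  been rewritten as a multiple of a point. The left counit axiom then leaves x \<otimes> c.\<close>

lemma sw_degree_0_left:
  assumes "c \<in> coalg_arrs C" and "abil s F (src c) (tgt c) (deg c)"
  shows "sw s (\<lambda>a b. if deg a = 0 then F a b else 0) c = F (pt (src c)) c"
proof -
  let ?x = "src c" and ?y = "tgt c" and ?n = "deg c"
  note s = abilD(1)[OF assms(2)] and cD = coalg_arrsD[OF assms(1)]
  interpret s: module s by (rule s)
  define f where "f u = F (pt ?x) (Arr ?x ?n (comp ?x ?y (nat ?n) u) ?y)" for u
  have al: "alin s (\<lambda>b. F (pt ?x) b) ?x ?y ?n"
    using abilD(3)[OF assms(2) pt_coalg_arrs[OF cD(1)]] cD by simp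
  have f: "lin s f"
    unfolding f_def using al cD by (auto intro: alin_comp)
  have f_elt: "f (elt b) = F (pt ?x) b" if "b \<in> coalg_arrs C" "src b = ?x" "tgt b = ?y" "deg b = ?n" for b
    using alin_comp_arr[OF s al cD(1,2,3) that(1)] that by (simp add: f_def)
  have "sw s (\<lambda>a b. if deg a = 0 then F a b else 0) c = sw s (\<lambda>a b. s (counit C (elt a)) (f (elt b))) c"
  proof (rule sw_cong[OF s assms(1)])
    fix a b assume "(a, b) \<in> splits c"
    then have ab: "a \<in> coalg_arrs C" "b \<in> coalg_arrs C" "src a = ?x" "tgt a = src b" "tgt b = ?y"
      "deg a + deg b = ?n" by (auto simp: splits_def)
    note a = coalg_arrsD[OF ab(1)] and b = coalg_arrsD[OF ab(2)]
    show "(if deg a = 0 then F a b else 0) = s (counit C (elt a)) (f (elt b))"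
    proof (cases "deg a = 0")
      case True
      have "alin s (\<lambda>a. F a b) ?x (src b) 0"
        using abilD(2)[OF assms(2) ab(2,5)] ab True by simp
      from alin_degree_0[OF s this ab(1) True ab(3,4)]
      have "F a b = (if ?x = src b then s (counit C (elt a)) (F (pt ?x) b) else 0)" .
      moreover have "counit C (elt a) = 0" if "?x \<noteq> src b"
        using degree_0_arr[OF ab(1) True] that ab lin_0[OF rm.module_axioms counit_lin] by simp
      ultimately show ?thesis using True f_elt[OF ab(2)] ab by auto
    next
      case False
      then have "counit C (elt a) = 0"
        using a by (intro counit_pos[of _ "nat (deg a)"]) (auto simp: coalg_piece_def)
      then show ?thesis using False by simp
    qed
  qed
  also have "\<dots> = dl s (\<lambda>a b. s (counit C a) (f b)) (elt c)"
    by (rule sw_elt[OF bil_mult(1)[OF s counit_lin f] assms(1)])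
  also have "\<dots> = f (elt c)" by (rule dl_counit_left[OF s f])
  finally show ?thesis using f_elt[OF assms(1)] by simp
qed

lemma sw_degree_0_right:
  assumes "c \<in> coalg_arrs C" and "abil s F (src c) (tgt c) (deg c)"
  shows "sw s (\<lambda>a b. if deg b = 0 then F a b else 0) c = F c (pt (tgt c))"
proof -
  let ?x = "src c" and ?y = "tgt c" and ?n = "deg c"
  note s = abilD(1)[OF assms(2)] and cD = coalg_arrsD[OF assms(1)]
  interpret s: module s by (rule s)
  define f where "f u = F (Arr ?x ?n (comp ?x ?y (nat ?n) u) ?y) (pt ?y)" for u
  have al: "alin s (\<lambda>a. F a (pt ?y)) ?x ?y ?n"
    using abilD(2)[OF assms(2) pt_coalg_arrs[OF cD(2)]] cD by simp
  have f: "lin s f"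
    unfolding f_def using al cD by (auto intro: alin_comp)
  have f_elt: "f (elt a) = F a (pt ?y)" if "a \<in> coalg_arrs C" "src a = ?x" "tgt a = ?y" "deg a = ?n" for a
    using alin_comp_arr[OF s al cD(1,2,3) that(1)] that by (simp add: f_def)
  have "sw s (\<lambda>a b. if deg b = 0 then F a b else 0) c = sw s (\<lambda>a b. s (counit C (elt b)) (f (elt a))) c"
  proof (rule sw_cong[OF s assms(1)])
    fix a b assume "(a, b) \<in> splits c"
    then have ab: "a \<in> coalg_arrs C" "b \<in> coalg_arrs C" "src a = ?x" "tgt a = src b" "tgt b = ?y"
      "deg a + deg b = ?n" by (auto simp: splits_def)
    note a = coalg_arrsD[OF ab(1)] and b = coalg_arrsD[OF ab(2)]
    show "(if deg b = 0 then F a b else 0) = s (counit C (elt b)) (f (elt a))"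
    proof (cases "deg b = 0")
      case True
      have "alin s (\<lambda>b. F a b) (tgt a) ?y 0"
        using abilD(3)[OF assms(2) ab(1,3)] ab True by simp
      from alin_degree_0[OF s this ab(2) True ab(4)[symmetric] ab(5)]
      have "F a b = (if tgt a = ?y then s (counit C (elt b)) (F a (pt (tgt a))) else 0)" .
      moreover have "counit C (elt b) = 0" if "tgt a \<noteq> ?y"
        using degree_0_arr[OF ab(2) True] that ab lin_0[OF rm.module_axioms counit_lin] by simp
      ultimately show ?thesis using True f_elt[OF ab(1)] ab by auto
    next
      case False
      then have "counit C (elt b) = 0"
        using b by (intro counit_pos[of _ "nat (deg b)"]) (auto simp: coalg_piece_def)
      then show ?thesis using False by simp
    qed
  qed
  also have "\<dots> = dl s (\<lambda>a b. s (counit C b) (f a)) (elt c)"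
    by (rule sw_elt[OF bil_mult(2)[OF s counit_lin f] assms(1)])
  also have "\<dots> = f (elt c)" by (rule dl_counit_right[OF s f])
  finally show ?thesis using f_elt[OF assms(1)] by simp
qed

abbreviation dC :: "('c, 'c) arr \<Rightarrow> ('c, 'c) arr" where
  "dC \<equiv> arr_map (codiff C) (-1)"

lemma dC_coalg_arrs: "c \<in> coalg_arrs C \<Longrightarrow> 1 \<le> deg c \<Longrightarrow> dC c \<in> coalg_arrs C"
  using codiff_piece[of "src c" "tgt c" "elt c" "nat (deg c - 1)"] coalg_arrsD[of c]
  by (auto simp: arr_map_def Suc_nat_eq_nat_zadd1 intro!: Arr_coalg_arrs)

lemma arr_map_simps [simp]:
  "src (arr_map f r a) = src a" "tgt (arr_map f r a) = tgt a" "deg (arr_map f r a) = deg a + r"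
  "elt (arr_map f r a) = f (elt a)"
  by (simp_all add: arr_map_def)

text \<open>Applied to a factor of degree 0, \<open>dC\<close> would produce the label -1. These
  terms are left out, which is harmless because d vanishes on C_0 and the bilinear extension is zero
  there.\<close>

lemma sw_coder:
  assumes "c \<in> coalg_arrs C" and "1 \<le> deg c" and "abil s F (src c) (tgt c) (deg c - 1)"
  shows "sw s F (dC c) = sw s (\<lambda>a b. (if 1 \<le> deg a then F (dC a) b else 0)
    + (if 1 \<le> deg b then s (ksign (deg a)) (F a (dC b)) else 0)) c"
proof -
  let ?x = "src c" and ?y = "tgt c" and ?n = "deg c - 1"
  note s = abilD(1)[OF assms(3)] and cD = coalg_arrsD[OF assms(1)]
  interpret s: module s by (rule s)
  note dc = dC_coalg_arrs[OF assms(1,2)]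
  let ?Z = "mids c \<union> mids (dC c)"
  have Z: "finite ?Z" "?Z \<subseteq> points C"
    using mids_points[OF assms(1)] mids_points[OF dc] by (auto simp: finite_mids)
  let ?F = "bext ?Z F ?x ?y ?n"
  note bil = bil_bext[OF assms(3) cD(1,2) Z(2)]
  have E: "?F (elt a) (elt b) = F a b"
    if "(a, b) \<in> splits (dC c)" "tgt a \<in> ?Z" for a b
    using bext_elt[OF assms(3) that(1) dc _ _ _ Z that(2)] by simp
  have d0: "codiff C (elt a) = 0" if "a \<in> coalg_arrs C" "\<not> 1 \<le> deg a" for a
    using coalg_arrsD[OF that(1)] that(2) by (intro codiff_0) (auto simp: coalg_piece_def)
  have "sw s F (dC c) = dl s ?F (codiff C (elt c))"
    using sw_bext[OF assms(3) dc _ _ _ Z] by simp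
  also have "\<dots> = dl s (\<lambda>a b. ?F (codiff C a) b + ?F (sgn_inv C a) (codiff C b)) (elt c)"
    by (rule dl_coder[OF bil])
  also have "\<dots> = sw s (\<lambda>a b. ?F (codiff C (elt a)) (elt b) + ?F (sgn_inv C (elt a)) (codiff C (elt b))) c"
  proof (rule sw_elt[OF _ assms(1), symmetric])
    show "bil s (\<lambda>a b. ?F (codiff C a) b + ?F (sgn_inv C a) (codiff C b))"
      using bil_comp[OF bil codiff_lin lin_on_ident] bil_comp[OF bil sgn_inv_lin codiff_lin]
      by (auto simp: bil_def intro!: s.lin_on_add)
  qed
  also have "\<dots> = sw s (\<lambda>a b. (if 1 \<le> deg a then F (dC a) b else 0)
    + (if 1 \<le> deg b then s (ksign (deg a)) (F a (dC b)) else 0)) c"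
  proof (rule sw_cong_mids[OF s assms(1)])
    fix a b assume spl: "(a, b) \<in> splits c" and mid: "tgt a \<in> mids c"
    then have ab: "a \<in> coalg_arrs C" "b \<in> coalg_arrs C" "src a = ?x" "tgt a = src b" "tgt b = ?y"
      "deg a + deg b = deg c" by (auto simp: splits_def)
    have "?F (codiff C (elt a)) (elt b) = (if 1 \<le> deg a then F (dC a) b else 0)"
    proof (cases "1 \<le> deg a")
      case True
      then have "(dC a, b) \<in> splits (dC c)" using ab dC_coalg_arrs by (auto simp: splits_def)
      from E[OF this] mid True show ?thesis by simp
    next
      case False
      then show ?thesis using d0[OF ab(1) False] bext_0[OF assms(3) cD(1,2) Z(2)] by simp
    qed
    moreover have "sgn_inv C (elt a) = smul C (ksign (deg a)) (elt a)"
      using sgn_inv_gr[of "elt a" "nat (deg a)"] coalg_arrsD[OF ab(1)] by (simp add: coalg_piece_def)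
    then have "?F (sgn_inv C (elt a)) (codiff C (elt b)) = s (ksign (deg a)) (?F (elt a) (codiff C (elt b)))"
      using lin_scale[OF bil_left[OF bil]] by simp
    moreover have "?F (elt a) (codiff C (elt b)) = (if 1 \<le> deg b then F a (dC b) else 0)"
    proof (cases "1 \<le> deg b")
      case True
      then have "(a, dC b) \<in> splits (dC c)" using ab dC_coalg_arrs by (auto simp: splits_def)
      from E[OF this] mid True show ?thesis by simp
    next
      case False
      then show ?thesis using d0[OF ab(2) False] bext_0[OF assms(3) cD(1,2) Z(2)] by simp
    qed
    ultimately show "?F (codiff C (elt a)) (elt b) + ?F (sgn_inv C (elt a)) (codiff C (elt b))
        = (if 1 \<le> deg a then F (dC a) b else 0)
          + (if 1 \<le> deg b then s (ksign (deg a)) (F a (dC b)) else 0)" by simp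
  qed
  finally show ?thesis .
qed

subsection \<open>The reduced coproduct\<close>

definition red :: "('k \<Rightarrow> 'q::ab_group_add \<Rightarrow> 'q) \<Rightarrow> (('c, 'c) arr \<Rightarrow> ('c, 'c) arr \<Rightarrow> 'q) \<Rightarrow> ('c, 'c) arr \<Rightarrow> 'q" where
  "red s F c = lext s (\<lambda>(a, b). F a b) (red_cop C c)"

definition psplits :: "('c, 'c) arr \<Rightarrow> (('c, 'c) arr \<times> ('c, 'c) arr) set" where
  "psplits c = {(a, b). (a, b) \<in> splits c \<and> 1 \<le> deg a \<and> 1 \<le> deg b}"

lemma red_cop_in: "c \<in> coalg_arrs C \<Longrightarrow> red_cop C c \<in> fsums (psplits c)"
  unfolding red_cop_def
  by (rule fsums_lext) (auto simp: psplits_def dest: fsums_keysD[OF sweedler_spec(1)])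

lemma red_sw: "module s \<Longrightarrow> red s F c = sw s (\<lambda>a b. if 1 \<le> deg a \<and> 1 \<le> deg b then F a b else 0) c"
  unfolding red_def red_cop_def sw_def
  by (simp add: module.lext_lext split_def if_distrib[of "lext s _"] module.lext_gen module.lext_0 cong: if_cong)

lemma red_cong:
  assumes "module s" and "c \<in> coalg_arrs C" and "\<And>a b. (a, b) \<in> psplits c \<Longrightarrow> F a b = F' a b"
  shows "red s F c = red s F' c"
  unfolding red_sw[OF assms(1)] by (rule sw_cong[OF assms(1,2)]) (auto simp: psplits_def assms(3))

lemma red_degree_1:
  assumes "module s" and "c \<in> coalg_arrs C" and "deg c \<le> 1"
  shows "red s F c = 0"
proof -
  have "red s F c = red s (\<lambda>a b. 0) c"
    by (rule red_cong[OF assms(1,2)]) (use assms(3) in \<open>auto simp: psplits_def splits_def\<close>)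
  then show ?thesis by (simp add: red_def split_def module.lext_fun_0[OF assms(1)])
qed

lemma red_add: "module s \<Longrightarrow> red s (\<lambda>a b. F a b + G a b) c = red s F c + red s G c"
  and red_diff: "module s \<Longrightarrow> red s (\<lambda>a b. F a b - G a b) c = red s F c - red s G c"
  and red_uminus: "module s \<Longrightarrow> red s (\<lambda>a b. - F a b) c = - red s F c"
  and red_0: "module s \<Longrightarrow> red s (\<lambda>a b. 0) c = 0"
  by (simp_all add: red_def split_def module.lext_fun_add module.lext_fun_diff module.lext_fun_uminus
      module.lext_fun_0)

lemma red_scale: "module s \<Longrightarrow> red s (\<lambda>a b. s r (F a b)) c = s r (red s F c)"
  unfolding red_def split_def by (rule module.lext_fun_scale)

text \<open>The reduced coproduct only meets factors of positive degree. Functions built from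
  brackets are controlled only there, so linearity is asked only there; \<open>abil_filter\<close>
  extends by zero.\<close>

definition pabil :: "('k \<Rightarrow> 'q::ab_group_add \<Rightarrow> 'q) \<Rightarrow> (('c, 'c) arr \<Rightarrow> ('c, 'c) arr \<Rightarrow> 'q) \<Rightarrow> 'c \<Rightarrow> 'c \<Rightarrow> int \<Rightarrow> bool" where
  "pabil s F x y n \<longleftrightarrow> module s
     \<and> (\<forall>b\<in>coalg_arrs C. tgt b = y \<and> 1 \<le> deg b \<and> deg b < n \<longrightarrow> alin s (\<lambda>a. F a b) x (src b) (n - deg b))
     \<and> (\<forall>a\<in>coalg_arrs C. src a = x \<and> 1 \<le> deg a \<and> deg a < n \<longrightarrow> alin s (F a) (tgt a) y (n - deg a))"

lemma pabilI:
  assumes "module s"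
    and "\<And>b. b \<in> coalg_arrs C \<Longrightarrow> tgt b = y \<Longrightarrow> 1 \<le> deg b \<Longrightarrow> deg b < n \<Longrightarrow>
      alin s (\<lambda>a. F a b) x (src b) (n - deg b)"
    and "\<And>a. a \<in> coalg_arrs C \<Longrightarrow> src a = x \<Longrightarrow> 1 \<le> deg a \<Longrightarrow> deg a < n \<Longrightarrow>
      alin s (\<lambda>b. F a b) (tgt a) y (n - deg a)"
  shows "pabil s F x y n"
  using assms by (simp add: pabil_def)

lemma alin_zero: "module s \<Longrightarrow> alin s (\<lambda>a. 0) x y n"
  by (simp add: alin_def module.lin_on_zero)

lemma alin_filter:
  assumes "module s" and "P n \<Longrightarrow> alin s f x y n"
  shows "alin s (\<lambda>a. if P (deg a) then f a else 0) x y n"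
  using assms by (cases "P n") (simp_all add: alin_def module.lin_on_zero)

lemma abil_filter:
  assumes "pabil s F x y n"
  shows "abil s (\<lambda>a b. if 1 \<le> deg a \<and> 1 \<le> deg b then F a b else 0) x y n"
proof -
  have s: "module s" using assms by (simp add: pabil_def)
  show ?thesis
  proof (rule abilI[OF s])
    fix b assume b: "b \<in> coalg_arrs C" "tgt b = y" "deg b \<le> n"
    show "alin s (\<lambda>a. if 1 \<le> deg a \<and> 1 \<le> deg b then F a b else 0) x (src b) (n - deg b)"
      by (rule alin_filter[OF s, where P = "\<lambda>k. 1 \<le> k \<and> 1 \<le> deg b"])
        (use assms b in \<open>auto simp: pabil_def\<close>)
  next
    fix a assume a: "a \<in> coalg_arrs C" "src a = x" "deg a \<le> n"
    show "alin s (\<lambda>b. if 1 \<le> deg a \<and> 1 \<le> deg b then F a b else 0) (tgt a) y (n - deg a)"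
      by (rule alin_filter[OF s, where P = "\<lambda>k. 1 \<le> deg a \<and> 1 \<le> k"])
        (use assms a in \<open>auto simp: pabil_def\<close>)
  qed
qed

lemma red_alin:
  assumes "pabil s F x y n" and "x \<in> points C" "y \<in> points C" "0 \<le> n"
  shows "alin s (red s F) x y n"
proof -
  have "red s F = sw s (\<lambda>a b. if 1 \<le> deg a \<and> 1 \<le> deg b then F a b else 0)"
    using assms(1) by (auto simp: red_sw pabil_def)
  then show ?thesis using sw_alin[OF abil_filter[OF assms(1)] assms(2-)] by simp
qed

text \<open>Split the terms by degree and evaluate the two extreme parts by the counit axioms.
  Positive degree of \<open>c\<close> ensures that no term has both factors in degree 0 and is
  counted twice.\<close>

lemma sw_split:
  assumes "c \<in> coalg_arrs C" and "abil s F (src c) (tgt c) (deg c)" and "1 \<le> deg c"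
  shows "sw s F c = F (pt (src c)) c + F c (pt (tgt c)) + red s F c"
proof -
  note s = abilD(1)[OF assms(2)]
  have "sw s F c = sw s (\<lambda>a b. (if deg a = 0 then F a b else 0) + (if deg b = 0 then F a b else 0)
      + (if 1 \<le> deg a \<and> 1 \<le> deg b then F a b else 0)) c"
  proof (rule sw_cong[OF s assms(1)])
    fix a b assume "(a, b) \<in> splits c"
    then have "0 \<le> deg a" "0 \<le> deg b" "deg a + deg b = deg c"
      using coalg_arrsD(3) by (auto simp: splits_def)
    then show "F a b = (if deg a = 0 then F a b else 0) + (if deg b = 0 then F a b else 0)
      + (if 1 \<le> deg a \<and> 1 \<le> deg b then F a b else 0)" using assms(3) by auto
  qed
  also have "\<dots> = F (pt (src c)) c + F c (pt (tgt c)) + red s F c"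
    unfolding red_sw[OF s] sw_degree_0_left[OF assms(1,2), symmetric] sw_degree_0_right[OF assms(1,2), symmetric]
    by (simp add: sw_def split_def module.lext_fun_add[OF s])
  finally show ?thesis .
qed

lemma sw_degree_0:
  assumes "c \<in> coalg_arrs C" and "abil s F (src c) (tgt c) (deg c)" and "deg c = 0"
  shows "sw s F c = F (pt (src c)) c"
proof -
  note s = abilD(1)[OF assms(2)]
  have "sw s F c = sw s (\<lambda>a b. if deg a = 0 then F a b else 0) c"
  proof (rule sw_cong[OF s assms(1)])
    fix a b assume "(a, b) \<in> splits c"
    then have "0 \<le> deg a" "0 \<le> deg b" "deg a + deg b = 0"
      using coalg_arrsD(3) assms(3) by (auto simp: splits_def)
    then show "F a b = (if deg a = 0 then F a b else 0)" by auto
  qed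
  then show ?thesis by (simp add: sw_degree_0_left[OF assms(1,2)])
qed

definition patril ::
    "('k \<Rightarrow> 'q::ab_group_add \<Rightarrow> 'q) \<Rightarrow> (('c, 'c) arr \<Rightarrow> ('c, 'c) arr \<Rightarrow> ('c, 'c) arr \<Rightarrow> 'q) \<Rightarrow>
     'c \<Rightarrow> 'c \<Rightarrow> int \<Rightarrow> bool" where
  "patril s G x y n \<longleftrightarrow> module s
     \<and> (\<forall>b\<in>coalg_arrs C. \<forall>c\<in>coalg_arrs C. tgt b = src c \<and> tgt c = y \<and> 1 \<le> deg b \<and> 1 \<le> deg c \<and> deg b + deg c < n \<longrightarrow>
          alin s (\<lambda>a. G a b c) x (src b) (n - deg b - deg c))
     \<and> (\<forall>a\<in>coalg_arrs C. \<forall>c\<in>coalg_arrs C. src a = x \<and> tgt c = y \<and> 1 \<le> deg a \<and> 1 \<le> deg c \<and> deg a + deg c < n \<longrightarrow>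
          alin s (\<lambda>b. G a b c) (tgt a) (src c) (n - deg a - deg c))
     \<and> (\<forall>a\<in>coalg_arrs C. \<forall>b\<in>coalg_arrs C. src a = x \<and> tgt a = src b \<and> 1 \<le> deg a \<and> 1 \<le> deg b \<and> deg a + deg b < n \<longrightarrow>
          alin s (\<lambda>c. G a b c) (tgt b) y (n - deg a - deg b))"

lemma atril_filter:
  assumes "patril s G x y n"
  shows "atril s (\<lambda>a b c. if 1 \<le> deg a \<and> 1 \<le> deg b \<and> 1 \<le> deg c then G a b c else 0) x y n"
proof -
  have s: "module s" using assms by (simp add: patril_def)
  show ?thesis
    unfolding atril_def
  proof (intro conjI ballI impI s; elim conjE)
    fix b c assume bc: "b \<in> coalg_arrs C" "c \<in> coalg_arrs C" "tgt b = src c" "tgt c = y" "deg b + deg c \<le> n"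
    show "alin s (\<lambda>a. if 1 \<le> deg a \<and> 1 \<le> deg b \<and> 1 \<le> deg c then G a b c else 0) x (src b) (n - deg b - deg c)"
      by (rule alin_filter[OF s, where P = "\<lambda>k. 1 \<le> k \<and> 1 \<le> deg b \<and> 1 \<le> deg c"])
        (use assms bc in \<open>auto simp: patril_def\<close>)
  next
    fix a c assume ac: "a \<in> coalg_arrs C" "c \<in> coalg_arrs C" "src a = x" "tgt c = y" "deg a + deg c \<le> n"
    show "alin s (\<lambda>b. if 1 \<le> deg a \<and> 1 \<le> deg b \<and> 1 \<le> deg c then G a b c else 0) (tgt a) (src c) (n - deg a - deg c)"
      by (rule alin_filter[OF s, where P = "\<lambda>k. 1 \<le> deg a \<and> 1 \<le> k \<and> 1 \<le> deg c"])
        (use assms ac in \<open>auto simp: patril_def\<close>)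
  next
    fix a b assume ab: "a \<in> coalg_arrs C" "b \<in> coalg_arrs C" "src a = x" "tgt a = src b" "deg a + deg b \<le> n"
    show "alin s (\<lambda>c. if 1 \<le> deg a \<and> 1 \<le> deg b \<and> 1 \<le> deg c then G a b c else 0) (tgt b) y (n - deg a - deg b)"
      by (rule alin_filter[OF s, where P = "\<lambda>k. 1 \<le> deg a \<and> 1 \<le> deg b \<and> 1 \<le> k"])
        (use assms ab in \<open>auto simp: patril_def\<close>)
  qed
qed

text \<open>Cut the trilinear function off to three factors of positive degree and use
  coassociativity of the full coproduct: if all three factors are positive, so is the intermediate
  one, and the cut-offs on both sides match.\<close>

lemma red_coassoc:
  assumes "c \<in> coalg_arrs C" and "patril s G (src c) (tgt c) (deg c)"
  shows "red s (\<lambda>a b. red s (\<lambda>a' a''. G a' a'' b) a) c = red s (\<lambda>a b. red s (\<lambda>b' b''. G a b' b'') b) c"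
proof -
  have s: "module s" using assms by (simp add: patril_def)
  let ?G = "\<lambda>a b c. if 1 \<le> deg a \<and> 1 \<le> deg b \<and> 1 \<le> deg c then G a b c else 0"
  have z: "sw s (\<lambda>a b. 0) c = 0" for c by (simp add: sw_def split_def module.lext_fun_0[OF s])
  have "red s (\<lambda>a b. red s (\<lambda>a' a''. G a' a'' b) a) c = sw s (\<lambda>a b. sw s (\<lambda>a' a''. ?G a' a'' b) a) c"
    unfolding red_sw[OF s]
  proof (rule sw_cong[OF s assms(1)])
    fix a b assume "(a, b) \<in> splits c"
    then have a: "a \<in> coalg_arrs C" by (simp add: splits_def)
    show "(if 1 \<le> deg a \<and> 1 \<le> deg b then sw s (\<lambda>a' a''. if 1 \<le> deg a' \<and> 1 \<le> deg a'' then G a' a'' b else 0) a else 0)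
        = sw s (\<lambda>a' a''. ?G a' a'' b) a"
    proof (cases "1 \<le> deg a \<and> 1 \<le> deg b")
      case False
      have "sw s (\<lambda>a' a''. ?G a' a'' b) a = sw s (\<lambda>a' a''. 0) a"
        by (rule sw_cong[OF s a]) (use False in \<open>auto simp: splits_def\<close>)
      then show ?thesis using False z by auto
    qed (auto intro: sw_cong[OF s a])
  qed
  also have "\<dots> = sw s (\<lambda>a b. sw s (\<lambda>b' b''. ?G a b' b'') b) c"
    by (rule sw_coassoc[OF assms(1) atril_filter[OF assms(2)]])
  also have "\<dots> = red s (\<lambda>a b. red s (\<lambda>b' b''. G a b' b'') b) c"
    unfolding red_sw[OF s]
  proof (rule sw_cong[OF s assms(1)])
    fix a b assume "(a, b) \<in> splits c"
    then have b: "b \<in> coalg_arrs C" by (simp add: splits_def)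
    show "sw s (\<lambda>b' b''. ?G a b' b'') b
      = (if 1 \<le> deg a \<and> 1 \<le> deg b then sw s (\<lambda>b' b''. if 1 \<le> deg b' \<and> 1 \<le> deg b'' then G a b' b'' else 0) b else 0)"
    proof (cases "1 \<le> deg a \<and> 1 \<le> deg b")
      case False
      have "sw s (\<lambda>b' b''. ?G a b' b'') b = sw s (\<lambda>a' a''. 0) b"
        by (rule sw_cong[OF s b]) (use False in \<open>auto simp: splits_def\<close>)
      then show ?thesis using False z by auto
    qed (auto intro: sw_cong[OF s b])
  qed
  finally show ?thesis .
qed

text \<open>The bound is 2 rather than 1 because d of a factor must again have positive degree to
  survive in the reduced coproduct.\<close>

lemma red_coder:
  assumes "c \<in> coalg_arrs C" and "1 \<le> deg c" and "pabil s F (src c) (tgt c) (deg c - 1)"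
  shows "red s F (dC c) = red s (\<lambda>a b. (if 2 \<le> deg a then F (dC a) b else 0)
    + (if 2 \<le> deg b then s (ksign (deg a)) (F a (dC b)) else 0)) c"
proof -
  have s: "module s" using assms by (simp add: pabil_def)
  show ?thesis
    unfolding red_sw[OF s] sw_coder[OF assms(1,2) abil_filter[OF assms(3)]]
    by (rule sw_cong[OF s assms(1)]) (auto simp: module.scale_zero_right[OF s])
qed

end

section \<open>The cobar category\<close>

lemma ksign_add: "ksign (i + j) = ksign i * ksign j"
  and ksign_diff: "ksign (i - j) = ksign i * ksign j"
  and ksign_1 [simp]: "ksign 1 = -1"
  and ksign_0 [simp]: "ksign 0 = 1"
  and ksign_2 [simp]: "ksign 2 = 1"
  and ksign_square [simp]: "ksign i * ksign i = 1"
  and ksign_square_left [simp]: "ksign i * (ksign i * r) = r"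
  by (simp_all add: ksign_def)

lemma letters_deg_simps [simp]:
  "letters_deg [] = 0" "letters_deg (c # cs) = deg c - 1 + letters_deg cs"
  "letters_deg (cs @ ds) = letters_deg cs + letters_deg ds"
  by (simp_all add: letters_deg_def)

lemma chain_append: "chain x (as @ bs) z \<longleftrightarrow> (\<exists>y. chain x as y \<and> chain y bs z)"
  by (induction as arbitrary: x) auto

lemma cobar_comp_gen: "cobar_comp (gen (x, cs)) (gen (y, ds)) = gen (x, cs @ ds)"
  by (simp add: cobar_comp_def)

lemma cobar_comp_lin_left: "lin_on fscale V fscale (\<lambda>a. cobar_comp a b)"
  unfolding cobar_comp_def by (rule fs.lin_on_lext_arg)

lemma cobar_comp_lin_right: "lin_on fscale V fscale (\<lambda>b. cobar_comp a b)"
  unfolding cobar_comp_def split_def by (intro fs.lin_on_lext fs.lin_on_lext_arg)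

lemma cobar_comp_simps:
  "cobar_comp (a + a') b = cobar_comp a b + cobar_comp a' b"
  "cobar_comp a (b + b') = cobar_comp a b + cobar_comp a b'"
  "cobar_comp (fscale r a) b = fscale r (cobar_comp a b)"
  "cobar_comp a (fscale r b) = fscale r (cobar_comp a b)"
  "cobar_comp 0 b = 0" "cobar_comp a 0 = 0"
  using cobar_comp_lin_left[of UNIV b] cobar_comp_lin_right[of UNIV a]
    fs.lin_on_0[OF cobar_comp_lin_left[of UNIV b] module_fscale]
    fs.lin_on_0[OF cobar_comp_lin_right[of UNIV a] module_fscale]
  by (auto simp: lin_on_def)

lemma fun_lext_right:
  assumes "lin_on fscale UNIV fscale f"
  shows "f (fext h x) = fext (\<lambda>g. f (h g)) x"
  by (rule fs.lin_on_lext_word[OF assms module_fscale]) auto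

lemma cobar_comp_assoc: "cobar_comp (cobar_comp a b) c = cobar_comp a (cobar_comp b c)"
  unfolding cobar_comp_def by (simp add: fs.lext_lext split_def)

lemma cobar_comp_id_right: "cobar_comp a (gen (y, [])) = a"
  by (simp add: cobar_comp_def split_def lext_gen_id)

lemma cobar_comp_id_left:
  assumes "\<And>w. w \<in> Poly_Mapping.keys b \<Longrightarrow> fst w = x"
  shows "cobar_comp (gen (x, [])) b = b"
proof -
  have "cobar_comp (gen (x, [])) b = fext gen b"
    unfolding cobar_comp_def using assms by (auto simp: split_def intro!: fs.lext_cong)
  then show ?thesis by (simp add: lext_gen_id)
qed

lemma cobar_diff_lin: "lin_on fscale V fscale (cobar_diff C)"
  unfolding cobar_diff_def by (rule fs.lin_on_lext_arg)

context categorical_coalgebra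
begin

section \<open>Composable words and functions of words\<close>

definition wd :: "'c \<Rightarrow> ('c, 'c) arr list \<Rightarrow> 'c \<Rightarrow> bool" where
  "wd x cs y \<longleftrightarrow> (x, cs) \<in> cobar_words C x y"

lemma cobar_words_iff: "(z, cs) \<in> cobar_words C x y \<longleftrightarrow> z = x \<and> wd x cs y"
  by (auto simp: wd_def cobar_words_def)

lemma wd_Nil [simp]: "wd x [] y \<longleftrightarrow> x = y \<and> x \<in> points C"
  by (auto simp: wd_def cobar_words_def)

lemma wd_Cons [simp]: "wd x (c # cs) y \<longleftrightarrow> c \<in> coalg_arrs C \<and> 1 \<le> deg c \<and> src c = x \<and> wd (tgt c) cs y"
  using coalg_arrsD[of c] by (auto simp: wd_def cobar_words_def)

lemma wd_points: "wd x cs y \<Longrightarrow> x \<in> points C" "wd x cs y \<Longrightarrow> y \<in> points C"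
  by (auto simp: wd_def cobar_words_def)

lemma wd_append: "wd x (cs @ ds) z \<longleftrightarrow> (\<exists>y. wd x cs y \<and> wd y ds z)"
  by (induction cs arbitrary: x) (auto dest: wd_points)

lemma wd_unique: "wd x cs y \<Longrightarrow> wd x cs z \<Longrightarrow> y = z"
  by (induction cs arbitrary: x) auto

lemma cobar_hom_keysD:
  assumes "a \<in> cobar_hom C x y j" and "w \<in> Poly_Mapping.keys a"
  shows "fst w = x" "wd x (snd w) y" "letters_deg (snd w) = j"
  using fsums_keysD[OF assms[unfolded cobar_hom_def]] by (cases w; auto simp: cobar_words_iff)+

lemma gen_cobar_hom: "wd x cs y \<Longrightarrow> letters_deg cs = j \<Longrightarrow> gen (x, cs) \<in> cobar_hom C x y j"
  by (auto simp: cobar_hom_def cobar_words_iff)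

lemma subspace_cobar_hom: "fs.subspace (cobar_hom C x y j)"
  unfolding cobar_hom_def by (rule subspace_fsums)

lemmas cobar_hom_closed =
  fs.subspace_0[OF subspace_cobar_hom] fs.subspace_add[OF subspace_cobar_hom]
  fs.subspace_diff[OF subspace_cobar_hom] fs.subspace_neg[OF subspace_cobar_hom]
  fs.subspace_scale[OF subspace_cobar_hom]

lemma lext_cobar_hom:
  assumes "\<And>g. g \<in> Poly_Mapping.keys x \<Longrightarrow> f g \<in> cobar_hom C p q j"
  shows "fext f x \<in> cobar_hom C p q j"
  using assms unfolding cobar_hom_def by (rule fsums_lext)

lemma lext_word:
  assumes "module s" and "lin_on fscale (cobar_hom C x y j) s f" and "a \<in> cobar_hom C x y j"
  shows "f a = lext s (\<lambda>(z, cs). f (gen (x, cs))) a"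
proof -
  interpret s: module s by fact
  have "f a = f (fext gen a)" by (simp add: lext_gen_id)
  also have "\<dots> = lext s (\<lambda>w. f (gen w)) a"
    by (rule s.lin_on_lext_word[OF assms(2) module_fscale subspace_cobar_hom])
      (metis assms(3) cobar_hom_keysD gen_cobar_hom prod.collapse)
  also have "\<dots> = lext s (\<lambda>(z, cs). f (gen (x, cs))) a"
    by (rule s.lext_cong) (auto dest: cobar_hom_keysD[OF assms(3)])
  finally show ?thesis .
qed

lemma cobar_hom_eqI:
  assumes "module s" and "lin_on fscale (cobar_hom C x y j) s f" and "lin_on fscale (cobar_hom C x y j) s g"
    and "a \<in> cobar_hom C x y j"
    and "\<And>cs. wd x cs y \<Longrightarrow> letters_deg cs = j \<Longrightarrow> f (gen (x, cs)) = g (gen (x, cs))"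
  shows "f a = g a"
  unfolding lext_word[OF assms(1,2,4)] lext_word[OF assms(1,3,4)]
  by (rule module.lext_cong[OF assms(1)]) (auto dest: cobar_hom_keysD[OF assms(4)] intro!: assms(5))

lemma cobar_comp_hom:
  assumes "a \<in> cobar_hom C x y i" and "b \<in> cobar_hom C y z j"
  shows "cobar_comp a b \<in> cobar_hom C x z (i + j)"
  unfolding cobar_comp_def
proof (intro lext_cobar_hom, clarify, intro lext_cobar_hom, clarify)
  fix p cs q ds assume "(p, cs) \<in> Poly_Mapping.keys a" "(q, ds) \<in> Poly_Mapping.keys b"
  from cobar_hom_keysD[OF assms(1) this(1)] cobar_hom_keysD[OF assms(2) this(2)]
  show "gen (p, cs @ ds) \<in> cobar_hom C x z (i + j)"
    by (auto intro!: gen_cobar_hom simp: wd_append)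
qed

lemma cobar_comp_id_left_hom: "a \<in> cobar_hom C x y j \<Longrightarrow> cobar_comp (gen (x, [])) a = a"
  by (rule cobar_comp_id_left) (rule cobar_hom_keysD)

text \<open>The source recorded in a word is dropped: inside one morphism space it is constant, and
  only the letters vary.\<close>

definition wx :: "('k \<Rightarrow> 'q::ab_group_add \<Rightarrow> 'q) \<Rightarrow> (('c, 'c) arr list \<Rightarrow> 'q) \<Rightarrow> ('k, 'c) cobar \<Rightarrow> 'q" where
  "wx s \<phi> a = lext s (\<lambda>(x, cs). \<phi> cs) a"

lemma wx_lin: "module s \<Longrightarrow> lin_on fscale V s (wx s \<phi>)"
  unfolding wx_def by (rule module.lin_on_lext_arg)

lemma wx_gen [simp]: "module s \<Longrightarrow> wx s \<phi> (gen (x, cs)) = \<phi> cs"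
  by (simp add: wx_def module.lext_gen)

lemma wx_simps:
  assumes "module s"
  shows "wx s \<phi> (a + b) = wx s \<phi> a + wx s \<phi> b" "wx s \<phi> (a - b) = wx s \<phi> a - wx s \<phi> b"
    "wx s \<phi> (- a) = - wx s \<phi> a" "wx s \<phi> (fscale r a) = s r (wx s \<phi> a)" "wx s \<phi> 0 = 0"
  unfolding wx_def by (simp_all add: module.lext_simps[OF assms] module.lext_0[OF assms])

lemma wx_cong:
  assumes "module s" and "a \<in> cobar_hom C x y j"
    and "\<And>cs. wd x cs y \<Longrightarrow> letters_deg cs = j \<Longrightarrow> \<phi> cs = \<psi> cs"
  shows "wx s \<phi> a = wx s \<psi> a"
  unfolding wx_def
  by (rule module.lext_cong[OF assms(1)]) (auto dest: cobar_hom_keysD[OF assms(2)] intro!: assms(3))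

lemma wx_comp_left: "module s \<Longrightarrow> wx s \<phi> (cobar_comp (gen (x, cs)) b) = wx s (\<lambda>ds. \<phi> (cs @ ds)) b"
  by (simp add: wx_def cobar_comp_def module.lext_lext module.lext_gen split_def)

lemma wx_comp_right: "module s \<Longrightarrow> wx s \<phi> (cobar_comp a (gen (y, ds))) = wx s (\<lambda>cs. \<phi> (cs @ ds)) a"
  by (simp add: wx_def cobar_comp_def module.lext_lext module.lext_gen split_def)

lemma wx_hom:
  assumes "module s" and "lin_on fscale (cobar_hom C x y j) s f" and "a \<in> cobar_hom C x y j"
  shows "f a = wx s (\<lambda>cs. f (gen (x, cs))) a"
  unfolding wx_def by (rule lext_word[OF assms])

text \<open>The bound 2 \<le> \<open>deg c\<close> reflects the convention that a bracket of a
  degree 0 element is zero.\<close>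

lemma wx_cobar_diff_letter:
  assumes "module s" and "1 \<le> deg c"
  shows "wx s \<psi> (cobar_diff_letter C c) = - s (curv C (elt c)) (\<psi> [])
    - (if 2 \<le> deg c then \<psi> [dC c] else 0) + red s (\<lambda>a b. s (ksign (deg a)) (\<psi> [a, b])) c"
proof -
  interpret s: module s by fact
  have "wx s \<psi> (brace (dC c)) = (if 2 \<le> deg c then \<psi> [dC c] else 0)"
    using assms by (auto simp: brace_def wx_simps)
  then show ?thesis
    unfolding cobar_diff_letter_def
    by (simp add: wx_simps assms(1))
      (simp add: wx_def red_def s.lext_lext s.lext_fscale split_def)
qed

text \<open>The delicate term is the multiple of an identity. It can be nonzero only for degree 2
  and, by \<open>curv_off_diagonal\<close>, only for equal source and target, which is when an
  identity is a morphism of the required degree.\<close>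

lemma cobar_diff_letter_hom:
  assumes "c \<in> coalg_arrs C" and "1 \<le> deg c"
  shows "cobar_diff_letter C c \<in> cobar_hom C (src c) (tgt c) (deg c - 2)"
proof -
  have 1: "fscale (curv C (elt c)) (gen (src c, [])) \<in> cobar_hom C (src c) (tgt c) (deg c - 2)"
  proof (cases "curv C (elt c) = 0")
    case False
    have "nat (deg c) = 2"
      using False coalg_arrsD[OF assms(1)] curv_degree[of "elt c" "nat (deg c)"]
      by (auto simp: coalg_piece_def)
    moreover have "src c = tgt c"
      using False curv_off_diagonal[of "src c" "tgt c"] coalg_arrsD[OF assms(1)] by blast
    ultimately show ?thesis
      using coalg_arrsD[OF assms(1)] by (intro cobar_hom_closed gen_cobar_hom) auto
  qed (simp add: cobar_hom_closed)
  have 2: "brace (dC c) \<in> cobar_hom C (src c) (tgt c) (deg c - 2)"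
  proof (cases "deg c = 1")
    case False
    then show ?thesis
      using assms dC_coalg_arrs[OF assms] coalg_arrsD[OF assms(1)]
      by (auto simp: brace_def intro!: gen_cobar_hom)
  qed (simp add: brace_def cobar_hom_closed)
  have 3: "fext (\<lambda>(a, b). fscale (ksign (deg a)) (gen (src a, [a, b]))) (red_cop C c)
      \<in> cobar_hom C (src c) (tgt c) (deg c - 2)"
  proof (rule lext_cobar_hom, clarify)
    fix a b assume "(a, b) \<in> Poly_Mapping.keys (red_cop C c)"
    from fsums_keysD[OF red_cop_in[OF assms(1)] this]
    have ab: "a \<in> coalg_arrs C" "b \<in> coalg_arrs C" "src a = src c" "tgt a = src b" "tgt b = tgt c"
      "deg a + deg b = deg c" "1 \<le> deg a" "1 \<le> deg b"
      by (auto simp: psplits_def splits_def)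
    then show "fscale (ksign (deg a)) (gen (src a, [a, b])) \<in> cobar_hom C (src c) (tgt c) (deg c - 2)"
      using coalg_arrsD[OF ab(2)] by (auto intro!: cobar_hom_closed gen_cobar_hom)
  qed
  show ?thesis unfolding cobar_diff_letter_def by (intro cobar_hom_closed 1 2 3)
qed

lemma cobar_diff_Nil: "cobar_diff C (gen (x, [])) = 0"
  by (simp add: cobar_diff_def)

lemma cobar_diff_Cons:
  assumes "c \<in> coalg_arrs C" and "1 \<le> deg c" and "src c = x"
  shows "cobar_diff C (gen (x, c # cs)) = cobar_comp (cobar_diff_letter C c) (gen (tgt c, cs))
    + fscale (ksign (deg c - 1)) (cobar_comp (gen (x, [c])) (cobar_diff C (gen (tgt c, cs))))"
proof -
  let ?t = "\<lambda>x cs i. cobar_comp (gen (x, take i cs))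
       (cobar_comp (cobar_diff_letter C (cs ! i)) (gen (tgt (cs ! i), drop (Suc i) cs)))"
  have "cobar_comp (gen (x, [])) (cobar_diff_letter C c) = cobar_diff_letter C c"
    using cobar_comp_id_left_hom[OF cobar_diff_letter_hom[OF assms(1,2)]] assms(3) by simp
  then have 0: "?t x (c # cs) 0 = cobar_comp (cobar_diff_letter C c) (gen (tgt c, cs))"
    by (simp add: cobar_comp_assoc[symmetric])
  have S: "?t x (c # cs) (Suc i) = cobar_comp (gen (x, [c])) (?t (tgt c) cs i)" for i
    by (simp add: cobar_comp_assoc[symmetric] cobar_comp_gen)
  have lin: "cobar_comp a (\<Sum>i\<in>I. f i) = (\<Sum>i\<in>I. cobar_comp a (f i))" for a f and I :: "nat set"
    by (rule fs.lin_on_sumD[OF cobar_comp_lin_right[of UNIV] module_fscale]) auto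
  have "cobar_diff C (gen (x, c # cs))
      = (\<Sum>i<Suc (length cs). fscale (ksign (letters_deg (take i (c # cs)))) (?t x (c # cs) i))"
    by (simp add: cobar_diff_def)
  also have "\<dots> = ?t x (c # cs) 0
      + (\<Sum>i<length cs. fscale (ksign (deg c - 1 + letters_deg (take i cs))) (?t x (c # cs) (Suc i)))"
    by (subst sum.lessThan_Suc_shift) simp
  also have "\<dots> = ?t x (c # cs) 0 + fscale (ksign (deg c - 1)) (cobar_comp (gen (x, [c]))
      (\<Sum>i<length cs. fscale (ksign (letters_deg (take i cs))) (?t (tgt c) cs i)))"
    unfolding S by (simp add: lin cobar_comp_simps fs.scale_sum_right ksign_add)
  finally show ?thesis unfolding 0 by (simp add: cobar_diff_def)
qed

lemma cobar_diff_single: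
  assumes "c \<in> coalg_arrs C" and "1 \<le> deg c"
  shows "cobar_diff C (gen (src c, [c])) = cobar_diff_letter C c"
  by (simp add: cobar_diff_Cons[OF assms refl] cobar_diff_Nil cobar_comp_simps cobar_comp_id_right)

lemma cobar_diff_word_hom:
  "wd x cs y \<Longrightarrow> cobar_diff C (gen (x, cs)) \<in> cobar_hom C x y (letters_deg cs - 1)"
proof (induction cs arbitrary: x)
  case (Cons c cs)
  then have c: "c \<in> coalg_arrs C" "1 \<le> deg c" "src c = x" "wd (tgt c) cs y" by auto
  have "cobar_comp (cobar_diff_letter C c) (gen (tgt c, cs)) \<in> cobar_hom C x y ((deg c - 2) + letters_deg cs)"
    using c cobar_diff_letter_hom[OF c(1,2)] by (intro cobar_comp_hom[of _ x "tgt c"] gen_cobar_hom) auto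
  moreover have "gen (x, [c]) \<in> cobar_hom C x (tgt c) (deg c - 1)"
    using c coalg_arrsD[OF c(1)] by (intro gen_cobar_hom) auto
  then have "cobar_comp (gen (x, [c])) (cobar_diff C (gen (tgt c, cs)))
      \<in> cobar_hom C x y ((deg c - 1) + (letters_deg cs - 1))"
    by (rule cobar_comp_hom[OF _ Cons.IH[OF c(4)]])
  ultimately show ?case
    unfolding cobar_diff_Cons[OF c(1-3)] by (intro cobar_hom_closed) (simp_all add: algebra_simps)
qed (simp add: cobar_diff_Nil cobar_hom_closed)

lemma cobar_diff_hom:
  assumes "a \<in> cobar_hom C x y j"
  shows "cobar_diff C a \<in> cobar_hom C x y (j - 1)"
proof -
  have "cobar_diff C (fext gen a) = fext (\<lambda>w. cobar_diff C (gen w)) a"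
    by (rule fun_lext_right[OF cobar_diff_lin])
  moreover have "\<dots> \<in> cobar_hom C x y (j - 1)"
  proof (rule lext_cobar_hom)
    fix w assume "w \<in> Poly_Mapping.keys a"
    from cobar_hom_keysD[OF assms this] cobar_diff_word_hom[of x "snd w" y]
    show "cobar_diff C (gen w) \<in> cobar_hom C x y (j - 1)" by (cases w) auto
  qed
  ultimately show ?thesis by (simp add: lext_gen_id)
qed

text \<open>On words this is the derivation formula split at the point of concatenation, by
  induction along \<open>cobar_diff_Cons\<close>; bilinearity of composition does the rest. It is an
  equation of formal sums, before any relation is imposed.\<close>

lemma cobar_diff_comp:
  assumes "a \<in> cobar_hom C x y i" and "b \<in> cobar_hom C y z j"
  shows "cobar_diff C (cobar_comp a b)
    = cobar_comp (cobar_diff C a) b + fscale (ksign i) (cobar_comp a (cobar_diff C b))"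
proof -
  note L = cobar_comp_lin_left cobar_comp_lin_right cobar_diff_lin
  note C1 = lin_on_comp[where W = UNIV]
  have word: "cobar_diff C (gen (x, cs @ ds)) = cobar_comp (cobar_diff C (gen (x, cs))) (gen (y, ds))
      + fscale (ksign (letters_deg cs)) (cobar_comp (gen (x, cs)) (cobar_diff C (gen (y, ds))))"
    if "wd x cs y" "wd y ds z" for x cs ds
    using that(1)
  proof (induction cs arbitrary: x)
    case Nil
    then show ?case
      using cobar_comp_id_left_hom[OF cobar_diff_word_hom[OF that(2)]]
      by (simp add: cobar_diff_Nil cobar_comp_simps)
  next
    case (Cons c cs)
    then have c: "c \<in> coalg_arrs C" "1 \<le> deg c" "src c = x" "wd (tgt c) cs y" by auto
    have g: "cobar_comp (gen (x, [c])) (cobar_comp (gen (tgt c, cs)) d) = cobar_comp (gen (x, c # cs)) d" for d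
      by (simp add: cobar_comp_assoc[symmetric] cobar_comp_gen)
    show ?case
      by (simp add: cobar_diff_Cons[OF c(1-3)] Cons.IH[OF c(4)] cobar_comp_simps cobar_comp_assoc cobar_comp_gen
          fs.scale_right_distrib ksign_add add.assoc g)
  qed
  show ?thesis
  proof (rule cobar_hom_eqI[OF module_fscale _ _ assms(1)])
    show "lin_on fscale (cobar_hom C x y i) fscale (\<lambda>a. cobar_diff C (cobar_comp a b))"
      by (rule C1[OF L(3) L(1)]) simp
    show "lin_on fscale (cobar_hom C x y i) fscale
        (\<lambda>a. cobar_comp (cobar_diff C a) b + fscale (ksign i) (cobar_comp a (cobar_diff C b)))"
      by (intro fs.lin_on_add fs.lin_on_scale C1[OF L(1) L(3)] L(1)) simp
    fix cs assume cs: "wd x cs y" "letters_deg cs = i"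
    show "cobar_diff C (cobar_comp (gen (x, cs)) b) = cobar_comp (cobar_diff C (gen (x, cs))) b
        + fscale (ksign i) (cobar_comp (gen (x, cs)) (cobar_diff C b))"
    proof (rule cobar_hom_eqI[OF module_fscale _ _ assms(2)])
      show "lin_on fscale (cobar_hom C y z j) fscale (\<lambda>b. cobar_diff C (cobar_comp (gen (x, cs)) b))"
        by (rule C1[OF L(3) L(2)]) simp
      show "lin_on fscale (cobar_hom C y z j) fscale
          (\<lambda>b. cobar_comp (cobar_diff C (gen (x, cs))) b + fscale (ksign i) (cobar_comp (gen (x, cs)) (cobar_diff C b)))"
        by (intro fs.lin_on_add fs.lin_on_scale C1[OF L(2) L(3)] L(2)) simp
      show "cobar_diff C (cobar_comp (gen (x, cs)) (gen (y, ds)))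
          = cobar_comp (cobar_diff C (gen (x, cs))) (gen (y, ds))
            + fscale (ksign i) (cobar_comp (gen (x, cs)) (cobar_diff C (gen (y, ds))))"
        if "wd y ds z" for ds
        using word[OF cs(1) that] cs(2) by (simp add: cobar_comp_gen)
    qed
  qed
qed

subsection \<open>Multilinear functions of words\<close>

definition wml :: "('k \<Rightarrow> 'q::ab_group_add \<Rightarrow> 'q) \<Rightarrow> (('c, 'c) arr list \<Rightarrow> 'q) \<Rightarrow> 'c \<Rightarrow> 'c \<Rightarrow> bool" where
  "wml s \<phi> x y \<longleftrightarrow> module s \<and> (\<forall>cs c ds. wd x (cs @ c # ds) y \<longrightarrow>
     alin s (\<lambda>c. \<phi> (cs @ c # ds)) (src c) (tgt c) (deg c))"

lemma wmlI:
  "module s \<Longrightarrow> (\<And>cs c ds. wd x (cs @ c # ds) y \<Longrightarrow> alin s (\<lambda>c. \<phi> (cs @ c # ds)) (src c) (tgt c) (deg c)) \<Longrightarrow>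
    wml s \<phi> x y"
  by (simp add: wml_def)

lemma wmlD: "wml s \<phi> x y \<Longrightarrow> wd x (cs @ c # ds) y \<Longrightarrow> alin s (\<lambda>c. \<phi> (cs @ c # ds)) (src c) (tgt c) (deg c)"
  by (simp add: wml_def)

definition cobar_gens :: "('k, 'c) cobar set" where
  "cobar_gens = \<Union>{lin_rels (smul C) (coalg_piece C s t (nat n)) (\<lambda>u. (x, cs @ [Arr s n u t] @ ds))
        | x y cs s n t ds. (x, cs @ [Arr s n 0 t] @ ds) \<in> cobar_words C x y}"

lemma cobar_rel_span: "cobar_rel C = fs.span cobar_gens"
  by (simp add: cobar_rel_def cobar_gens_def)

lemma wd_letter:
  assumes "wd x (cs @ Arr p n u q # ds) y"
  shows "p \<in> points C" "q \<in> points C" "1 \<le> n"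
    and "v \<in> coalg_piece C p q (nat n) \<Longrightarrow> wd x (cs @ Arr p n v q # ds) y"
proof -
  have c: "Arr p n u q \<in> coalg_arrs C" "1 \<le> n" using assms by (auto simp: wd_append)
  show "p \<in> points C" "q \<in> points C" "1 \<le> n" using c coalg_arrsD[OF c(1)] by auto
  then show "v \<in> coalg_piece C p q (nat n) \<Longrightarrow> wd x (cs @ Arr p n v q # ds) y"
    using assms by (auto simp: wd_append Arr_coalg_arrs)
qed

text \<open>The generators of the relations range over words with arbitrary endpoints, so \<phi> is
  extended by zero outside the words from x to y. All words in one relation share their endpoints,
  hence a relation is met entirely or not at all.\<close>

lemma wml_kills:
  assumes "wml s \<phi> x y"
  shows "kills s cobar_gens (\<lambda>w. if w \<in> cobar_words C x y then \<phi> (snd w) else 0)"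
proof -
  interpret s: module s using assms by (simp add: wml_def)
  let ?\<phi> = "\<lambda>w. if w \<in> cobar_words C x y then \<phi> (snd w) else 0"
  have "lin_on (smul C) (coalg_piece C p q (nat n)) s (\<lambda>u. ?\<phi> (x', cs @ [Arr p n u q] @ ds))"
    if "wd x' (cs @ [Arr p n 0 q] @ ds) y'" for x' y' cs p n q ds
  proof -
    have w: "wd x' (cs @ [Arr p n u q] @ ds) y'" if u: "u \<in> coalg_piece C p q (nat n)" for u
      using wd_letter(4)[OF _ u] \<open>wd x' (cs @ [Arr p n 0 q] @ ds) y'\<close> by simp
    have pq: "p \<in> points C" "q \<in> points C" using wd_letter that by auto
    show ?thesis
    proof (cases "x' = x \<and> y' = y")
      case True
      have "lin_on (smul C) (coalg_piece C p q (nat n)) s (\<lambda>u. \<phi> (cs @ [Arr p n u q] @ ds))"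
        using wmlD[OF assms, of cs "Arr p n 0 q" ds] that True by (simp add: alin_def)
      then show ?thesis
        by (subst lin_on_cong[OF _ module_C subspace_piece[OF pq]]) (use w True in \<open>auto simp: cobar_words_iff\<close>)
    next
      case False
      have "?\<phi> (x', cs @ [Arr p n u q] @ ds) = 0" if "u \<in> coalg_piece C p q (nat n)" for u
        using w[OF that] False wd_unique by (auto simp: cobar_words_iff)
      then show ?thesis
        by (subst lin_on_cong[OF _ module_C subspace_piece[OF pq]]) (auto simp: s.lin_on_zero)
    qed
  qed
  then show ?thesis
    unfolding cobar_gens_def by (auto simp: s.kills_Union s.kills_lin_rels cobar_words_iff cong: if_cong)
qed

lemma wx_words:
  assumes "module s" and "a \<in> cobar_hom C x y j"
  shows "wx s \<phi> a = lext s (\<lambda>w. if w \<in> cobar_words C x y then \<phi> (snd w) else 0) a"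
  unfolding wx_def
  by (rule module.lext_cong[OF assms(1)]) (use cobar_hom_keysD[OF assms(2)] in \<open>fastforce simp: cobar_words_iff\<close>)

lemma wml_rel:
  assumes "wml s \<phi> x y" and "a \<in> cobar_hom C x y j" and "a \<in> cobar_rel C"
  shows "wx s \<phi> a = 0"
proof -
  interpret s: module s using assms by (simp add: wml_def)
  have "kills s (cobar_rel C) (\<lambda>w. if w \<in> cobar_words C x y then \<phi> (snd w) else 0)"
    unfolding cobar_rel_span s.kills_span by (rule wml_kills[OF assms(1)])
  then show ?thesis
    using assms(3) unfolding wx_words[OF s.module_axioms assms(2)] kills_def by blast
qed

text \<open>The normalized relations add only the empty words, and these are killed by the
  assumption on \<phi>.\<close>

lemma wml_normal_rel:
  assumes "wml s \<phi> x y" and "\<phi> [] = 0" and "a \<in> cobar_hom C x y j" and "a \<in> normal_rel C"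
  shows "wx s \<phi> a = 0"
proof -
  interpret s: module s using assms by (simp add: wml_def)
  have "kills s (cobar_rel C \<union> {gen (x, []) |x. x \<in> points C})
      (\<lambda>w. if w \<in> cobar_words C x y then \<phi> (snd w) else 0)"
    unfolding s.kills_Un cobar_rel_span s.kills_span
    using wml_kills[OF assms(1)] assms(2) by (auto simp: kills_def)
  then have "kills s (normal_rel C) (\<lambda>w. if w \<in> cobar_words C x y then \<phi> (snd w) else 0)"
    unfolding normal_rel_def s.kills_span .
  then show ?thesis
    using assms(4) unfolding wx_words[OF s.module_axioms assms(3)] kills_def by blast
qed

lemma rel_lettersI:
  assumes "wd x (cs @ c # ds) y" and "u \<in> coalg_piece C (src c) (tgt c) (nat (deg c))"
    and "v \<in> coalg_piece C (src c) (tgt c) (nat (deg c))"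
  shows "gen (x, cs @ Arr (src c) (deg c) (u + v) (tgt c) # ds)
      - gen (x, cs @ Arr (src c) (deg c) u (tgt c) # ds)
      - gen (x, cs @ Arr (src c) (deg c) v (tgt c) # ds) \<in> cobar_rel C" (is ?add)
    and "gen (x, cs @ Arr (src c) (deg c) (smul C r u) (tgt c) # ds)
      - fscale r (gen (x, cs @ Arr (src c) (deg c) u (tgt c) # ds)) \<in> cobar_rel C" (is ?scale)
proof -
  have "c = Arr (src c) (deg c) (elt c) (tgt c)" by simp
  then have "wd x (cs @ Arr (src c) (deg c) (elt c) (tgt c) # ds) y" using assms(1) by metis
  from wd_letter[OF this] cm.subspace_0[OF subspace_piece]
  have "(x, cs @ [Arr (src c) (deg c) 0 (tgt c)] @ ds) \<in> cobar_words C x y"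
    by (simp add: cobar_words_iff)
  then have "lin_rels (smul C) (coalg_piece C (src c) (tgt c) (nat (deg c)))
      (\<lambda>u. (x, cs @ [Arr (src c) (deg c) u (tgt c)] @ ds)) \<subseteq> cobar_gens"
    unfolding cobar_gens_def by blast
  then have sub: "lin_rels (smul C) (coalg_piece C (src c) (tgt c) (nat (deg c)))
      (\<lambda>u. (x, cs @ [Arr (src c) (deg c) u (tgt c)] @ ds)) \<subseteq> cobar_rel C"
    unfolding cobar_rel_span using fs.span_superset by blast
  show ?add
    by (rule subsetD[OF sub]) (use assms(2,3) in \<open>auto simp: lin_rels_def\<close>)
  show ?scale
    by (rule subsetD[OF sub]) (use assms(2,3) in \<open>auto simp: lin_rels_def\<close>)
qed

text \<open>The converse of \<open>wml_rel\<close>: differences such as \<dots>(u + v)\<dots> -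
  \<dots>u\<dots> - \<dots>v\<dots> are themselves elements of \<open>cobar_rel\<close>. The family
  \<open>f j\<close> is indexed by degree because a function of labelled arrows may depend on the
  label.\<close>

lemma wml_of_linear:
  assumes "module s" and "\<And>j. lin_on fscale (cobar_hom C x y j) s (f j)"
    and "\<And>j a. a \<in> cobar_hom C x y j \<Longrightarrow> a \<in> cobar_rel C \<Longrightarrow> f j a = 0"
  shows "wml s (\<lambda>cs. f (letters_deg cs) (gen (x, cs))) x y"
proof (rule wmlI[OF assms(1)])
  interpret s: module s by fact
  fix cs c ds assume wd: "wd x (cs @ c # ds) y"
  let ?w = "\<lambda>u. gen (x, cs @ Arr (src c) (deg c) u (tgt c) # ds)"
  have "c = Arr (src c) (deg c) (elt c) (tgt c)" by simp
  then have wd': "wd x (cs @ Arr (src c) (deg c) (elt c) (tgt c) # ds) y" using wd by metis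
  let ?j = "letters_deg (cs @ c # ds)"
  have hom: "?w u \<in> cobar_hom C x y ?j" if "u \<in> coalg_piece C (src c) (tgt c) (nat (deg c))" for u
    using wd_letter(4)[OF wd' that] by (intro gen_cobar_hom) auto
  note sub = subspace_piece[OF wd_letter(1,2)[OF wd']]
  have f: "f ?j (a - b) = f ?j a - f ?j b" if "a \<in> cobar_hom C x y ?j" "b \<in> cobar_hom C x y ?j" for a b
    using lin_on_addD[OF assms(2) that(1) cobar_hom_closed(4)[OF that(2)]]
      s.lin_on_neg[OF assms(2) module_fscale that(2)] by simp
  have "lin_on (smul C) (coalg_piece C (src c) (tgt c) (nat (deg c))) s (\<lambda>u. f ?j (?w u))"
  proof (rule lin_onI)
    fix u v r assume u: "u \<in> coalg_piece C (src c) (tgt c) (nat (deg c))"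
    have ru: "smul C r u \<in> coalg_piece C (src c) (tgt c) (nat (deg c))"
      using u by (rule cm.subspace_scale[OF sub])
    have "f ?j (?w (smul C r u) - fscale r (?w u)) = 0"
      by (rule assms(3)) (use rel_lettersI(2)[OF wd u u] hom[OF u] hom[OF ru] cobar_hom_closed in auto)
    then show "f ?j (?w (smul C r u)) = s r (f ?j (?w u))"
      using f[OF hom[OF ru] cobar_hom_closed(5)[OF hom[OF u]]] lin_on_scaleD[OF assms(2) hom[OF u]] by simp
    assume v: "v \<in> coalg_piece C (src c) (tgt c) (nat (deg c))"
    have uv: "u + v \<in> coalg_piece C (src c) (tgt c) (nat (deg c))"
      using u v by (rule cm.subspace_add[OF sub])
    have "f ?j (?w (u + v) - ?w u - ?w v) = 0"
      by (rule assms(3)) (use rel_lettersI(1)[OF wd u v] hom[OF u] hom[OF v] hom[OF uv] cobar_hom_closed in auto)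
    then show "f ?j (?w (u + v)) = f ?j (?w u) + f ?j (?w v)"
      using f[OF cobar_hom_closed(3)[OF hom[OF uv] hom[OF u]] hom[OF v]] f[OF hom[OF uv] hom[OF u]]
      by (simp add: algebra_simps)
  qed
  then show "alin s (\<lambda>c. f (letters_deg (cs @ c # ds)) (gen (x, cs @ c # ds))) (src c) (tgt c) (deg c)"
    by (simp add: alin_def)
qed

lemma wml_append_right:
  assumes "wml s \<phi> x z" and "wd y ds z"
  shows "wml s (\<lambda>cs. \<phi> (cs @ ds)) x y"
proof (rule wmlI)
  show "module s" using assms(1) by (simp add: wml_def)
  fix cs c es assume "wd x (cs @ c # es) y"
  then have "wd x (cs @ c # (es @ ds)) z" using assms(2) by (force simp: wd_append)
  from wmlD[OF assms(1) this] show "alin s (\<lambda>c. \<phi> ((cs @ c # es) @ ds)) (src c) (tgt c) (deg c)" by simp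
qed

lemma wml_append_left:
  assumes "wml s \<phi> x z" and "wd x ds y"
  shows "wml s (\<lambda>cs. \<phi> (ds @ cs)) y z"
proof (rule wmlI)
  show "module s" using assms(1) by (simp add: wml_def)
  fix cs c es assume "wd y (cs @ c # es) z"
  then have "wd x ((ds @ cs) @ c # es) z" using assms(2) by (force simp: wd_append)
  from wmlD[OF assms(1) this] show "alin s (\<lambda>c. \<phi> (ds @ cs @ c # es)) (src c) (tgt c) (deg c)" by simp
qed

lemma rel_cls_iff: "a \<in> cobar_rel C \<longleftrightarrow> cls cobar_gens a = 0"
  using cls_eq_iff[of cobar_gens a 0]
  by (simp add: cobar_rel_span eqmod_def module_hom.zero[OF cls_hom])

lemma wml_cls: "wml qscale (\<lambda>cs. cls cobar_gens (gen (x, cs))) x y"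
  using wml_of_linear[OF qs.module_axioms, where f = "\<lambda>j. cls cobar_gens"]
  by (simp add: lin_on_hom[OF cls_hom] rel_cls_iff)

lemma cls_wx:
  assumes "a \<in> cobar_hom C x y j"
  shows "cls cobar_gens a = wx qscale (\<lambda>cs. cls cobar_gens (gen (x, cs))) a"
  by (rule wx_hom[OF qs.module_axioms lin_on_hom[OF cls_hom] assms])

text \<open>With \<open>comp_rel_right\<close>, this says that \<open>cobar_rel\<close> is an ideal.
  Fixing the second word, the class of the product is a multilinear function of the first word, so
  it vanishes on relations.\<close>

lemma comp_rel_left:
  assumes "a \<in> cobar_hom C x y i" "a \<in> cobar_rel C" "b \<in> cobar_hom C y z j"
  shows "cobar_comp a b \<in> cobar_rel C"
proof -
  have "cls cobar_gens (cobar_comp a b) = (0 :: (_, 'k) quot)"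
  proof (rule cobar_hom_eqI[OF qs.module_axioms _ qs.lin_on_zero assms(3)])
    show "lin_on fscale (cobar_hom C y z j) qscale (\<lambda>b. cls cobar_gens (cobar_comp a b))"
      by (rule lin_on_comp[OF lin_on_hom[OF cls_hom, of UNIV] cobar_comp_lin_right]) simp
    fix ds assume ds: "wd y ds z" "letters_deg ds = j"
    have "cls cobar_gens (cobar_comp a (gen (y, ds)))
        = wx qscale (\<lambda>cs. cls cobar_gens (gen (x, cs))) (cobar_comp a (gen (y, ds)))"
      by (rule cls_wx[OF cobar_comp_hom[OF assms(1) gen_cobar_hom[OF ds]]])
    also have "\<dots> = wx qscale (\<lambda>cs. cls cobar_gens (gen (x, cs @ ds))) a"
      by (rule wx_comp_right[OF qs.module_axioms])
    also have "\<dots> = 0"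
      by (rule wml_rel[OF wml_append_right[OF wml_cls ds(1)] assms(1,2)])
    finally show "cls cobar_gens (cobar_comp a (gen (y, ds))) = 0" .
  qed
  then show ?thesis by (simp add: rel_cls_iff)
qed

lemma comp_rel_right:
  assumes "a \<in> cobar_hom C x y i" "b \<in> cobar_hom C y z j" "b \<in> cobar_rel C"
  shows "cobar_comp a b \<in> cobar_rel C"
proof -
  have "cls cobar_gens (cobar_comp a b) = (0 :: (_, 'k) quot)"
  proof (rule cobar_hom_eqI[OF qs.module_axioms _ qs.lin_on_zero assms(1)])
    show "lin_on fscale (cobar_hom C x y i) qscale (\<lambda>a. cls cobar_gens (cobar_comp a b))"
      by (rule lin_on_comp[OF lin_on_hom[OF cls_hom, of UNIV] cobar_comp_lin_left]) simp
    fix cs assume cs: "wd x cs y" "letters_deg cs = i"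
    have "cls cobar_gens (cobar_comp (gen (x, cs)) b)
        = wx qscale (\<lambda>cs. cls cobar_gens (gen (x, cs))) (cobar_comp (gen (x, cs)) b)"
      by (rule cls_wx[OF cobar_comp_hom[OF gen_cobar_hom[OF cs] assms(2)]])
    also have "\<dots> = wx qscale (\<lambda>ds. cls cobar_gens (gen (x, cs @ ds))) b"
      by (rule wx_comp_left[OF qs.module_axioms])
    also have "\<dots> = 0"
      by (rule wml_rel[OF wml_append_left[OF wml_cls cs(1)] assms(2,3)])
    finally show "cls cobar_gens (cobar_comp (gen (x, cs)) b) = 0" .
  qed
  then show ?thesis by (simp add: rel_cls_iff)
qed

lemma alin_add: "module s \<Longrightarrow> alin s f x y n \<Longrightarrow> alin s g x y n \<Longrightarrow> alin s (\<lambda>c. f c + g c) x y n"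
  and alin_diff: "module s \<Longrightarrow> alin s f x y n \<Longrightarrow> alin s g x y n \<Longrightarrow> alin s (\<lambda>c. f c - g c) x y n"
  and alin_uminus: "module s \<Longrightarrow> alin s f x y n \<Longrightarrow> alin s (\<lambda>c. - f c) x y n"
  by (simp_all add: alin_def module.lin_on_add module.lin_on_diff module.lin_on_uminus)

lemma alin_scale: "module s \<Longrightarrow> alin s f x y n \<Longrightarrow> alin s (\<lambda>c. s r (f c)) x y n"
  unfolding alin_def by (rule module.lin_on_scale)

lemma alin_ksign:
  assumes "module s" and "alin s f x y n"
  shows "alin s (\<lambda>c. s (ksign (deg c)) (f c)) x y n" "alin s (\<lambda>c. s (ksign (e + deg c)) (f c)) x y n"
    "alin s (\<lambda>c. s (ksign (deg c - 1)) (f c)) x y n"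
  using assms by (auto simp: alin_def intro!: module.lin_on_scale)

lemma alin_dC:
  assumes "alin s f x y (n - 1)" and "x \<in> points C" "y \<in> points C" and "1 \<le> n"
  shows "alin s (\<lambda>c. f (dC c)) x y n"
proof -
  have "nat n = Suc (nat (n - 1))" using assms(4) by simp
  then have "lin_on (smul C) (coalg_piece C x y (nat n)) s (\<lambda>u. f (Arr x (n - 1) (codiff C u) y))"
    using codiff_piece[OF assms(2,3)]
    by (intro lin_on_comp[OF assms(1)[unfolded alin_def] lin_on_subset[OF codiff_lin]]) auto
  then show ?thesis by (simp add: alin_def arr_map_def)
qed

text \<open>Differentiating a word keeps multilinearity because the curvature, d and, by
  \<open>red_alin\<close>, the reduced coproduct under bilinear functions are linear in the letter.
  The choice inside \<open>red_cop\<close> makes the last point the only subtle one.\<close>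

lemma wml_diff:
  assumes "wml s \<phi> x y"
  shows "wml s (\<lambda>cs. wx s \<phi> (cobar_diff C (gen (x, cs)))) x y"
proof -
  have s: "module s" using assms by (simp add: wml_def)
  interpret s: module s by (rule s)
  have D_Cons: "wx s \<phi> (cobar_diff C (gen (x, c # cs))) = wx s (\<lambda>w. \<phi> (w @ cs)) (cobar_diff_letter C c)
      + s (ksign (deg c - 1)) (wx s (\<lambda>w. \<phi> (c # w)) (cobar_diff C (gen (tgt c, cs))))"
    if "wd x (c # cs) y" for x c cs \<phi>
    using that by (simp add: cobar_diff_Cons wx_simps s wx_comp_left wx_comp_right)
  have letter: "alin s (\<lambda>c. wx s \<psi> (cobar_diff_letter C c)) p q n"
    if "wml s \<psi> p q" "p \<in> points C" "q \<in> points C" "1 \<le> n" for \<psi> p q n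
  proof -
    have 1: "alin s (\<lambda>c. s (curv C (elt c)) (\<psi> [])) p q n"
      unfolding alin_def by (auto intro!: s.lin_on_scale_left lin_on_subset[OF curv_lin])
    have 2: "alin s (\<lambda>c. if 2 \<le> deg c then \<psi> [dC c] else 0) p q n"
    proof (rule alin_filter[OF s, where P = "\<lambda>k. 2 \<le> k"])
      assume n: "2 \<le> n"
      have "0 \<in> coalg_piece C p q (nat (n - 1))"
        by (rule cm.subspace_0[OF subspace_piece[OF that(2,3)]])
      then have "alin s (\<lambda>c. \<psi> [c]) p q (n - 1)"
        using wmlD[OF that(1), of "[]" "Arr p (n - 1) 0 q" "[]"] that n
        by (simp add: Arr_coalg_arrs)
      then show "alin s (\<lambda>c. \<psi> [dC c]) p q n" using that by (intro alin_dC) auto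
    qed
    have 3: "alin s (red s (\<lambda>a b. s (ksign (deg a)) (\<psi> [a, b]))) p q n"
    proof (rule red_alin[OF pabilI[OF s] that(2,3)])
      fix b assume b: "b \<in> coalg_arrs C" "tgt b = q" "1 \<le> deg b" "deg b < n"
      have "0 \<in> coalg_piece C p (src b) (nat (n - deg b))"
        using that coalg_arrsD[OF b(1)] by (intro cm.subspace_0[OF subspace_piece])
      then have "alin s (\<lambda>a. \<psi> [a, b]) p (src b) (n - deg b)"
        using wmlD[OF that(1), of "[]" "Arr p (n - deg b) 0 (src b)" "[b]"] that b coalg_arrsD[OF b(1)]
        by (simp add: Arr_coalg_arrs)
      then show "alin s (\<lambda>a. s (ksign (deg a)) (\<psi> [a, b])) p (src b) (n - deg b)"
        by (rule alin_ksign[OF s])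
    next
      fix a assume a: "a \<in> coalg_arrs C" "src a = p" "1 \<le> deg a" "deg a < n"
      have "0 \<in> coalg_piece C (tgt a) q (nat (n - deg a))"
        using that coalg_arrsD[OF a(1)] by (intro cm.subspace_0[OF subspace_piece])
      then have "alin s (\<lambda>b. \<psi> [a, b]) (tgt a) q (n - deg a)"
        using wmlD[OF that(1), of "[a]" "Arr (tgt a) (n - deg a) 0 q" "[]"] that a coalg_arrsD[OF a(1)]
        by (simp add: Arr_coalg_arrs)
      then show "alin s (\<lambda>b. s (ksign (deg a)) (\<psi> [a, b])) (tgt a) q (n - deg a)"
        by (rule alin_scale[OF s])
    qed (use that in auto)
    have "alin s (\<lambda>c. - s (curv C (elt c)) (\<psi> []) - (if 2 \<le> deg c then \<psi> [dC c] else 0)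
        + red s (\<lambda>a b. s (ksign (deg a)) (\<psi> [a, b])) c) p q n"
      by (intro alin_add alin_diff alin_uminus s 1 2 3)
    then show ?thesis
      by (subst alin_cong[OF that(2,3)]) (use that in \<open>simp_all add: wx_cobar_diff_letter[OF s]\<close>)
  qed
  show ?thesis
  proof (rule wmlI[OF s])
    fix cs c ds assume "wd x (cs @ c # ds) y"
    then show "alin s (\<lambda>c. wx s \<phi> (cobar_diff C (gen (x, cs @ c # ds)))) (src c) (tgt c) (deg c)"
      using assms
    \<comment> \<open>The induction is on the letters in front of the varying one. In the base case
      the varying letter comes first and is either differentiated or carried along; afterwards the
      first letter is fixed.\<close>
    proof (induction cs arbitrary: x \<phi>)
      case Nil
      then have c: "c \<in> coalg_arrs C" "1 \<le> deg c" "src c = x" "wd (tgt c) ds y" by auto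
      note cD = coalg_arrsD[OF c(1)]
      have 1: "alin s (\<lambda>c. wx s (\<lambda>w. \<phi> (w @ ds)) (cobar_diff_letter C c)) (src c) (tgt c) (deg c)"
        using wml_append_right[OF Nil.prems(2) c(4)] c cD by (intro letter) auto
      have 2: "alin s (\<lambda>e. wx s (\<lambda>w. \<phi> (e # w)) (cobar_diff C (gen (tgt c, ds)))) (src c) (tgt c) (deg c)"
        unfolding alin_def wx_def split_def
      proof (rule s.lin_on_lext)
        fix g assume "g \<in> Poly_Mapping.keys (cobar_diff C (gen (tgt c, ds)))"
        then have "wd (tgt c) (snd g) y"
          using cobar_hom_keysD(2)[OF cobar_diff_word_hom[OF c(4)]] by blast
        then show "lin_on (smul C) (coalg_piece C (src c) (tgt c) (nat (deg c))) s
            (\<lambda>u. \<phi> (Arr (src c) (deg c) u (tgt c) # snd g))"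
          using wmlD[OF Nil.prems(2), of "[]" c "snd g"] c by (simp add: alin_def)
      qed
      have "alin s (\<lambda>e. wx s (\<lambda>w. \<phi> (w @ ds)) (cobar_diff_letter C e)
          + s (ksign (deg c - 1)) (wx s (\<lambda>w. \<phi> (e # w)) (cobar_diff C (gen (tgt c, ds))))) (src c) (tgt c) (deg c)"
        by (intro alin_add alin_scale s 1 2)
      then show ?case
        by (subst alin_cong[OF cD(1-3)]) (use c in \<open>auto simp: D_Cons\<close>)
    next
      case (Cons b cs)
      then have b: "b \<in> coalg_arrs C" "1 \<le> deg b" "src b = x" "wd (tgt b) (cs @ c # ds) y" by auto
      then obtain z where cz: "wd (tgt b) cs z" "wd z (c # ds) y" by (auto simp: wd_append)
      then have c: "c \<in> coalg_arrs C" "1 \<le> deg c" "src c = z" "wd (tgt c) ds y" by auto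
      note cD = coalg_arrsD[OF c(1)]
      have wb: "wd x [b] (tgt b)" using b coalg_arrsD[OF b(1)] by simp
      have "wml s (\<lambda>w. \<phi> (b # w)) (tgt b) y" using wml_append_left[OF Cons.prems(2) wb] by simp
      from Cons.IH[OF b(4) this]
      have 1: "alin s (\<lambda>e. wx s (\<lambda>w. \<phi> (b # w)) (cobar_diff C (gen (tgt b, cs @ e # ds)))) (src c) (tgt c) (deg c)" .
      have 2: "alin s (\<lambda>e. wx s (\<lambda>w. \<phi> (w @ cs @ e # ds)) (cobar_diff_letter C b)) (src c) (tgt c) (deg c)"
        unfolding alin_def wx_def split_def
      proof (rule s.lin_on_lext)
        fix g assume "g \<in> Poly_Mapping.keys (cobar_diff_letter C b)"
        then have "wd x (snd g) (tgt b)"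
          using cobar_hom_keysD(2)[OF cobar_diff_letter_hom[OF b(1,2)]] b(3) by blast
        then have "wd x ((snd g @ cs) @ c # ds) y" using b(4) by (auto simp: wd_append)
        from wmlD[OF Cons.prems(2) this]
        show "lin_on (smul C) (coalg_piece C (src c) (tgt c) (nat (deg c))) s
            (\<lambda>u. \<phi> (snd g @ cs @ Arr (src c) (deg c) u (tgt c) # ds))"
          by (simp add: alin_def)
      qed
      have "alin s (\<lambda>e. wx s (\<lambda>w. \<phi> (w @ cs @ e # ds)) (cobar_diff_letter C b)
          + s (ksign (deg b - 1)) (wx s (\<lambda>w. \<phi> (b # w)) (cobar_diff C (gen (tgt b, cs @ e # ds))))) (src c) (tgt c) (deg c)"
        by (intro alin_add alin_scale s 1 2)
      moreover have "wx s \<phi> (cobar_diff C (gen (x, (b # cs) @ e # ds)))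
          = wx s (\<lambda>w. \<phi> (w @ cs @ e # ds)) (cobar_diff_letter C b)
          + s (ksign (deg b - 1)) (wx s (\<lambda>w. \<phi> (b # w)) (cobar_diff C (gen (tgt b, cs @ e # ds))))"
        if "e \<in> coalg_arrs C" "src e = src c" "tgt e = tgt c" "deg e = deg c" for e
      proof -
        have "wd x (b # (cs @ e # ds)) y" using that b c cz by (auto simp: wd_append)
        from D_Cons[OF this] show ?thesis by simp
      qed
      ultimately show ?case by (subst alin_cong[OF cD(1-3)]) auto
    qed
  qed
qed

text \<open>The class of D on words is multilinear by \<open>wml_diff\<close>, so it kills
  relations; this is what lets D act inside a bar slot.\<close>

lemma diff_rel:
  assumes "a \<in> cobar_hom C x y j" and "a \<in> cobar_rel C"
  shows "cobar_diff C a \<in> cobar_rel C"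
proof -
  let ?\<phi> = "\<lambda>cs. cls cobar_gens (gen (x, cs))"
  have "cls cobar_gens (cobar_diff C a) = wx qscale (\<lambda>cs. cls cobar_gens (cobar_diff C (gen (x, cs)))) a"
    by (rule wx_hom[OF qs.module_axioms _ assms(1)])
      (rule lin_on_comp[OF lin_on_hom[OF cls_hom, of UNIV] cobar_diff_lin], simp)
  also have "\<dots> = wx qscale (\<lambda>cs. wx qscale ?\<phi> (cobar_diff C (gen (x, cs)))) a"
    by (rule wx_cong[OF qs.module_axioms assms(1)]) (rule cls_wx[OF cobar_diff_word_hom])
  also have "\<dots> = 0" by (rule wml_rel[OF wml_diff[OF wml_cls] assms])
  finally show ?thesis by (simp add: rel_cls_iff)
qed

end

section \<open>The inner bar differential\<close>

lemma arr_comp_simps [simp]: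
  "src (arr_comp f a b) = src a" "tgt (arr_comp f a b) = tgt b" "deg (arr_comp f a b) = deg a + deg b"
  "elt (arr_comp f a b) = f (elt a) (elt b)"
  by (simp_all add: arr_comp_def)

lemma mono_arr_simps [simp]:
  "src (mono_arr x cs y) = x" "tgt (mono_arr x cs y) = y" "deg (mono_arr x cs y) = letters_deg cs"
  "elt (mono_arr x cs y) = gen (x, cs)"
  by (simp_all add: mono_arr_def)

lemma brace_arr_simps [simp]:
  "src (brace_arr c) = src c" "tgt (brace_arr c) = tgt c" "deg (brace_arr c) = deg c - 1"
  "elt (brace_arr c) = brace c"
  by (simp_all add: brace_arr_def)

lemma arr_eqI: "src a = src b \<Longrightarrow> deg a = deg b \<Longrightarrow> elt a = elt b \<Longrightarrow> tgt a = tgt b \<Longrightarrow> a = b"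
  by (metis arr.collapse)

lemma brace_mono: "1 \<le> deg c \<Longrightarrow> brace_arr c = mono_arr (src c) [c] (tgt c)"
  by (rule arr_eqI) (auto simp: brace_def)

text \<open>The scalar action \<open>s\<close> of the target of the test functions is a parameter
  because two targets are required in the end: classes of bar generators and classes of \<Q>
  generators.\<close>

locale bar_context = categorical_coalgebra C + RM: right_dg_module C M + LN: left_dg_module C N + S: module s
  for C :: "('k::comm_ring_1, 'c::ab_group_add) coalg"
    and M :: "('k, 'c, 'm::ab_group_add) rmod"
    and N :: "('k, 'c, 'n::ab_group_add) lmod"
    and s :: "'k \<Rightarrow> 'q::ab_group_add \<Rightarrow> 'q"
begin

abbreviation ra (infixl "\<lhd>" 75) where "ra \<equiv> arr_comp (ract M)"
abbreviation la (infixr "\<rhd>" 75) where "la \<equiv> arr_comp (lact N)"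
abbreviation cc (infixl "\<odot>" 76) where "cc \<equiv> arr_comp cobar_comp"
abbreviation dM where "dM \<equiv> arr_map (bdiff M) (-1)"
abbreviation dN where "dN \<equiv> arr_map (bdiff N) (-1)"
abbreviation Da :: "('c, ('k, 'c) cobar) arr \<Rightarrow> ('c, ('k, 'c) cobar) arr" where "Da \<equiv> arr_map (cobar_diff C) (-1)"
abbreviation ident :: "'c \<Rightarrow> ('c, ('k, 'c) cobar) arr" where "ident x \<equiv> mono_arr x [] x"
abbreviation br :: "('c, 'c) arr \<Rightarrow> ('c, ('k, 'c) cobar) arr" where "br \<equiv> brace_arr"

lemmas mod = S.module_axioms

lemma cobar_arrsD:
  "a \<in> cobar_arrs C \<Longrightarrow> src a \<in> points C" "a \<in> cobar_arrs C \<Longrightarrow> tgt a \<in> points C"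
  "a \<in> cobar_arrs C \<Longrightarrow> elt a \<in> cobar_hom C (src a) (tgt a) (deg a)"
  by (simp_all add: cobar_arrs_def)

lemma mod_arrsD:
  "m \<in> mod_arrs C B \<Longrightarrow> src m \<in> points C" "m \<in> mod_arrs C B \<Longrightarrow> tgt m \<in> points C"
  "m \<in> mod_arrs C B \<Longrightarrow> elt m \<in> piece B (src m) (tgt m) (deg m)"
  by (simp_all add: mod_arrs_def)

lemma ra_in: "m \<in> mod_arrs C M \<Longrightarrow> a \<in> cobar_arrs C \<Longrightarrow> tgt m = src a \<Longrightarrow> m \<lhd> a \<in> mod_arrs C M"
  using RM.ract_piece[of "src m" "tgt m" "tgt a" "elt m" "deg m" "elt a" "deg a"]
  by (simp add: mod_arrs_def cobar_arrs_def)

lemma la_in: "a \<in> cobar_arrs C \<Longrightarrow> n \<in> mod_arrs C N \<Longrightarrow> tgt a = src n \<Longrightarrow> a \<rhd> n \<in> mod_arrs C N"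
  using LN.lact_piece[of "src a" "tgt a" "tgt n" "elt a" "deg a" "elt n" "deg n"]
  by (simp add: mod_arrs_def cobar_arrs_def)

lemma cc_in: "a \<in> cobar_arrs C \<Longrightarrow> b \<in> cobar_arrs C \<Longrightarrow> tgt a = src b \<Longrightarrow> a \<odot> b \<in> cobar_arrs C"
  using cobar_comp_hom[of "elt a" "src a" "tgt a" "deg a" "elt b" "tgt b" "deg b"]
  by (simp add: cobar_arrs_def)

lemma dM_in: "m \<in> mod_arrs C M \<Longrightarrow> dM m \<in> mod_arrs C M"
  using RM.bdiff_piece[of "src m" "tgt m" "elt m" "deg m"] by (simp add: mod_arrs_def)

lemma dN_in: "n \<in> mod_arrs C N \<Longrightarrow> dN n \<in> mod_arrs C N"
  using LN.bdiff_piece[of "src n" "tgt n" "elt n" "deg n"] by (simp add: mod_arrs_def)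

lemma Da_in: "a \<in> cobar_arrs C \<Longrightarrow> Da a \<in> cobar_arrs C"
  using cobar_diff_hom[of "elt a" "src a" "tgt a" "deg a"] by (simp add: cobar_arrs_def)

lemma mono_in: "wd x cs y \<Longrightarrow> mono_arr x cs y \<in> cobar_arrs C"
  using wd_points[of x cs y] by (simp add: cobar_arrs_def gen_cobar_hom)

lemma ident_in: "x \<in> points C \<Longrightarrow> ident x \<in> cobar_arrs C"
  by (rule mono_in) simp

lemma br_in: "c \<in> coalg_arrs C \<Longrightarrow> br c \<in> cobar_arrs C"
  using coalg_arrsD[of c] mono_in[of "src c" "[c]" "tgt c"] brace_mono[of c]
  by (cases "deg c = 0") (auto simp: cobar_arrs_def brace_def cobar_hom_closed)

lemma Arr_cobar_arrs:
  "x \<in> points C \<Longrightarrow> y \<in> points C \<Longrightarrow> u \<in> cobar_hom C x y j \<Longrightarrow> Arr x j u y \<in> cobar_arrs C"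
  by (simp add: cobar_arrs_def)

lemma ra_assoc:
  assumes "m \<in> mod_arrs C M" "a \<in> cobar_arrs C" "b \<in> cobar_arrs C" "tgt m = src a" "tgt a = src b"
  shows "m \<lhd> a \<lhd> b = m \<lhd> (a \<odot> b)"
  using RM.ract_assoc[of "src m" "tgt m" "tgt a" "tgt b" "elt m" "deg m" "elt a" "deg a" "elt b" "deg b"] assms
  by (intro arr_eqI) (auto simp: mod_arrs_def cobar_arrs_def)

lemma la_assoc:
  assumes "n \<in> mod_arrs C N" "a \<in> cobar_arrs C" "b \<in> cobar_arrs C" "tgt b = src n" "tgt a = src b"
  shows "a \<rhd> b \<rhd> n = (a \<odot> b) \<rhd> n"
  using LN.lact_assoc[of "src a" "src b" "src n" "tgt n" "elt a" "deg a" "elt b" "deg b" "elt n" "deg n"] assms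
  by (intro arr_eqI) (auto simp: mod_arrs_def cobar_arrs_def)

lemma cc_assoc: "a \<odot> b \<odot> c = a \<odot> (b \<odot> c)"
  by (rule arr_eqI) (simp_all add: cobar_comp_assoc)

lemma ra_ident: "m \<in> mod_arrs C M \<Longrightarrow> m \<lhd> ident (tgt m) = m"
  using RM.ract_unit[of "src m" "tgt m" "elt m" "deg m"] by (intro arr_eqI) (auto simp: mod_arrs_def)

lemma la_ident: "n \<in> mod_arrs C N \<Longrightarrow> ident (src n) \<rhd> n = n"
  using LN.lact_unit[of "src n" "tgt n" "elt n" "deg n"] by (intro arr_eqI) (auto simp: mod_arrs_def)

lemma cc_ident_left: "a \<in> cobar_arrs C \<Longrightarrow> ident (src a) \<odot> a = a"
  using cobar_comp_id_left_hom[OF cobar_arrsD(3)] by (intro arr_eqI) auto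

lemma cc_ident_right: "a \<odot> ident (tgt a) = a"
  by (rule arr_eqI) (simp_all add: cobar_comp_id_right)

lemma mono_cc: "mono_arr x cs y \<odot> mono_arr y ds z = mono_arr x (cs @ ds) z"
  by (rule arr_eqI) (simp_all add: cobar_comp_gen)

lemma Da_ident: "elt (Da (ident x)) = 0"
  by (simp add: cobar_diff_Nil)

subsection \<open>Multilinear functions of bar words\<close>

text \<open>The condition for a function to be well defined in one cobar argument: linear on formal
  sums with fixed labels, and zero on the relations among words.\<close>

definition cslot :: "(('c, ('k, 'c) cobar) arr \<Rightarrow> 'q) \<Rightarrow> 'c \<Rightarrow> 'c \<Rightarrow> int \<Rightarrow> bool" where
  "cslot f x y j \<longleftrightarrow> lin_on fscale (cobar_hom C x y j) s (\<lambda>u. f (Arr x j u y))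
     \<and> (\<forall>u \<in> cobar_hom C x y j. u \<in> cobar_rel C \<longrightarrow> f (Arr x j u y) = 0)"

definition nlin :: "(('c, 'n) arr \<Rightarrow> 'q) \<Rightarrow> 'c \<Rightarrow> 'c \<Rightarrow> int \<Rightarrow> bool" where
  "nlin f x y j \<longleftrightarrow> lin_on (bmul N) (piece N x y j) s (\<lambda>u. f (Arr x j u y))"

definition mlin :: "(('c, 'm) arr \<Rightarrow> 'q) \<Rightarrow> 'c \<Rightarrow> 'c \<Rightarrow> int \<Rightarrow> bool" where
  "mlin f x y j \<longleftrightarrow> lin_on (bmul M) (piece M x y j) s (\<lambda>u. f (Arr x j u y))"

lemma cslot_rel:
  "cslot f x y j \<Longrightarrow> a \<in> cobar_arrs C \<Longrightarrow> src a = x \<Longrightarrow> tgt a = y \<Longrightarrow> deg a = j \<Longrightarrow> elt a \<in> cobar_rel C \<Longrightarrow> f a = 0"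
  unfolding cslot_def by (metis arr.collapse cobar_arrsD(3))

lemma rel_0: "0 \<in> cobar_rel C"
  by (simp add: cobar_rel_span fs.span_zero)

lemma subspace_M: "x \<in> points C \<Longrightarrow> y \<in> points C \<Longrightarrow> module.subspace (bmul M) (piece M x y i)"
  using RM.pieces by (auto simp: direct_sum_def)

lemma subspace_N: "x \<in> points C \<Longrightarrow> y \<in> points C \<Longrightarrow> module.subspace (bmul N) (piece N x y i)"
  using LN.pieces by (auto simp: direct_sum_def)

lemma cslot_cong:
  assumes "x \<in> points C" "y \<in> points C"
    and "\<And>a. a \<in> cobar_arrs C \<Longrightarrow> src a = x \<Longrightarrow> tgt a = y \<Longrightarrow> deg a = j \<Longrightarrow> f a = g a"
  shows "cslot f x y j \<longleftrightarrow> cslot g x y j"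
proof -
  have "f (Arr x j u y) = g (Arr x j u y)" if "u \<in> cobar_hom C x y j" for u
    using that assms by (intro assms(3)) (auto intro: Arr_cobar_arrs)
  then show ?thesis
    unfolding cslot_def by (subst lin_on_cong[OF _ module_fscale subspace_cobar_hom]) auto
qed

lemma nlin_cong:
  assumes "x \<in> points C" "y \<in> points C"
    and "\<And>n. n \<in> mod_arrs C N \<Longrightarrow> src n = x \<Longrightarrow> tgt n = y \<Longrightarrow> deg n = j \<Longrightarrow> f n = g n"
  shows "nlin f x y j \<longleftrightarrow> nlin g x y j"
  unfolding nlin_def using assms
  by (intro lin_on_cong[OF _ LN.module_M subspace_N]) (auto intro!: assms(3) simp: mod_arrs_def)

lemma mlin_cong:
  assumes "x \<in> points C" "y \<in> points C"
    and "\<And>n. n \<in> mod_arrs C M \<Longrightarrow> src n = x \<Longrightarrow> tgt n = y \<Longrightarrow> deg n = j \<Longrightarrow> f n = g n"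
  shows "mlin f x y j \<longleftrightarrow> mlin g x y j"
  unfolding mlin_def using assms
  by (intro lin_on_cong[OF _ RM.module_M subspace_M]) (auto intro!: assms(3) simp: mod_arrs_def)

lemma cslot_zero: "cslot (\<lambda>a. 0) x y j"
  and cslot_add: "cslot f x y j \<Longrightarrow> cslot g x y j \<Longrightarrow> cslot (\<lambda>a. f a + g a) x y j"
  and cslot_uminus: "cslot f x y j \<Longrightarrow> cslot (\<lambda>a. - f a) x y j"
  by (simp_all add: cslot_def S.lin_on_zero S.lin_on_add S.lin_on_uminus)

lemma cslot_scale: "cslot f x y j \<Longrightarrow> cslot (\<lambda>a. s r (f a)) x y j"
  unfolding cslot_def by (auto intro: S.lin_on_scale)

lemma cslot_ksign:
  "cslot f x y j \<Longrightarrow> cslot (\<lambda>a. s (r (deg a)) (f a)) x y j"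
  unfolding cslot_def by (auto intro!: S.lin_on_scale)

lemma cslot_Da:
  assumes "cslot f x y (j - 1)"
  shows "cslot (\<lambda>a. f (Da a)) x y j"
proof -
  have "lin_on fscale (cobar_hom C x y j) s (\<lambda>u. f (Arr x (j - 1) (cobar_diff C u) y))"
    using assms unfolding cslot_def by (intro lin_on_comp[OF _ cobar_diff_lin]) (auto intro: cobar_diff_hom)
  moreover have "f (Arr x (j - 1) (cobar_diff C u) y) = 0" if "u \<in> cobar_hom C x y j" "u \<in> cobar_rel C" for u
    using assms diff_rel[OF that] cobar_diff_hom[OF that(1)] by (simp add: cslot_def)
  ultimately show ?thesis by (simp add: cslot_def arr_map_def)
qed

lemma cslot_cc_left:
  assumes "cslot f x (tgt b) (j + deg b)" and "b \<in> cobar_arrs C" and "src b = y"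
  shows "cslot (\<lambda>a. f (a \<odot> b)) x y j"
proof -
  note b = cobar_arrsD(3)[OF assms(2), unfolded assms(3)]
  have "lin_on fscale (cobar_hom C x y j) s (\<lambda>u. f (Arr x (j + deg b) (cobar_comp u (elt b)) (tgt b)))"
    using assms unfolding cslot_def
    by (intro lin_on_comp[OF _ cobar_comp_lin_left]) (auto intro: cobar_comp_hom[OF _ b])
  moreover have "f (Arr x (j + deg b) (cobar_comp u (elt b)) (tgt b)) = 0"
    if "u \<in> cobar_hom C x y j" "u \<in> cobar_rel C" for u
    using assms comp_rel_left[OF that b] cobar_comp_hom[OF that(1) b] by (simp add: cslot_def)
  ultimately show ?thesis by (simp add: cslot_def arr_comp_def)
qed

lemma cslot_cc_right:
  assumes "cslot f (src a) z (deg a + j)" and "a \<in> cobar_arrs C" and "tgt a = y"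
  shows "cslot (\<lambda>b. f (a \<odot> b)) y z j"
proof -
  note a = cobar_arrsD(3)[OF assms(2), unfolded assms(3)]
  have "lin_on fscale (cobar_hom C y z j) s (\<lambda>u. f (Arr (src a) (deg a + j) (cobar_comp (elt a) u) z))"
    using assms unfolding cslot_def
    by (intro lin_on_comp[OF _ cobar_comp_lin_right]) (auto intro: cobar_comp_hom[OF a])
  moreover have "f (Arr (src a) (deg a + j) (cobar_comp (elt a) u) z) = 0"
    if "u \<in> cobar_hom C y z j" "u \<in> cobar_rel C" for u
    using assms comp_rel_right[OF a that] cobar_comp_hom[OF a that(1)] by (simp add: cslot_def)
  ultimately show ?thesis by (simp add: cslot_def arr_comp_def)
qed

lemma cslot_la:
  assumes "nlin f x (tgt n) (j + deg n)" and "n \<in> mod_arrs C N" and "src n = y" and "x \<in> points C"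
  shows "cslot (\<lambda>a. f (a \<rhd> n)) x y j"
proof -
  note n = mod_arrsD[OF assms(2)]
  have "lin_on fscale (cobar_hom C x y j) s (\<lambda>u. f (Arr x (j + deg n) (lact N u (elt n)) (tgt n)))"
    using assms n unfolding nlin_def
    by (intro lin_on_comp[OF assms(1)[unfolded nlin_def]] lin_onI LN.lact_add_left[of x "src n" "tgt n"]
      LN.lact_scale_left[of x "src n" "tgt n"] LN.lact_piece[of x "src n" "tgt n"]) auto
  moreover have "f (Arr x (j + deg n) (lact N u (elt n)) (tgt n)) = 0"
    if "u \<in> cobar_hom C x y j" "u \<in> cobar_rel C" for u
  proof -
    have "lact N u (elt n) = 0"
      using LN.lact_rel[of x "src n" "tgt n" u j "elt n" "deg n"] that n assms by simp
    moreover have "f (Arr x (j + deg n) 0 (tgt n)) = 0"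
      using S.lin_on_0[OF assms(1)[unfolded nlin_def] LN.module_M]
        module.subspace_0[OF LN.module_M subspace_N[OF assms(4) n(2)]] by simp
    ultimately show ?thesis by simp
  qed
  ultimately show ?thesis by (simp add: cslot_def arr_comp_def)
qed

lemma cslot_ra:
  assumes "mlin f (src m) z (deg m + j)" and "m \<in> mod_arrs C M" and "tgt m = y" and "z \<in> points C"
  shows "cslot (\<lambda>a. f (m \<lhd> a)) y z j"
proof -
  note m = mod_arrsD[OF assms(2)]
  have "lin_on fscale (cobar_hom C y z j) s (\<lambda>u. f (Arr (src m) (deg m + j) (ract M (elt m) u) z))"
    using assms m unfolding mlin_def
    by (intro lin_on_comp[OF assms(1)[unfolded mlin_def]] lin_onI RM.ract_add_right[of "src m" "tgt m" z]
      RM.ract_scale_right[of "src m" "tgt m" z] RM.ract_piece[of "src m" "tgt m" z]) auto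
  moreover have "f (Arr (src m) (deg m + j) (ract M (elt m) u) z) = 0"
    if "u \<in> cobar_hom C y z j" "u \<in> cobar_rel C" for u
  proof -
    have "ract M (elt m) u = 0"
      using RM.ract_rel[of "src m" "tgt m" z "elt m" "deg m" u j] that m assms by simp
    moreover have "f (Arr (src m) (deg m + j) 0 z) = 0"
      using S.lin_on_0[OF assms(1)[unfolded mlin_def] RM.module_M]
        module.subspace_0[OF RM.module_M subspace_M[OF m(1) assms(4)]] by simp
    ultimately show ?thesis by simp
  qed
  ultimately show ?thesis by (simp add: cslot_def arr_comp_def)
qed

lemma nlin_0: "nlin f x y j \<Longrightarrow> n \<in> mod_arrs C N \<Longrightarrow> src n = x \<Longrightarrow> tgt n = y \<Longrightarrow> deg n = j \<Longrightarrow> elt n = 0 \<Longrightarrow> f n = 0"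
  using S.lin_on_0[OF _ LN.module_M] module.subspace_0[OF LN.module_M subspace_N]
  unfolding nlin_def by (metis arr.collapse mod_arrsD(3))

lemma mlin_0: "mlin f x y j \<Longrightarrow> n \<in> mod_arrs C M \<Longrightarrow> src n = x \<Longrightarrow> tgt n = y \<Longrightarrow> deg n = j \<Longrightarrow> elt n = 0 \<Longrightarrow> f n = 0"
  using S.lin_on_0[OF _ RM.module_M] module.subspace_0[OF RM.module_M subspace_M]
  unfolding mlin_def by (metis arr.collapse mod_arrsD(3))

lemma nlin_la:
  assumes "nlin f (src a) z (deg a + j)" and "a \<in> cobar_arrs C" and "tgt a = y" and "z \<in> points C"
  shows "nlin (\<lambda>n. f (a \<rhd> n)) y z j"
proof -
  note a = cobar_arrsD[OF assms(2), unfolded assms(3)]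
  have "lin_on (bmul N) (piece N y z j) s (\<lambda>u. f (Arr (src a) (deg a + j) (lact N (elt a) u) z))"
    using assms a
    by (intro lin_on_comp[OF assms(1)[unfolded nlin_def]] lin_onI LN.lact_add_right[of "src a" y z]
      LN.lact_scale_right[of "src a" y z] LN.lact_piece[of "src a" y z]) auto
  then show ?thesis by (simp add: nlin_def arr_comp_def)
qed

lemma mlin_ra:
  assumes "mlin f x (tgt a) (j + deg a)" and "a \<in> cobar_arrs C" and "src a = y" and "x \<in> points C"
  shows "mlin (\<lambda>m. f (m \<lhd> a)) x y j"
proof -
  note a = cobar_arrsD[OF assms(2), unfolded assms(3)]
  have "lin_on (bmul M) (piece M x y j) s (\<lambda>u. f (Arr x (j + deg a) (ract M u (elt a)) (tgt a)))"
    using assms a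
    by (intro lin_on_comp[OF assms(1)[unfolded mlin_def]] lin_onI RM.ract_add_left[of x y "tgt a"]
      RM.ract_scale_left[of x y "tgt a"] RM.ract_piece[of x y "tgt a"]) auto
  then show ?thesis by (simp add: mlin_def arr_comp_def)
qed

lemma nlin_dN:
  assumes "nlin f x y (j - 1)" and "x \<in> points C" "y \<in> points C"
  shows "nlin (\<lambda>n. f (dN n)) x y j"
proof -
  have "lin_on (bmul N) (piece N x y j) s (\<lambda>u. f (Arr x (j - 1) (bdiff N u) y))"
    by (rule lin_on_comp[OF assms(1)[unfolded nlin_def] lin_on_hom[OF LN.bdiff_linear]])
      (rule LN.bdiff_piece[OF assms(2,3)])
  then show ?thesis by (simp add: nlin_def arr_map_def)
qed

lemma mlin_dM:
  assumes "mlin f x y (j - 1)" and "x \<in> points C" "y \<in> points C"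
  shows "mlin (\<lambda>n. f (dM n)) x y j"
proof -
  have "lin_on (bmul M) (piece M x y j) s (\<lambda>u. f (Arr x (j - 1) (bdiff M u) y))"
    by (rule lin_on_comp[OF assms(1)[unfolded mlin_def] lin_on_hom[OF RM.bdiff_linear]])
      (rule RM.bdiff_piece[OF assms(2,3)])
  then show ?thesis by (simp add: mlin_def arr_map_def)
qed

section \<open>Multilinear, normalized functions of the tail of a bar word\<close>

definition lt :: "'c \<Rightarrow> ('c, ('k, 'c) cobar) arr list \<Rightarrow> 'c \<Rightarrow> bool" where
  "lt x as y \<longleftrightarrow> set as \<subseteq> cobar_arrs C \<and> chain x as y"

lemma lt_Nil [simp]: "lt x [] y \<longleftrightarrow> x = y"
  and lt_Cons [simp]: "lt x (a # as) y \<longleftrightarrow> a \<in> cobar_arrs C \<and> src a = x \<and> lt (tgt a) as y"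
  by (auto simp: lt_def)

lemma lt_append: "lt x (as @ bs) z \<longleftrightarrow> (\<exists>y. lt x as y \<and> lt y bs z)"
  by (auto simp: lt_def chain_append)

definition lm :: "'c \<Rightarrow> 'c \<Rightarrow> (('c, ('k, 'c) cobar) arr list \<Rightarrow> 'q) \<Rightarrow> bool" where
  "lm x y f \<longleftrightarrow> (\<forall>as a bs. lt x (as @ a # bs) y \<longrightarrow> cslot (\<lambda>a. f (as @ a # bs)) (src a) (tgt a) (deg a))"

lemma lmI:
  "(\<And>as a bs. lt x (as @ a # bs) y \<Longrightarrow> cslot (\<lambda>a. f (as @ a # bs)) (src a) (tgt a) (deg a)) \<Longrightarrow> lm x y f"
  by (simp add: lm_def)

text \<open>\<open>lm\<close> quantifies over actual arrows. The zero arrow with prescribed labels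
  exists for every p, q and j, so the slot condition holds for all labels.\<close>

lemma lmD:
  assumes "lm x y f" and "lt x as p" and "lt q bs y" and "p \<in> points C" "q \<in> points C"
  shows "cslot (\<lambda>a. f (as @ a # bs)) p q j"
proof -
  have "lt x (as @ Arr p j 0 q # bs) y"
    using assms by (auto simp: lt_append Arr_cobar_arrs cobar_hom_closed)
  then show ?thesis using assms(1) unfolding lm_def by fastforce
qed

lemma lm_append_right:
  assumes "lm x z f" and "lt y W z"
  shows "lm x y (\<lambda>l. f (l @ W))"
proof (rule lmI)
  fix as a bs assume "lt x (as @ a # bs) y"
  then have "lt x (as @ a # (bs @ W)) z" using assms(2) by (force simp: lt_append)
  then show "cslot (\<lambda>a. f ((as @ a # bs) @ W)) (src a) (tgt a) (deg a)"
    using assms(1) unfolding lm_def by fastforce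
qed

lemma lm_append_left:
  assumes "lm x z f" and "lt x W y"
  shows "lm y z (\<lambda>l. f (W @ l))"
proof (rule lmI)
  fix as a bs assume "lt y (as @ a # bs) z"
  then have "lt x ((W @ as) @ a # bs) z" using assms(2) by (force simp: lt_append)
  then show "cslot (\<lambda>a. f (W @ as @ a # bs)) (src a) (tgt a) (deg a)"
    using assms(1) unfolding lm_def by fastforce
qed

type_synonym (in -) ('k1, 'c1, 'n1, 'q1) tailfun =
  "('c1, ('k1, 'c1) cobar) arr list \<Rightarrow> ('c1, 'n1) arr \<Rightarrow> 'q1"

text \<open>The module element on the left is suppressed, so that functions can be shifted past
  letters already read; this is what inductions along the bar word require.\<close>

definition lml :: "'c \<Rightarrow> ('k, 'c, 'n, 'q) tailfun \<Rightarrow> bool" where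
  "lml x F \<longleftrightarrow> (\<forall>n\<in>mod_arrs C N. lm x (src n) (\<lambda>as. F as n))
     \<and> (\<forall>as. \<forall>n\<in>mod_arrs C N. lt x as (src n) \<longrightarrow> nlin (F as) (src n) (tgt n) (deg n))"

definition nrm :: "'c \<Rightarrow> ('k, 'c, 'n, 'q) tailfun \<Rightarrow> bool" where
  "nrm x F \<longleftrightarrow> (\<forall>as y bs. \<forall>n\<in>mod_arrs C N. lt x (as @ ident y # bs) (src n) \<longrightarrow> F (as @ ident y # bs) n = 0)"

lemma lmlD_n:
  assumes "lml x F" and "lt x as p" and "p \<in> points C" "q \<in> points C"
  shows "nlin (F as) p q j"
proof -
  have "Arr p j 0 q \<in> mod_arrs C N"
    using assms module.subspace_0[OF LN.module_M subspace_N] by (simp add: mod_arrs_def)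
  then show ?thesis using assms unfolding lml_def by fastforce
qed

lemma lmlD: "lml x F \<Longrightarrow> n \<in> mod_arrs C N \<Longrightarrow> lm x (src n) (\<lambda>as. F as n)"
  by (simp add: lml_def)

lemma lml_append_left:
  assumes "lml x F" and "lt x W y"
  shows "lml y (\<lambda>l. F (W @ l))"
proof -
  have "lm y (src n) (\<lambda>l. F (W @ l) n)" if "n \<in> mod_arrs C N" for n
    using lm_append_left[OF lmlD[OF assms(1) that] assms(2)] .
  moreover have "nlin (F (W @ as)) (src n) (tgt n) (deg n)" if "n \<in> mod_arrs C N" "lt y as (src n)" for as n
    using that assms mod_arrsD[OF that(1)] by (intro lmlD_n) (auto simp: lt_append)
  ultimately show ?thesis by (simp add: lml_def)
qed

lemma lml_Cons: "lml x F \<Longrightarrow> a \<in> cobar_arrs C \<Longrightarrow> src a = x \<Longrightarrow> lml (tgt a) (\<lambda>l. F (a # l))"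
  using lml_append_left[of x F "[a]" "tgt a"] by simp

lemma nrmD: "nrm x F \<Longrightarrow> n \<in> mod_arrs C N \<Longrightarrow> lt x (as @ ident y # bs) (src n) \<Longrightarrow> F (as @ ident y # bs) n = 0"
  by (simp add: nrm_def)

lemma nrm_append_left:
  assumes "nrm x F" and "lt x W y"
  shows "nrm y (\<lambda>l. F (W @ l))"
  unfolding nrm_def
proof (intro allI ballI impI)
  fix as z bs n assume "n \<in> mod_arrs C N" "lt y (as @ ident z # bs) (src n)"
  then show "F (W @ as @ ident z # bs) n = 0"
    using nrmD[OF assms(1), of n "W @ as" z bs] assms(2) unfolding lt_append append_assoc by blast
qed

lemma nrm_Cons: "nrm x F \<Longrightarrow> a \<in> cobar_arrs C \<Longrightarrow> src a = x \<Longrightarrow> nrm (tgt a) (\<lambda>l. F (a # l))"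
  using nrm_append_left[of x F "[a]" "tgt a"] by simp

subsection \<open>The recursive form of the differential\<close>

text \<open>Everything is contravariant: a function \<open>F\<close> on bar words stands for the class of a generator,
  and \<open>rb e F as n\<close> is the value of \<open>F\<close> on the part of the differential of \<open>m[as]n\<close> that does not
  touch \<open>m\<close>, where \<open>e\<close> is the degree of \<open>m\<close>.\<close>

definition J :: "int \<Rightarrow> ('c, ('k, 'c) cobar) arr \<Rightarrow> ('k, 'c, 'n, 'q) tailfun \<Rightarrow> ('k, 'c, 'n, 'q) tailfun" where
  "J e a F as n = (case as of [] \<Rightarrow> - s (ksign e) (F [] (a \<rhd> n))
     | b # bs \<Rightarrow> s (ksign (e + deg a + 1)) (F ((a \<odot> b) # bs) n))"

text \<open>\<open>J\<close> multiplies \<open>a\<close> into whatever follows it, the next letter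
  or the module element. With \<open>e\<close> the degree in front of \<open>a\<close>, the signs
  are those of \<theta> in the bar differential.\<close>

lemma J_simps [simp]:
  "J e a F [] n = - s (ksign e) (F [] (a \<rhd> n))"
  "J e a F (b # bs) n = s (ksign (e + deg a + 1)) (F ((a \<odot> b) # bs) n)"
  by (simp_all add: J_def)

primrec rb :: "int \<Rightarrow> ('k, 'c, 'n, 'q) tailfun \<Rightarrow> ('k, 'c, 'n, 'q) tailfun" where
  "rb e F [] n = s (ksign e) (F [] (dN n))"
| "rb e F (a # as) n = - s (ksign e) (F (Da a # as) n) + J e a F as n
     + rb (e + deg a + 1) (\<lambda>bs. F (a # bs)) as n"

lemma J_param:
  assumes "\<And>cs n. lt (src a) cs (src n) \<Longrightarrow> n \<in> mod_arrs C N \<Longrightarrow> lin_on t V s (\<lambda>u. F u cs n)"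
    and "a \<in> cobar_arrs C" and "lt (tgt a) as (src n)" and "n \<in> mod_arrs C N"
  shows "lin_on t V s (\<lambda>u. J e a (F u) as n)"
  using assms by (cases as) (auto intro!: S.lin_on_uminus S.lin_on_scale assms(1) la_in cc_in)

lemma rb_param:
  assumes "\<And>cs n. lt x cs (src n) \<Longrightarrow> n \<in> mod_arrs C N \<Longrightarrow> lin_on t V s (\<lambda>u. F u cs n)"
    and "lt x as (src n)" and "n \<in> mod_arrs C N"
  shows "lin_on t V s (\<lambda>u. rb e (F u) as n)"
  using assms
proof (induction as arbitrary: x e F)
  case Nil
  then show ?case by (auto intro!: S.lin_on_scale Nil.prems(1) dN_in)
next
  case (Cons a as)
  then have a: "a \<in> cobar_arrs C" "src a = x" "lt (tgt a) as (src n)" by auto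
  have "lin_on t V s (\<lambda>u. rb (e + deg a + 1) (\<lambda>bs. F u (a # bs)) as n)"
    by (rule Cons.IH[OF _ a(3) Cons.prems(3)]) (rule Cons.prems(1), use a in auto)
  moreover have "lin_on t V s (\<lambda>u. J e a (F u) as n)"
    by (rule J_param[OF _ a(1,3) Cons.prems(3)]) (rule Cons.prems(1), use a in auto)
  moreover have "lin_on t V s (\<lambda>u. F u (Da a # as) n)"
    by (rule Cons.prems(1)) (use a Cons.prems(3) in \<open>auto intro: Da_in\<close>)
  ultimately show ?case
    by (auto intro!: S.lin_on_add S.lin_on_diff S.lin_on_scale)
qed

lemma J_cong:
  assumes "\<And>cs n. lt (src a) cs (src n) \<Longrightarrow> n \<in> mod_arrs C N \<Longrightarrow> F cs n = G cs n"
    and "a \<in> cobar_arrs C" and "lt (tgt a) as (src n)" and "n \<in> mod_arrs C N"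
  shows "J e a F as n = J e a G as n"
  using assms by (cases as) (auto intro!: arg_cong[where f = "s _"] assms(1) la_in cc_in)

text \<open>Differentiating, multiplying neighbours and acting all preserve composability, so
  \<open>F\<close> is only ever evaluated at composable words.\<close>

lemma rb_cong:
  assumes "\<And>cs n. lt x cs (src n) \<Longrightarrow> n \<in> mod_arrs C N \<Longrightarrow> F cs n = G cs n"
    and "lt x as (src n)" and "n \<in> mod_arrs C N"
  shows "rb e F as n = rb e G as n"
  using assms
proof (induction as arbitrary: x e F G)
  case Nil
  then show ?case by (auto intro!: arg_cong[where f = "s _"] Nil.prems(1) dN_in)
next
  case (Cons a as)
  then have a: "a \<in> cobar_arrs C" "src a = x" "lt (tgt a) as (src n)" by auto
  have "rb (e + deg a + 1) (\<lambda>bs. F (a # bs)) as n = rb (e + deg a + 1) (\<lambda>bs. G (a # bs)) as n"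
    by (rule Cons.IH[OF _ a(3) Cons.prems(3)]) (rule Cons.prems(1), use a in auto)
  moreover have "J e a F as n = J e a G as n"
    by (rule J_cong[OF _ a(1,3) Cons.prems(3)]) (rule Cons.prems(1), use a in auto)
  moreover have "F (Da a # as) n = G (Da a # as) n"
    by (rule Cons.prems(1)) (use a Cons.prems(3) in \<open>auto intro: Da_in\<close>)
  ultimately show ?case by simp
qed

lemma J_zero [simp]: "J e a (\<lambda>cs n. 0) as n = 0"
  by (cases as) simp_all

lemma rb_zero_fun [simp]: "rb e (\<lambda>cs n. 0) as n = 0"
  by (induction as arbitrary: e) simp_all

lemma rb_zero:
  assumes "\<And>cs n. lt x cs (src n) \<Longrightarrow> n \<in> mod_arrs C N \<Longrightarrow> F cs n = 0"
    and "lt x as (src n)" and "n \<in> mod_arrs C N"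
  shows "rb e F as n = 0"
  using rb_cong[of x F "\<lambda>cs n. 0" as n e] assms by simp

lemma J_add: "J e a (\<lambda>cs n. F cs n + G cs n) as n = J e a F as n + J e a G as n"
  and J_scale: "J e a (\<lambda>cs n. s r (F cs n)) as n = s r (J e a F as n)"
  by (cases as; simp add: S.scale_right_distrib mult.commute)+

lemma rb_add: "rb e (\<lambda>cs n. F cs n + G cs n) as n = rb e F as n + rb e G as n"
  by (induction as arbitrary: e F G) (simp_all add: S.scale_right_distrib J_add algebra_simps)

lemma rb_scale: "rb e (\<lambda>cs n. s r (F cs n)) as n = s r (rb e F as n)"
  by (induction as arbitrary: e F) (simp_all add: S.scale_right_distrib S.scale_right_diff_distrib J_scale mult.commute)

lemma J_shift: "J (e + i) a F as n = s (ksign i) (J e a F as n)"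
proof (cases as)
  case (Cons b bs)
  have "ksign (e + i + deg a + 1) = (ksign i * ksign (e + deg a + 1) :: 'k)"
    by (simp add: ksign_def)
  with Cons show ?thesis by simp
qed (simp add: ksign_def)

text \<open>The degree \<open>e\<close> in front enters only through a global sign.\<close>

lemma rb_shift: "rb (e + i) F as n = s (ksign i) (rb e F as n)"
proof (induction as arbitrary: e F)
  case (Cons a as)
  have "rb (e + i + deg a + 1) (\<lambda>bs. F (a # bs)) as n = s (ksign i) (rb (e + deg a + 1) (\<lambda>bs. F (a # bs)) as n)"
    using Cons[of "e + deg a + 1" "\<lambda>bs. F (a # bs)"] by (simp add: algebra_simps)
  moreover have "ksign (e + i) = (ksign i * ksign e :: 'k)" by (simp add: ksign_def)
  ultimately show ?case by (simp add: J_shift S.scale_right_distrib S.scale_right_diff_distrib)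
qed (simp add: ksign_def)

lemma cslot_J:
  assumes "lml x F" and "lt y as (src n)" and "n \<in> mod_arrs C N" and "x \<in> points C" "y \<in> points C"
  shows "cslot (\<lambda>a. J e a F as n) x y j"
proof (cases as)
  case Nil
  have "nlin (F []) x (tgt n) (j + deg n)"
    using assms mod_arrsD[OF assms(3)] by (intro lmlD_n) auto
  from cslot_la[OF this assms(3)] show ?thesis
    using assms Nil by (auto intro!: cslot_uminus cslot_scale)
next
  case (Cons b bs)
  then have b: "b \<in> cobar_arrs C" "src b = y" "lt (tgt b) bs (src n)" using assms(2) by auto
  have "cslot (\<lambda>a. F (a # bs) n) x (tgt b) (j + deg b)"
    using lmD[OF lmlD[OF assms(1,3)], of "[]" x "tgt b" bs] b assms cobar_arrsD[OF b(1)] by simp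
  from cslot_cc_left[OF this b(1,2)] have "cslot (\<lambda>a. F ((a \<odot> b) # bs) n) x y j" .
  from cslot_ksign[OF this, of "\<lambda>i. ksign (e + i + 1)"] show ?thesis by (simp add: Cons)
qed

lemma cslot_param:
  assumes "\<And>u. u \<in> cobar_hom C x y j \<Longrightarrow> u \<in> cobar_rel C \<Longrightarrow> f (Arr x j u y) = 0"
    and "lin_on fscale (cobar_hom C x y j) s (\<lambda>u. f (Arr x j u y))"
  shows "cslot f x y j"
  using assms by (simp add: cslot_def)

lemma rb_cslot_head:
  assumes "lml x F" and "x \<in> points C" "y \<in> points C" and "lt y bs (src n)" and "n \<in> mod_arrs C N"
  shows "cslot (\<lambda>a. rb e F (a # bs) n) x y j"
proof -
  have sl: "cslot (\<lambda>a. F (a # cs) n) x y i" if "lt y cs (src n)" "n \<in> mod_arrs C N" for cs n i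
    using lmD[OF lmlD[OF assms(1) that(2)], of "[]" x y cs] that assms by simp
  have 1: "cslot (\<lambda>a. F (Da a # bs) n) x y j"
    by (rule cslot_Da) (rule sl[OF assms(4,5)])
  have 2: "cslot (\<lambda>a. rb (e + j + 1) (\<lambda>cs. F (a # cs)) bs n) x y j"
  proof (rule cslot_param)
    show "lin_on fscale (cobar_hom C x y j) s (\<lambda>u. rb (e + j + 1) (\<lambda>cs. F (Arr x j u y # cs)) bs n)"
      by (rule rb_param[OF _ assms(4,5)]) (use sl in \<open>simp add: cslot_def\<close>)
    show "rb (e + j + 1) (\<lambda>cs. F (Arr x j u y # cs)) bs n = 0"
      if "u \<in> cobar_hom C x y j" "u \<in> cobar_rel C" for u
      by (rule rb_zero[OF _ assms(4,5)]) (use sl that in \<open>simp add: cslot_def\<close>)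
  qed
  \<comment> \<open>Within a slot the degree label is constant, so \<open>deg a\<close> in the sign
    and in the recursion may be replaced by the fixed \<open>j\<close>.\<close>
  have "cslot (\<lambda>a. - s (ksign e) (F (Da a # bs) n) + J e a F bs n + rb (e + j + 1) (\<lambda>cs. F (a # cs)) bs n) x y j"
    by (intro cslot_add cslot_uminus cslot_scale 1 2 cslot_J[OF assms(1,4,5,2,3)])
  then show ?thesis by (subst cslot_cong[OF assms(2,3)]) auto
qed

text \<open>Each part of the differential substitutes \<open>Da\<close>, a product or an action into
  a slot of \<open>F\<close>, and these preserve slots because relations form an ideal stable under
  D and act by zero.\<close>

lemma lml_rb:
  assumes "lml x F" and "x \<in> points C"
  shows "lml x (rb e F)"
proof -
  have "lm x (src n) (\<lambda>as. rb e F as n)" if n: "n \<in> mod_arrs C N" for n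
  proof (rule lmI)
    fix as a bs assume "lt x (as @ a # bs) (src n)"
    then show "cslot (\<lambda>a. rb e F (as @ a # bs) n) (src a) (tgt a) (deg a)"
      using assms
    proof (induction as arbitrary: x e F)
      case Nil
      then show ?case
        using rb_cslot_head[OF Nil.prems(2,3) _ _ n, of "tgt a" bs] cobar_arrsD[of a] by simp
    next
      case (Cons b as)
      then have b: "b \<in> cobar_arrs C" "src b = x" "lt (tgt b) (as @ a # bs) (src n)" by auto
      then obtain p where p: "lt (tgt b) as p" "lt p (a # bs) (src n)" by (auto simp: lt_append)
      then have a: "a \<in> cobar_arrs C" "src a = p" "lt (tgt a) bs (src n)" by auto
      note aD = cobar_arrsD[OF a(1)] and bD = cobar_arrsD[OF b(1)]
      have sl: "cslot (\<lambda>e. F (W @ e # bs) n) (src a) (tgt a) (deg a)" if "lt x W p" for W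
        using lmD[OF lmlD[OF Cons.prems(2) n] that a(3)] a aD by simp
      have 1: "cslot (\<lambda>e. F (Da b # as @ e # bs) n) (src a) (tgt a) (deg a)"
        using sl[of "Da b # as"] b p by (simp add: Da_in)
      have 2: "cslot (\<lambda>a. J e b F (as @ a # bs) n) (src a) (tgt a) (deg a)"
      \<comment> \<open>If the varying letter directly follows \<open>b\<close>, it enters through
        the product with \<open>b\<close>; otherwise \<open>J\<close> leaves it in place.\<close>
      proof (cases as)
        case Nil
        have "cslot (\<lambda>e. F (e # bs) n) x (tgt a) (deg b + deg a)"
          using lmD[OF lmlD[OF Cons.prems(2) n], of "[]" x "tgt a" bs] a aD Cons.prems by simp
        from cslot_cc_right[where f = "\<lambda>e. F (e # bs) n", OF _ b(1), of "tgt a" "deg a" "src a"] this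
        have "cslot (\<lambda>e. F ((b \<odot> e) # bs) n) (src a) (tgt a) (deg a)"
          using b a p Nil by simp
        then show ?thesis using Nil by (auto intro: cslot_scale)
      next
        case (Cons c cs)
        then show ?thesis
          using sl[of "(b \<odot> c) # cs"] b p by (auto simp: cc_in intro!: cslot_scale)
      qed
      have 3: "cslot (\<lambda>a. rb (e + deg b + 1) (\<lambda>cs. F (b # cs)) (as @ a # bs) n) (src a) (tgt a) (deg a)"
        by (rule Cons.IH[OF b(3) lml_Cons[OF Cons.prems(2) b(1,2)] bD(2)])
      show ?case
        unfolding append_Cons rb.simps by (intro cslot_add cslot_uminus cslot_scale 1 2 3)
    qed
  qed
  moreover have "nlin (rb e F as) (src n) (tgt n) (deg n)"
    if n: "n \<in> mod_arrs C N" and as: "lt x as (src n)" for as n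
    using as assms
  proof (induction as arbitrary: x e F)
    case Nil
    then show ?case
      unfolding rb.simps using mod_arrsD[OF n]
      by (auto simp: nlin_def intro!: S.lin_on_scale nlin_dN[unfolded nlin_def] lmlD_n[unfolded nlin_def])
  next
    case (Cons b as)
    then have b: "b \<in> cobar_arrs C" "src b = x" "lt (tgt b) as (src n)" by auto
    note nD = mod_arrsD[OF n] and bD = cobar_arrsD[OF b(1)]
    have 1: "nlin (F (Da b # as)) (src n) (tgt n) (deg n)"
      using b nD by (intro lmlD_n[OF Cons.prems(2)]) (auto intro: Da_in)
    have 2: "nlin (J e b F as) (src n) (tgt n) (deg n)"
    proof (cases as)
      case Nil
      have "nlin (F []) (src b) (tgt n) (deg b + deg n)"
        using b nD bD by (intro lmlD_n[OF Cons.prems(2)]) auto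
      from nlin_la[OF this b(1)] have "nlin (\<lambda>n. F [] (b \<rhd> n)) (src n) (tgt n) (deg n)"
        using b Nil nD by simp
      then show ?thesis
        using Nil by (auto simp: nlin_def intro!: S.lin_on_uminus S.lin_on_scale)
    next
      case (Cons c cs)
      have "nlin (F ((b \<odot> c) # cs)) (src n) (tgt n) (deg n)"
        using b nD Cons by (intro lmlD_n[OF Cons.prems(2)]) (auto intro: cc_in)
      then show ?thesis using Cons by (auto simp: nlin_def intro!: S.lin_on_scale)
    qed
    have 3: "nlin (rb (e + deg b + 1) (\<lambda>cs. F (b # cs)) as) (src n) (tgt n) (deg n)"
      by (rule Cons.IH[OF b(3) lml_Cons[OF Cons.prems(2) b(1,2)] bD(2)])
    show ?case
      using 1 2 3 unfolding nlin_def rb.simps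
      by (intro S.lin_on_add S.lin_on_uminus S.lin_on_scale)
  qed
  ultimately show ?thesis by (simp add: lml_def)
qed

lemma lml_rel:
  assumes "lml x F" and "lt x (as @ a # bs) (src n)" and "n \<in> mod_arrs C N" and "elt a \<in> cobar_rel C"
  shows "F (as @ a # bs) n = 0"
proof -
  have a: "a \<in> cobar_arrs C" using assms(2) by (auto simp: lt_append)
  have "cslot (\<lambda>a. F (as @ a # bs) n) (src a) (tgt a) (deg a)"
    using lmlD[OF assms(1,3)] assms(2) by (simp add: lm_def)
  from cslot_rel[OF this a] assms(4) show ?thesis by simp
qed

text \<open>D of an identity is zero and words that still contain the identity are normalized away.
  Only its product with the next entry survives; in the full differential this cancels against its
  action on the module element in front.\<close>

lemma rb_ident_head:
  assumes "lml x F" "nrm x F" and "lt x as (src n)" and "n \<in> mod_arrs C N" and "x \<in> points C"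
  shows "rb e F (ident x # as) n = - s (ksign e) (F as n)"
proof -
  note I = ident_in[OF assms(5)]
  have 1: "F (Da (ident x) # as) n = 0"
    using lml_rel[OF assms(1) _ assms(4), of "[]" "Da (ident x)" as] assms I rel_0 Da_ident
    by (simp add: Da_in)
  have 2: "rb (e + 1) (\<lambda>cs. F (ident x # cs)) as n = 0"
    by (rule rb_zero[OF _ assms(3,4)]) (use nrmD[OF assms(2), of _ "[]"] I in auto)
  have 3: "J e (ident x) F as n = - s (ksign e) (F as n)"
  proof (cases as)
    case Nil
    then show ?thesis using la_ident[OF assms(4)] assms(3) by simp
  next
    case (Cons b bs)
    then show ?thesis using cc_ident_left[of b] assms(3) by (auto simp: ksign_add)
  qed
  show ?thesis using 1 2 3 by simp
qed

text \<open>The identity is absorbed by its left neighbour and by its right neighbour, giving the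
  same word with opposite signs; all other terms still contain it.\<close>

lemma rb_ident_later:
  assumes "lml x F" "nrm x F" and "lt x (b # as @ ident y # bs) (src n)" and "n \<in> mod_arrs C N"
  shows "rb e F (b # as @ ident y # bs) n = 0"
  using assms
proof (induction as arbitrary: x b e F)
  case Nil
  then have b: "b \<in> cobar_arrs C" "src b = x" "tgt b = y" "lt y bs (src n)" "ident y \<in> cobar_arrs C" by auto
  note bD = cobar_arrsD[OF b(1)]
  have 1: "F (Da b # ident y # bs) n = 0"
    using nrmD[OF Nil.prems(2,4), of "[Da b]" y bs] b by (simp add: Da_in)
  have 2: "rb (e + deg b + 1) (\<lambda>cs. F (b # cs)) (ident y # bs) n = - s (ksign (e + deg b + 1)) (F (b # bs) n)"
    using rb_ident_head[OF lml_Cons[OF Nil.prems(1) b(1,2)] nrm_Cons[OF Nil.prems(2) b(1,2)] _ Nil.prems(4)]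
      b bD by (simp del: rb.simps)
  have "b \<odot> ident y = b" using cc_ident_right[of b] b by simp
  then show ?case using 1 2 by (simp del: rb.simps(2) add: rb.simps(2)[of e F b])
next
  case (Cons c as)
  then have b: "b \<in> cobar_arrs C" "src b = x" "c \<in> cobar_arrs C" "tgt b = src c"
    "lt (tgt b) (c # as @ ident y # bs) (src n)" by auto
  have 1: "F (Da b # c # as @ ident y # bs) n = 0"
    using nrmD[OF Cons.prems(2,4), of "Da b # c # as" y bs] b by (simp add: Da_in)
  have 2: "F ((b \<odot> c) # as @ ident y # bs) n = 0"
    using nrmD[OF Cons.prems(2,4), of "(b \<odot> c) # as" y bs] b by (simp add: cc_in)
  have 3: "rb (e + deg b + 1) (\<lambda>cs. F (b # cs)) (c # as @ ident y # bs) n = 0"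
    by (rule Cons.IH[OF lml_Cons[OF Cons.prems(1) b(1,2)] nrm_Cons[OF Cons.prems(2) b(1,2)] b(5) Cons.prems(4)])
  show ?case using 1 2 3 by (simp del: rb.simps(2) add: rb.simps(2)[of e F b])
qed

end

section \<open>Iterated coproducts in bar words\<close>

context categorical_coalgebra
begin

text \<open>Every reduced splitting takes at least one from the degree. This allows the number of
  splittings in \<open>AA\<close> to be raised freely.\<close>

lemma red_iter_vanish: "c \<in> coalg_arrs C \<Longrightarrow> 1 \<le> deg c \<Longrightarrow> nat (deg c) \<le> k \<Longrightarrow> red_iter C k c = 0"
proof (induction k arbitrary: c)
  case (Suc k)
  have "fext (\<lambda>(a, b). fext (\<lambda>cs. gen (a # cs)) (red_iter C k b)) (red_cop C c)
      = fext (\<lambda>p. 0) (red_cop C c)"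
  proof (rule fs.lext_cong, clarify)
    fix a b assume "(a, b) \<in> Poly_Mapping.keys (red_cop C c)"
    from fsums_keysD[OF red_cop_in[OF Suc.prems(1)] this]
    have "b \<in> coalg_arrs C" "1 \<le> deg b" "nat (deg b) \<le> k"
      using Suc.prems by (auto simp: psplits_def splits_def)
    then show "fext (\<lambda>cs. gen (a # cs)) (red_iter C k b) = 0" by (simp add: Suc.IH)
  qed
  then show ?case by simp
qed simp

definition cuts :: "('c, 'c) arr \<Rightarrow> ('c, 'c) arr list set" where
  "cuts c = {cs. cs \<noteq> [] \<and> wd (src c) cs (tgt c) \<and> sum_list (map deg cs) = deg c}"

lemma red_iter_in: "c \<in> coalg_arrs C \<Longrightarrow> 1 \<le> deg c \<Longrightarrow> red_iter C k c \<in> fsums (cuts c)"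
proof (induction k arbitrary: c)
  case 0
  then show ?case using coalg_arrsD[OF 0(1)] by (auto simp: cuts_def)
next
  case (Suc k)
  show ?case
    unfolding red_iter.simps
  proof (rule fsums_lext, clarify, rule fsums_lext)
    fix a b cs assume ab: "(a, b) \<in> Poly_Mapping.keys (red_cop C c)" and cs: "cs \<in> Poly_Mapping.keys (red_iter C k b)"
    from fsums_keysD[OF red_cop_in[OF Suc.prems(1)] ab]
    have ab: "a \<in> coalg_arrs C" "b \<in> coalg_arrs C" "src a = src c" "tgt a = src b" "tgt b = tgt c"
      "deg a + deg b = deg c" "1 \<le> deg a" "1 \<le> deg b"
      by (auto simp: psplits_def splits_def)
    from fsums_keysD[OF Suc.IH[OF ab(2,8)] cs] ab show "gen (a # cs) \<in> fsums (cuts c)"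
      by (auto simp: cuts_def)
  qed
qed

end

context bar_context
begin

text \<open>\<open>AA f c\<close> is the value of \<open>f\<close> on \<open>\<Sum>[{c\<^sup>1}|\<dots>|{c\<^sup>k}]\<close>, the sum in the definition of \<open>\<alpha>\<close>.\<close>

definition AA :: "(('c, ('k, 'c) cobar) arr list \<Rightarrow> 'q) \<Rightarrow> ('c, 'c) arr \<Rightarrow> 'q" where
  "AA f c = (\<Sum>k=1..nat (deg c). lext s (\<lambda>cs. f (map brace_arr cs)) (red_iter C (k - 1) c))"

lemma psplitsD:
  assumes "(a, b) \<in> psplits c"
  shows "a \<in> coalg_arrs C" "b \<in> coalg_arrs C" "src a = src c" "tgt a = src b" "tgt b = tgt c"
    "deg a + deg b = deg c" "1 \<le> deg a" "1 \<le> deg b" "deg a < deg c" "deg b < deg c"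
  using assms by (auto simp: psplits_def splits_def)

lemma lt_map_br: "wd x cs y \<Longrightarrow> lt x (map br cs) y"
  by (induction cs arbitrary: x) (auto intro: br_in)

lemma cuts_lt: "cs \<in> cuts c \<Longrightarrow> lt (src c) (map br cs) (tgt c)" "cs \<in> cuts c \<Longrightarrow> map br cs \<noteq> []"
  by (auto simp: cuts_def intro: lt_map_br)

lemma AA_cong:
  assumes "c \<in> coalg_arrs C" and "1 \<le> deg c"
    and "\<And>l. lt (src c) l (tgt c) \<Longrightarrow> l \<noteq> [] \<Longrightarrow> f l = g l"
  shows "AA f c = AA g c"
  unfolding AA_def
proof (intro sum.cong refl S.lext_cong)
  fix k cs assume "cs \<in> Poly_Mapping.keys (red_iter C (k - 1) c)"
  from fsums_keysD[OF red_iter_in[OF assms(1,2)] this]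
  show "f (map br cs) = g (map br cs)" by (intro assms(3) cuts_lt)
qed

lemma AA_param:
  assumes "c \<in> coalg_arrs C" and "1 \<le> deg c"
    and "\<And>l. lt (src c) l (tgt c) \<Longrightarrow> l \<noteq> [] \<Longrightarrow> lin_on t V s (\<lambda>u. f u l)"
  shows "lin_on t V s (\<lambda>u. AA (f u) c)"
  unfolding AA_def
proof (intro S.lin_on_sum S.lin_on_lext)
  fix k cs assume "cs \<in> Poly_Mapping.keys (red_iter C (k - 1) c)"
  from fsums_keysD[OF red_iter_in[OF assms(1,2)] this]
  show "lin_on t V s (\<lambda>u. f u (map br cs))" by (intro assms(3) cuts_lt)
qed

lemma AA_zero [simp]: "AA (\<lambda>l. 0) c = 0"
  by (simp add: AA_def)

lemma AA_add: "AA (\<lambda>l. f l + g l) c = AA f c + AA g c"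
  and AA_diff: "AA (\<lambda>l. f l - g l) c = AA f c - AA g c"
  and AA_uminus: "AA (\<lambda>l. - f l) c = - AA f c"
  by (simp_all add: AA_def S.lext_fun_add S.lext_fun_diff S.lext_fun_uminus sum.distrib sum_subtractf sum_negf)

lemma AA_scale: "AA (\<lambda>l. s r (f l)) c = s r (AA f c)"
  unfolding AA_def S.lext_fun_scale by (simp add: S.scale_sum_right)

lemma AA_red: "AA (\<lambda>l. red s (\<lambda>a b. f a b l) d) c = red s (\<lambda>a b. AA (f a b) c) d"
  unfolding AA_def red_def split_def S.lext_fun_sum
  by (rule sum.cong[OF refl]) (rule S.lext_swap)

text \<open>Peeling off the leftmost factor turns the sum over all numbers of factors into a
  recursion on degree. The inner sum runs up to \<open>deg c - 1\<close>, which may exceed the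
  degree of the right factor; the surplus terms vanish by \<open>red_iter_vanish\<close>.\<close>

lemma AA_left:
  assumes "c \<in> coalg_arrs C" and "1 \<le> deg c"
  shows "AA f c = f [br c] + red s (\<lambda>a b. AA (\<lambda>l. f (br a # l)) b) c"
proof -
  define n where "n = nat (deg c) - 1"
  have n: "nat (deg c) = Suc n" using assms(2) by (simp add: n_def)
  have AA0: "AA g d = (\<Sum>k<nat (deg d). lext s (\<lambda>cs. g (map br cs)) (red_iter C k d))" for g d
    unfolding AA_def by (rule sum.reindex_bij_witness[of _ Suc "\<lambda>k. k - 1"]) auto
  have "AA f c = f [br c] + (\<Sum>k<n. lext s (\<lambda>cs. f (map br cs)) (red_iter C (Suc k) c))"
    unfolding AA0 n by (subst sum.lessThan_Suc_shift) simp
  also have "(\<Sum>k<n. lext s (\<lambda>cs. f (map br cs)) (red_iter C (Suc k) c))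
      = red s (\<lambda>a b. \<Sum>k<n. lext s (\<lambda>cs. f (br a # map br cs)) (red_iter C k b)) c"
    by (simp add: red_def split_def S.lext_fun_sum S.lext_lext)
  also have "\<dots> = red s (\<lambda>a b. AA (\<lambda>l. f (br a # l)) b) c"
  proof (rule red_cong[OF mod assms(1)])
    fix a b assume "(a, b) \<in> psplits c"
    note ab = psplitsD[OF this]
    have "nat (deg b) \<le> n" using ab n by simp
    then show "(\<Sum>k<n. lext s (\<lambda>cs. f (br a # map br cs)) (red_iter C k b)) = AA (\<lambda>l. f (br a # l)) b"
      unfolding AA0
      by (intro sum.mono_neutral_right) (auto simp: red_iter_vanish[OF ab(2,8)])
  qed
  finally show ?thesis .
qed

lemma alin_br:
  assumes "cslot f x y (n - 1)" and "x \<in> points C" "y \<in> points C" "1 \<le> n"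
  shows "alin s (\<lambda>c. f (br c)) x y n"
proof -
  have "alin s (\<lambda>c. f (mono_arr x [c] y)) x y n"
  proof -
    \<comment> \<open>\<open>wml_of_linear\<close> asks for a family over all degrees, while only
      degree n - 1, that of a single bracket, is known; the family is extended by zero.\<close>
    let ?f = "\<lambda>(j::int) u. if j = n - 1 then f (Arr x (n - 1) u y) else 0"
    have wml: "wml s (\<lambda>cs. ?f (letters_deg cs) (gen (x, cs))) x y"
      by (rule wml_of_linear[OF mod]) (use assms(1) in \<open>auto simp: cslot_def intro!: S.lin_on_if S.lin_on_zero\<close>)
    have "0 \<in> coalg_piece C x y (nat n)"
      by (rule cm.subspace_0[OF subspace_piece[OF assms(2,3)]])
    then have "wd x ([] @ Arr x n 0 y # []) y" using assms by (simp add: Arr_coalg_arrs)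
    from wmlD[OF wml this] show ?thesis by (simp add: alin_def mono_arr_def)
  qed
  then show ?thesis
    by (subst alin_cong[OF assms(2,3)]) (use assms(4) in \<open>auto simp: brace_mono\<close>)
qed

lemma lm_alin_br:
  assumes "lm x y f" and "lt x as p" "lt q bs y" and "p \<in> points C" "q \<in> points C" "1 \<le> n"
  shows "alin s (\<lambda>c. f (as @ br c # bs)) p q n"
  by (rule alin_br[where f = "\<lambda>a. f (as @ a # bs)", OF lmD[OF assms(1-5)] assms(4-6)])

lemma AA_alin_param:
  assumes "c \<in> coalg_arrs C" and "1 \<le> deg c"
    and "\<And>l. lt (src c) l (tgt c) \<Longrightarrow> alin s (\<lambda>d. f d l) x y n"
  shows "alin s (\<lambda>d. AA (f d) c) x y n"
  unfolding alin_def by (rule AA_param[OF assms(1,2)]) (use assms(3) in \<open>simp add: alin_def\<close>)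

text \<open>The iterated coproduct is assembled from choices, so linearity is proved through
  \<open>AA_left\<close> by induction on the degree, one bracket at a time.\<close>

lemma AA_alin:
  assumes "lm x y f" and "x \<in> points C" "y \<in> points C" "1 \<le> n"
  shows "alin s (AA f) x y n"
  using assms
proof (induction "nat n" arbitrary: n x f rule: less_induct)
  case less
  have 1: "alin s (\<lambda>c. f [br c]) x y n"
    using lm_alin_br[OF less.prems(1), of "[]" x y "[]"] less.prems by simp
  have 2: "alin s (red s (\<lambda>a b. AA (\<lambda>l. f (br a # l)) b)) x y n"
  proof (rule red_alin[OF pabilI[OF mod] less.prems(2,3)])
    fix b assume b: "b \<in> coalg_arrs C" "tgt b = y" "1 \<le> deg b" "deg b < n"
    show "alin s (\<lambda>a. AA (\<lambda>l. f (br a # l)) b) x (src b) (n - deg b)"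
      by (rule AA_alin_param[OF b(1,3)])
        (use lm_alin_br[OF less.prems(1), of "[]"] less.prems b coalg_arrsD[OF b(1)] in auto)
  next
    fix a assume a: "a \<in> coalg_arrs C" "src a = x" "1 \<le> deg a" "deg a < n"
    have "lm (tgt a) y (\<lambda>l. f (br a # l))"
      using lm_append_left[OF less.prems(1), of "[br a]" "tgt a"] a br_in by simp
    then show "alin s (\<lambda>b. AA (\<lambda>l. f (br a # l)) b) (tgt a) y (n - deg a)"
      using a less.prems coalg_arrsD[OF a(1)] by (intro less.hyps) auto
  qed (use less.prems in auto)
  have "alin s (\<lambda>c. f [br c] + red s (\<lambda>a b. AA (\<lambda>l. f (br a # l)) b) c) x y n"
    by (intro alin_add mod 1 2)
  then show ?case
    by (subst alin_cong[OF less.prems(2,3)]) (use less.prems in \<open>auto intro: AA_left\<close>)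
qed

lemma lm_Cons_br: "lm (src a) y f \<Longrightarrow> a \<in> coalg_arrs C \<Longrightarrow> lm (tgt a) y (\<lambda>l. f (br a # l))"
  using lm_append_left[of "src a" y f "[br a]" "tgt a"] br_in by simp

lemma pabil_AA:
  assumes "lm x y f" and "x \<in> points C" "y \<in> points C"
  shows "pabil s (\<lambda>a b. AA (\<lambda>l. f (br a # l)) b) x y n"
proof (rule pabilI[OF mod])
  fix b assume b: "b \<in> coalg_arrs C" "tgt b = y" "1 \<le> deg b" "deg b < n"
  show "alin s (\<lambda>a. AA (\<lambda>l. f (br a # l)) b) x (src b) (n - deg b)"
    by (rule AA_alin_param[OF b(1,3)])
      (use lm_alin_br[OF assms(1), of "[]"] assms b coalg_arrsD[OF b(1)] in auto)
next
  fix a assume a: "a \<in> coalg_arrs C" "src a = x" "1 \<le> deg a" "deg a < n"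
  then show "alin s (\<lambda>b. AA (\<lambda>l. f (br a # l)) b) (tgt a) y (n - deg a)"
    using assms coalg_arrsD[OF a(1)] by (intro AA_alin lm_Cons_br) auto
qed

lemma patril_scale:
  assumes "patril s G x y n"
  shows "patril s (\<lambda>a b c. s (r (deg a) (deg b) (deg c)) (G a b c)) x y n"
  using assms unfolding patril_def alin_def by (auto intro!: S.lin_on_scale)

text \<open>The middle factor is the one that is cut further; the first and last are single
  brackets. This is the form in which the terms that multiply the last bracket into the tail
  appear.\<close>

lemma patril_mid:
  assumes "x \<in> points C" "y \<in> points C"
    and "\<And>c. c \<in> coalg_arrs C \<Longrightarrow> 1 \<le> deg c \<Longrightarrow> tgt c = y \<Longrightarrow> lm x (src c) (\<lambda>l. K l c)"
    and "\<And>l z n. lt x l z \<Longrightarrow> z \<in> points C \<Longrightarrow> 1 \<le> n \<Longrightarrow> alin s (K l) z y n"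
  shows "patril s (\<lambda>a b c. AA (\<lambda>l. K (br a # l) c) b) x y n"
  unfolding patril_def
proof (intro conjI ballI impI mod; elim conjE)
  fix b c assume bc: "b \<in> coalg_arrs C" "c \<in> coalg_arrs C" "tgt b = src c" "tgt c = y"
    "1 \<le> deg b" "1 \<le> deg c" "deg b + deg c < n"
  show "alin s (\<lambda>a. AA (\<lambda>l. K (br a # l) c) b) x (src b) (n - deg b - deg c)"
    by (rule AA_alin_param[OF bc(1,5)])
      (use lm_alin_br[OF assms(3)[OF bc(2,6,4)], of "[]"] assms bc coalg_arrsD[OF bc(1)] in auto)
next
  fix a c assume ac: "a \<in> coalg_arrs C" "c \<in> coalg_arrs C" "src a = x" "tgt c = y"
    "1 \<le> deg a" "1 \<le> deg c" "deg a + deg c < n"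
  show "alin s (\<lambda>b. AA (\<lambda>l. K (br a # l) c) b) (tgt a) (src c) (n - deg a - deg c)"
    using lm_append_left[OF assms(3)[OF ac(2,6,4)], of "[br a]" "tgt a"] ac
      coalg_arrsD[OF ac(1)] coalg_arrsD[OF ac(2)]
    by (intro AA_alin) (auto intro: br_in)
next
  fix a b assume ab: "a \<in> coalg_arrs C" "b \<in> coalg_arrs C" "src a = x" "tgt a = src b"
    "1 \<le> deg a" "1 \<le> deg b" "deg a + deg b < n"
  show "alin s (\<lambda>c. AA (\<lambda>l. K (br a # l) c) b) (tgt b) y (n - deg a - deg b)"
    by (rule AA_alin_param[OF ab(2,6)]) (rule assms(4), use ab coalg_arrsD[OF ab(2)] in \<open>auto intro: br_in\<close>)
qed

text \<open>Evaluation of the formula for D{c} in an arbitrary slot. The test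
  \<open>deg c = 2\<close> and \<open>src c = tgt c\<close> is automatic when the curvature is
  nonzero; it guarantees that the identity arrow carries the labels of the slot.\<close>

lemma slot_Da_br_curv:
  assumes "c \<in> coalg_arrs C" and "1 \<le> deg c" and "cslot G (src c) (tgt c) (deg c - 2)"
  shows "G (Da (br c)) =
    - (if deg c = 2 \<and> src c = tgt c then s (curv C (elt c)) (G (ident (src c))) else 0)
    - (if 2 \<le> deg c then G (br (dC c)) else 0)
    + red s (\<lambda>a b. s (ksign (deg a)) (G (br a \<odot> br b))) c"
proof -
  let ?x = "src c" and ?y = "tgt c" and ?j = "deg c - 2"
  let ?\<psi> = "\<lambda>cs. G (Arr ?x ?j (gen (?x, cs)) ?y)"
  note cD = coalg_arrsD[OF assms(1)]
  have "Da (br c) = Arr ?x ?j (cobar_diff_letter C c) ?y"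
    using assms by (intro arr_eqI) (auto simp: brace_def cobar_diff_single)
  then have "G (Da (br c)) = G (Arr ?x ?j (cobar_diff_letter C c) ?y)" by simp
  also have "\<dots> = wx s ?\<psi> (cobar_diff_letter C c)"
    using assms(3) by (intro wx_hom[OF mod _ cobar_diff_letter_hom[OF assms(1,2)]]) (simp add: cslot_def)
  also have "\<dots> = - s (curv C (elt c)) (?\<psi> []) - (if 2 \<le> deg c then ?\<psi> [dC c] else 0)
      + red s (\<lambda>a b. s (ksign (deg a)) (?\<psi> [a, b])) c"
    by (rule wx_cobar_diff_letter[OF mod assms(2)])
  also have "s (curv C (elt c)) (?\<psi> [])
      = (if deg c = 2 \<and> ?x = ?y then s (curv C (elt c)) (G (ident ?x)) else 0)"
  proof (cases "deg c = 2 \<and> ?x = ?y")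
    case True
    moreover have "ident ?x = Arr ?x 0 (gen (?x, [])) ?x" by (rule arr_eqI) simp_all
    ultimately show ?thesis by simp
  next
    case False
    have "curv C (elt c) = 0"
    proof (rule ccontr)
      assume h: "curv C (elt c) \<noteq> 0"
      have "nat (deg c) = 2"
        using h cD curv_degree[of "elt c" "nat (deg c)"] by (auto simp: coalg_piece_def)
      moreover have "?x = ?y"
        using h curv_off_diagonal[of ?x ?y] cD by blast
      ultimately show False using False by simp
    qed
    then show ?thesis using False by simp
  qed
  also have "(if 2 \<le> deg c then ?\<psi> [dC c] else 0) = (if 2 \<le> deg c then G (br (dC c)) else 0)"
  proof -
    have "br (dC c) = Arr ?x ?j (gen (?x, [dC c])) ?y" if "2 \<le> deg c"
      using that by (intro arr_eqI) (auto simp: brace_def)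
    then show ?thesis by simp
  qed
  also have "red s (\<lambda>a b. s (ksign (deg a)) (?\<psi> [a, b])) c = red s (\<lambda>a b. s (ksign (deg a)) (G (br a \<odot> br b))) c"
  proof (rule red_cong[OF mod assms(1)])
    fix a b assume "(a, b) \<in> psplits c"
    note ab = psplitsD[OF this]
    have "br a \<odot> br b = Arr ?x ?j (gen (?x, [a, b])) ?y"
      using ab by (intro arr_eqI) (auto simp: brace_def cobar_comp_gen)
    then show "s (ksign (deg a)) (?\<psi> [a, b]) = s (ksign (deg a)) (G (br a \<odot> br b))" by simp
  qed
  finally show ?thesis .
qed

lemma slot_Da_br:
  assumes "c \<in> coalg_arrs C" and "1 \<le> deg c" and "cslot G (src c) (tgt c) (deg c - 2)"
    and "src c = tgt c \<Longrightarrow> G (ident (src c)) = 0"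
  shows "G (Da (br c)) = - (if 2 \<le> deg c then G (br (dC c)) else 0)
    + red s (\<lambda>a b. s (ksign (deg a)) (G (br a \<odot> br b))) c"
  using slot_Da_br_curv[OF assms(1-3)] assms(4) by auto

text \<open>The brackets of the iterated coproducts form a cycle up to the internal differential: the terms
  with \<open>c'|c''\<close> merged by the cobar differential cancel against the bar products of neighbours.\<close>

lemma AA_rb:
  assumes "c \<in> coalg_arrs C" and "1 \<le> deg c" and "lml (src c) F" "nrm (src c) F"
    and "lt (tgt c) W (src n)" and "n \<in> mod_arrs C N"
  shows "AA (\<lambda>l. rb e F (l @ W) n) c = s (ksign e) (if 2 \<le> deg c then AA (\<lambda>l. F (l @ W) n) (dC c) else 0)
    + (J e (br c) F W n + red s (\<lambda>a b. AA (\<lambda>l. J (e + deg a) (br b) (\<lambda>bs. F (l @ bs)) W n) a) c)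
    + AA (\<lambda>l. rb (e + deg c) (\<lambda>bs. F (l @ bs)) W n) c"
  using assms
proof (induction "nat (deg c)" arbitrary: c e F rule: less_induct)
  case less
  note c = less.prems(1,2) and F = less.prems(3) and nF = less.prems(4) and W = less.prems(5) and n = less.prems(6)
  note cD = coalg_arrsD[OF c(1)]
  let ?x = "src c" and ?y = "tgt c"
  have lmF: "lm ?x (src n) (\<lambda>as. F as n)" by (rule lmlD[OF F n])
  have sn: "src n \<in> points C" by (rule mod_arrsD(1)[OF n])
  have lmFW: "lm ?x ?y (\<lambda>l. F (l @ W) n)" by (rule lm_append_right[OF lmF W])
  have slot: "cslot (\<lambda>a. F (a # l @ W) n) ?x z j" if "lt z l ?y" "z \<in> points C" for l z j
    using lmD[OF lmF, of "[]" ?x z "l @ W"] that W cD by (auto simp: lt_append)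
  have norm: "F (ident ?x # l @ W) n = 0" if "lt ?x l ?y" for l
    using nrmD[OF nF n, of "[]" ?x "l @ W"] that W ident_in[OF cD(1)] by (auto simp: lt_append)
  \<comment> \<open>Names for the contributions: \<open>?T\<close> and \<open>?U\<close> have d on
    the first or on a later factor, \<open>?X1\<close> and \<open>?G\<close> merge two neighbouring
    brackets, \<open>?J1\<close> and \<open>?K\<close> multiply the last bracket into the tail, and
    \<open>?R\<close> differentiates the tail.\<close>
  let ?T = "\<lambda>a b. if 2 \<le> deg a then AA (\<lambda>l. F (br (dC a) # l @ W) n) b else 0"
  let ?U = "\<lambda>a b. s (ksign (deg a)) (if 2 \<le> deg b then AA (\<lambda>l. F (br a # l @ W) n) (dC b) else 0)"
  let ?X1 = "\<lambda>a b. s (ksign (deg a)) (F ((br a \<odot> br b) # W) n)"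
  let ?G = "\<lambda>a b c. s (ksign (deg a)) (AA (\<lambda>l. F ((br a \<odot> br b) # l @ W) n) c)"
  let ?J1 = "\<lambda>a b. J (e + deg a) (br b) (\<lambda>bs. F (br a # bs)) W n"
  let ?K = "\<lambda>a b c. AA (\<lambda>l. J (e + deg a + deg b) (br c) (\<lambda>bs. F (br a # l @ bs)) W n) b"
  let ?R = "\<lambda>a b. AA (\<lambda>l. rb (e + deg c) (\<lambda>bs. F (br a # l @ bs)) W n) b"

  have head: "F (Da (br c) # W) n = - (if 2 \<le> deg c then F (br (dC c) # W) n else 0) + red s ?X1 c"
    using slot_Da_br[OF c, of "\<lambda>a. F (a # W) n"] slot[of ?y "[]" "deg c - 2"] norm[of "[]"] cD by simp

  \<comment> \<open>The first bracket is read off by the recursion of \<open>rb\<close>, and the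
    remaining ones are handled by the induction hypothesis for the right factor \<open>b\<close>, of
    smaller degree. Degrees shift by \<open>deg a\<close> since a bracket, suspended in the bar
    word, has degree \<open>deg a\<close>.\<close>
  have step: "AA (\<lambda>l. rb e F (br a # l @ W) n) b
      = s (ksign e) (?T a b) - s (ksign e) (red s (\<lambda>a' a''. ?G a' a'' b) a)
        + s (ksign e) (?X1 a b) + s (ksign e) (red s (\<lambda>b' b''. ?G a b' b'') b)
        + s (ksign e) (?U a b) + ?J1 a b + red s (\<lambda>b' b''. ?K a b' b'') b + ?R a b"
    if ab0: "(a, b) \<in> psplits c" for a b
  proof -
    note ab = psplitsD[OF ab0] and aD = coalg_arrsD[OF psplitsD(1)[OF ab0]] and bD = coalg_arrsD[OF psplitsD(2)[OF ab0]]
    have eb: "e + (deg a - 1) + 1 = e + deg a" by simp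
    have "AA (\<lambda>l. rb e F (br a # l @ W) n) b = AA (\<lambda>l. - s (ksign e) (F (Da (br a) # l @ W) n)
        + s (ksign (e + deg a)) (F ((br a \<odot> hd l) # tl l @ W) n)
        + rb (e + deg a) (\<lambda>bs. F (br a # bs)) (l @ W) n) b"
    proof (rule AA_cong[OF ab(2,8)])
      \<comment> \<open>A cut of \<open>b\<close> is never empty, so the first bracket always meets
        another bracket and \<open>hd l\<close> is meaningful.\<close>
      fix l assume "lt (src b) l (tgt b)" "l \<noteq> []"
      then show "rb e F (br a # l @ W) n = - s (ksign e) (F (Da (br a) # l @ W) n)
        + s (ksign (e + deg a)) (F ((br a \<odot> hd l) # tl l @ W) n)
        + rb (e + deg a) (\<lambda>bs. F (br a # bs)) (l @ W) n"
        by (cases l) (simp_all del: rb.simps(2) add: rb.simps(2)[of e F "br a"] eb)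
    qed
    also have "\<dots> = - s (ksign e) (AA (\<lambda>l. F (Da (br a) # l @ W) n) b)
        + s (ksign (e + deg a)) (AA (\<lambda>l. F ((br a \<odot> hd l) # tl l @ W) n) b)
        + AA (\<lambda>l. rb (e + deg a) (\<lambda>bs. F (br a # bs)) (l @ W) n) b"
      by (simp only: AA_add AA_uminus AA_scale)
    also have "AA (\<lambda>l. F (Da (br a) # l @ W) n) b
        = - ?T a b + red s (\<lambda>a' a''. ?G a' a'' b) a"
    proof -
      have "AA (\<lambda>l. F (Da (br a) # l @ W) n) b
          = AA (\<lambda>l. - (if 2 \<le> deg a then F (br (dC a) # l @ W) n else 0)
              + red s (\<lambda>a' a''. s (ksign (deg a')) (F ((br a' \<odot> br a'') # l @ W) n)) a) b"
      proof (rule AA_cong[OF ab(2,8)])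
        fix l assume l: "lt (src b) l (tgt b)"
        have sl: "cslot (\<lambda>a. F (a # l @ W) n) (src a) (tgt a) (deg a - 2)"
          using slot[of "tgt a" l "deg a - 2"] l ab aD by simp
        have nz: "F (ident (src a) # l @ W) n = 0" if "src a = tgt a"
          using norm[of l] l ab that by simp
        show "F (Da (br a) # l @ W) n = - (if 2 \<le> deg a then F (br (dC a) # l @ W) n else 0)
              + red s (\<lambda>a' a''. s (ksign (deg a')) (F ((br a' \<odot> br a'') # l @ W) n)) a"
          by (rule slot_Da_br[OF ab(1,7) sl nz])
      qed
      also have "\<dots> = - ?T a b + red s (\<lambda>a' a''. ?G a' a'' b) a"
        by (simp add: AA_add AA_diff AA_uminus AA_red AA_scale)
      finally show ?thesis .
    qed
    also have "AA (\<lambda>l. F ((br a \<odot> hd l) # tl l @ W) n) b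
        = F ((br a \<odot> br b) # W) n + red s (\<lambda>b' b''. AA (\<lambda>l. F ((br a \<odot> br b') # l @ W) n) b'') b"
      by (subst AA_left[OF ab(2,8)]) simp
    also have "AA (\<lambda>l. rb (e + deg a) (\<lambda>bs. F (br a # bs)) (l @ W) n) b
        = s (ksign (e + deg a)) (if 2 \<le> deg b then AA (\<lambda>l. F (br a # l @ W) n) (dC b) else 0)
          + (?J1 a b + red s (\<lambda>b' b''. ?K a b' b'') b)
          + AA (\<lambda>l. rb (e + deg a + deg b) (\<lambda>bs. F (br a # l @ bs)) W n) b"
    proof (rule less.hyps[OF _ ab(2,8) _ _ _ n])
      show "nat (deg b) < nat (deg c)" using ab by simp
      show "lml (src b) (\<lambda>bs. F (br a # bs))" using lml_Cons[OF F br_in[OF ab(1)]] ab by simp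
      show "nrm (src b) (\<lambda>bs. F (br a # bs))" using nrm_Cons[OF nF br_in[OF ab(1)]] ab by simp
      show "lt (tgt b) W (src n)" using W ab by simp
    qed
    finally show ?thesis
      using ab by (simp add: ksign_add S.scale_right_distrib S.scale_right_diff_distrib add.assoc red_scale[OF mod]
          diff_conv_add_uminus del: add_uminus_conv_diff)
  qed
  \<comment> \<open>The cancellation at the heart of the lemma: splitting the first factor, as D
    does, and splitting the second, where the first two brackets are multiplied, give the same sum
    by coassociativity, with opposite signs.\<close>
  have coassoc_G: "red s (\<lambda>a b. red s (\<lambda>a' a''. ?G a' a'' b) a) c = red s (\<lambda>a b. red s (\<lambda>b' b''. ?G a b' b'') b) c"
  proof (rule red_coassoc[OF c(1)])
    have "patril s (\<lambda>a b c. AA (\<lambda>l. F ((br a \<odot> br b) # l @ W) n) c) ?x ?y (deg c)"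
      unfolding patril_def
    proof (intro conjI ballI impI mod; elim conjE)
      fix a b assume ab: "a \<in> coalg_arrs C" "b \<in> coalg_arrs C" "tgt a = src b" "tgt b = ?y" "1 \<le> deg a" "1 \<le> deg b"
      note aD = coalg_arrsD[OF ab(1)] and bD = coalg_arrsD[OF ab(2)]
      show "alin s (\<lambda>d. AA (\<lambda>l. F ((br d \<odot> br a) # l @ W) n) b) ?x (src a) (deg c - deg a - deg b)"
        if "deg a + deg b < deg c"
      proof (rule AA_alin_param[OF ab(2,6)])
        fix l assume l: "lt (src b) l (tgt b)"
        have "cslot (\<lambda>d. F ((d \<odot> br a) # l @ W) n) ?x (src a) (deg c - deg a - deg b - 1)"
          using slot[of "tgt a" l] l ab aD
          by (intro cslot_cc_left[where f = "\<lambda>d. F (d # l @ W) n"] br_in) auto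
        then show "alin s (\<lambda>d. F ((br d \<odot> br a) # l @ W) n) ?x (src a) (deg c - deg a - deg b)"
          using that cD aD by (intro alin_br) auto
      qed
    next
      fix a b assume ab: "a \<in> coalg_arrs C" "b \<in> coalg_arrs C" "src a = ?x" "tgt b = ?y" "1 \<le> deg a" "1 \<le> deg b"
      note aD = coalg_arrsD[OF ab(1)] and bD = coalg_arrsD[OF ab(2)]
      show "alin s (\<lambda>d. AA (\<lambda>l. F ((br a \<odot> br d) # l @ W) n) b) (tgt a) (src b) (deg c - deg a - deg b)"
        if "deg a + deg b < deg c"
      proof (rule AA_alin_param[OF ab(2,6)])
        fix l assume l: "lt (src b) l (tgt b)"
        have "cslot (\<lambda>d. F ((br a \<odot> d) # l @ W) n) (tgt a) (src b) (deg c - deg a - deg b - 1)"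
          using slot[of "src b" l] l ab bD
          by (intro cslot_cc_right[where f = "\<lambda>d. F (d # l @ W) n"] br_in) auto
        then show "alin s (\<lambda>d. F ((br a \<odot> br d) # l @ W) n) (tgt a) (src b) (deg c - deg a - deg b)"
          using that aD bD by (intro alin_br) auto
      qed
    next
      fix a b assume ab: "a \<in> coalg_arrs C" "b \<in> coalg_arrs C" "src a = ?x" "tgt a = src b" "1 \<le> deg a" "1 \<le> deg b"
      note aD = coalg_arrsD[OF ab(1)] and bD = coalg_arrsD[OF ab(2)]
      show "alin s (\<lambda>d. AA (\<lambda>l. F ((br a \<odot> br b) # l @ W) n) d) (tgt b) ?y (deg c - deg a - deg b)"
        if "deg a + deg b < deg c"
        using lm_append_left[OF lmFW, of "[br a \<odot> br b]" "tgt b"] ab aD bD cD that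
        by (intro AA_alin) (auto simp: cc_in br_in)
    qed
    from patril_scale[OF this, of "\<lambda>i j k. ksign i"]
    show "patril s ?G ?x ?y (deg c)" .
  qed
  \<comment> \<open>The induction peels brackets from the left, whereas the claim separates the last
    bracket; coassociativity regroups the factors.\<close>
  have coassoc_K: "red s (\<lambda>a b. red s (\<lambda>b' b''. ?K a b' b'') b) c = red s (\<lambda>a b. red s (\<lambda>a' a''. ?K a' a'' b) a) c"
  proof (rule red_coassoc[OF c(1), symmetric])
    have "patril s (\<lambda>a b c. AA (\<lambda>l. J e (br c) (\<lambda>bs. F ((br a # l) @ bs)) W n) b) ?x ?y (deg c)"
    proof (rule patril_mid[OF cD(1,2), of "\<lambda>l c. J e (br c) (\<lambda>bs. F (l @ bs)) W n"])
      fix d assume d: "d \<in> coalg_arrs C" "1 \<le> deg d" "tgt d = ?y"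
      show "lm ?x (src d) (\<lambda>l. J e (br d) (\<lambda>bs. F (l @ bs)) W n)"
      proof (cases W)
        case Nil
        have "br d \<rhd> n \<in> mod_arrs C N" using d W Nil n by (intro la_in br_in) auto
        from lmlD[OF F this] show ?thesis
          using Nil by (auto simp: lm_def intro!: cslot_uminus cslot_scale)
      next
        case (Cons v V)
        then have "lt (src d) ((br d \<odot> v) # V) (src n)" using d W by (auto intro!: cc_in br_in)
        from lm_append_right[OF lmF this] show ?thesis
          using Cons by (auto simp: lm_def intro!: cslot_scale)
      qed
    next
      fix l z k assume l: "lt ?x l z" "z \<in> points C" "1 \<le> (k::int)"
      from cslot_J[OF lml_append_left[OF F l(1)] W n l(2) cD(2)]
      have "cslot (\<lambda>a. J e a (\<lambda>bs. F (l @ bs)) W n) z ?y (k - 1)" .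
      then show "alin s (\<lambda>d. J e (br d) (\<lambda>bs. F (l @ bs)) W n) z ?y k"
        by (rule alin_br) (use l cD in auto)
    qed
    from patril_scale[OF this, of "\<lambda>i j k. ksign (i + j)"]
    show "patril s ?K ?x ?y (deg c)" by (simp add: add.assoc J_shift AA_scale)
  qed
  have "AA (\<lambda>l. rb e F (l @ W) n) c = rb e F (br c # W) n + red s (\<lambda>a b. AA (\<lambda>l. rb e F (br a # l @ W) n) b) c"
    by (subst AA_left[OF c]) simp
  also have "red s (\<lambda>a b. AA (\<lambda>l. rb e F (br a # l @ W) n) b) c
      = red s (\<lambda>a b. s (ksign e) (?T a b) - s (ksign e) (red s (\<lambda>a' a''. ?G a' a'' b) a)
        + s (ksign e) (?X1 a b) + s (ksign e) (red s (\<lambda>b' b''. ?G a b' b'') b)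
        + s (ksign e) (?U a b) + ?J1 a b + red s (\<lambda>b' b''. ?K a b' b'') b + ?R a b) c"
    by (rule red_cong[OF mod c(1) step])
  also have "\<dots> = s (ksign e) (red s ?T c) + s (ksign e) (red s ?X1 c) + s (ksign e) (red s ?U c)
      + red s ?J1 c + red s (\<lambda>a b. red s (\<lambda>b' b''. ?K a b' b'') b) c + red s ?R c"
    by (simp add: red_add[OF mod] red_diff[OF mod] red_scale[OF mod] coassoc_G del: S.scale_scale)
  also have "rb e F (br c # W) n = - s (ksign e) (F (Da (br c) # W) n) + J e (br c) F W n
      + rb (e + deg c) (\<lambda>bs. F (br c # bs)) W n"
    by (simp add: algebra_simps)
  also note head
  finally have LHS: "AA (\<lambda>l. rb e F (l @ W) n) c
      = s (ksign e) ((if 2 \<le> deg c then F (br (dC c) # W) n else 0) + red s ?T c + red s ?U c)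
      + (J e (br c) F W n + red s ?J1 c + red s (\<lambda>a b. red s (\<lambda>b' b''. ?K a b' b'') b) c)
      + (rb (e + deg c) (\<lambda>bs. F (br c # bs)) W n + red s ?R c)"
    by (simp add: S.scale_right_distrib S.scale_right_diff_distrib algebra_simps)
  \<comment> \<open>The reduced coderivation identity reassembles the terms with d on one factor
    into the cuts of dc.\<close>
  have 1: "(if 2 \<le> deg c then AA (\<lambda>l. F (l @ W) n) (dC c) else 0)
      = (if 2 \<le> deg c then F (br (dC c) # W) n else 0) + red s ?T c + red s ?U c"
  proof (cases "2 \<le> deg c")
    case True
    have "AA (\<lambda>l. F (l @ W) n) (dC c) = F (br (dC c) # W) n + red s (\<lambda>a b. AA (\<lambda>l. F (br a # l @ W) n) b) (dC c)"
      by (subst AA_left) (use True dC_coalg_arrs[OF c] in auto)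
    also have "red s (\<lambda>a b. AA (\<lambda>l. F (br a # l @ W) n) b) (dC c)
        = red s (\<lambda>a b. ?T a b + ?U a b) c"
      using red_coder[OF c pabil_AA[OF lmFW cD(1,2)]]
      by (simp add: if_distrib[of "s _"] cong: if_cong)
    finally show ?thesis using True by (simp add: red_add[OF mod] add.assoc)
  next
    case False
    then have "deg c \<le> 1" by simp
    then show ?thesis using False by (simp add: red_degree_1[OF mod c(1)])
  qed
  have 2: "red s (\<lambda>a b. AA (\<lambda>l. J (e + deg a) (br b) (\<lambda>bs. F (l @ bs)) W n) a) c
      = red s ?J1 c + red s (\<lambda>a b. red s (\<lambda>b' b''. ?K a b' b'') b) c"
  proof -
    have "red s (\<lambda>a b. AA (\<lambda>l. J (e + deg a) (br b) (\<lambda>bs. F (l @ bs)) W n) a) c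
        = red s (\<lambda>a b. ?J1 a b + red s (\<lambda>a' a''. ?K a' a'' b) a) c"
    proof (rule red_cong[OF mod c(1)])
      fix a b assume "(a, b) \<in> psplits c"
      note ab = psplitsD[OF this]
      have "AA (\<lambda>l. J (e + deg a) (br b) (\<lambda>bs. F (l @ bs)) W n) a
          = ?J1 a b + red s (\<lambda>a' a''. AA (\<lambda>l. J (e + deg a) (br b) (\<lambda>bs. F (br a' # l @ bs)) W n) a'') a"
        by (subst AA_left[OF ab(1,7)]) simp
      also have "red s (\<lambda>a' a''. AA (\<lambda>l. J (e + deg a) (br b) (\<lambda>bs. F (br a' # l @ bs)) W n) a'') a
          = red s (\<lambda>a' a''. ?K a' a'' b) a"
        by (rule red_cong[OF mod ab(1)]) (auto dest!: psplitsD(6) simp: add.assoc)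
      finally show "AA (\<lambda>l. J (e + deg a) (br b) (\<lambda>bs. F (l @ bs)) W n) a
          = ?J1 a b + red s (\<lambda>a' a''. ?K a' a'' b) a" .
    qed
    then show ?thesis by (simp add: red_add[OF mod] coassoc_K)
  qed
  have 3: "AA (\<lambda>l. rb (e + deg c) (\<lambda>bs. F (l @ bs)) W n) c = rb (e + deg c) (\<lambda>bs. F (br c # bs)) W n + red s ?R c"
    by (subst AA_left[OF c]) simp
  show ?case unfolding LHS 1 2 3 by (simp add: add.assoc)
qed

end

section \<open>Well-definedness of the maps\<close>

context bar_context
begin

lemma cslot_words:
  assumes "cslot f x y j" and "a \<in> cobar_arrs C" "src a = x" "tgt a = y" "deg a = j"
  shows "f a = wx s (\<lambda>cs. f (mono_arr x cs y)) (elt a)"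
proof -
  have a: "elt a \<in> cobar_hom C x y j" using cobar_arrsD(3)[OF assms(2)] assms by simp
  have "f a = f (Arr x j (elt a) y)" using assms by (metis arr.collapse)
  also have "\<dots> = wx s (\<lambda>cs. f (Arr x j (gen (x, cs)) y)) (elt a)"
    using assms(1) by (intro wx_hom[OF mod _ a]) (simp add: cslot_def)
  also have "\<dots> = wx s (\<lambda>cs. f (mono_arr x cs y)) (elt a)"
    by (rule wx_cong[OF mod a]) (simp add: mono_arr_def)
  finally show ?thesis .
qed

lemma cslot_of_wml:
  assumes "wml s \<phi> x y"
  shows "cslot (\<lambda>a. wx s \<phi> (elt a)) x y j"
  using wml_rel[OF assms] by (auto simp: cslot_def wx_lin[OF mod])

lemma wml_of_cslot:
  assumes "\<And>j. cslot f x y j"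
  shows "wml s (\<lambda>cs. f (mono_arr x cs y)) x y"
  using wml_of_linear[OF mod, of x y "\<lambda>j u. f (Arr x j u y)"] assms
  by (simp add: cslot_def mono_arr_def)

text \<open>A slot function is determined by its values on words. Moving the first bracket of a word
  from the slot onto the module element shortens the word, so the statement must hold for all
  \<open>m\<close> at once.\<close>

lemma slot_word_induct:
  assumes "\<And>m j. m \<in> mod_arrs C M \<Longrightarrow> cslot (f m) (tgt m) y j" "\<And>m j. m \<in> mod_arrs C M \<Longrightarrow> cslot (g m) (tgt m) y j"
    and "\<And>m. m \<in> mod_arrs C M \<Longrightarrow> tgt m = y \<Longrightarrow> f m (ident y) = g m (ident y)"
    and "\<And>m c v. m \<in> mod_arrs C M \<Longrightarrow> c \<in> coalg_arrs C \<Longrightarrow> 1 \<le> deg c \<Longrightarrow> tgt m = src c \<Longrightarrow>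
      v \<in> cobar_arrs C \<Longrightarrow> src v = tgt c \<Longrightarrow> tgt v = y \<Longrightarrow> f (m \<lhd> br c) v = g (m \<lhd> br c) v \<Longrightarrow>
      f m (br c \<odot> v) = g m (br c \<odot> v)"
    and "m \<in> mod_arrs C M" "a \<in> cobar_arrs C" "tgt m = src a" "tgt a = y"
  shows "f m a = g m a"
proof -
  have words: "f m (mono_arr (tgt m) cs y) = g m (mono_arr (tgt m) cs y)"
    if "m \<in> mod_arrs C M" "wd (tgt m) cs y" for m cs
    using that
  proof (induction cs arbitrary: m)
    case (Cons c cs)
    then have c: "c \<in> coalg_arrs C" "1 \<le> deg c" "tgt m = src c" "wd (tgt c) cs y" by auto
    have "m \<lhd> br c \<in> mod_arrs C M" using Cons.prems c by (auto intro: ra_in br_in)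
    from Cons.IH[OF this] c have "f (m \<lhd> br c) (mono_arr (tgt c) cs y) = g (m \<lhd> br c) (mono_arr (tgt c) cs y)" by simp
    from assms(4)[OF Cons.prems(1) c(1-3) mono_in[OF c(4)] _ _ this]
    show ?case using c by (simp add: brace_mono mono_cc)
  qed (use assms(3) in auto)
  have "f m a = wx s (\<lambda>cs. f m (mono_arr (tgt m) cs y)) (elt a)"
    using assms by (intro cslot_words[OF assms(1)]) auto
  also have "\<dots> = wx s (\<lambda>cs. g m (mono_arr (tgt m) cs y)) (elt a)"
    using assms cobar_arrsD(3)[OF assms(6)] by (intro wx_cong[OF mod _ words]) auto
  also have "\<dots> = g m a"
    using assms by (intro cslot_words[OF assms(2), symmetric]) auto
  finally show ?thesis .
qed

text \<open>Labelled arrows cannot be added, so the Leibniz rule is stated for the values of a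
  function that is linear in the slot; the same applies to the two module versions below.\<close>

lemma slot_Da_cc:
  assumes "cslot f (src a) (tgt b) (deg a + deg b - 1)" and "a \<in> cobar_arrs C" "b \<in> cobar_arrs C" "tgt a = src b"
  shows "f (Da (a \<odot> b)) = f (Da a \<odot> b) + s (ksign (deg a)) (f (a \<odot> Da b))"
proof -
  let ?A = "\<lambda>u. Arr (src a) (deg a + deg b - 1) u (tgt b)"
  note a = cobar_arrsD(3)[OF assms(2)] and b = cobar_arrsD(3)[OF assms(3)]
  have h1: "cobar_comp (cobar_diff C (elt a)) (elt b) \<in> cobar_hom C (src a) (tgt b) (deg a + deg b - 1)"
    using cobar_comp_hom[OF cobar_diff_hom[OF a], of "elt b" "tgt b" "deg b"] b assms(4) by (simp add: algebra_simps)
  have h2: "cobar_comp (elt a) (cobar_diff C (elt b)) \<in> cobar_hom C (src a) (tgt b) (deg a + deg b - 1)"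
    using cobar_comp_hom[OF a, of "cobar_diff C (elt b)" "tgt b" "deg b - 1"] cobar_diff_hom[OF b] assms(4)
    by (simp add: algebra_simps)
  have "Da (a \<odot> b) = ?A (cobar_comp (cobar_diff C (elt a)) (elt b)
      + fscale (ksign (deg a)) (cobar_comp (elt a) (cobar_diff C (elt b))))"
    using cobar_diff_comp[OF a, of "elt b" "tgt b" "deg b"] b assms(4) by (intro arr_eqI) simp_all
  moreover have "Da a \<odot> b = ?A (cobar_comp (cobar_diff C (elt a)) (elt b))"
    "a \<odot> Da b = ?A (cobar_comp (elt a) (cobar_diff C (elt b)))"
    by (rule arr_eqI; simp)+
  moreover have lin: "lin_on fscale (cobar_hom C (src a) (tgt b) (deg a + deg b - 1)) s (\<lambda>u. f (?A u))"
    using assms(1) by (simp add: cslot_def)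
  ultimately show ?thesis
    using lin_on_addD[OF lin h1 cobar_hom_closed(5)[OF h2]] lin_on_scaleD[OF lin h2] by simp
qed

lemma slot_dM_ra:
  assumes "mlin f (src m) (tgt a) (deg m + deg a - 1)" and "m \<in> mod_arrs C M" "a \<in> cobar_arrs C" "tgt m = src a"
  shows "f (dM (m \<lhd> a)) = f (dM m \<lhd> a) + s (ksign (deg m)) (f (m \<lhd> Da a))"
proof -
  let ?A = "\<lambda>u. Arr (src m) (deg m + deg a - 1) u (tgt a)"
  note m = mod_arrsD[OF assms(2)] and a = cobar_arrsD[OF assms(3)]
  have h1: "ract M (bdiff M (elt m)) (elt a) \<in> piece M (src m) (tgt a) (deg m + deg a - 1)"
    using mod_arrsD(3)[OF ra_in[OF dM_in[OF assms(2)] assms(3)]] assms(4) by (simp add: algebra_simps)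
  have h2: "ract M (elt m) (cobar_diff C (elt a)) \<in> piece M (src m) (tgt a) (deg m + deg a - 1)"
    using mod_arrsD(3)[OF ra_in[OF assms(2) Da_in[OF assms(3)]]] assms(4) by (simp add: algebra_simps)
  have "dM (m \<lhd> a) = ?A (ract M (bdiff M (elt m)) (elt a)
      + bmul M (ksign (deg m)) (ract M (elt m) (cobar_diff C (elt a))))"
    using RM.ract_leibniz[of "src m" "tgt m" "tgt a" "elt m" "deg m" "elt a" "deg a"] m a assms(4)
    by (intro arr_eqI) simp_all
  moreover have "dM m \<lhd> a = ?A (ract M (bdiff M (elt m)) (elt a))"
    "m \<lhd> Da a = ?A (ract M (elt m) (cobar_diff C (elt a)))"
    by (rule arr_eqI; simp)+
  moreover note lin = assms(1)[unfolded mlin_def]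
  ultimately show ?thesis
    using lin_on_addD[OF lin h1 module.subspace_scale[OF RM.module_M subspace_M[OF m(1) a(2)] h2]]
      lin_on_scaleD[OF lin h2] by simp
qed

lemma slot_dN_la:
  assumes "nlin f (src a) (tgt n) (deg a + deg n - 1)" and "a \<in> cobar_arrs C" "n \<in> mod_arrs C N" "tgt a = src n"
  shows "f (dN (a \<rhd> n)) = f (Da a \<rhd> n) + s (ksign (deg a)) (f (a \<rhd> dN n))"
proof -
  let ?A = "\<lambda>u. Arr (src a) (deg a + deg n - 1) u (tgt n)"
  note n = mod_arrsD[OF assms(3)] and a = cobar_arrsD[OF assms(2)]
  have h1: "lact N (cobar_diff C (elt a)) (elt n) \<in> piece N (src a) (tgt n) (deg a + deg n - 1)"
    using mod_arrsD(3)[OF la_in[OF Da_in[OF assms(2)] assms(3)]] assms(4) by (simp add: algebra_simps)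
  have h2: "lact N (elt a) (bdiff N (elt n)) \<in> piece N (src a) (tgt n) (deg a + deg n - 1)"
    using mod_arrsD(3)[OF la_in[OF assms(2) dN_in[OF assms(3)]]] assms(4) by (simp add: algebra_simps)
  have "dN (a \<rhd> n) = ?A (lact N (cobar_diff C (elt a)) (elt n)
      + bmul N (ksign (deg a)) (lact N (elt a) (bdiff N (elt n))))"
    using LN.lact_leibniz[of "src a" "src n" "tgt n" "elt a" "deg a" "elt n" "deg n"] n a assms(4)
    by (intro arr_eqI) simp_all
  moreover have "Da a \<rhd> n = ?A (lact N (cobar_diff C (elt a)) (elt n))"
    "a \<rhd> dN n = ?A (lact N (elt a) (bdiff N (elt n)))"
    by (rule arr_eqI; simp)+
  moreover note lin = assms(1)[unfolded nlin_def]
  ultimately show ?thesis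
    using lin_on_addD[OF lin h1 module.subspace_scale[OF LN.module_M subspace_N[OF a(1) n(2)] h2]]
      lin_on_scaleD[OF lin h2] by simp
qed

subsection \<open>The bar differential\<close>

text \<open>\<open>bml B\<close> and \<open>qml Q\<close> say that \<open>B\<close> and \<open>Q\<close> descend to linear maps out of \<open>Bar\<close> and \<open>\<Q>\<close>.  The
  composites \<open>B \<circ> \<partial>\<close>, \<open>Q \<circ> \<partial>\<^sub>\<Q>\<close>, \<open>Q \<circ> \<pi>\<close>, \<open>B \<circ> \<alpha>\<close> and \<open>B \<circ> H\<close> are \<open>bd B\<close>, \<open>qd Q\<close>, \<open>BP Q\<close>, \<open>AB B\<close> and \<open>HB B\<close>.\<close>

definition bml :: "(('k, 'c, 'm, 'n) bar_gen \<Rightarrow> 'q) \<Rightarrow> bool" where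
  "bml B \<longleftrightarrow> (\<forall>m\<in>mod_arrs C M. lml (tgt m) (\<lambda>as n. B (m, as, n)) \<and> nrm (tgt m) (\<lambda>as n. B (m, as, n))
     \<and> (\<forall>as. \<forall>n\<in>mod_arrs C N. lt (tgt m) as (src n) \<longrightarrow> mlin (\<lambda>m. B (m, as, n)) (src m) (tgt m) (deg m)))"

lemma bml_lml: "bml B \<Longrightarrow> m \<in> mod_arrs C M \<Longrightarrow> tgt m = x \<Longrightarrow> lml x (\<lambda>as n. B (m, as, n))"
  and bml_nrm: "bml B \<Longrightarrow> m \<in> mod_arrs C M \<Longrightarrow> tgt m = x \<Longrightarrow> nrm x (\<lambda>as n. B (m, as, n))"
  by (auto simp: bml_def)

lemma bml_mlin:
  assumes "bml B" and "x \<in> points C" "y \<in> points C" "lt y as (src n)" "n \<in> mod_arrs C N"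
  shows "mlin (\<lambda>m. B (m, as, n)) x y j"
proof -
  have "Arr x j 0 y \<in> mod_arrs C M"
    using assms module.subspace_0[OF RM.module_M subspace_M] by (simp add: mod_arrs_def)
  then show ?thesis using assms unfolding bml_def by fastforce
qed

lemma bmlI:
  assumes "\<And>m. m \<in> mod_arrs C M \<Longrightarrow> lml (tgt m) (\<lambda>as n. B (m, as, n))"
    and "\<And>m. m \<in> mod_arrs C M \<Longrightarrow> nrm (tgt m) (\<lambda>as n. B (m, as, n))"
    and "\<And>x y j as n. x \<in> points C \<Longrightarrow> y \<in> points C \<Longrightarrow> lt y as (src n) \<Longrightarrow> n \<in> mod_arrs C N \<Longrightarrow>
      mlin (\<lambda>m. B (m, as, n)) x y j"
  shows "bml B"
  unfolding bml_def using assms(1,2) by (auto intro!: assms(3) dest: mod_arrsD(1,2)[where B = M])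

lemma bml_slot:
  assumes "bml B" and "m \<in> mod_arrs C M" "n \<in> mod_arrs C N" and "lt (tgt m) as x" "lt y bs (src n)"
    and "x \<in> points C" "y \<in> points C"
  shows "cslot (\<lambda>a. B (m, as @ a # bs, n)) x y j"
  using lmD[OF lmlD[OF bml_lml[OF assms(1,2) refl] assms(3)] assms(4-7)] .

lemma bml_slot_hd:
  assumes "bml B" and "m \<in> mod_arrs C M" "n \<in> mod_arrs C N" and "lt y bs (src n)" and "y \<in> points C"
  shows "cslot (\<lambda>a. B (m, a # bs, n)) (tgt m) y j"
  using bml_slot[OF assms(1-3), of "[]" "tgt m" y bs] assms mod_arrsD[OF assms(2)] by simp

lemma bml_nlin:
  assumes "bml B" and "m \<in> mod_arrs C M" and "lt (tgt m) as p" and "p \<in> points C" "q \<in> points C"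
  shows "nlin (\<lambda>n. B (m, as, n)) p q j"
  using lmlD_n[OF bml_lml[OF assms(1,2) refl] assms(3-5)] .

lemma bml_ident_hd:
  assumes "bml B" and "m \<in> mod_arrs C M" "n \<in> mod_arrs C N" and "lt (tgt m) bs (src n)"
  shows "B (m, ident (tgt m) # bs, n) = 0"
  using nrmD[OF bml_nrm[OF assms(1,2) refl] assms(3), of "[]"] assms(4)
    ident_in mod_arrsD[OF assms(2)] by simp

definition bd :: "(('k, 'c, 'm, 'n) bar_gen \<Rightarrow> 'q) \<Rightarrow> ('k, 'c, 'm, 'n) bar_gen \<Rightarrow> 'q" where
  "bd B = (\<lambda>(m, as, n). B (dM m, as, n)
     + (case as of [] \<Rightarrow> 0 | a # bs \<Rightarrow> s (ksign (deg m)) (B (m \<lhd> a, bs, n)))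
     + rb (deg m) (\<lambda>as n. B (m, as, n)) as n)"

lemma bd_simps:
  "bd B (m, [], n) = B (dM m, [], n) + s (ksign (deg m)) (B (m, [], dN n))"
  "bd B (m, a # as, n) = B (dM m, a # as, n) + s (ksign (deg m)) (B (m \<lhd> a, as, n))
     + rb (deg m) (\<lambda>as n. B (m, as, n)) (a # as) n"
  by (simp_all add: bd_def)

text \<open>Unrolls the recursion into the indexed sums of the definition of the bar differential;
  it is only used to identify \<open>bd\<close> with that definition.\<close>

lemma rb_index:
  "rb e F as n = - (\<Sum>i<length as. s (ksign (e + (\<Sum>a\<leftarrow>take i as. deg a + 1))) (F (as[i := Da (as ! i)]) n))
     + s (ksign (e + (\<Sum>a\<leftarrow>as. deg a + 1))) (F as (dN n))
     + (if as = [] then 0 else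
         (\<Sum>i<length as - 1. s (ksign (e + (\<Sum>a\<leftarrow>take (Suc i) as. deg a + 1)))
            (F (take i as @ [(as ! i) \<odot> (as ! Suc i)] @ drop (i + 2) as) n))
       - s (ksign (e + (\<Sum>a\<leftarrow>take (length as - 1) as. deg a + 1))) (F (butlast as) (last as \<rhd> n)))"
proof (induction as arbitrary: e F)
  case (Cons a as)
  let ?e = "e + deg a + 1"
  have 1: "(\<Sum>i<length (a # as). s (ksign (e + (\<Sum>a\<leftarrow>take i (a # as). deg a + 1))) (F ((a # as)[i := Da ((a # as) ! i)]) n))
      = s (ksign e) (F (Da a # as) n)
        + (\<Sum>i<length as. s (ksign (?e + (\<Sum>a\<leftarrow>take i as. deg a + 1))) (F (a # as[i := Da (as ! i)]) n))"
    by (simp add: sum.lessThan_Suc_shift add_ac del: sum.lessThan_Suc)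
  show ?case
  proof (cases as)
    case Nil
    then show ?thesis by (simp add: add_ac)
  next
    case (Cons b bs)
    have 2: "(\<Sum>i<length (a # as) - 1. s (ksign (e + (\<Sum>a\<leftarrow>take (Suc i) (a # as). deg a + 1)))
            (F (take i (a # as) @ [((a # as) ! i) \<odot> ((a # as) ! Suc i)] @ drop (i + 2) (a # as)) n))
      = s (ksign ?e) (F ((a \<odot> b) # bs) n)
       + (\<Sum>i<length as - 1. s (ksign (?e + (\<Sum>a\<leftarrow>take (Suc i) as. deg a + 1)))
            (F (a # take i as @ [(as ! i) \<odot> (as ! Suc i)] @ drop (i + 2) as) n))"
      using Cons by (simp add: sum.lessThan_Suc_shift add_ac del: sum.lessThan_Suc)
    have 3: "e + (\<Sum>a\<leftarrow>take (length (a # as) - 1) (a # as). deg a + 1) = ?e + (\<Sum>a\<leftarrow>take (length as - 1) as. deg a + 1)"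
      using Cons by (simp add: add_ac)
    have 4: "e + (\<Sum>a\<leftarrow>a # as. deg a + 1) = ?e + (\<Sum>a\<leftarrow>as. deg a + 1)" by (simp add: add_ac)
    have ne: "as \<noteq> []" using Cons by simp
    have J: "J e a F as n = s (ksign ?e) (F ((a \<odot> b) # bs) n)" using Cons by simp
    show ?thesis
      unfolding rb.simps Cons.IH 1 2 3 4 J using ne
      by (simp add: algebra_simps)
  qed
qed simp

lemma lext_bar_diff: "lext s B (bar_diff_gen C M N (m, as, n)) = bd B (m, as, n)"
proof (cases as)
  case Nil
  then show ?thesis
    by (simp add: bd_simps bar_diff_gen_def bar_theta_def bar_eta_def S.lext_simps)
next
  case (Cons a bs)
  have "lext s B (bar_diff_gen C M N (m, as, n)) = B (dM m, as, n) + s (ksign (deg m)) (B (m \<lhd> a, bs, n))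
      + rb (deg m) (\<lambda>as n. B (m, as, n)) as n"
    unfolding rb_index using Cons
    by (simp add: bar_diff_gen_def bar_theta_def bar_eta_def S.lext_simps algebra_simps del: sum.lessThan_Suc)
  then show ?thesis using Cons by (simp add: bd_simps)
qed

lemma lml_add: "lml x F \<Longrightarrow> lml x G \<Longrightarrow> lml x (\<lambda>as n. F as n + G as n)"
  unfolding lml_def lm_def nlin_def by (auto intro: cslot_add S.lin_on_add)

lemma bml_bd:
  assumes "bml B"
  shows "bml (bd B)"
proof (rule bmlI)
  fix m assume m: "m \<in> mod_arrs C M"
  note mD = mod_arrsD[OF m]
  let ?F = "\<lambda>as n. B (m, as, n)" and ?H = "\<lambda>as n. case as of [] \<Rightarrow> 0 | a # bs \<Rightarrow> s (ksign (deg m)) (B (m \<lhd> a, bs, n))"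
  have "lml (tgt m) ?H"
  proof -
    have "lm (tgt m) (src n) (\<lambda>as. ?H as n)" if n: "n \<in> mod_arrs C N" for n
    proof (rule lmI)
      fix as a bs assume lt: "lt (tgt m) (as @ a # bs) (src n)"
      show "cslot (\<lambda>a. ?H (as @ a # bs) n) (src a) (tgt a) (deg a)"
      proof (cases as)
        case Nil
        then have a: "a \<in> cobar_arrs C" "src a = tgt m" "lt (tgt a) bs (src n)" using lt by auto
        have "cslot (\<lambda>a. B (m \<lhd> a, bs, n)) (src a) (tgt a) (deg a)"
          using a m mD n cobar_arrsD[OF a(1)] by (intro cslot_ra bml_mlin[OF assms]) auto
        then show ?thesis using Nil by (simp add: cslot_scale)
      next
        case (Cons b as')
        then have b: "b \<in> cobar_arrs C" "src b = tgt m" "lt (tgt b) (as' @ a # bs) (src n)" using lt by auto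
        then obtain p where p: "lt (tgt b) as' p" "lt p (a # bs) (src n)" by (auto simp: lt_append)
        have "cslot (\<lambda>a. B (m \<lhd> b, as' @ a # bs, n)) (src a) (tgt a) (deg a)"
          using p b m cobar_arrsD[of a] by (intro bml_slot[OF assms ra_in n]) auto
        then show ?thesis using Cons by (simp add: cslot_scale)
      qed
    qed
    moreover have "nlin (?H as) (src n) (tgt n) (deg n)" if n: "n \<in> mod_arrs C N" "lt (tgt m) as (src n)" for as n
    proof (cases as)
      case (Cons b bs)
      then have "nlin (\<lambda>n. B (m \<lhd> b, bs, n)) (src n) (tgt n) (deg n)"
        using n m mod_arrsD[OF n(1)] by (intro bml_nlin[OF assms ra_in]) auto
      then show ?thesis using Cons by (auto simp: nlin_def intro: S.lin_on_scale)
    qed (simp add: nlin_def S.lin_on_zero)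
    ultimately show ?thesis by (simp add: lml_def)
  qed
  moreover have "lml (tgt m) (\<lambda>as n. B (dM m, as, n))"
    by (rule bml_lml[OF assms dM_in[OF m]]) simp
  moreover have "lml (tgt m) (rb (deg m) ?F)"
    by (rule lml_rb[OF bml_lml[OF assms m refl] mD(2)])
  ultimately show "lml (tgt m) (\<lambda>as n. bd B (m, as, n))"
    unfolding bd_def prod.case by (intro lml_add)
  show "nrm (tgt m) (\<lambda>as n. bd B (m, as, n))"
    unfolding nrm_def
  proof (intro allI ballI impI)
    fix as y bs n assume n: "n \<in> mod_arrs C N" and lt: "lt (tgt m) (as @ ident y # bs) (src n)"
    note l = bml_lml[OF assms m refl] and r = bml_nrm[OF assms m refl]
    have 1: "B (dM m, as @ ident y # bs, n) = 0"
      using nrmD[OF bml_nrm[OF assms dM_in[OF m]] n] lt by simp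
    show "bd B (m, as @ ident y # bs, n) = 0"
    proof (cases as)
      \<comment> \<open>Here the identity comes first: the action on \<open>m\<close> returns
        \<open>m\<close>, and the resulting term cancels the one left by
        \<open>rb_ident_head\<close>.\<close>
      case Nil
      then have y: "y = tgt m" "lt (tgt m) bs (src n)" using lt by auto
      show ?thesis
        using 1 Nil y rb_ident_head[OF l r y(2) n mD(2), of "deg m"] ra_ident[OF m]
        by (simp add: bd_simps del: rb.simps)
    next
      case (Cons b as')
      have "B (m \<lhd> b, as' @ ident y # bs, n) = 0"
        using nrmD[OF bml_nrm[OF assms ra_in[OF m]] n] lt Cons by simp
      then show ?thesis
        using 1 Cons rb_ident_later[OF l r _ n, of b as' y bs "deg m"] lt
        by (simp add: bd_simps del: rb.simps)
    qed
  qed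
next
  fix x y j as n
  assume xy: "x \<in> points C" "y \<in> points C" and lt: "lt y as (src n)" and n: "n \<in> mod_arrs C N"
  have 1: "mlin (\<lambda>m. B (dM m, as, n)) x y j"
    by (rule mlin_dM[OF bml_mlin[OF assms xy lt n] xy])
  have 2: "mlin (\<lambda>m. case as of [] \<Rightarrow> 0 | a # bs \<Rightarrow> s (ksign (deg m)) (B (m \<lhd> a, bs, n))) x y j"
  proof (cases as)
    case (Cons a bs)
    then have a: "a \<in> cobar_arrs C" "src a = y" "lt (tgt a) bs (src n)" using lt by auto
    have "mlin (\<lambda>m. B (m \<lhd> a, bs, n)) x y j"
      using a xy n cobar_arrsD[OF a(1)] by (intro mlin_ra bml_mlin[OF assms]) auto
    then show ?thesis using Cons by (auto simp: mlin_def intro: S.lin_on_scale)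
  qed (simp add: mlin_def S.lin_on_zero)
  have 3: "mlin (\<lambda>m. rb (deg m) (\<lambda>as n. B (m, as, n)) as n) x y j"
    unfolding mlin_def arr.sel
    by (rule rb_param[OF _ lt n]) (use bml_mlin[OF assms xy] in \<open>simp add: mlin_def\<close>)
  show "mlin (\<lambda>m. bd B (m, as, n)) x y j"
    using 1 2 3 unfolding bd_def prod.case mlin_def by (intro S.lin_on_add)
qed

end

context bar_context
begin

subsection \<open>The differential of the twisted tensor product\<close>

definition qml :: "(('c, 'm, 'n) q_gen \<Rightarrow> 'q) \<Rightarrow> bool" where
  "qml Q \<longleftrightarrow> (\<forall>m\<in>mod_arrs C M. \<forall>c\<in>coalg_arrs C. \<forall>n\<in>mod_arrs C N. tgt m = src c \<and> tgt c = src n \<longrightarrow>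
     mlin (\<lambda>m. Q (m, c, n)) (src m) (tgt m) (deg m) \<and> alin s (\<lambda>c. Q (m, c, n)) (src c) (tgt c) (deg c)
     \<and> nlin (\<lambda>n. Q (m, c, n)) (src n) (tgt n) (deg n))"

lemma zero_M: "x \<in> points C \<Longrightarrow> y \<in> points C \<Longrightarrow> Arr x j 0 y \<in> mod_arrs C M"
  using module.subspace_0[OF RM.module_M subspace_M] by (simp add: mod_arrs_def)

lemma zero_N: "x \<in> points C \<Longrightarrow> y \<in> points C \<Longrightarrow> Arr x j 0 y \<in> mod_arrs C N"
  using module.subspace_0[OF LN.module_M subspace_N] by (simp add: mod_arrs_def)

lemma zero_C: "x \<in> points C \<Longrightarrow> y \<in> points C \<Longrightarrow> 0 \<le> j \<Longrightarrow> Arr x j 0 y \<in> coalg_arrs C"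
  using cm.subspace_0[OF subspace_piece] by (intro Arr_coalg_arrs)

lemma qml_m:
  assumes "qml Q" and "c \<in> coalg_arrs C" "n \<in> mod_arrs C N" "tgt c = src n" and "x \<in> points C" "y = src c"
  shows "mlin (\<lambda>m. Q (m, c, n)) x y j"
  using assms zero_M[OF assms(5) coalg_arrsD(1)[OF assms(2)], of j] unfolding qml_def by fastforce

lemma qml_c:
  assumes "qml Q" and "m \<in> mod_arrs C M" "n \<in> mod_arrs C N" and "x = tgt m" "y = src n" "0 \<le> j"
  shows "alin s (\<lambda>c. Q (m, c, n)) x y j"
  using assms zero_C[OF mod_arrsD(2)[OF assms(2)] mod_arrsD(1)[OF assms(3)] assms(6)] unfolding qml_def by fastforce

lemma qml_n:
  assumes "qml Q" and "m \<in> mod_arrs C M" "c \<in> coalg_arrs C" "tgt m = src c" and "x = tgt c" "y \<in> points C"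
  shows "nlin (\<lambda>n. Q (m, c, n)) x y j"
  using assms zero_N[OF coalg_arrsD(2)[OF assms(3)] assms(6), of j] unfolding qml_def by fastforce

lemma qmlI:
  assumes "\<And>c n x j. c \<in> coalg_arrs C \<Longrightarrow> n \<in> mod_arrs C N \<Longrightarrow> tgt c = src n \<Longrightarrow> x \<in> points C \<Longrightarrow>
      mlin (\<lambda>m. Q (m, c, n)) x (src c) j"
    and "\<And>m n j. m \<in> mod_arrs C M \<Longrightarrow> n \<in> mod_arrs C N \<Longrightarrow> 0 \<le> j \<Longrightarrow> alin s (\<lambda>c. Q (m, c, n)) (tgt m) (src n) j"
    and "\<And>m c y j. m \<in> mod_arrs C M \<Longrightarrow> c \<in> coalg_arrs C \<Longrightarrow> tgt m = src c \<Longrightarrow> y \<in> points C \<Longrightarrow>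
      nlin (\<lambda>n. Q (m, c, n)) (tgt c) y j"
  shows "qml Q"
  unfolding qml_def
proof (intro ballI impI; elim conjE)
  fix m c n assume h: "m \<in> mod_arrs C M" "c \<in> coalg_arrs C" "n \<in> mod_arrs C N" "tgt m = src c" "tgt c = src n"
  show "mlin (\<lambda>m. Q (m, c, n)) (src m) (tgt m) (deg m) \<and> alin s (\<lambda>c. Q (m, c, n)) (src c) (tgt c) (deg c)
     \<and> nlin (\<lambda>n. Q (m, c, n)) (src n) (tgt n) (deg n)"
    using assms(1)[OF h(2,3,5) mod_arrsD(1)[OF h(1)]] assms(2)[OF h(1,3) coalg_arrsD(3)[OF h(2)]]
      assms(3)[OF h(1,2,4) mod_arrsD(2)[OF h(3)]] h by simp
qed

definition qd :: "(('c, 'm, 'n) q_gen \<Rightarrow> 'q) \<Rightarrow> ('c, 'm, 'n) q_gen \<Rightarrow> 'q" where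
  "qd Q = (\<lambda>(m, c, n). Q (dM m, c, n) + (if deg c \<noteq> 0 then s (ksign (deg m)) (Q (m, dC c, n)) else 0)
     + s (ksign (deg m + deg c)) (Q (m, c, dN n))
     + sw s (\<lambda>a b. s (ksign (deg m)) (Q (m \<lhd> br a, b, n))) c
     - sw s (\<lambda>a b. s (ksign (deg m + deg a)) (Q (m, a, br b \<rhd> n))) c)"

lemma lext_q_diff: "lext s Q (q_diff_gen C M N g) = qd Q g"
  by (cases g) (simp add: q_diff_gen_def qd_def S.lext_simps S.lext_lext sw_def split_def)

text \<open>In degree 0 the bracket is zero, so the slot function gives zero and linearity is
  trivial. This covers the full coproduct in the differential of \<Q>, where degree 0 factors do
  occur.\<close>

lemma alin_br0:
  assumes "cslot f x y (n - 1)" and "x \<in> points C" "y \<in> points C" "0 \<le> n"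
  shows "alin s (\<lambda>c. f (br c)) x y n"
proof (cases "1 \<le> n")
  case False
  have "f (br c) = 0" if "c \<in> coalg_arrs C" "src c = x" "tgt c = y" "deg c = n" for c
    using False that assms(4) rel_0
    by (intro cslot_rel[OF assms(1) br_in[OF that(1)]]) (auto simp: brace_def)
  then show ?thesis
    by (subst alin_cong[OF assms(2,3,4), of _ "\<lambda>c. 0"]) (auto simp: alin_zero[OF mod])
qed (intro alin_br assms)

lemma abil_left_action:
  assumes "qml Q" and "m \<in> mod_arrs C M" "n \<in> mod_arrs C N"
  shows "abil s (\<lambda>a b. s (ksign (deg m)) (Q (m \<lhd> br a, b, n))) (tgt m) (src n) k"
proof (rule abilI[OF mod])
  note mD = mod_arrsD[OF assms(2)] and nD = mod_arrsD[OF assms(3)]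
  fix b assume b: "b \<in> coalg_arrs C" "tgt b = src n" "deg b \<le> k"
  have "cslot (\<lambda>a. Q (m \<lhd> a, b, n)) (tgt m) (src b) (k - deg b - 1)"
    using mD coalg_arrsD[OF b(1)] b assms by (intro cslot_ra qml_m[OF assms(1)]) auto
  then show "alin s (\<lambda>a. s (ksign (deg m)) (Q (m \<lhd> br a, b, n))) (tgt m) (src b) (k - deg b)"
    using mD coalg_arrsD[OF b(1)] b by (intro alin_scale[OF mod] alin_br0) auto
next
  fix a assume a: "a \<in> coalg_arrs C" "src a = tgt m" "deg a \<le> k"
  then show "alin s (\<lambda>b. s (ksign (deg m)) (Q (m \<lhd> br a, b, n))) (tgt a) (src n) (k - deg a)"
    using assms by (intro alin_scale[OF mod] qml_c[OF assms(1)] ra_in br_in) auto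
qed

lemma abil_right_action:
  assumes "qml Q" and "m \<in> mod_arrs C M" "n \<in> mod_arrs C N"
  shows "abil s (\<lambda>a b. s (ksign (deg m + deg a)) (Q (m, a, br b \<rhd> n))) (tgt m) (src n) k"
proof (rule abilI[OF mod])
  note mD = mod_arrsD[OF assms(2)] and nD = mod_arrsD[OF assms(3)]
  fix b assume b: "b \<in> coalg_arrs C" "tgt b = src n" "deg b \<le> k"
  have "alin s (\<lambda>a. Q (m, a, br b \<rhd> n)) (tgt m) (src b) (k - deg b)"
    using assms b by (intro qml_c[OF assms(1)] la_in br_in) auto
  then show "alin s (\<lambda>a. s (ksign (deg m + deg a)) (Q (m, a, br b \<rhd> n))) (tgt m) (src b) (k - deg b)"
    by (rule alin_ksign(2)[OF mod])
next
  note mD = mod_arrsD[OF assms(2)] and nD = mod_arrsD[OF assms(3)]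
  fix a assume a: "a \<in> coalg_arrs C" "src a = tgt m" "deg a \<le> k"
  have "cslot (\<lambda>b. Q (m, a, b \<rhd> n)) (tgt a) (src n) (k - deg a - 1)"
    using nD coalg_arrsD[OF a(1)] a assms by (intro cslot_la qml_n[OF assms(1)]) auto
  then show "alin s (\<lambda>b. s (ksign (deg m + deg a)) (Q (m, a, br b \<rhd> n))) (tgt a) (src n) (k - deg a)"
    using nD coalg_arrsD[OF a(1)] a by (intro alin_scale[OF mod] alin_br0) auto
qed

lemma sw_param:
  assumes "c \<in> coalg_arrs C" and "\<And>a b. (a, b) \<in> splits c \<Longrightarrow> lin_on t V s (\<lambda>u. F u a b)"
  shows "lin_on t V s (\<lambda>u. sw s (F u) c)"
  unfolding sw_def split_def
  by (rule S.lin_on_lext) (use fsums_keysD[OF sweedler_spec(1)[OF assms(1)]] assms(2) in force)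

lemma splitsD:
  assumes "(a, b) \<in> splits c"
  shows "a \<in> coalg_arrs C" "b \<in> coalg_arrs C" "src a = src c" "tgt a = src b" "tgt b = tgt c"
    "deg a + deg b = deg c"
  using assms by (auto simp: splits_def)

lemma qml_qd:
  assumes "qml Q"
  shows "qml (qd Q)"
proof (rule qmlI)
  fix c n x j assume h: "c \<in> coalg_arrs C" "n \<in> mod_arrs C N" "tgt c = src n" "x \<in> points C"
  note cD = coalg_arrsD[OF h(1)] and nD = mod_arrsD[OF h(2)]
  have 1: "mlin (\<lambda>m. Q (dM m, c, n)) x (src c) j"
    using h cD by (intro mlin_dM qml_m[OF assms]) auto
  have 2: "mlin (\<lambda>m. Q (m, dC c, n)) x (src c) j" if "deg c \<noteq> 0"
    using h that cD dC_coalg_arrs[OF h(1)] by (intro qml_m[OF assms]) auto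
  have 3: "mlin (\<lambda>m. Q (m, c, dN n)) x (src c) j"
    using h dN_in[OF h(2)] by (intro qml_m[OF assms]) auto
  have 4: "mlin (\<lambda>m. Q (m \<lhd> br a, b, n)) x (src c) j" "mlin (\<lambda>m. Q (m, a, br b \<rhd> n)) x (src c) j"
    if "(a, b) \<in> splits c" for a b
    using splitsD[OF that] h coalg_arrsD[OF splitsD(1)[OF that]]
    by (auto intro!: mlin_ra qml_m[OF assms] br_in la_in)
  show "mlin (\<lambda>m. qd Q (m, c, n)) x (src c) j"
    unfolding qd_def prod.case mlin_def arr.sel
    using 1 2 3 4 unfolding mlin_def
    by (intro S.lin_on_add S.lin_on_diff S.lin_on_if S.lin_on_scale sw_param[OF h(1)] S.lin_on_zero) auto
next
  fix m n j assume h: "m \<in> mod_arrs C M" "n \<in> mod_arrs C N" "0 \<le> (j::int)"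
  note mD = mod_arrsD[OF h(1)] and nD = mod_arrsD[OF h(2)]
  have 1: "alin s (\<lambda>c. Q (dM m, c, n)) (tgt m) (src n) j"
    using h by (intro qml_c[OF assms] dM_in) auto
  have 2: "alin s (\<lambda>c. if deg c \<noteq> 0 then s (ksign (deg m)) (Q (m, dC c, n)) else 0) (tgt m) (src n) j"
    by (rule alin_filter[OF mod, where P = "\<lambda>k. k \<noteq> 0"])
      (use h mD nD in \<open>auto intro!: alin_scale[OF mod] alin_dC[where f = "\<lambda>c. Q (m, c, n)"] qml_c[OF assms]\<close>)
  have 3: "alin s (\<lambda>c. Q (m, c, dN n)) (tgt m) (src n) j"
    using h by (intro qml_c[OF assms] dN_in) auto
  have 4: "alin s (sw s (\<lambda>a b. s (ksign (deg m)) (Q (m \<lhd> br a, b, n)))) (tgt m) (src n) j"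
    "alin s (sw s (\<lambda>a b. s (ksign (deg m + deg a)) (Q (m, a, br b \<rhd> n)))) (tgt m) (src n) j"
    by (intro sw_alin abil_left_action abil_right_action assms h mD nD)+
  show "alin s (\<lambda>c. qd Q (m, c, n)) (tgt m) (src n) j"
    unfolding qd_def prod.case by (intro alin_add alin_diff mod 1 2 alin_ksign(2)[OF mod 3] 4)
next
  fix m c y j assume h: "m \<in> mod_arrs C M" "c \<in> coalg_arrs C" "tgt m = src c" "y \<in> points C"
  note cD = coalg_arrsD[OF h(2)] and mD = mod_arrsD[OF h(1)]
  have 1: "nlin (\<lambda>n. Q (m, c, dN n)) (tgt c) y j"
    using h cD by (intro nlin_dN qml_n[OF assms]) auto
  have 2: "nlin (\<lambda>n. Q (m, dC c, n)) (tgt c) y j" if "deg c \<noteq> 0"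
    using h that cD dC_coalg_arrs[OF h(2)] by (intro qml_n[OF assms]) auto
  have 3: "nlin (\<lambda>n. Q (dM m, c, n)) (tgt c) y j"
    using h dM_in[OF h(1)] by (intro qml_n[OF assms]) auto
  have 4: "nlin (\<lambda>n. Q (m \<lhd> br a, b, n)) (tgt c) y j" "nlin (\<lambda>n. Q (m, a, br b \<rhd> n)) (tgt c) y j"
    if "(a, b) \<in> splits c" for a b
    using splitsD[OF that] h coalg_arrsD[OF splitsD(1)[OF that]]
    by (auto intro!: nlin_la qml_n[OF assms] br_in ra_in)
  show "nlin (\<lambda>n. qd Q (m, c, n)) (tgt c) y j"
    unfolding qd_def prod.case nlin_def
    using 1 2 3 4 unfolding nlin_def
    by (intro S.lin_on_add S.lin_on_diff S.lin_on_if S.lin_on_scale sw_param[OF h(2)] S.lin_on_zero) auto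
qed

text \<open>The full coproduct is the reduced one plus x \<otimes> c and c \<otimes> y. In each of
  the two sums one of these extra terms contains the bracket of a point and vanishes. The bound 2 is
  justified because d is zero on C_1.\<close>

lemma qd_pos:
  assumes "qml Q" and "m \<in> mod_arrs C M" "c \<in> coalg_arrs C" "n \<in> mod_arrs C N" "tgt m = src c" "tgt c = src n" "1 \<le> deg c"
  shows "qd Q (m, c, n) = Q (dM m, c, n) + (if 2 \<le> deg c then s (ksign (deg m)) (Q (m, dC c, n)) else 0)
     + s (ksign (deg m + deg c)) (Q (m, c, dN n))
     + (s (ksign (deg m)) (Q (m \<lhd> br c, pt (tgt c), n)) + s (ksign (deg m)) (red s (\<lambda>a b. Q (m \<lhd> br a, b, n)) c))
     - (s (ksign (deg m)) (Q (m, pt (src c), br c \<rhd> n)) + s (ksign (deg m)) (red s (\<lambda>a b. s (ksign (deg a)) (Q (m, a, br b \<rhd> n))) c))"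
proof -
  note cD = coalg_arrsD[OF assms(3)] and mD = mod_arrsD[OF assms(2)] and nD = mod_arrsD[OF assms(4)]
  note ptL = pt_coalg_arrs[OF cD(1)] and ptR = pt_coalg_arrs[OF cD(2)]
  have 1: "s (ksign (deg m)) (Q (m \<lhd> br (pt (src c)), c, n)) = 0"
  proof -
    have "m \<lhd> br (pt (src c)) \<in> mod_arrs C M" using assms br_in[OF ptL] by (intro ra_in) auto
    moreover have "elt (m \<lhd> br (pt (src c))) = 0"
      using RM.ract_rel[of "src m" "tgt m" "tgt m" "elt m" "deg m" 0 "-1"] mD rel_0
      by (simp add: brace_def cobar_hom_closed)
    ultimately have "Q (m \<lhd> br (pt (src c)), c, n) = 0"
      using assms by (intro mlin_0[OF qml_m[OF assms(1,3,4,6) mD(1) refl, of "deg m - 1"]]) auto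
    then show ?thesis by simp
  qed
  have 2: "s (ksign (deg m + deg c)) (Q (m, c, br (pt (tgt c)) \<rhd> n)) = 0"
  proof -
    have "br (pt (tgt c)) \<rhd> n \<in> mod_arrs C N" using assms br_in[OF ptR] by (intro la_in) auto
    moreover have "elt (br (pt (tgt c)) \<rhd> n) = 0"
      using LN.lact_rel[of "src n" "src n" "tgt n" 0 "-1" "elt n" "deg n"] nD rel_0
      by (simp add: brace_def cobar_hom_closed)
    ultimately have "Q (m, c, br (pt (tgt c)) \<rhd> n) = 0"
      using assms by (intro nlin_0[OF qml_n[OF assms(1,2,3,5) refl nD(2), of "deg n - 1"]]) auto
    then show ?thesis by simp
  qed
  have 3: "(if deg c \<noteq> 0 then s (ksign (deg m)) (Q (m, dC c, n)) else 0)
      = (if 2 \<le> deg c then s (ksign (deg m)) (Q (m, dC c, n)) else 0)"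
  proof (cases "deg c = 1")
    case True
    have "elt c \<in> gr C 1" using cD True by (simp add: coalg_piece_def)
    then have "dC c = Arr (src c) 0 0 (tgt c)" using True codiff_1 by (intro arr_eqI) auto
    then have "Q (m, dC c, n) = 0"
      using alin_0[OF mod qml_c[OF assms(1,2,4) refl refl, of 0]] assms cD by simp
    then show ?thesis using True by simp
  qed (use assms(7) in auto)
  have 4: "s (ksign (deg m)) (red s (\<lambda>a b. Q (m \<lhd> br a, b, n)) c) = red s (\<lambda>a b. s (ksign (deg m)) (Q (m \<lhd> br a, b, n))) c"
    "s (ksign (deg m)) (red s (\<lambda>a b. s (ksign (deg a)) (Q (m, a, br b \<rhd> n))) c)
      = red s (\<lambda>a b. s (ksign (deg m + deg a)) (Q (m, a, br b \<rhd> n))) c"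
    by (simp_all add: red_scale[OF mod, symmetric] ksign_add)
  show ?thesis
    unfolding qd_def prod.case 3 4
      sw_split[OF assms(3) abil_left_action[OF assms(1,2,4), of "deg c", unfolded assms(5) assms(6)[symmetric]] assms(7)]
      sw_split[OF assms(3) abil_right_action[OF assms(1,2,4), of "deg c", unfolded assms(5) assms(6)[symmetric]] assms(7)]
    using 1 2 by simp
qed

lemma qd_0:
  assumes "qml Q" and "m \<in> mod_arrs C M" "c \<in> coalg_arrs C" "n \<in> mod_arrs C N" "tgt m = src c" "tgt c = src n" "deg c = 0"
  shows "qd Q (m, c, n) = Q (dM m, c, n) + s (ksign (deg m)) (Q (m, c, dN n))"
proof -
  note cD = coalg_arrsD[OF assms(3)] and mD = mod_arrsD[OF assms(2)] and nD = mod_arrsD[OF assms(4)]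
  note ptL = pt_coalg_arrs[OF cD(1)]
  have 1: "s (ksign (deg m)) (Q (m \<lhd> br (pt (src c)), c, n)) = 0"
  proof -
    have "m \<lhd> br (pt (src c)) \<in> mod_arrs C M" using assms br_in[OF ptL] by (intro ra_in) auto
    moreover have "elt (m \<lhd> br (pt (src c))) = 0"
      using RM.ract_rel[of "src m" "tgt m" "tgt m" "elt m" "deg m" 0 "-1"] mD rel_0
      by (simp add: brace_def cobar_hom_closed)
    ultimately have "Q (m \<lhd> br (pt (src c)), c, n) = 0"
      using assms by (intro mlin_0[OF qml_m[OF assms(1,3,4,6) mD(1) refl, of "deg m - 1"]]) auto
    then show ?thesis by simp
  qed
  have 2: "Q (m, pt (src c), br c \<rhd> n) = 0"
  proof -
    have "br c \<rhd> n \<in> mod_arrs C N" using assms br_in[OF assms(3)] by (intro la_in) auto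
    moreover have "elt (br c \<rhd> n) = 0"
      using LN.lact_rel[of "src c" "src n" "tgt n" 0 "-1" "elt n" "deg n"] nD cD rel_0 assms(7)
      by (simp add: brace_def cobar_hom_closed)
    moreover have "nlin (\<lambda>n. Q (m, pt (src c), n)) (src c) (tgt n) (deg n - 1)"
      using assms by (intro qml_n[OF assms(1,2) ptL _ _ nD(2)]) auto
    ultimately show ?thesis
      using assms by (intro nlin_0[where x = "src c" and y = "tgt n" and j = "deg n - 1"]) auto
  qed
  show ?thesis
    unfolding qd_def prod.case
      sw_degree_0[OF assms(3) abil_left_action[OF assms(1,2,4), of "deg c", unfolded assms(5) assms(6)[symmetric]] assms(7)]
      sw_degree_0[OF assms(3) abil_right_action[OF assms(1,2,4), of "deg c", unfolded assms(5) assms(6)[symmetric]] assms(7)]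
    using 1 2 assms(7) by simp
qed

subsection \<open>The projection\<close>

primrec pw :: "(('c, 'm, 'n) q_gen \<Rightarrow> 'q) \<Rightarrow> ('c, 'c) arr list \<Rightarrow> ('c, 'm) arr \<Rightarrow> ('c, 'n) arr \<Rightarrow> 'q" where
  "pw Q [] m n = 0"
| "pw Q (c # cs) m n = Q (m, c, mono_arr (tgt c) cs (src n) \<rhd> n)
     + s (ksign (deg c - 1)) (pw Q cs (m \<lhd> br c) n)"

lemma wd_take:
  assumes "wd x cs y" and "i < length cs"
  shows "wd x (take i cs) (src (cs ! i))" "wd (tgt (cs ! i)) (drop (Suc i) cs) y"
proof -
  have "cs = take i cs @ cs ! i # drop (Suc i) cs" using assms(2) by (rule id_take_nth_drop)
  then have "wd x (take i cs @ cs ! i # drop (Suc i) cs) y" using assms(1) by metis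
  then show "wd x (take i cs) (src (cs ! i))" "wd (tgt (cs ! i)) (drop (Suc i) cs) y"
    by (auto simp: wd_append)
qed

lemma mono_Cons: "1 \<le> deg c \<Longrightarrow> mono_arr (src c) (c # cs) y = br c \<odot> mono_arr (tgt c) cs y"
  by (simp add: brace_mono mono_cc)

lemma ra_mono_Cons:
  assumes "m \<in> mod_arrs C M" "c \<in> coalg_arrs C" "1 \<le> deg c" "tgt m = src c" "wd (tgt c) cs y"
  shows "m \<lhd> mono_arr (src c) (c # cs) y = m \<lhd> br c \<lhd> mono_arr (tgt c) cs y"
  using assms by (simp add: mono_Cons ra_assoc br_in mono_in)

text \<open>Splitting off the first letter moves its bracket onto \<open>m\<close> and takes the
  sign of that bracket out of all remaining summands.\<close>

lemma lext_pi_word: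
  assumes "m \<in> mod_arrs C M" and "n \<in> mod_arrs C N" and "wd (tgt m) cs (src n)"
  shows "lext s Q (pi_word M N m n (tgt m, cs)) = pw Q cs m n"
  using assms(1,3)
proof (induction cs arbitrary: m)
  case (Cons c cs)
  then have c: "c \<in> coalg_arrs C" "1 \<le> deg c" "tgt m = src c" "wd (tgt c) cs (src n)" by auto
  let ?t = "\<lambda>m cs i. s (ksign (letters_deg (take i cs))) (Q (m \<lhd> mono_arr (tgt m) (take i cs) (src (cs ! i)),
           cs ! i, mono_arr (tgt (cs ! i)) (drop (Suc i) cs) (src n) \<rhd> n))"
  have pi: "lext s Q (pi_word M N m n (tgt m, cs)) = (\<Sum>i<length cs. ?t m cs i)" for m cs
    by (simp add: pi_word_def S.lext_simps)
  have "?t m (c # cs) (Suc i) = s (ksign (deg c - 1)) (?t (m \<lhd> br c) cs i)" if "i < length cs" for i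
  proof -
    have "m \<lhd> mono_arr (tgt m) (c # take i cs) (src (cs ! i)) = m \<lhd> br c \<lhd> mono_arr (tgt c) (take i cs) (src (cs ! i))"
      using ra_mono_Cons[OF Cons.prems(1) c(1-3) wd_take(1)[OF c(4) that]] c(3) by simp
    then show ?thesis by (simp add: ksign_add[of "deg c - 1"])
  qed
  then have "(\<Sum>i<length (c # cs). ?t m (c # cs) i)
      = ?t m (c # cs) 0 + (\<Sum>i<length cs. s (ksign (deg c - 1)) (?t (m \<lhd> br c) cs i))"
    by (simp add: sum.lessThan_Suc_shift del: sum.lessThan_Suc)
  also have "?t m (c # cs) 0 = Q (m, c, mono_arr (tgt c) cs (src n) \<rhd> n)"
    using ra_ident[OF Cons.prems(1)] c(3) by simp
  also have "(\<Sum>i<length cs. s (ksign (deg c - 1)) (?t (m \<lhd> br c) cs i)) = s (ksign (deg c - 1)) (pw Q cs (m \<lhd> br c) n)"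
    using Cons.IH[of "m \<lhd> br c"] c Cons.prems pi[of "m \<lhd> br c" cs]
    by (simp add: ra_in br_in S.scale_sum_right del: S.scale_scale)
  finally show ?case unfolding pi by simp
qed (simp add: pi_word_def)

definition BP :: "(('c, 'm, 'n) q_gen \<Rightarrow> 'q) \<Rightarrow> ('k, 'c, 'm, 'n) bar_gen \<Rightarrow> 'q" where
  "BP Q g = lext s Q (pi_gen M N g)"

lemma BP_Nil [simp]: "BP Q (m, [], n) = Q (m, pt (tgt m), n)"
  and BP_two [simp]: "BP Q (m, a # b # as, n) = 0"
  by (simp_all add: BP_def pi_gen_def)

lemma BP_one:
  assumes "m \<in> mod_arrs C M" "n \<in> mod_arrs C N" "a \<in> cobar_arrs C" "tgt m = src a" "tgt a = src n"
  shows "BP Q (m, [a], n) = wx s (\<lambda>cs. pw Q cs m n) (elt a)"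
proof -
  have "BP Q (m, [a], n) = lext s (\<lambda>w. lext s Q (pi_word M N m n w)) (elt a)"
    by (simp add: BP_def pi_gen_def S.lext_lext)
  also have "\<dots> = wx s (\<lambda>cs. pw Q cs m n) (elt a)"
    unfolding wx_def
  proof (rule S.lext_cong, clarify)
    fix x cs assume "(x, cs) \<in> Poly_Mapping.keys (elt a)"
    from cobar_hom_keysD[OF cobar_arrsD(3)[OF assms(3)] this] assms
    show "lext s Q (pi_word M N m n (x, cs)) = pw Q cs m n"
      using lext_pi_word[OF assms(1,2), of cs Q] by simp
  qed
  finally show ?thesis .
qed

lemma pw_mlin:
  assumes "qml Q" and "n \<in> mod_arrs C N" and "wd y cs (src n)" and "x \<in> points C"
  shows "mlin (\<lambda>m. pw Q cs m n) x y j"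
  using assms(3)
proof (induction cs arbitrary: y j)
  case Nil
  then show ?case by (simp add: mlin_def S.lin_on_zero)
next
  case (Cons c cs y j)
  then have c: "c \<in> coalg_arrs C" "1 \<le> deg c" "src c = y" "wd (tgt c) cs (src n)" by auto
  have 1: "mlin (\<lambda>m. Q (m, c, mono_arr (tgt c) cs (src n) \<rhd> n)) x y j"
    using c assms by (intro qml_m[OF assms(1)] la_in mono_in) auto
  have 2: "mlin (\<lambda>m. pw Q cs (m \<lhd> br c) n) x y j"
    using c assms Cons.IH[OF c(4)] br_in[OF c(1)] by (intro mlin_ra) auto
  show ?case using 1 2 unfolding mlin_def pw.simps by (intro S.lin_on_add S.lin_on_scale)
qed

lemma pw_nlin:
  assumes "qml Q" and "m \<in> mod_arrs C M" and "wd (tgt m) cs x" and "y \<in> points C"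
  shows "nlin (\<lambda>n. pw Q cs m n) x y j"
  using assms(2,3)
proof (induction cs arbitrary: m)
  case Nil
  then show ?case by (simp add: nlin_def S.lin_on_zero)
next
  case (Cons c cs)
  then have c: "c \<in> coalg_arrs C" "1 \<le> deg c" "tgt m = src c" "wd (tgt c) cs x" by auto
  have "nlin (\<lambda>n. Q (m, c, mono_arr (tgt c) cs x \<rhd> n)) x y j"
    using c assms Cons.prems wd_points[OF c(4)] by (intro nlin_la qml_n[OF assms(1)] mono_in) auto
  then have 1: "nlin (\<lambda>n. Q (m, c, mono_arr (tgt c) cs (src n) \<rhd> n)) x y j" by (simp add: nlin_def)
  have 2: "nlin (\<lambda>n. pw Q cs (m \<lhd> br c) n) x y j"
    using c Cons.prems by (intro Cons.IH ra_in br_in) auto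
  show ?case using 1 2 unfolding nlin_def pw.simps by (intro S.lin_on_add S.lin_on_scale)
qed

lemma pw_wml:
  assumes "qml Q" and "m \<in> mod_arrs C M" "n \<in> mod_arrs C N"
  shows "wml s (\<lambda>cs. pw Q cs m n) (tgt m) (src n)"
proof (rule wmlI[OF mod])
  fix cs c ds assume "wd (tgt m) (cs @ c # ds) (src n)"
  then show "alin s (\<lambda>c. pw Q (cs @ c # ds) m n) (src c) (tgt c) (deg c)"
    using assms(2)
  proof (induction cs arbitrary: m)
    case Nil
    then have c: "c \<in> coalg_arrs C" "1 \<le> deg c" "tgt m = src c" "wd (tgt c) ds (src n)" by auto
    note cD = coalg_arrsD[OF c(1)]
    have 1: "alin s (\<lambda>e. Q (m, e, mono_arr (tgt c) ds (src n) \<rhd> n)) (src c) (tgt c) (deg c)"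
      using c cD Nil assms by (intro qml_c[OF assms(1)] la_in mono_in) auto
    have "cslot (\<lambda>a. pw Q ds (m \<lhd> a) n) (src c) (tgt c) (deg c - 1)"
      using c cD Nil mod_arrsD[OF Nil(2)] by (intro cslot_ra pw_mlin assms) auto
    then have 2: "alin s (\<lambda>e. pw Q ds (m \<lhd> br e) n) (src c) (tgt c) (deg c)"
      using c cD by (intro alin_br) auto
    have "alin s (\<lambda>e. Q (m, e, mono_arr (tgt c) ds (src n) \<rhd> n) + s (ksign (deg e - 1)) (pw Q ds (m \<lhd> br e) n))
        (src c) (tgt c) (deg c)"
      by (intro alin_add mod 1 alin_ksign(3)[OF mod 2])
    then show ?case by (simp add: alin_def)
  next
    case (Cons b cs)
    then have b: "b \<in> coalg_arrs C" "1 \<le> deg b" "tgt m = src b" "wd (tgt b) (cs @ c # ds) (src n)" by auto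
    note bD = coalg_arrsD[OF b(1)] and nD = mod_arrsD[OF assms(3)]
    have "cslot (\<lambda>a. Q (m, b, a \<rhd> n)) (tgt b) (src n) j" for j
      using b bD nD Cons assms by (intro cslot_la qml_n[OF assms(1)]) auto
    from wmlD[OF wml_of_cslot[where f = "\<lambda>a. Q (m, b, a \<rhd> n)", OF this] b(4)]
    have 1: "alin s (\<lambda>e. Q (m, b, mono_arr (tgt b) (cs @ e # ds) (src n) \<rhd> n)) (src c) (tgt c) (deg c)" .
    have 2: "alin s (\<lambda>e. pw Q (cs @ e # ds) (m \<lhd> br b) n) (src c) (tgt c) (deg c)"
      using b Cons by (intro Cons.IH ra_in br_in) auto
    show ?case unfolding append_Cons pw.simps by (intro alin_add alin_scale mod 1 2)
  qed
qed

lemma lin_on_wx: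
  assumes "a \<in> cobar_hom C x y j" and "\<And>cs. wd x cs y \<Longrightarrow> lin_on t V s (\<lambda>u. \<phi> u cs)"
  shows "lin_on t V s (\<lambda>u. wx s (\<phi> u) a)"
  unfolding wx_def split_def
  by (rule S.lin_on_lext) (use cobar_hom_keysD[OF assms(1)] assms(2) in blast)

lemma BP_slot:
  assumes "qml Q" and "m \<in> mod_arrs C M" "n \<in> mod_arrs C N"
  shows "cslot (\<lambda>a. BP Q (m, [a], n)) (tgt m) (src n) j"
  using cslot_of_wml[OF pw_wml[OF assms], of j] mod_arrsD[OF assms(2)] mod_arrsD[OF assms(3)]
  by (subst cslot_cong) (auto simp: BP_one[OF assms(2,3)])

lemma bml_BP:
  assumes "qml Q"
  shows "bml (BP Q)"
proof (rule bmlI)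
  fix m assume m: "m \<in> mod_arrs C M"
  note mD = mod_arrsD[OF m]
  have "lm (tgt m) (src n) (\<lambda>as. BP Q (m, as, n))" if n: "n \<in> mod_arrs C N" for n
  proof (rule lmI)
    fix as a bs assume lt: "lt (tgt m) (as @ a # bs) (src n)"
    show "cslot (\<lambda>a. BP Q (m, as @ a # bs, n)) (src a) (tgt a) (deg a)"
    proof (cases "as = [] \<and> bs = []")
      case True
      then show ?thesis using BP_slot[OF assms m n] lt by simp
    next
      case False
      then have "BP Q (m, as @ a # bs, n) = 0" for a
        by (cases as; cases bs; cases "tl as") auto
      then show ?thesis by (simp add: cslot_zero)
    qed
  qed
  moreover have "nlin (\<lambda>n. BP Q (m, as, n)) (src n) (tgt n) (deg n)"
    if n: "n \<in> mod_arrs C N" and lt: "lt (tgt m) as (src n)" for as n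
  \<comment> \<open>The rule serves only as a case distinction: the empty list, one entry, at least
    two entries.\<close>
  proof (cases as rule: remdups_adj.cases)
    case 1
    then show ?thesis
      using lt mD mod_arrsD[OF n] pt_coalg_arrs[OF mD(2)] by (auto intro!: qml_n[OF assms m])
  next
    case (2 a)
    then have a: "a \<in> cobar_arrs C" "src a = tgt m" "tgt a = src n" using lt by auto
    have "nlin (\<lambda>n. wx s (\<lambda>cs. pw Q cs m n) (elt a)) (src n) (tgt n) (deg n)"
      unfolding nlin_def
      by (rule lin_on_wx[OF cobar_arrsD(3)[OF a(1)]])
        (use pw_nlin[OF assms m] a mod_arrsD[OF n] in \<open>auto simp: nlin_def\<close>)
    then show ?thesis
      using 2 a mod_arrsD[OF n] by (subst nlin_cong) (auto simp: BP_one[OF m])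
  next
    case (3 a b as')
    then show ?thesis by (simp add: nlin_def S.lin_on_zero)
  qed
  ultimately show "lml (tgt m) (\<lambda>as n. BP Q (m, as, n))" by (simp add: lml_def)
  show "nrm (tgt m) (\<lambda>as n. BP Q (m, as, n))"
    unfolding nrm_def
  proof (intro allI ballI impI)
    fix as y bs n assume n: "n \<in> mod_arrs C N" and lt: "lt (tgt m) (as @ ident y # bs) (src n)"
    show "BP Q (m, as @ ident y # bs, n) = 0"
    proof (cases "as = [] \<and> bs = []")
      case True
      with lt have y: "ident y \<in> cobar_arrs C" "tgt m = src (ident y)" "tgt (ident y) = src n" by auto
      have "BP Q (m, [ident y], n) = 0"
        unfolding BP_one[OF m n y] by (simp add: wx_gen[OF mod])
      then show ?thesis using True by simp
    next
      case False
      then show ?thesis by (cases as; cases bs; cases "tl as") auto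
    qed
  qed
next
  fix x y j as n
  assume xy: "x \<in> points C" "y \<in> points C" and lt: "lt y as (src n)" and n: "n \<in> mod_arrs C N"
  show "mlin (\<lambda>m. BP Q (m, as, n)) x y j"
  proof (cases as rule: remdups_adj.cases)
    case 1
    have "mlin (\<lambda>m. Q (m, pt y, n)) x y j"
      using lt xy n 1 pt_coalg_arrs[OF xy(2)] by (intro qml_m[OF assms]) auto
    then show ?thesis using 1 by (simp add: mlin_def)
  next
    case (2 a)
    then have a: "a \<in> cobar_arrs C" "src a = y" "tgt a = src n" using lt by auto
    have "mlin (\<lambda>m. wx s (\<lambda>cs. pw Q cs m n) (elt a)) x y j"
      unfolding mlin_def
      by (rule lin_on_wx[OF cobar_arrsD(3)[OF a(1)]])
        (use pw_mlin[OF assms n] a xy in \<open>auto simp: mlin_def\<close>)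
    then show ?thesis
      using 2 a xy by (subst mlin_cong) (auto simp: BP_one[OF _ n])
  next
    case (3 a b as')
    then show ?thesis by (simp add: mlin_def S.lin_on_zero)
  qed
qed

text \<open>The word recursion for an arbitrary morphism \<open>v\<close>: both sides are slot
  functions of \<open>v\<close>, so words suffice.\<close>

lemma BP_cons:
  assumes "qml Q" and "m \<in> mod_arrs C M" "n \<in> mod_arrs C N"
    and c: "c \<in> coalg_arrs C" "1 \<le> deg c" "tgt m = src c"
    and v: "v \<in> cobar_arrs C" "src v = tgt c" "tgt v = src n"
  shows "BP Q (m, [br c \<odot> v], n) = Q (m, c, v \<rhd> n) + s (ksign (deg c - 1)) (BP Q (m \<lhd> br c, [v], n))"
proof -
  note cD = coalg_arrsD[OF c(1)] and mD = mod_arrsD[OF assms(2)] and nD = mod_arrsD[OF assms(3)]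
  have mc: "m \<lhd> br c \<in> mod_arrs C M" using assms by (intro ra_in br_in) auto
  have L: "cslot (\<lambda>v. BP Q (m, [br c \<odot> v], n)) (tgt c) (src n) (deg v)"
    using BP_slot[OF assms(1-3)] c br_in[OF c(1)]
    by (intro cslot_cc_right[where f = "\<lambda>a. BP Q (m, [a], n)"]) auto
  have R1: "cslot (\<lambda>v. Q (m, c, v \<rhd> n)) (tgt c) (src n) (deg v)"
    using assms cD nD by (intro cslot_la qml_n[OF assms(1)]) auto
  have R2: "cslot (\<lambda>v. BP Q (m \<lhd> br c, [v], n)) (tgt c) (src n) (deg v)"
    using BP_slot[OF assms(1) mc assms(3)] by simp
  have R: "cslot (\<lambda>v. Q (m, c, v \<rhd> n) + s (ksign (deg c - 1)) (BP Q (m \<lhd> br c, [v], n))) (tgt c) (src n) (deg v)"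
    by (intro cslot_add cslot_scale R1 R2)
  show ?thesis
    unfolding cslot_words[OF L v refl] cslot_words[OF R v refl]
  proof (rule wx_cong[OF mod])
    show "elt v \<in> cobar_hom C (tgt c) (src n) (deg v)" using cobar_arrsD(3)[OF v(1)] v by simp
    fix cs assume cs: "wd (tgt c) cs (src n)"
    have w: "wd (src c) (c # cs) (src n)" using c cs by simp
    show "BP Q (m, [br c \<odot> mono_arr (tgt c) cs (src n)], n)
        = Q (m, c, mono_arr (tgt c) cs (src n) \<rhd> n) + s (ksign (deg c - 1)) (BP Q (m \<lhd> br c, [mono_arr (tgt c) cs (src n)], n))"
      using BP_one[OF assms(2,3) mono_in[OF w], of Q] BP_one[OF mc assms(3) mono_in[OF cs], of Q] c mod
      by (simp add: mono_Cons[symmetric])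
  qed
qed

end

context bar_context
begin

subsection \<open>The inclusion and the homotopy\<close>

definition AB :: "(('k, 'c, 'm, 'n) bar_gen \<Rightarrow> 'q) \<Rightarrow> ('c, 'm, 'n) q_gen \<Rightarrow> 'q" where
  "AB B = (\<lambda>(m, c, n). if deg c = 0 then s (counit C (elt c)) (B (m, [], n)) else AA (\<lambda>l. B (m, l, n)) c)"

lemma lext_alpha: "lext s B (alpha_gen C g) = AB B g"
  by (cases g) (simp add: alpha_gen_def AB_def AA_def S.lext_simps S.lext_lext)

text \<open>In positive degree this rests on linearity of the iterated coproduct. In degree 0 with
  different endpoints m[]n is not composable, but the counit of such an element is zero.\<close>

lemma qml_AB:
  assumes "bml B"
  shows "qml (AB B)"
proof (rule qmlI)
  fix c n x j assume h: "c \<in> coalg_arrs C" "n \<in> mod_arrs C N" "tgt c = src n" "x \<in> points C"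
  note cD = coalg_arrsD[OF h(1)]
  show "mlin (\<lambda>m. AB B (m, c, n)) x (src c) j"
  proof (cases "deg c = 0")
    case True
    show ?thesis
    proof (cases "src c = tgt c")
      case eq: True
      have "mlin (\<lambda>m. B (m, [], n)) x (src c) j"
        using h cD eq by (intro bml_mlin[OF assms]) auto
      then show ?thesis using True by (auto simp: AB_def mlin_def intro: S.lin_on_scale)
    next
      case False
      then have "counit C (elt c) = 0"
        using degree_0_arr[OF h(1) True] lin_0[OF rm.module_axioms counit_lin] by simp
      then show ?thesis using True by (simp add: AB_def mlin_def S.lin_on_zero)
    qed
  next
    case False
    then have "lin_on (bmul M) (piece M x (src c) j) s (\<lambda>u. AA (\<lambda>l. B (Arr x j u (src c), l, n)) c)"
      using h cD bml_mlin[OF assms h(4) cD(1) _ h(2)] by (intro AA_param) (auto simp: mlin_def)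
    then show ?thesis using False by (simp add: AB_def mlin_def)
  qed
next
  fix m n j assume h: "m \<in> mod_arrs C M" "n \<in> mod_arrs C N" "0 \<le> (j::int)"
  note mD = mod_arrsD[OF h(1)] and nD = mod_arrsD[OF h(2)]
  show "alin s (\<lambda>c. AB B (m, c, n)) (tgt m) (src n) j"
  proof (cases "j = 0")
    case True
    have "lin_on (smul C) V s (\<lambda>u. s (counit C u) (B (m, [], n)))" for V
      by (rule S.lin_on_scale_left) (rule lin_on_hom[OF counit_linear])
    then show ?thesis using True by (simp add: AB_def alin_def)
  next
    case False
    have "alin s (AA (\<lambda>l. B (m, l, n))) (tgt m) (src n) j"
      using False h mD nD lmlD[OF bml_lml[OF assms h(1) refl] h(2)] by (intro AA_alin) auto
    then show ?thesis using False by (simp add: AB_def alin_def)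
  qed
next
  fix m c y j assume h: "m \<in> mod_arrs C M" "c \<in> coalg_arrs C" "tgt m = src c" "y \<in> points C"
  note cD = coalg_arrsD[OF h(2)]
  show "nlin (\<lambda>n. AB B (m, c, n)) (tgt c) y j"
  proof (cases "deg c = 0")
    case True
    show ?thesis
    proof (cases "src c = tgt c")
      case eq: True
      have "nlin (\<lambda>n. B (m, [], n)) (tgt c) y j"
        using h cD eq by (intro bml_nlin[OF assms]) auto
      then show ?thesis using True by (auto simp: AB_def nlin_def intro: S.lin_on_scale)
    next
      case False
      then have "counit C (elt c) = 0"
        using degree_0_arr[OF h(2) True] lin_0[OF rm.module_axioms counit_lin] by simp
      then show ?thesis using True by (simp add: AB_def nlin_def S.lin_on_zero)
    qed
  next
    case False
    then have "lin_on (bmul N) (piece N (tgt c) y j) s (\<lambda>u. AA (\<lambda>l. B (m, l, Arr (tgt c) j u y)) c)"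
      using h cD bml_nlin[OF assms h(1) _ cD(2) h(4)] by (intro AA_param) (auto simp: nlin_def)
    then show ?thesis using False by (simp add: AB_def nlin_def)
  qed
qed

text \<open>The sign of a summand of the homotopy involves |m| but not the letters in front of c_i.
  Passing to m{c} raises the degree of the module element by |c| - 1, which the factor in the
  recursion undoes.\<close>

primrec hw :: "(('c, 'm) arr \<Rightarrow> ('c, ('k, 'c) cobar) arr list \<Rightarrow> 'q) \<Rightarrow> ('c, 'c) arr list \<Rightarrow> ('c, 'm) arr \<Rightarrow> 'c \<Rightarrow> 'q" where
  "hw G [] m y = 0"
| "hw G (c # cs) m y = s (ksign (deg m + deg c - 1)) (AA (\<lambda>l. G m (l @ [mono_arr (tgt c) cs y])) c)
     + s (ksign (deg c - 1)) (hw G cs (m \<lhd> br c) y)"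

lemma hw_param:
  assumes "\<And>m' l. m' \<in> mod_arrs C M \<Longrightarrow> src m' = src m \<Longrightarrow> lt (tgt m') l y \<Longrightarrow> lin_on t V s (\<lambda>u. G u m' l)"
    and "wd (tgt m) cs y" and "m \<in> mod_arrs C M"
  shows "lin_on t V s (\<lambda>u. hw (G u) cs m y)"
  using assms
proof (induction cs arbitrary: m)
  case Nil
  then show ?case by (simp add: S.lin_on_zero)
next
  case (Cons c cs)
  then have c: "c \<in> coalg_arrs C" "1 \<le> deg c" "tgt m = src c" "wd (tgt c) cs y" by auto
  have 1: "lin_on t V s (\<lambda>u. AA (\<lambda>l. G u m (l @ [mono_arr (tgt c) cs y])) c)"
    using c Cons.prems mono_in[OF c(4)] by (intro AA_param Cons.prems(1)) (auto simp: lt_append)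
  have 2: "lin_on t V s (\<lambda>u. hw (G u) cs (m \<lhd> br c) y)"
    using c Cons.prems(1,3) by (intro Cons.IH ra_in br_in) auto
  show ?case unfolding hw.simps by (intro S.lin_on_add S.lin_on_scale 1 2)
qed

lemma hw_zero:
  assumes "\<And>m' l. m' \<in> mod_arrs C M \<Longrightarrow> src m' = src m \<Longrightarrow> lt (tgt m') l y \<Longrightarrow> l \<noteq> [] \<Longrightarrow> G m' l = 0"
    and "wd (tgt m) cs y" and "m \<in> mod_arrs C M"
  shows "hw G cs m y = 0"
  using assms
proof (induction cs arbitrary: m)
  case (Cons c cs)
  then have c: "c \<in> coalg_arrs C" "1 \<le> deg c" "tgt m = src c" "wd (tgt c) cs y" by auto
  have 1: "AA (\<lambda>l. G m (l @ [mono_arr (tgt c) cs y])) c = AA (\<lambda>l. 0) c"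
    using c Cons.prems mono_in[OF c(4)] by (intro AA_cong Cons.prems(1)) (auto simp: lt_append)
  have 2: "hw G cs (m \<lhd> br c) y = 0"
    using c Cons.prems(1,3) by (intro Cons.IH ra_in br_in) auto
  show ?case unfolding hw.simps 1 2 by simp
qed simp

lemma hw_mlin:
  assumes "\<And>l z j. lt z l y \<Longrightarrow> z \<in> points C \<Longrightarrow> mlin (\<lambda>m. G m l) x z j"
    and "wd z cs y" and "x \<in> points C"
  shows "mlin (\<lambda>m. hw G cs m y) x z j"
  using assms(2)
proof (induction cs arbitrary: z j)
  case Nil
  then show ?case by (simp add: mlin_def S.lin_on_zero)
next
  case (Cons c cs z j)
  then have c: "c \<in> coalg_arrs C" "1 \<le> deg c" "src c = z" "wd (tgt c) cs y" by auto
  note cD = coalg_arrsD[OF c(1)]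
  have 1: "mlin (\<lambda>m. AA (\<lambda>l. G m (l @ [mono_arr (tgt c) cs y])) c) x z j"
    unfolding mlin_def
  proof (rule AA_param[OF c(1,2)])
    fix l assume "lt (src c) l (tgt c)"
    then show "lin_on (bmul M) (piece M x z j) s (\<lambda>u. G (Arr x j u z) (l @ [mono_arr (tgt c) cs y]))"
      using assms(1)[of z "l @ [mono_arr (tgt c) cs y]" j] c cD mono_in[OF c(4)]
      by (auto simp: lt_append mlin_def)
  qed
  have 2: "mlin (\<lambda>m. hw G cs (m \<lhd> br c) y) x z j"
    using c assms(3) Cons.IH[OF c(4)] br_in[OF c(1)] by (intro mlin_ra) auto
  show ?case using 1 2 unfolding mlin_def hw.simps arr.sel by (intro S.lin_on_add S.lin_on_scale)
qed

lemma hw_wml: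
  assumes "\<And>m. m \<in> mod_arrs C M \<Longrightarrow> lm (tgt m) y (G m)"
    and "\<And>l x z j. lt z l y \<Longrightarrow> x \<in> points C \<Longrightarrow> z \<in> points C \<Longrightarrow> mlin (\<lambda>m. G m l) x z j"
    and "m \<in> mod_arrs C M" "y \<in> points C"
  shows "wml s (\<lambda>cs. hw G cs m y) (tgt m) y"
proof (rule wmlI[OF mod])
  fix cs c ds assume "wd (tgt m) (cs @ c # ds) y"
  then show "alin s (\<lambda>c. hw G (cs @ c # ds) m y) (src c) (tgt c) (deg c)"
    using assms(3)
  proof (induction cs arbitrary: m)
    case Nil
    then have c: "c \<in> coalg_arrs C" "1 \<le> deg c" "tgt m = src c" "wd (tgt c) ds y" by auto
    note cD = coalg_arrsD[OF c(1)] and mD = mod_arrsD[OF Nil(2)]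
    have "lm (src c) (tgt c) (\<lambda>l. G m (l @ [mono_arr (tgt c) ds y]))"
      using lm_append_right[OF assms(1)[OF Nil(2)], of "tgt c" "[mono_arr (tgt c) ds y]"] c mono_in[OF c(4)] by simp
    then have 1: "alin s (\<lambda>e. AA (\<lambda>l. G m (l @ [mono_arr (tgt c) ds y])) e) (src c) (tgt c) (deg c)"
      using c cD by (intro AA_alin) auto
    have "cslot (\<lambda>a. hw G ds (m \<lhd> a) y) (src c) (tgt c) (deg c - 1)"
      using c cD Nil mD by (intro cslot_ra hw_mlin assms(2)) auto
    then have 2: "alin s (\<lambda>e. hw G ds (m \<lhd> br e) y) (src c) (tgt c) (deg c)"
      using c cD by (intro alin_br) auto
    have "alin s (\<lambda>e. s (ksign (deg m + deg c - 1)) (AA (\<lambda>l. G m (l @ [mono_arr (tgt c) ds y])) e)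
        + s (ksign (deg e - 1)) (hw G ds (m \<lhd> br e) y)) (src c) (tgt c) (deg c)"
      by (intro alin_add mod alin_scale[OF mod 1] alin_ksign(3)[OF mod 2])
    then show ?case by (simp add: alin_def)
  next
    case (Cons b cs)
    then have b: "b \<in> coalg_arrs C" "1 \<le> deg b" "tgt m = src b" "wd (tgt b) (cs @ c # ds) y" by auto
    note bD = coalg_arrsD[OF b(1)]
    have 1: "alin s (\<lambda>e. AA (\<lambda>l. G m (l @ [mono_arr (tgt b) (cs @ e # ds) y])) b) (src c) (tgt c) (deg c)"
    proof (rule AA_alin_param[OF b(1,2)])
      fix l assume l: "lt (src b) l (tgt b)"
      have "cslot (\<lambda>a. G m (l @ [a])) (tgt b) y j" for j
        using lmD[OF assms(1)[OF Cons.prems(2)], of l "tgt b" y "[]"] l b bD assms(4) by simp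
      from wmlD[OF wml_of_cslot[where f = "\<lambda>a. G m (l @ [a])", OF this] b(4)]
      show "alin s (\<lambda>e. G m (l @ [mono_arr (tgt b) (cs @ e # ds) y])) (src c) (tgt c) (deg c)" .
    qed
    have 2: "alin s (\<lambda>e. hw G (cs @ e # ds) (m \<lhd> br b) y) (src c) (tgt c) (deg c)"
      using b Cons by (intro Cons.IH ra_in br_in) auto
    show ?case unfolding append_Cons hw.simps by (intro alin_add alin_scale mod 1 2)
  qed
qed

lemma lext_H_word:
  assumes "bml B" and "m \<in> mod_arrs C M" and "n \<in> mod_arrs C N" and "wd (tgt m) cs y" and "lt y W (src n)"
  shows "lext s B (H_word C M m y W n (tgt m, cs)) = hw (\<lambda>m l. B (m, l @ W, n)) cs m y"
  using assms(2,4)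
proof (induction cs arbitrary: m)
  case (Cons c cs)
  then have c: "c \<in> coalg_arrs C" "1 \<le> deg c" "tgt m = src c" "wd (tgt c) cs y" by auto
  let ?t = "\<lambda>m cs i. s (ksign (deg m + deg (cs ! i) - 1))
     (AA (\<lambda>l. B (m \<lhd> mono_arr (tgt m) (take i cs) (src (cs ! i)), l @ [mono_arr (tgt (cs ! i)) (drop (Suc i) cs) y] @ W, n)) (cs ! i))"
  have H: "lext s B (H_word C M m y W n (tgt m, cs)) = (\<Sum>i<length cs - 1. ?t m cs i)" for m cs
    by (simp add: H_word_def AA_def S.lext_simps S.lext_lext)
  have t0: "?t m (c # cs) 0 = s (ksign (deg m + deg c - 1)) (AA (\<lambda>l. B (m, l @ [mono_arr (tgt c) cs y] @ W, n)) c)"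
    using ra_ident[OF Cons.prems(1)] c(3) by simp
  have mc: "m \<lhd> br c \<in> mod_arrs C M" using c Cons.prems by (intro ra_in br_in) auto
  show ?case
  proof (cases cs)
    \<comment> \<open>The recursion has one summand more than the definition, namely for the last
      letter. The word left after it is an identity, so this summand vanishes by
      normalization.\<close>
    case Nil
    have "AA (\<lambda>l. B (m, l @ [mono_arr (tgt c) cs y] @ W, n)) c = AA (\<lambda>l. 0) c"
    proof (rule AA_cong[OF c(1,2)])
      fix l assume "lt (src c) l (tgt c)"
      then have "lt (tgt m) (l @ ident y # W) (src n)"
        using c Nil assms(5) ident_in by (auto simp: lt_append)
      from nrmD[OF bml_nrm[OF assms(1) Cons.prems(1) refl] assms(3) this]
      show "B (m, l @ [mono_arr (tgt c) cs y] @ W, n) = 0" using Nil c by simp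
    qed
    then show ?thesis unfolding H using Nil by simp
  next
    case (Cons d ds)
    have "?t m (c # cs) (Suc i) = s (ksign (deg c - 1)) (?t (m \<lhd> br c) cs i)" if "i < length cs" for i
    proof -
      have "m \<lhd> mono_arr (tgt m) (c # take i cs) (src (cs ! i)) = m \<lhd> br c \<lhd> mono_arr (tgt c) (take i cs) (src (cs ! i))"
        using ra_mono_Cons[OF Cons.prems(1) c(1-3) wd_take(1)[OF c(4) that]] c(3) by simp
      moreover have "(ksign (deg m + deg (cs ! i) - 1) :: 'k)
          = ksign (deg c - 1) * ksign (deg m + (deg c - 1) + deg (cs ! i) - 1)"
        by (simp add: ksign_def)
      ultimately show ?thesis by simp
    qed
    then have "(\<Sum>i<length (c # cs) - 1. ?t m (c # cs) i)
        = ?t m (c # cs) 0 + (\<Sum>i<length cs - 1. s (ksign (deg c - 1)) (?t (m \<lhd> br c) cs i))"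
      using Cons by (simp add: sum.lessThan_Suc_shift del: sum.lessThan_Suc)
    also have "(\<Sum>i<length cs - 1. s (ksign (deg c - 1)) (?t (m \<lhd> br c) cs i))
        = s (ksign (deg c - 1)) (hw (\<lambda>m l. B (m, l @ W, n)) cs (m \<lhd> br c) y)"
      using Cons.IH[OF mc] c H[of "m \<lhd> br c" cs] by (simp add: S.scale_sum_right del: S.scale_scale)
    finally show ?thesis unfolding H t0 by simp
  qed
qed (simp add: H_word_def)

definition HB :: "(('k, 'c, 'm, 'n) bar_gen \<Rightarrow> 'q) \<Rightarrow> ('k, 'c, 'm, 'n) bar_gen \<Rightarrow> 'q" where
  "HB B g = lext s B (H_gen C M g)"

lemma HB_Nil [simp]: "HB B (m, [], n) = 0"
  by (simp add: HB_def H_gen_def)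

lemma HB_Cons:
  assumes "bml B" and "m \<in> mod_arrs C M" and "n \<in> mod_arrs C N" and "lt (tgt m) (a # W) (src n)"
  shows "HB B (m, a # W, n) = wx s (\<lambda>cs. hw (\<lambda>m l. B (m, l @ W, n)) cs m (tgt a)) (elt a)"
proof -
  have "HB B (m, a # W, n) = lext s (\<lambda>w. lext s B (H_word C M m (tgt a) W n w)) (elt a)"
    by (simp add: HB_def H_gen_def S.lext_lext)
  also have "\<dots> = wx s (\<lambda>cs. hw (\<lambda>m l. B (m, l @ W, n)) cs m (tgt a)) (elt a)"
    unfolding wx_def
  proof (rule S.lext_cong, clarify)
    fix x cs assume "(x, cs) \<in> Poly_Mapping.keys (elt a)"
    from cobar_hom_keysD[OF cobar_arrsD(3) this] assms
    show "lext s B (H_word C M m (tgt a) W n (x, cs)) = hw (\<lambda>m l. B (m, l @ W, n)) cs m (tgt a)"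
      using lext_H_word[OF assms(1-3), of cs "tgt a" W] by simp
  qed
  finally show ?thesis .
qed

lemma HB_slot:
  assumes "bml B" and "m \<in> mod_arrs C M" "n \<in> mod_arrs C N" and "lt y W (src n)" "y \<in> points C"
  shows "cslot (\<lambda>a. HB B (m, a # W, n)) (tgt m) y j"
proof -
  have "wml s (\<lambda>cs. hw (\<lambda>m l. B (m, l @ W, n)) cs m y) (tgt m) y"
  proof (rule hw_wml[OF _ _ assms(2,5)])
    show "lm (tgt m) y (\<lambda>l. B (m, l @ W, n))" if "m \<in> mod_arrs C M" for m
      by (rule lm_append_right[OF lmlD[OF bml_lml[OF assms(1) that refl] assms(3)] assms(4)])
    show "mlin (\<lambda>m. B (m, l @ W, n)) x z j" if "lt z l y" "x \<in> points C" "z \<in> points C" for l x z j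
      using that assms by (intro bml_mlin[OF assms(1)]) (auto simp: lt_append)
  qed
  from cslot_of_wml[OF this] show ?thesis
    using assms mod_arrsD[OF assms(2)] by (subst cslot_cong) (auto simp: HB_Cons)
qed

lemma bml_HB:
  assumes "bml B"
  shows "bml (HB B)"
proof (rule bmlI)
  fix m assume m: "m \<in> mod_arrs C M"
  note mD = mod_arrsD[OF m]
  have "lm (tgt m) (src n) (\<lambda>as. HB B (m, as, n))" if n: "n \<in> mod_arrs C N" for n
  proof (rule lmI)
    fix as a bs assume lt: "lt (tgt m) (as @ a # bs) (src n)"
    show "cslot (\<lambda>a. HB B (m, as @ a # bs, n)) (src a) (tgt a) (deg a)"
    proof (cases as)
      case Nil
      then show ?thesis using HB_slot[OF assms m n, of "tgt a" bs "deg a"] lt cobar_arrsD[of a] by simp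
    next
      case (Cons b as')
      then have b: "b \<in> cobar_arrs C" "src b = tgt m" "lt (tgt b) (as' @ a # bs) (src n)" using lt by auto
      then obtain p where p: "lt (tgt b) as' p" "lt p (a # bs) (src n)" by (auto simp: lt_append)
      then have a: "a \<in> cobar_arrs C" "src a = p" "lt (tgt a) bs (src n)" by auto
      note aD = cobar_arrsD[OF a(1)] and bD = cobar_arrsD[OF b(1)]
      have sl: "cslot (\<lambda>a. B (m', l @ as' @ a # bs, n)) (src a) (tgt a) (deg a)"
        if "m' \<in> mod_arrs C M" "lt (tgt m') l (tgt b)" for m' l
        using bml_slot[OF assms that(1) n, of "l @ as'" "src a" "tgt a" bs] that a p aD by (auto simp: lt_append)
      let ?f = "\<lambda>a. wx s (\<lambda>cs. hw (\<lambda>m l. B (m, l @ as' @ a # bs, n)) cs m (tgt b)) (elt b)"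
      have "cslot ?f (src a) (tgt a) (deg a)"
      proof (rule cslot_param)
        show "lin_on fscale (cobar_hom C (src a) (tgt a) (deg a)) s (\<lambda>u. ?f (Arr (src a) (deg a) u (tgt a)))"
          by (rule lin_on_wx[OF cobar_arrsD(3)[OF b(1)]], rule hw_param[OF _ _ m])
            (use sl b in \<open>auto simp: cslot_def\<close>)
        show "?f (Arr (src a) (deg a) u (tgt a)) = 0"
          if "u \<in> cobar_hom C (src a) (tgt a) (deg a)" "u \<in> cobar_rel C" for u
        proof -
          have "?f (Arr (src a) (deg a) u (tgt a)) = wx s (\<lambda>cs. 0) (elt b)"
            by (rule wx_cong[OF mod cobar_arrsD(3)[OF b(1)]], rule hw_zero[OF _ _ m])
              (use sl b that in \<open>auto simp: cslot_def\<close>)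
          then show ?thesis by (simp add: wx_def split_def)
        qed
      qed
      then show ?thesis
        by (subst cslot_cong[OF aD(1,2)]) (use Cons b a p HB_Cons[OF assms m n] in \<open>auto simp: lt_append\<close>)
    qed
  qed
  moreover have "nlin (\<lambda>n. HB B (m, as, n)) (src n) (tgt n) (deg n)"
    if n: "n \<in> mod_arrs C N" and lt: "lt (tgt m) as (src n)" for as n
  proof (cases as)
    case (Cons b W)
    then have b: "b \<in> cobar_arrs C" "src b = tgt m" "lt (tgt b) W (src n)" using lt by auto
    note nD = mod_arrsD[OF n]
    have sl: "nlin (\<lambda>n. B (m', l @ W, n)) (src n) (tgt n) (deg n)"
      if "m' \<in> mod_arrs C M" "lt (tgt m') l (tgt b)" for m' l
      using bml_nlin[OF assms that(1), of "l @ W" "src n" "tgt n"] that b nD by (auto simp: lt_append)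
    have "nlin (\<lambda>n. wx s (\<lambda>cs. hw (\<lambda>m l. B (m, l @ W, n)) cs m (tgt b)) (elt b)) (src n) (tgt n) (deg n)"
      unfolding nlin_def
      by (rule lin_on_wx[OF cobar_arrsD(3)[OF b(1)]], rule hw_param[OF _ _ m])
        (use sl b in \<open>auto simp: nlin_def\<close>)
    then show ?thesis
      by (subst nlin_cong[OF nD(1,2)]) (use Cons b HB_Cons[OF assms m] in auto)
  qed (simp add: nlin_def S.lin_on_zero)
  ultimately show "lml (tgt m) (\<lambda>as n. HB B (m, as, n))" by (simp add: lml_def)
  show "nrm (tgt m) (\<lambda>as n. HB B (m, as, n))"
    unfolding nrm_def
  proof (intro allI ballI impI)
    fix as y bs n assume n: "n \<in> mod_arrs C N" and lt: "lt (tgt m) (as @ ident y # bs) (src n)"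
    show "HB B (m, as @ ident y # bs, n) = 0"
    proof (cases as)
      case Nil
      then have lt': "lt (tgt m) (ident y # bs) (src n)" using lt by auto
      then have "y = tgt m" by auto
      with HB_Cons[OF assms m n lt'] lt' Nil show ?thesis by (simp add: wx_gen[OF mod])
    next
      case (Cons b as')
      then have b: "b \<in> cobar_arrs C" "src b = tgt m" "lt (tgt b) (as' @ ident y # bs) (src n)" using lt by auto
      have "HB B (m, as @ ident y # bs, n) = wx s (\<lambda>cs. hw (\<lambda>m l. B (m, l @ as' @ ident y # bs, n)) cs m (tgt b)) (elt b)"
        using HB_Cons[OF assms m n, of b "as' @ ident y # bs"] lt Cons by simp
      also have "\<dots> = wx s (\<lambda>cs. 0) (elt b)"
      proof (rule wx_cong[OF mod cobar_arrsD(3)[OF b(1)]], rule hw_zero[OF _ _ m])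
        fix m' l assume m': "m' \<in> mod_arrs C M" "lt (tgt m') l (tgt b)"
        have "lt (tgt m') ((l @ as') @ ident y # bs) (src n)" using m'(2) b(3) by (force simp: lt_append)
        from nrmD[OF bml_nrm[OF assms m'(1) refl] n this] show "B (m', l @ as' @ ident y # bs, n) = 0" by simp
      qed (use b in simp)
      finally show ?thesis by (simp add: wx_def split_def)
    qed
  qed
next
  fix x y j as n
  assume xy: "x \<in> points C" "y \<in> points C" and lt: "lt y as (src n)" and n: "n \<in> mod_arrs C N"
  show "mlin (\<lambda>m. HB B (m, as, n)) x y j"
  proof (cases as)
    case (Cons b W)
    then have b: "b \<in> cobar_arrs C" "src b = y" "lt (tgt b) W (src n)" using lt by auto
    have "mlin (\<lambda>m. B (m, l @ W, n)) x z j" if "lt z l (tgt b)" "z \<in> points C" for l z j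
      using that b xy n by (intro bml_mlin[OF assms]) (auto simp: lt_append)
    then have "mlin (\<lambda>m. wx s (\<lambda>cs. hw (\<lambda>m l. B (m, l @ W, n)) cs m (tgt b)) (elt b)) x y j"
      unfolding mlin_def
      by (intro lin_on_wx[OF cobar_arrsD(3)[OF b(1)]] hw_mlin[unfolded mlin_def]) (use b xy in auto)
    then show ?thesis
      by (subst mlin_cong[OF xy]) (use Cons b HB_Cons[OF assms _ n] in auto)
  qed (simp add: mlin_def S.lin_on_zero)
qed

lemma HB_cons:
  assumes "bml B" and "m \<in> mod_arrs C M" "n \<in> mod_arrs C N"
    and c: "c \<in> coalg_arrs C" "1 \<le> deg c" "tgt m = src c"
    and v: "v \<in> cobar_arrs C" "src v = tgt c" and W: "lt (tgt v) W (src n)"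
  shows "HB B (m, (br c \<odot> v) # W, n) = s (ksign (deg m + deg c - 1)) (AA (\<lambda>l. B (m, l @ v # W, n)) c)
    + s (ksign (deg c - 1)) (HB B (m \<lhd> br c, v # W, n))"
proof -
  note cD = coalg_arrsD[OF c(1)] and mD = mod_arrsD[OF assms(2)] and vD = cobar_arrsD[OF v(1)]
  have mc: "m \<lhd> br c \<in> mod_arrs C M" using assms by (intro ra_in br_in) auto
  have L: "cslot (\<lambda>v. HB B (m, (br c \<odot> v) # W, n)) (tgt c) (tgt v) (deg v)"
    using HB_slot[OF assms(1-3) W vD(2)] c br_in[OF c(1)]
    by (intro cslot_cc_right[where f = "\<lambda>a. HB B (m, a # W, n)"]) auto
  have R1: "cslot (\<lambda>v. AA (\<lambda>l. B (m, l @ v # W, n)) c) (tgt c) (tgt v) (deg v)"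
  proof -
    have sl: "cslot (\<lambda>v. B (m, l @ v # W, n)) (tgt c) (tgt v) (deg v)" if "lt (src c) l (tgt c)" for l
      using that c cD vD by (intro bml_slot[OF assms(1-3) _ W]) auto
    show ?thesis
    proof (rule cslot_param)
      show "lin_on fscale (cobar_hom C (tgt c) (tgt v) (deg v)) s (\<lambda>u. AA (\<lambda>l. B (m, l @ Arr (tgt c) (deg v) u (tgt v) # W, n)) c)"
        by (rule AA_param[OF c(1,2)]) (use sl in \<open>simp add: cslot_def\<close>)
      show "AA (\<lambda>l. B (m, l @ Arr (tgt c) (deg v) u (tgt v) # W, n)) c = 0"
        if "u \<in> cobar_hom C (tgt c) (tgt v) (deg v)" "u \<in> cobar_rel C" for u
      proof -
        have "AA (\<lambda>l. B (m, l @ Arr (tgt c) (deg v) u (tgt v) # W, n)) c = AA (\<lambda>l. 0) c"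
          by (rule AA_cong[OF c(1,2)]) (use sl that in \<open>simp add: cslot_def\<close>)
        then show ?thesis by simp
      qed
    qed
  qed
  have R2: "cslot (\<lambda>v. HB B (m \<lhd> br c, v # W, n)) (tgt c) (tgt v) (deg v)"
    using HB_slot[OF assms(1) mc assms(3) W vD(2)] by simp
  have R: "cslot (\<lambda>v. s (ksign (deg m + deg c - 1)) (AA (\<lambda>l. B (m, l @ v # W, n)) c)
    + s (ksign (deg c - 1)) (HB B (m \<lhd> br c, v # W, n))) (tgt c) (tgt v) (deg v)"
    by (intro cslot_add cslot_scale R1 R2)
  show ?thesis
    unfolding cslot_words[OF L v refl refl] cslot_words[OF R v refl refl]
  proof (rule wx_cong[OF mod])
    show "elt v \<in> cobar_hom C (tgt c) (tgt v) (deg v)" using vD(3) v by simp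
    fix cs assume cs: "wd (tgt c) cs (tgt v)"
    have w: "wd (src c) (c # cs) (tgt v)" using c cs by simp
    show "HB B (m, (br c \<odot> mono_arr (tgt c) cs (tgt v)) # W, n)
        = s (ksign (deg m + deg c - 1)) (AA (\<lambda>l. B (m, l @ mono_arr (tgt c) cs (tgt v) # W, n)) c)
          + s (ksign (deg c - 1)) (HB B (m \<lhd> br c, mono_arr (tgt c) cs (tgt v) # W, n))"
      using HB_Cons[OF assms(1-3), of "mono_arr (src c) (c # cs) (tgt v)" W] mono_in[OF w]
        HB_Cons[OF assms(1) mc assms(3), of "mono_arr (tgt c) cs (tgt v)" W] mono_in[OF cs] c W
      by (simp add: mono_Cons[symmetric] wx_gen[OF mod])
  qed
qed

end

section \<open>The chain maps and the homotopy\<close>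

context bar_context
begin

section \<open>The inclusion is a chain map\<close>

lemma AB_pt: "x \<in> points C \<Longrightarrow> AB B (m, pt x, n) = B (m, [], n)"
  by (simp add: AB_def counit_pt)

lemma AB_pos: "1 \<le> deg c \<Longrightarrow> AB B (m, c, n) = AA (\<lambda>l. B (m, l, n)) c"
  by (simp add: AB_def)

lemma AA_scale_fun: "AA (\<lambda>l. s r (f l)) = (\<lambda>c. s r (AA f c))"
  by (simp add: fun_eq_iff AA_scale)

text \<open>The first bracket of a cut acts on the module element. If the cut is a single bracket,
  the tail \<open>W\<close> remains; otherwise the cuts of the right factor do.\<close>

lemma AA_first:
  assumes "c \<in> coalg_arrs C" "1 \<le> deg c"
  shows "AA (\<lambda>l. case l @ W of [] \<Rightarrow> 0 | a # bs \<Rightarrow> s r (B (m \<lhd> a, bs, n))) c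
    = s r (B (m \<lhd> br c, W, n)) + s r (red s (\<lambda>a b. AA (\<lambda>l. B (m \<lhd> br a, l @ W, n)) b) c)"
  by (subst AA_left[OF assms]) (simp add: AA_scale_fun red_scale[OF mod])

text \<open>In positive degree this is \<open>AA_rb\<close> with empty tail. \<open>AA_first\<close>
  supplies the terms where a first bracket acts on the left, the \<open>J\<close> terms those where
  a last bracket acts on the right, and they match the coproduct terms of
  \<open>qd_pos\<close>.\<close>

lemma AB_bd:
  assumes "bml B" and "m \<in> mod_arrs C M" "c \<in> coalg_arrs C" "n \<in> mod_arrs C N" "tgt m = src c" "tgt c = src n"
  shows "qd (AB B) (m, c, n) = AB (bd B) (m, c, n)"
proof (cases "deg c = 0")
  case True
  then show ?thesis
    using qd_0[OF qml_AB[OF assms(1)] assms(2-6) True]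
    by (simp add: AB_def bd_simps S.scale_right_distrib mult.commute)
next
  case False
  note cD = coalg_arrsD[OF assms(3)]
  then have c1: "1 \<le> deg c" using False by simp
  let ?F = "\<lambda>as n. B (m, as, n)"
  have lF: "lml (src c) ?F" "nrm (src c) ?F"
    using bml_lml[OF assms(1,2) assms(5)] bml_nrm[OF assms(1,2) assms(5)] .
  have W: "lt (tgt c) [] (src n)" using assms by simp
  let ?R1 = "red s (\<lambda>a b. AA (\<lambda>l. B (m \<lhd> br a, l, n)) b) c"
  let ?R2 = "red s (\<lambda>a b. s (ksign (deg a)) (AA (\<lambda>l. B (m, l, br b \<rhd> n)) a)) c"
  have 1: "red s (\<lambda>a b. AB B (m \<lhd> br a, b, n)) c = ?R1"
    by (rule red_cong[OF mod assms(3)]) (auto dest: psplitsD simp: AB_pos)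
  have 2: "red s (\<lambda>a b. s (ksign (deg a)) (AB B (m, a, br b \<rhd> n))) c = ?R2"
    by (rule red_cong[OF mod assms(3)]) (auto dest: psplitsD simp: AB_pos)
  have 3: "red s (\<lambda>a b. AA (\<lambda>l. J (deg m + deg a) (br b) (\<lambda>bs n. ?F (l @ bs) n) [] n) a) c
      = - s (ksign (deg m)) ?R2"
    by (simp add: AA_uminus AA_scale red_uminus[OF mod] ksign_add red_scale[OF mod, symmetric])
  have "AB (bd B) (m, c, n) = AA (\<lambda>l. bd B (m, l, n)) c" by (rule AB_pos[OF c1])
  also have "\<dots> = AA (\<lambda>l. B (dM m, l, n)) c
      + AA (\<lambda>l. case l @ [] of [] \<Rightarrow> 0 | a # bs \<Rightarrow> s (ksign (deg m)) (B (m \<lhd> a, bs, n))) c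
      + AA (\<lambda>l. rb (deg m) ?F (l @ []) n) c"
    by (simp add: bd_def AA_add)
  also have "\<dots> = AA (\<lambda>l. B (dM m, l, n)) c
      + (s (ksign (deg m)) (B (m \<lhd> br c, [], n)) + s (ksign (deg m)) ?R1)
      + (s (ksign (deg m)) (if 2 \<le> deg c then AA (\<lambda>l. B (m, l, n)) (dC c) else 0)
      + (- s (ksign (deg m)) (B (m, [], br c \<rhd> n)) - s (ksign (deg m)) ?R2)
      + s (ksign (deg m + deg c)) (AA (\<lambda>l. B (m, l, dN n)) c))"
    unfolding AA_rb[OF assms(3) c1 lF W assms(4)] AA_first[OF assms(3) c1] 3 by (simp add: AA_scale)
  also have "\<dots> = qd (AB B) (m, c, n)"
    unfolding qd_pos[OF qml_AB[OF assms(1)] assms(2-6) c1] 1 2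
    using c1 cD by (simp add: AB_pt AB_pos S.scale_right_distrib algebra_simps)
  finally show ?thesis ..
qed

section \<open>The projection is a chain map\<close>

text \<open>The letter selected by \<pi> lies either in \<open>a\<close> or in \<open>b\<close>,
  which gives the two terms. This is the chain map identity on bar words of length two, where \<pi>
  itself is zero.\<close>

lemma BP_mult:
  assumes "qml Q" and "m \<in> mod_arrs C M" "n \<in> mod_arrs C N" "a \<in> cobar_arrs C" "b \<in> cobar_arrs C"
    and "tgt m = src a" "tgt a = src b" "tgt b = src n"
  shows "BP Q (m, [a \<odot> b], n) = BP Q (m, [a], b \<rhd> n) + s (ksign (deg a)) (BP Q (m \<lhd> a, [b], n))"
proof -
  note bD = cobar_arrsD[OF assms(5)] and nD = mod_arrsD[OF assms(3)]
  have bn: "b \<rhd> n \<in> mod_arrs C N" using assms by (intro la_in) auto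
  let ?f = "\<lambda>m a. BP Q (m, [a \<odot> b], n)"
    and ?g = "\<lambda>m a. BP Q (m, [a], b \<rhd> n) + s (ksign (deg a)) (BP Q (m \<lhd> a, [b], n))"
  have "?f m a = ?g m a"
  proof (rule slot_word_induct[where f = ?f and g = ?g and y = "src b"])
    fix m j assume m: "m \<in> mod_arrs C M"
    note mD = mod_arrsD[OF m]
    show "cslot (?f m) (tgt m) (src b) j"
      using BP_slot[OF assms(1) m assms(3)] assms by (intro cslot_cc_left[where f = "\<lambda>a. BP Q (m, [a], n)"]) auto
    have "cslot (\<lambda>a. BP Q (m \<lhd> a, [b], n)) (tgt m) (src b) j"
      using assms m mD bD by (intro cslot_ra bml_mlin[OF bml_BP[OF assms(1)]]) auto
    then show "cslot (?g m) (tgt m) (src b) j"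
      using BP_slot[OF assms(1) m bn, of j] by (intro cslot_add cslot_ksign) auto
  next
    fix m assume m: "m \<in> mod_arrs C M" "tgt m = src b"
    have "BP Q (m, [ident (src b)], b \<rhd> n) = 0"
      using bml_ident_hd[OF bml_BP[OF assms(1)] m(1) bn, of "[]"] m by simp
    then show "?f m (ident (src b)) = ?g m (ident (src b))"
      using cc_ident_left[OF assms(5)] ra_ident[OF m(1)] m by simp
  next
    fix m c v assume h: "m \<in> mod_arrs C M" "c \<in> coalg_arrs C" "1 \<le> deg c" "tgt m = src c"
      "v \<in> cobar_arrs C" "src v = tgt c" "tgt v = src b" and IH: "?f (m \<lhd> br c) v = ?g (m \<lhd> br c) v"
    have "?f m (br c \<odot> v) = Q (m, c, v \<rhd> b \<rhd> n) + s (ksign (deg c - 1)) (?f (m \<lhd> br c) v)"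
      using BP_cons[OF assms(1) h(1) assms(3) h(2-4), of "v \<odot> b"] h assms
      by (simp add: cc_assoc cc_in la_assoc)
    moreover have "BP Q (m, [br c \<odot> v], b \<rhd> n) = Q (m, c, v \<rhd> b \<rhd> n) + s (ksign (deg c - 1)) (BP Q (m \<lhd> br c, [v], b \<rhd> n))"
      using BP_cons[OF assms(1) h(1) bn h(2-6)] h by simp
    moreover have "m \<lhd> (br c \<odot> v) = m \<lhd> br c \<lhd> v" using h by (simp add: ra_assoc br_in)
    ultimately show "?f m (br c \<odot> v) = ?g m (br c \<odot> v)"
      unfolding IH by (simp add: S.scale_right_distrib ksign_add[of "deg c - 1"])
  qed (use assms in auto)
  then show ?thesis .
qed

lemma bd_single:
  "bd B (m, [a], n) = B (dM m, [a], n) + s (ksign (deg m)) (B (m \<lhd> a, [], n)) - s (ksign (deg m)) (B (m, [Da a], n))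
    - s (ksign (deg m)) (B (m, [], a \<rhd> n)) + s (ksign (deg m + deg a + 1)) (B (m, [a], dN n))"
  by (simp add: bd_simps)

text \<open>D{c} is compared in the two places where it occurs: in front of \<open>v\<close> inside
  the slot and acting on \<open>m\<close>. Expanding {a}{b}v twice by \<open>BP_cons\<close>, the
  terms where neither letter is selected agree; what remains are the terms that select dc, a or
  b.\<close>

lemma BP_Da_br:
  assumes "qml Q" and "m \<in> mod_arrs C M" "n \<in> mod_arrs C N"
    and c: "c \<in> coalg_arrs C" "1 \<le> deg c" "tgt m = src c"
    and v: "v \<in> cobar_arrs C" "src v = tgt c" "tgt v = src n"
  shows "BP Q (m, [Da (br c) \<odot> v], n) = s (ksign (deg c)) (BP Q (m \<lhd> Da (br c), [v], n))
    - (if 2 \<le> deg c then Q (m, dC c, v \<rhd> n) else 0)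
    + red s (\<lambda>a b. s (ksign (deg a)) (Q (m, a, br b \<rhd> v \<rhd> n))) c
    - red s (\<lambda>a b. Q (m \<lhd> br a, b, v \<rhd> n)) c"
proof -
  note cD = coalg_arrsD[OF c(1)] and mD = mod_arrsD[OF assms(2)] and nD = mod_arrsD[OF assms(3)] and vD = cobar_arrsD[OF v(1)]
  let ?G1 = "\<lambda>a. BP Q (m, [a \<odot> v], n)" and ?G2 = "\<lambda>a. BP Q (m \<lhd> a, [v], n)"
  let ?X1 = "\<lambda>a b. s (ksign (deg a)) (?G1 (br a \<odot> br b))" and ?X2 = "\<lambda>a b. s (ksign (deg a)) (?G2 (br a \<odot> br b))"
  let ?Ra = "\<lambda>a b. s (ksign (deg a)) (Q (m, a, br b \<rhd> v \<rhd> n))" and ?Rb = "\<lambda>a b. Q (m \<lhd> br a, b, v \<rhd> n)"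
  have s1: "cslot ?G1 (src c) (tgt c) (deg c - 2)"
    using BP_slot[OF assms(1-3)] c v by (intro cslot_cc_left[where f = "\<lambda>a. BP Q (m, [a], n)"]) auto
  have s2: "cslot ?G2 (src c) (tgt c) (deg c - 2)"
    using assms mD vD cD by (intro cslot_ra bml_mlin[OF bml_BP[OF assms(1)]]) auto
  \<comment> \<open>The curvature contribution. Multiplying the identity into \<open>v\<close> or
    letting it act on \<open>m\<close> gives the same value, and the sign (-1)^|c| is trivial in
    degree 2, so it drops out.\<close>
  define H where "H = (if deg c = 2 \<and> src c = tgt c then s (curv C (elt c)) (BP Q (m, [v], n)) else 0)"
  have H1: "(if deg c = 2 \<and> src c = tgt c then s (curv C (elt c)) (?G1 (ident (src c))) else 0) = H"
    using cc_ident_left[OF v(1)] v by (auto simp: H_def)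
  have H2: "(if deg c = 2 \<and> src c = tgt c then s (curv C (elt c)) (?G2 (ident (src c))) else 0) = H"
    using ra_ident[OF assms(2)] c by (auto simp: H_def)
  define Z where "Z = (if 2 \<le> deg c then ?G2 (br (dC c)) else 0)"
  define Y where "Y = (if 2 \<le> deg c then Q (m, dC c, v \<rhd> n) else 0)"
  have Z1: "(if 2 \<le> deg c then ?G1 (br (dC c)) else 0) = Y + s (ksign (deg c)) Z"
    using BP_cons[OF assms(1-3), of "dC c" v] dC_coalg_arrs[OF c(1)] c v
    by (simp add: Y_def Z_def ksign_def)
  have "red s ?X1 c = red s (\<lambda>a b. ?Ra a b - ?Rb a b + s (ksign (deg c)) (?X2 a b)) c"
  proof (rule red_cong[OF mod c(1)])
    fix a b assume "(a, b) \<in> psplits c"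
    note ab = psplitsD[OF this]
    have ma: "m \<lhd> br a \<in> mod_arrs C M" using ab assms by (intro ra_in br_in) auto
    have bv: "br b \<odot> v \<in> cobar_arrs C" using ab v by (intro cc_in br_in) auto
    have "?G1 (br a \<odot> br b) = Q (m, a, br b \<rhd> v \<rhd> n) + s (ksign (deg a - 1)) (BP Q (m \<lhd> br a, [br b \<odot> v], n))"
      using BP_cons[OF assms(1-3) ab(1,7) _ bv] ab c v assms by (simp add: cc_assoc la_assoc br_in)
    moreover have "BP Q (m \<lhd> br a, [br b \<odot> v], n) = Q (m \<lhd> br a, b, v \<rhd> n) + s (ksign (deg b - 1)) (?G2 (br a \<odot> br b))"
      using BP_cons[OF assms(1) ma assms(3) ab(2,8) _ v(1)] ab c v assms by (simp add: ra_assoc br_in)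
    moreover have "(ksign (deg a) * ksign (deg a - 1) :: 'k) = - 1"
      "(ksign (deg a) * (ksign (deg a - 1) * ksign (deg b - 1)) :: 'k) = ksign (deg c) * ksign (deg a)"
      using ab(6)[symmetric] by (simp_all add: ksign_def)
    ultimately show "?X1 a b = ?Ra a b - ?Rb a b + s (ksign (deg c)) (?X2 a b)"
      by (simp add: S.scale_right_distrib)
  qed
  also have "\<dots> = red s ?Ra c - red s ?Rb c + s (ksign (deg c)) (red s ?X2 c)"
    by (simp add: red_add[OF mod] red_diff[OF mod] red_scale[OF mod] del: S.scale_scale)
  finally have X1: "red s ?X1 c = red s ?Ra c - red s ?Rb c + s (ksign (deg c)) (red s ?X2 c)" .
  have HH: "s (ksign (deg c)) H = H" by (simp add: H_def)
  have "s (ksign (deg c)) (?G2 (Da (br c))) = - H - s (ksign (deg c)) Z + s (ksign (deg c)) (red s ?X2 c)"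
    unfolding slot_Da_br_curv[OF c(1,2) s2] H2 Z_def[symmetric]
    by (simp add: S.scale_right_distrib S.scale_right_diff_distrib HH)
  then show ?thesis
    unfolding slot_Da_br_curv[OF c(1,2) s1] H1 Z1 X1 Y_def[symmetric] by simp
qed

text \<open>The composite with the bar differential obeys the same recursion as \<pi>, with
  \<open>Q\<close> replaced by \<open>qd Q\<close>. The three Leibniz rules distribute D, d_M and
  d_N over the products with {c} and v, and \<open>BP_Da_br\<close> supplies the coproduct terms of
  \<open>qd_pos\<close>.\<close>

lemma BP_bd_cons:
  assumes "qml Q" and "m \<in> mod_arrs C M" "n \<in> mod_arrs C N"
    and c: "c \<in> coalg_arrs C" "1 \<le> deg c" "tgt m = src c"
    and v: "v \<in> cobar_arrs C" "src v = tgt c" "tgt v = src n"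
  shows "bd (BP Q) (m, [br c \<odot> v], n) = qd Q (m, c, v \<rhd> n) + s (ksign (deg c - 1)) (bd (BP Q) (m \<lhd> br c, [v], n))"
proof -
  note cD = coalg_arrsD[OF c(1)] and mD = mod_arrsD[OF assms(2)] and nD = mod_arrsD[OF assms(3)] and vD = cobar_arrsD[OF v(1)]
  let ?B = "BP Q" and ?n = "v \<rhd> n" and ?m = "m \<lhd> br c"
  have mc: "?m \<in> mod_arrs C M" using assms by (intro ra_in br_in) auto
  have vn: "?n \<in> mod_arrs C N" using assms by (intro la_in) auto
  note bml = bml_BP[OF assms(1)]
  have f1: "?B (dM m, [br c \<odot> v], n) = Q (dM m, c, ?n) + s (ksign (deg c - 1)) (?B (dM m \<lhd> br c, [v], n))"
    using BP_cons[OF assms(1) dM_in[OF assms(2)] assms(3) c(1,2) _ v] c by simp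
  have f2: "?B (m \<lhd> (br c \<odot> v), [], n) = ?B (?m \<lhd> v, [], n)"
    using ra_assoc[OF assms(2) br_in[OF c(1)] v(1)] c v by simp
  have f3: "?B (m, [Da (br c \<odot> v)], n) = ?B (m, [Da (br c) \<odot> v], n) + s (ksign (deg c - 1)) (?B (m, [br c \<odot> Da v], n))"
    using slot_Da_cc[where f = "\<lambda>a. ?B (m, [a], n)", OF _ br_in[OF c(1)] v(1)] BP_slot[OF assms(1-3)] c v by simp
  have f4: "?B (m, [br c \<odot> Da v], n) = Q (m, c, Da v \<rhd> n) + s (ksign (deg c - 1)) (?B (?m, [Da v], n))"
    using BP_cons[OF assms(1-3) c Da_in[OF v(1)]] v by simp
  note f5 = BP_Da_br[OF assms(1-3) c v]
  have f6: "(br c \<odot> v) \<rhd> n = br c \<rhd> ?n"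
    using la_assoc[OF assms(3) br_in[OF c(1)] v(1)] v by simp
  have f7: "?B (m, [br c \<odot> v], dN n) = Q (m, c, v \<rhd> dN n) + s (ksign (deg c - 1)) (?B (?m, [v], dN n))"
    using BP_cons[OF assms(1,2) dN_in[OF assms(3)] c v(1,2)] v by simp
  have f8: "?B (dM ?m, [v], n) = ?B (dM m \<lhd> br c, [v], n) + s (ksign (deg m)) (?B (m \<lhd> Da (br c), [v], n))"
    using mD cD vD v c assms
    by (intro slot_dM_ra[where f = "\<lambda>m. ?B (m, [v], n)"] bml_mlin[OF bml] br_in) auto
  have f9: "Q (m, c, dN ?n) = Q (m, c, Da v \<rhd> n) + s (ksign (deg v)) (Q (m, c, v \<rhd> dN n))"
    using mD cD vD nD v c assms
    by (intro slot_dN_la[where f = "\<lambda>n. Q (m, c, n)"] qml_n[OF assms(1)]) auto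
  have f10: "qd Q (m, c, ?n) = Q (dM m, c, ?n) + (if 2 \<le> deg c then s (ksign (deg m)) (Q (m, dC c, ?n)) else 0)
     + s (ksign (deg m + deg c)) (Q (m, c, dN ?n))
     + (s (ksign (deg m)) (Q (?m, pt (tgt c), ?n)) + s (ksign (deg m)) (red s (\<lambda>a b. Q (m \<lhd> br a, b, ?n)) c))
     - (s (ksign (deg m)) (Q (m, pt (src c), br c \<rhd> ?n)) + s (ksign (deg m)) (red s (\<lambda>a b. s (ksign (deg a)) (Q (m, a, br b \<rhd> ?n))) c))"
    using v c by (intro qd_pos[OF assms(1,2) c(1) vn]) auto
  define Y where "Y = (if 2 \<le> deg c then Q (m, dC c, ?n) else 0)"
  have Y: "(if 2 \<le> deg c then s (ksign (deg m)) (Q (m, dC c, ?n)) else 0) = s (ksign (deg m)) Y"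
    by (simp add: Y_def)
  define Ra Rb where "Ra = red s (\<lambda>a b. s (ksign (deg a)) (Q (m, a, br b \<rhd> ?n))) c" and "Rb = red s (\<lambda>a b. Q (m \<lhd> br a, b, ?n)) c"
  have sc: "tgt m = src c" by (rule c(3))
  show ?thesis
    unfolding bd_single f1 f2 f3 f4 f5 f6 f7 f8 f10 f9 Y Y_def[symmetric] Ra_def[symmetric] Rb_def[symmetric]
    \<comment> \<open>After all substitutions both sides are sums of the same values; fixing the
      three parities makes the signs explicit.\<close>
    by (cases "even (deg m)"; cases "even (deg c)"; cases "even (deg v)")
      (simp_all add: ksign_def sc algebra_simps)
qed

text \<open>Each operation shortens a bar word by at most one letter, so from three letters at least
  two remain, and there \<pi> is zero.\<close>

lemma rb_vanish3:
  assumes "\<And>a b cs n. F (a # b # cs) n = 0"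
  shows "rb e F (a # b # c # cs) n = 0"
proof -
  have "(\<lambda>bs. F (a # b # bs)) = (\<lambda>_ _. 0)" using assms by (simp add: fun_eq_iff)
  then show ?thesis using assms by (simp add: rb_zero_fun J_def split: list.split)
qed

text \<open>Length zero is the degree 0 case of the differential of \<Q>; length one is the
  induction on the word by \<open>BP_bd_cons\<close>; length two is \<open>BP_mult\<close>; from
  length three on all terms vanish.\<close>

lemma BP_bd:
  assumes "qml Q" and "m \<in> mod_arrs C M" "n \<in> mod_arrs C N" and "lt (tgt m) as (src n)"
  shows "bd (BP Q) (m, as, n) = BP (qd Q) (m, as, n)"
proof (cases as rule: remdups_adj.cases)
  case 1
  note mD = mod_arrsD[OF assms(2)]
  have "tgt m = src n" using assms(4) 1 by simp
  then show ?thesis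
    using 1 qd_0[OF assms(1,2) pt_coalg_arrs[OF mD(2)] assms(3)] by (simp add: bd_simps)
next
  case (2 a)
  then have a: "a \<in> cobar_arrs C" "src a = tgt m" "tgt a = src n" using assms(4) by auto
  note nD = mod_arrsD[OF assms(3)]
  let ?f = "\<lambda>m a. bd (BP Q) (m, [a], n)" and ?g = "\<lambda>m a. BP (qd Q) (m, [a], n)"
  have bml: "bml (bd (BP Q))" by (intro bml_bd bml_BP assms)
  have bml': "bml (BP (qd Q))" by (intro bml_BP qml_qd assms)
  have "?f m a = ?g m a"
  proof (rule slot_word_induct[where f = ?f and g = ?g and y = "src n"])
    show "cslot (?f m) (tgt m) (src n) j" "cslot (?g m) (tgt m) (src n) j" if "m \<in> mod_arrs C M" for m j
      using bml_slot_hd[OF bml that assms(3), of "src n" "[]"] bml_slot_hd[OF bml' that assms(3), of "src n" "[]"] nD by auto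
    show "?f m (ident (src n)) = ?g m (ident (src n))" if "m \<in> mod_arrs C M" "tgt m = src n" for m
      using bml_ident_hd[OF bml that(1) assms(3), of "[]"] bml_ident_hd[OF bml' that(1) assms(3), of "[]"] that by simp
    fix m c v assume h: "m \<in> mod_arrs C M" "c \<in> coalg_arrs C" "1 \<le> deg c" "tgt m = src c"
      "v \<in> cobar_arrs C" "src v = tgt c" "tgt v = src n" and IH: "?f (m \<lhd> br c) v = ?g (m \<lhd> br c) v"
    show "?f m (br c \<odot> v) = ?g m (br c \<odot> v)"
      unfolding BP_bd_cons[OF assms(1) h(1) assms(3) h(2-7)] IH
        BP_cons[OF qml_qd[OF assms(1)] h(1) assms(3) h(2-7)] ..
  qed (use assms a in auto)
  then show ?thesis using 2 by simp
next
  case (3 a b cs)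
  show ?thesis
  proof (cases cs)
    case Nil
    then have ab: "a \<in> cobar_arrs C" "src a = tgt m" "b \<in> cobar_arrs C" "tgt a = src b" "tgt b = src n"
      using assms(4) 3 by auto
    have eb: "deg m + deg a + 1 = deg m + (deg a + 1)" by simp
    show ?thesis
      using 3 Nil BP_mult[OF assms(1-3) ab(1,3)] ab
      by (simp add: bd_simps ksign_def S.scale_right_distrib)
  next
    case (Cons d ds)
    then show ?thesis using 3 rb_vanish3[of "\<lambda>as n. BP Q (m, as, n)" "deg m" a b d ds n]
      by (simp add: bd_simps del: rb.simps)
  qed
qed

section \<open>The homotopy identity\<close>

lemma AA_rb_swap: "AA (\<lambda>l. rb e (F l) W n) c = rb e (\<lambda>bs n. AA (\<lambda>l. F l bs n) c) W n"
proof (induction W arbitrary: e F)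
  case (Cons a W)
  have "AA (\<lambda>l. J e a (F l) W n) c = J e a (\<lambda>bs n. AA (\<lambda>l. F l bs n) c) W n"
    by (cases W) (simp_all add: AA_uminus AA_scale)
  then show ?case
    by (simp add: AA_add AA_diff AA_uminus AA_scale Cons)
qed (simp add: AA_scale)

text \<open>The analogue of \<open>BP_Da_br\<close> with single letters replaced by cuts. The two
  reduced sums on the right are, up to sign, the boundary terms produced by \<open>AA_rb\<close>,
  against which they cancel in \<open>homotopy_cons\<close>.\<close>

lemma HB_Da_br:
  assumes "bml B" and "m \<in> mod_arrs C M" "n \<in> mod_arrs C N"
    and c: "c \<in> coalg_arrs C" "1 \<le> deg c" "tgt m = src c"
    and v: "v \<in> cobar_arrs C" "src v = tgt c" and W: "lt (tgt v) W (src n)"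
  shows "HB B (m, (Da (br c) \<odot> v) # W, n) = s (ksign (deg c)) (HB B (m \<lhd> Da (br c), v # W, n))
    - s (ksign (deg m + deg c)) (if 2 \<le> deg c then AA (\<lambda>l. B (m, l @ v # W, n)) (dC c) else 0)
    - s (ksign (deg m)) (red s (\<lambda>a b. AA (\<lambda>l. B (m, l @ (br b \<odot> v) # W, n)) a) c)
    - s (ksign (deg m + deg c)) (red s (\<lambda>a b. AA (\<lambda>l. B (m \<lhd> br a, l @ v # W, n)) b) c)"
proof -
  note cD = coalg_arrsD[OF c(1)] and mD = mod_arrsD[OF assms(2)] and nD = mod_arrsD[OF assms(3)] and vD = cobar_arrsD[OF v(1)]
  let ?G1 = "\<lambda>a. HB B (m, (a \<odot> v) # W, n)" and ?G2 = "\<lambda>a. HB B (m \<lhd> a, v # W, n)"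
  let ?X1 = "\<lambda>a b. s (ksign (deg a)) (?G1 (br a \<odot> br b))" and ?X2 = "\<lambda>a b. s (ksign (deg a)) (?G2 (br a \<odot> br b))"
  let ?Ra = "\<lambda>a b. AA (\<lambda>l. B (m, l @ (br b \<odot> v) # W, n)) a" and ?Rb = "\<lambda>a b. AA (\<lambda>l. B (m \<lhd> br a, l @ v # W, n)) b"
  have s1: "cslot ?G1 (src c) (tgt c) (deg c - 2)"
    using HB_slot[OF assms(1-3) W vD(2)] c v by (intro cslot_cc_left[where f = "\<lambda>a. HB B (m, a # W, n)"]) auto
  have s2: "cslot ?G2 (src c) (tgt c) (deg c - 2)"
    using assms mD vD cD by (intro cslot_ra bml_mlin[OF bml_HB[OF assms(1)]]) auto
  define H where "H = (if deg c = 2 \<and> src c = tgt c then s (curv C (elt c)) (HB B (m, v # W, n)) else 0)"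
  have H1: "(if deg c = 2 \<and> src c = tgt c then s (curv C (elt c)) (?G1 (ident (src c))) else 0) = H"
    using cc_ident_left[OF v(1)] v by (auto simp: H_def)
  have H2: "(if deg c = 2 \<and> src c = tgt c then s (curv C (elt c)) (?G2 (ident (src c))) else 0) = H"
    using ra_ident[OF assms(2)] c by (auto simp: H_def)
  define Z where "Z = (if 2 \<le> deg c then ?G2 (br (dC c)) else 0)"
  define Y where "Y = (if 2 \<le> deg c then AA (\<lambda>l. B (m, l @ v # W, n)) (dC c) else 0)"
  have Z1: "(if 2 \<le> deg c then ?G1 (br (dC c)) else 0) = s (ksign (deg m + deg c)) Y + s (ksign (deg c)) Z"
    using HB_cons[OF assms(1-3), of "dC c" v W] dC_coalg_arrs[OF c(1)] c v W
    by (simp add: Y_def Z_def ksign_def)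
  have "red s ?X1 c = red s (\<lambda>a b. - s (ksign (deg m)) (?Ra a b) - s (ksign (deg m + deg c)) (?Rb a b) + s (ksign (deg c)) (?X2 a b)) c"
  proof (rule red_cong[OF mod c(1)])
    fix a b assume "(a, b) \<in> psplits c"
    note ab = psplitsD[OF this]
    have ma: "m \<lhd> br a \<in> mod_arrs C M" using ab assms by (intro ra_in br_in) auto
    have bv: "br b \<odot> v \<in> cobar_arrs C" using ab v by (intro cc_in br_in) auto
    have "?G1 (br a \<odot> br b) = s (ksign (deg m + deg a - 1)) (?Ra a b) + s (ksign (deg a - 1)) (HB B (m \<lhd> br a, (br b \<odot> v) # W, n))"
      using HB_cons[OF assms(1-3) ab(1,7) _ bv] ab c v W by (simp add: cc_assoc)
    moreover have "HB B (m \<lhd> br a, (br b \<odot> v) # W, n) = s (ksign (deg m + (deg a - 1) + deg b - 1)) (?Rb a b)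
        + s (ksign (deg b - 1)) (?G2 (br a \<odot> br b))"
      using HB_cons[OF assms(1) ma assms(3) ab(2,8) _ v(1)] ab c v W assms by (simp add: ra_assoc br_in)
    moreover have "(ksign (deg a) * ksign (deg m + deg a - 1) :: 'k) = - ksign (deg m)"
      "(ksign (deg a) * (ksign (deg a - 1) * ksign (deg m + (deg a - 1) + deg b - 1)) :: 'k) = - ksign (deg m + deg c)"
      "(ksign (deg a) * (ksign (deg a - 1) * ksign (deg b - 1)) :: 'k) = ksign (deg c) * ksign (deg a)"
      using ab(6)[symmetric] by (simp_all add: ksign_def)
    ultimately show "?X1 a b = - s (ksign (deg m)) (?Ra a b) - s (ksign (deg m + deg c)) (?Rb a b) + s (ksign (deg c)) (?X2 a b)"
      by (simp only: S.scale_right_distrib S.scale_scale S.scale_minus_left) simp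
  qed
  also have "\<dots> = - s (ksign (deg m)) (red s ?Ra c) - s (ksign (deg m + deg c)) (red s ?Rb c) + s (ksign (deg c)) (red s ?X2 c)"
    by (simp only: red_add[OF mod] red_diff[OF mod] red_uminus[OF mod] red_scale[OF mod])
  finally have X1: "red s ?X1 c = - s (ksign (deg m)) (red s ?Ra c) - s (ksign (deg m + deg c)) (red s ?Rb c) + s (ksign (deg c)) (red s ?X2 c)" .
  have HH: "s (ksign (deg c)) H = H" by (simp add: H_def)
  have "s (ksign (deg c)) (?G2 (Da (br c))) = - H - s (ksign (deg c)) Z + s (ksign (deg c)) (red s ?X2 c)"
    unfolding slot_Da_br_curv[OF c(1,2) s2] H2 Z_def[symmetric]
    by (simp add: S.scale_right_distrib S.scale_right_diff_distrib HH)
  then show ?thesis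
    unfolding slot_Da_br_curv[OF c(1,2) s1] H1 Z1 X1 Y_def[symmetric] by simp
qed

text \<open>The homotopy applied to {c}v is the cuts of c in front of v plus the homotopy of v over
  m{c}. In the differential of the cuts, the single bracket {c} acting on m gives the term at m{c},
  and its product with v gives minus the identity. The term with d on a factor and the remaining
  boundary terms cancel against \<open>HB_Da_br\<close>.\<close>

lemma homotopy_cons:
  assumes "bml B" and "m \<in> mod_arrs C M" "n \<in> mod_arrs C N"
    and c: "c \<in> coalg_arrs C" "1 \<le> deg c" "tgt m = src c"
    and v: "v \<in> cobar_arrs C" "src v = tgt c" and W: "lt (tgt v) W (src n)"
  shows "bd (HB B) (m, (br c \<odot> v) # W, n) + HB (bd B) (m, (br c \<odot> v) # W, n)
    = s (ksign (deg c - 1)) (bd (HB B) (m \<lhd> br c, v # W, n) + HB (bd B) (m \<lhd> br c, v # W, n))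
      + s (ksign (deg c - 1)) (B (m \<lhd> br c, v # W, n)) - B (m, (br c \<odot> v) # W, n)
      + (if W = [] then AA (\<lambda>l. B (m, l, v \<rhd> n)) c else 0)"
proof -
  note cD = coalg_arrsD[OF c(1)] and mD = mod_arrsD[OF assms(2)] and nD = mod_arrsD[OF assms(3)] and vD = cobar_arrsD[OF v(1)]
  let ?h = "HB B" and ?m = "m \<lhd> br c" and ?a = "br c \<odot> v" and ?e = "deg m + deg c + deg v"
  have mc: "?m \<in> mod_arrs C M" using assms by (intro ra_in br_in) auto
  note bml = bml_HB[OF assms(1)]
  have lvW: "lt (tgt c) (v # W) (src n)" using v W by simp
  \<comment> \<open>The cuts of \<open>c\<close> followed by a variable tail, as a function of that
    tail; by \<open>AA_rb_swap\<close> the differential of the tail can be applied to it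
    directly.\<close>
  define \<Gamma> where "\<Gamma> = (\<lambda>bs n. AA (\<lambda>l. B (m, l @ bs, n)) c)"
  define Ra where "Ra = red s (\<lambda>a b. AA (\<lambda>l. B (m, l @ (br b \<odot> v) # W, n)) a) c"
  define Rb where "Rb = red s (\<lambda>a b. AA (\<lambda>l. B (m \<lhd> br a, l @ v # W, n)) b) c"
  define Y where "Y = (if 2 \<le> deg c then AA (\<lambda>l. B (m, l @ v # W, n)) (dC c) else 0)"
  have g1: "HB (bd B) (m, ?a # W, n) = s (ksign (deg m + deg c - 1)) (AA (\<lambda>l. bd B (m, l @ v # W, n)) c)
      + s (ksign (deg c - 1)) (HB (bd B) (?m, v # W, n))"
    by (rule HB_cons[OF bml_bd[OF assms(1)] assms(2,3) c v W])
  have g2: "AA (\<lambda>l. bd B (m, l @ v # W, n)) c = AA (\<lambda>l. B (dM m, l @ v # W, n)) c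
      + (s (ksign (deg m)) (B (?m, v # W, n)) + s (ksign (deg m)) Rb)
      + (s (ksign (deg m)) Y + (s (ksign (deg m + deg c)) (B (m, ?a # W, n)) + s (ksign (deg m + deg c)) Ra)
         + rb (deg m + deg c) \<Gamma> (v # W) n)"
  proof -
    have lF: "lml (src c) (\<lambda>as n. B (m, as, n))" "nrm (src c) (\<lambda>as n. B (m, as, n))"
      using bml_lml[OF assms(1,2) c(3)] bml_nrm[OF assms(1,2) c(3)] .
    have R: "red s (\<lambda>a b. AA (\<lambda>l. J (deg m + deg a) (br b) (\<lambda>bs n. B (m, l @ bs, n)) (v # W) n) a) c
        = s (ksign (deg m + deg c)) Ra"
      unfolding Ra_def red_scale[OF mod, symmetric]
    proof (rule red_cong[OF mod c(1)])
      fix a b assume "(a, b) \<in> psplits c"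
      note ab = psplitsD[OF this]
      have "deg m + deg a + (deg b - 1) + 1 = deg m + deg c" using ab(6) by simp
      then show "AA (\<lambda>l. J (deg m + deg a) (br b) (\<lambda>bs n. B (m, l @ bs, n)) (v # W) n) a
          = s (ksign (deg m + deg c)) (AA (\<lambda>l. B (m, l @ (br b \<odot> v) # W, n)) a)"
        by (simp add: AA_scale)
    qed
    have J: "J (deg m) (br c) (\<lambda>as n. B (m, as, n)) (v # W) n = s (ksign (deg m + deg c)) (B (m, ?a # W, n))"
      by simp
    have "AA (\<lambda>l. bd B (m, l @ v # W, n)) c = AA (\<lambda>l. B (dM m, l @ v # W, n)) c
        + AA (\<lambda>l. case l @ v # W of [] \<Rightarrow> 0 | a # bs \<Rightarrow> s (ksign (deg m)) (B (m \<lhd> a, bs, n))) c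
        + AA (\<lambda>l. rb (deg m) (\<lambda>as n. B (m, as, n)) (l @ v # W) n) c"
      by (simp add: bd_def AA_add)
    then show ?thesis
      unfolding AA_first[OF c(1,2)] AA_rb[OF c(1,2) lF lvW assms(3)] R J AA_rb_swap
      by (simp only: \<Gamma>_def Rb_def Y_def)
  qed
  have g3: "rb (deg m + deg c) \<Gamma> (v # W) n = - s (ksign (deg m + deg c)) (\<Gamma> (Da v # W) n) + J (deg m + deg c) v \<Gamma> W n
      - rb ?e (\<lambda>bs. \<Gamma> (v # bs)) W n"
    using rb_shift[of ?e 1 "\<lambda>bs. \<Gamma> (v # bs)" W n] by simp
  have g4: "bd ?h (m, ?a # W, n) = ?h (dM m, ?a # W, n) + s (ksign (deg m)) (?h (m \<lhd> ?a, W, n))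
      + (- s (ksign (deg m)) (?h (m, Da ?a # W, n)) + J (deg m) ?a (\<lambda>as n. ?h (m, as, n)) W n
      + rb ?e (\<lambda>bs n. ?h (m, ?a # bs, n)) W n)"
    by (simp add: bd_simps add_ac)
  have g5: "?h (dM m, ?a # W, n) = s (ksign (deg m + deg c)) (AA (\<lambda>l. B (dM m, l @ v # W, n)) c)
      + s (ksign (deg c - 1)) (?h (dM m \<lhd> br c, v # W, n))"
    using HB_cons[OF assms(1) dM_in[OF assms(2)] assms(3) c(1,2) _ v W] c by (simp add: ksign_def)
  have g6: "?h (m, Da ?a # W, n) = ?h (m, (Da (br c) \<odot> v) # W, n) + s (ksign (deg c - 1)) (?h (m, (br c \<odot> Da v) # W, n))"
    using slot_Da_cc[where f = "\<lambda>a. ?h (m, a # W, n)", OF _ br_in[OF c(1)] v(1)] HB_slot[OF assms(1-3) W vD(2)] c v by simp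
  have g7: "?h (m, (br c \<odot> Da v) # W, n) = s (ksign (deg m + deg c - 1)) (\<Gamma> (Da v # W) n) + s (ksign (deg c - 1)) (?h (?m, Da v # W, n))"
    using HB_cons[OF assms(1-3) c Da_in[OF v(1)]] v W by (simp add: \<Gamma>_def)
  have g8: "?h (m, (Da (br c) \<odot> v) # W, n) = s (ksign (deg c)) (?h (m \<lhd> Da (br c), v # W, n))
      - s (ksign (deg m + deg c)) Y - s (ksign (deg m)) Ra - s (ksign (deg m + deg c)) Rb"
    unfolding Y_def Ra_def Rb_def by (rule HB_Da_br[OF assms(1-3) c v W])
  \<comment> \<open>For empty \<open>W\<close> the product of the last letter into \<open>n\<close>
    leaves the empty bar word, on which the homotopy is zero but \<Gamma> is not. The correction is
    exactly the new term of \<alpha> \<circ> \<pi>.\<close>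
  have g9: "J (deg m) ?a (\<lambda>as n. ?h (m, as, n)) W n = - s (ksign (deg m + deg c - 1)) (J (deg m + deg c) v \<Gamma> W n)
      + s (ksign (deg c - 1)) (J (deg m + deg c - 1) v (\<lambda>as n. ?h (?m, as, n)) W n)
      + (if W = [] then \<Gamma> [] (v \<rhd> n) else 0)"
  proof (cases W)
    case Nil
    have "(ksign (deg m + deg c - 1) * ksign (deg m + deg c) :: 'k) = -1" by (simp add: ksign_def)
    then show ?thesis using Nil by simp
  next
    case (Cons b bs)
    then have b: "b \<in> cobar_arrs C" "src b = tgt v" "lt (tgt b) bs (src n)" using W by auto
    have "?h (m, (br c \<odot> (v \<odot> b)) # bs, n) = s (ksign (deg m + deg c - 1)) (\<Gamma> ((v \<odot> b) # bs) n)
        + s (ksign (deg c - 1)) (?h (?m, (v \<odot> b) # bs, n))"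
      using HB_cons[OF assms(1-3) c, of "v \<odot> b" bs] b v by (simp add: \<Gamma>_def cc_in)
    then show ?thesis using Cons
      by (cases "even (deg m)"; cases "even (deg c)"; cases "even (deg v)") (simp_all add: cc_assoc ksign_def)
  qed
  have g10: "rb ?e (\<lambda>bs n. ?h (m, ?a # bs, n)) W n = s (ksign (deg m + deg c - 1)) (rb ?e (\<lambda>bs. \<Gamma> (v # bs)) W n)
      + s (ksign (deg c - 1)) (rb ?e (\<lambda>bs n. ?h (?m, v # bs, n)) W n)"
  proof -
    have "rb ?e (\<lambda>bs n. ?h (m, ?a # bs, n)) W n = rb ?e (\<lambda>bs n. s (ksign (deg m + deg c - 1)) (\<Gamma> (v # bs) n)
        + s (ksign (deg c - 1)) (?h (?m, v # bs, n))) W n"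
      by (rule rb_cong[OF _ W assms(3)]) (use HB_cons[OF assms(1,2) _ c v] in \<open>simp add: \<Gamma>_def\<close>)
    then show ?thesis by (simp add: rb_add rb_scale)
  qed
  have g11: "bd ?h (?m, v # W, n) = ?h (dM ?m, v # W, n) + s (ksign (deg m + deg c - 1)) (?h (?m \<lhd> v, W, n))
      + (- s (ksign (deg m + deg c - 1)) (?h (?m, Da v # W, n)) + J (deg m + deg c - 1) v (\<lambda>as n. ?h (?m, as, n)) W n
      + rb ?e (\<lambda>bs n. ?h (?m, v # bs, n)) W n)"
    by (simp add: bd_simps algebra_simps)
  have g12: "?h (dM ?m, v # W, n) = ?h (dM m \<lhd> br c, v # W, n) + s (ksign (deg m)) (?h (m \<lhd> Da (br c), v # W, n))"
    using mD cD vD v c assms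
    by (intro slot_dM_ra[where f = "\<lambda>m. ?h (m, v # W, n)"] bml_mlin[OF bml] br_in) auto
  have g13: "m \<lhd> ?a = ?m \<lhd> v"
    using ra_assoc[OF assms(2) br_in[OF c(1)] v(1)] c v by simp
  have g14: "(if W = [] then AA (\<lambda>l. B (m, l, v \<rhd> n)) c else 0) = (if W = [] then \<Gamma> [] (v \<rhd> n) else 0)"
    by (simp add: \<Gamma>_def)
  define K where "K = (if W = [] then \<Gamma> [] (v \<rhd> n) else 0)"
  define T1 where "T1 = J (deg m + deg c) v \<Gamma> W n"
  define T2 where "T2 = J (deg m + deg c - 1) v (\<lambda>as n. ?h (?m, as, n)) W n"
  define T3 where "T3 = rb ?e (\<lambda>bs. \<Gamma> (v # bs)) W n"
  define T4 where "T4 = rb ?e (\<lambda>bs n. ?h (?m, v # bs, n)) W n"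
  define T5 where "T5 = AA (\<lambda>l. B (dM m, l @ v # W, n)) c"
  show ?thesis
    unfolding g1 g2 g3 g4 g5 g6 g7 g8 g9 g10 g11 g12 g13 g14 K_def[symmetric] T1_def[symmetric] T2_def[symmetric]
      T3_def[symmetric] T4_def[symmetric] T5_def[symmetric]
    by (cases "even (deg m)"; cases "even (deg c)") (simp_all add: ksign_def algebra_simps)
qed

text \<open>Both sides vanish when the first letter is an identity, by normalization, and both obey
  the recursion of \<open>homotopy_cons\<close>: on the right it comes from \<open>BP_cons\<close>,
  whose extra term is present only for bar words of length one.\<close>

lemma homotopy:
  assumes "bml B" and "m \<in> mod_arrs C M" "n \<in> mod_arrs C N" and "lt (tgt m) as (src n)"
  shows "bd (HB B) (m, as, n) + HB (bd B) (m, as, n) = BP (AB B) (m, as, n) - B (m, as, n)"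
proof (cases as)
  case Nil
  then show ?thesis using mod_arrsD[OF assms(2)] by (simp add: bd_simps AB_pt)
next
  case (Cons a W)
  then have a: "a \<in> cobar_arrs C" "src a = tgt m" "lt (tgt a) W (src n)" using assms(4) by auto
  note aD = cobar_arrsD[OF a(1)]
  let ?f = "\<lambda>m a. bd (HB B) (m, a # W, n) + HB (bd B) (m, a # W, n)"
    and ?g = "\<lambda>m a. BP (AB B) (m, a # W, n) - B (m, a # W, n)"
  note bml1 = bml_bd[OF bml_HB[OF assms(1)]] and bml2 = bml_HB[OF bml_bd[OF assms(1)]]
    and bml3 = bml_BP[OF qml_AB[OF assms(1)]]
  have "?f m a = ?g m a"
  proof (rule slot_word_induct[where f = ?f and g = ?g and y = "tgt a"])
    fix m j assume m: "m \<in> mod_arrs C M"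
    note sl = bml_slot_hd[OF _ m assms(3) a(3) aD(2)]
    show "cslot (?f m) (tgt m) (tgt a) j" by (intro cslot_add sl bml1 bml2)
    have "cslot (\<lambda>a. BP (AB B) (m, a # W, n) + - B (m, a # W, n)) (tgt m) (tgt a) j"
      by (intro cslot_add cslot_uminus sl bml3 assms(1))
    then show "cslot (?g m) (tgt m) (tgt a) j" by simp
  next
    fix m assume m: "m \<in> mod_arrs C M" "tgt m = tgt a"
    have *: "B' (m, ident (tgt a) # W, n) = 0" if "bml B'" for B'
      using bml_ident_hd[OF that m(1) assms(3), of W] a(3) m(2) by simp
    show "?f m (ident (tgt a)) = ?g m (ident (tgt a))"
      by (simp add: *[OF bml1] *[OF bml2] *[OF bml3] *[OF assms(1)])
  next
    fix m c v assume h: "m \<in> mod_arrs C M" "c \<in> coalg_arrs C" "1 \<le> deg c" "tgt m = src c"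
      "v \<in> cobar_arrs C" "src v = tgt c" "tgt v = tgt a" and IH: "?f (m \<lhd> br c) v = ?g (m \<lhd> br c) v"
    have W: "lt (tgt v) W (src n)" using a(3) h(7) by simp
    have "BP (AB B) (m, (br c \<odot> v) # W, n) = s (ksign (deg c - 1)) (BP (AB B) (m \<lhd> br c, v # W, n))
        + (if W = [] then AA (\<lambda>l. B (m, l, v \<rhd> n)) c else 0)"
    proof (cases W)
      case Nil
      then have "tgt v = src n" using W by simp
      from BP_cons[OF qml_AB[OF assms(1)] h(1) assms(3) h(2-6) this] show ?thesis
        using Nil h(3) by (simp add: AB_pos)
    qed simp
    then show "?f m (br c \<odot> v) = ?g m (br c \<odot> v)"
      unfolding homotopy_cons[OF assms(1) h(1) assms(3) h(2-6) W] IH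
      by (simp add: S.scale_right_diff_distrib)
  qed (use assms a in auto)
  then show ?thesis using Cons by simp
qed

end

section \<open>The maps on the quotients\<close>

text \<open>The generators of \<open>bar_rels\<close>, separated from the span so that
  \<open>kills_span\<close> reduces well-definedness to them.\<close>

definition bar_rel_gens ::
    "('k::comm_ring_1, 'c::ab_group_add) coalg \<Rightarrow> ('k, 'c, 'm::ab_group_add) rmod \<Rightarrow>
     ('k, 'c, 'n::ab_group_add) lmod \<Rightarrow> (('k, 'c, 'm, 'n) bar_gen \<Rightarrow>\<^sub>0 'k) set" where
  "bar_rel_gens C M N =
     \<Union>{lin_rels (bmul M) (piece M x y i) (\<lambda>u. (Arr x i u y, as, n))
        | x y i as n. (Arr x i 0 y, as, n) \<in> bar_gens C M N}
    \<union> \<Union>{lin_rels (bmul N) (piece N x y i) (\<lambda>u. (m, as, Arr x i u y))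
        | x y i as m. (m, as, Arr x i 0 y) \<in> bar_gens C M N}
    \<union> \<Union>{lin_rels fscale (cobar_hom C x y i) (\<lambda>u. (m, as @ [Arr x i u y] @ bs, n))
        | x y i as bs m n. (m, as @ [Arr x i 0 y] @ bs, n) \<in> bar_gens C M N}
    \<union> {gen (m, as @ [a] @ bs, n)
        | m as a bs n. (m, as @ [a] @ bs, n) \<in> bar_gens C M N \<and> elt a \<in> normal_rel C}"

definition q_rel_gens ::
    "('k::comm_ring_1, 'c::ab_group_add) coalg \<Rightarrow> ('k, 'c, 'm::ab_group_add) rmod \<Rightarrow>
     ('k, 'c, 'n::ab_group_add) lmod \<Rightarrow> (('c, 'm, 'n) q_gen \<Rightarrow>\<^sub>0 'k) set" where
  "q_rel_gens C M N =
     \<Union>{lin_rels (bmul M) (piece M x y i) (\<lambda>u. (Arr x i u y, c, n))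
        | x y i c n. (Arr x i 0 y, c, n) \<in> q_gens C M N}
    \<union> \<Union>{lin_rels (smul C) (coalg_piece C x y (nat i)) (\<lambda>u. (m, Arr x i u y, n))
        | x y i m n. (m, Arr x i 0 y, n) \<in> q_gens C M N}
    \<union> \<Union>{lin_rels (bmul N) (piece N x y i) (\<lambda>u. (m, c, Arr x i u y))
        | x y i m c. (m, c, Arr x i 0 y) \<in> q_gens C M N}"

lemma rels_Bar: "rels (Bar C M N) = fs.span (bar_rel_gens C M N)"
  by (simp add: Bar_def bar_rels_def bar_rel_gens_def)

lemma rels_Qcx: "rels (Qcx C M N) = fs.span (q_rel_gens C M N)"
  by (simp add: Qcx_def q_rels_def q_rel_gens_def)

context bar_context
begin

lemma bar_gens_iff:
  "(m, as, n) \<in> bar_gens C M N \<longleftrightarrow> m \<in> mod_arrs C M \<and> n \<in> mod_arrs C N \<and> lt (tgt m) as (src n)"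
  by (auto simp: bar_gens_def lt_def)

lemma q_gens_iff:
  "(m, c, n) \<in> q_gens C M N \<longleftrightarrow>
    m \<in> mod_arrs C M \<and> c \<in> coalg_arrs C \<and> n \<in> mod_arrs C N \<and> tgt m = src c \<and> tgt c = src n"
  by (simp add: q_gens_def)

lemma kills_bar_rel_gens:
  "kills s (bar_rel_gens C M N) B \<longleftrightarrow>
     (\<forall>x y i as n. (Arr x i 0 y, as, n) \<in> bar_gens C M N \<longrightarrow> mlin (\<lambda>m. B (m, as, n)) x y i)
   \<and> (\<forall>x y i as m. (m, as, Arr x i 0 y) \<in> bar_gens C M N \<longrightarrow> nlin (\<lambda>n. B (m, as, n)) x y i)
   \<and> (\<forall>x y i as bs m n. (m, as @ [Arr x i 0 y] @ bs, n) \<in> bar_gens C M N \<longrightarrow>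
        lin_on fscale (cobar_hom C x y i) s (\<lambda>u. B (m, as @ [Arr x i u y] @ bs, n)))
   \<and> (\<forall>m as a bs n. (m, as @ [a] @ bs, n) \<in> bar_gens C M N \<and> elt a \<in> normal_rel C \<longrightarrow>
        B (m, as @ [a] @ bs, n) = 0)"
proof -
  have 1: "kills s {gen (m, as @ [a] @ bs, n) | m as a bs n. (m, as @ [a] @ bs, n) \<in> bar_gens C M N \<and> elt a \<in> normal_rel C} B
     \<longleftrightarrow> (\<forall>m as a bs n. (m, as @ [a] @ bs, n) \<in> bar_gens C M N \<and> elt a \<in> normal_rel C \<longrightarrow>
        B (m, as @ [a] @ bs, n) = 0)"
    unfolding kills_def by (auto, metis S.lext_gen)
  show ?thesis
    unfolding bar_rel_gens_def S.kills_Un S.kills_Union 1 mlin_def nlin_def conj_assoc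
    by (intro conj_cong refl iffI ballI allI impI; (elim CollectE exE conjE)?) (fastforce simp: S.kills_lin_rels)+
qed

lemma kills_q_rel_gens: "kills s (q_rel_gens C M N) Q \<longleftrightarrow>
     (\<forall>x y i c n. (Arr x i 0 y, c, n) \<in> q_gens C M N \<longrightarrow> mlin (\<lambda>m. Q (m, c, n)) x y i)
   \<and> (\<forall>x y i m n. (m, Arr x i 0 y, n) \<in> q_gens C M N \<longrightarrow> alin s (\<lambda>c. Q (m, c, n)) x y i)
   \<and> (\<forall>x y i m c. (m, c, Arr x i 0 y) \<in> q_gens C M N \<longrightarrow> nlin (\<lambda>n. Q (m, c, n)) x y i)"
  unfolding q_rel_gens_def S.kills_Un S.kills_Union mlin_def nlin_def alin_def conj_assoc
  by (intro conj_cong refl iffI ballI allI impI; (elim CollectE exE conjE)?) (fastforce simp: S.kills_lin_rels)+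

lemma ident_normal_rel: "x \<in> points C \<Longrightarrow> elt (ident x) \<in> normal_rel C"
  by (auto simp: normal_rel_def intro: fs.span_base)

lemma cobar_rel_normal_rel: "u \<in> cobar_rel C \<Longrightarrow> u \<in> normal_rel C"
  unfolding normal_rel_def by (rule fs.span_base) simp

text \<open>The only gap between the two notions is the normalized relation: \<open>nrm\<close>
  speaks of identity arrows, while the relation concerns every morphism in the span of relations and
  identities.\<close>

lemma bml_iff: "bml B \<longleftrightarrow> kills s (bar_rel_gens C M N) B"
proof
  assume B: "bml B"
  show "kills s (bar_rel_gens C M N) B"
    unfolding kills_bar_rel_gens
  proof (intro conjI allI impI; (elim conjE)?)
    fix x y i as n assume "(Arr x i 0 y, as, n) \<in> bar_gens C M N"
    then show "mlin (\<lambda>m. B (m, as, n)) x y i"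
      using mod_arrsD(1,2)[of "Arr x i 0 y" M] by (intro bml_mlin[OF B]) (auto simp: bar_gens_iff)
  next
    fix x y i as m assume "(m, as, Arr x i 0 y) \<in> bar_gens C M N"
    then show "nlin (\<lambda>n. B (m, as, n)) x y i"
      using mod_arrsD(1,2)[of "Arr x i 0 y" N] by (intro bml_nlin[OF B]) (auto simp: bar_gens_iff)
  next
    fix x y i as bs m n assume "(m, as @ [Arr x i 0 y] @ bs, n) \<in> bar_gens C M N"
    then have "m \<in> mod_arrs C M" "n \<in> mod_arrs C N" "lt (tgt m) as x" "lt y bs (src n)" "Arr x i 0 y \<in> cobar_arrs C"
      by (auto simp: bar_gens_iff lt_append)
    then show "lin_on fscale (cobar_hom C x y i) s (\<lambda>u. B (m, as @ [Arr x i u y] @ bs, n))"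
      using bml_slot[OF B, of m n as x y bs i] cobar_arrsD(1,2)[of "Arr x i 0 y"] by (simp add: cslot_def)
  next
    fix m as a bs n assume "(m, as @ [a] @ bs, n) \<in> bar_gens C M N" and r: "elt a \<in> normal_rel C"
    then have h: "m \<in> mod_arrs C M" "n \<in> mod_arrs C N" "lt (tgt m) as (src a)" "lt (tgt a) bs (src n)" "a \<in> cobar_arrs C"
      by (auto simp: bar_gens_iff lt_append)
    let ?f = "\<lambda>a. B (m, as @ a # bs, n)"
    note aD = cobar_arrsD[OF h(5)]
    have sl: "cslot ?f (src a) (tgt a) j" for j
      by (rule bml_slot[OF B h(1-4) aD(1,2)])
    \<comment> \<open>Setting the value on the empty word to zero makes
      \<open>wml_normal_rel\<close> applicable. By normalization of \<open>B\<close> this does not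
      change the values on words from \<open>src a\<close> to \<open>tgt a\<close>.\<close>
    define \<phi> where "\<phi> cs = (if cs = [] then 0 else ?f (mono_arr (src a) cs (tgt a)))" for cs
    have "wml s \<phi> (src a) (tgt a)"
      using wmlD[OF wml_of_cslot[where f = ?f, OF sl]] by (intro wmlI[OF mod]) (simp add: \<phi>_def)
    then have "wx s \<phi> (elt a) = 0"
      by (rule wml_normal_rel[OF _ _ aD(3) r]) (simp add: \<phi>_def)
    moreover have "wx s \<phi> (elt a) = wx s (\<lambda>cs. ?f (mono_arr (src a) cs (tgt a))) (elt a)"
    proof (rule wx_cong[OF mod aD(3)])
      fix cs assume cs: "wd (src a) cs (tgt a)"
      show "\<phi> cs = ?f (mono_arr (src a) cs (tgt a))"
      proof (cases "cs = []")
        case True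
        then have "src a = tgt a" using cs by simp
        moreover from this have "lt (tgt m) (as @ ident (tgt a) # bs) (src n)"
          using h ident_in[OF aD(2)] by (auto simp: lt_append)
        ultimately show ?thesis
          using nrmD[OF bml_nrm[OF B h(1) refl] h(2)] True by (simp add: \<phi>_def)
      qed (simp add: \<phi>_def)
    qed
    ultimately show "B (m, as @ [a] @ bs, n) = 0"
      using cslot_words[OF sl h(5) refl refl refl] by simp
  qed
next
  assume "kills s (bar_rel_gens C M N) B"
  note K = this[unfolded kills_bar_rel_gens]
  note k = K[THEN conjunct1, rule_format] K[THEN conjunct2, THEN conjunct1, rule_format]
    K[THEN conjunct2, THEN conjunct2, THEN conjunct1, rule_format]
    K[THEN conjunct2, THEN conjunct2, THEN conjunct2, rule_format, OF conjI]
  show "bml B"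
  proof (rule bmlI)
    fix m assume m: "m \<in> mod_arrs C M"
    have "cslot (\<lambda>a. B (m, as @ a # bs, n)) (src a) (tgt a) (deg a)"
      if n: "n \<in> mod_arrs C N" and lt: "lt (tgt m) (as @ a # bs) (src n)" for as a bs n
    proof -
      have a: "a \<in> cobar_arrs C" using lt by (auto simp: lt_append)
      have in_gens: "(m, as @ [Arr (src a) (deg a) u (tgt a)] @ bs, n) \<in> bar_gens C M N"
        if "u \<in> cobar_hom C (src a) (tgt a) (deg a)" for u
        using m n lt that cobar_arrsD[OF a] by (auto simp: bar_gens_iff lt_append Arr_cobar_arrs)
      show ?thesis
        using k(3)[OF in_gens[OF cobar_hom_closed(1)]] k(4)[OF in_gens] cobar_rel_normal_rel
        by (auto simp: cslot_def)
    qed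
    moreover have "nlin (\<lambda>n. B (m, as, n)) (src n) (tgt n) (deg n)"
      if "n \<in> mod_arrs C N" "lt (tgt m) as (src n)" for as n
      using that m mod_arrsD(1,2)[OF that(1)] by (intro k(2)) (auto simp: bar_gens_iff zero_N)
    ultimately show "lml (tgt m) (\<lambda>as n. B (m, as, n))"
      by (simp add: lml_def lm_def)
    show "nrm (tgt m) (\<lambda>as n. B (m, as, n))"
      unfolding nrm_def
    proof (intro allI ballI impI)
      fix as y bs n assume n: "n \<in> mod_arrs C N" and lt: "lt (tgt m) (as @ ident y # bs) (src n)"
      then have "y \<in> points C" using cobar_arrsD(1)[of "ident y"] by (auto simp: lt_append)
      then show "B (m, as @ ident y # bs, n) = 0"
        using k(4)[of m as "ident y" bs n] m n lt ident_normal_rel by (simp add: bar_gens_iff)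
    qed
  next
    fix x y j as n
    assume "x \<in> points C" "y \<in> points C" "lt y as (src n)" "n \<in> mod_arrs C N"
    then show "mlin (\<lambda>m. B (m, as, n)) x y j"
      by (intro k(1)) (auto simp: bar_gens_iff zero_M)
  qed
qed

lemma qml_iff: "qml Q \<longleftrightarrow> kills s (q_rel_gens C M N) Q"
proof
  assume Q: "qml Q"
  show "kills s (q_rel_gens C M N) Q"
    unfolding kills_q_rel_gens q_gens_iff
    using qml_m[OF Q] qml_c[OF Q] qml_n[OF Q]
    by (auto dest: mod_arrsD(1,2) coalg_arrsD(3))
next
  assume "kills s (q_rel_gens C M N) Q"
  note K = this[unfolded kills_q_rel_gens q_gens_iff]
  note k = K[THEN conjunct1, rule_format] K[THEN conjunct2, THEN conjunct1, rule_format]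
    K[THEN conjunct2, THEN conjunct2, rule_format]
  show "qml Q"
    by (rule qmlI; rule k)
      (auto intro: zero_M zero_N zero_C dest: mod_arrsD(1,2) coalg_arrsD(1,2))
qed

subsection \<open>Degrees\<close>

definition bar_deg :: "int \<Rightarrow> ('k, 'c, 'm, 'n) bar_gen set" where
  "bar_deg d = {g \<in> gens (Bar C M N). gdeg (Bar C M N) g = d}"

definition q_deg :: "int \<Rightarrow> ('c, 'm, 'n) q_gen set" where
  "q_deg d = {g \<in> gens (Qcx C M N). gdeg (Qcx C M N) g = d}"

lemma bar_deg_iff:
  "(m, as, n) \<in> bar_deg d \<longleftrightarrow> m \<in> mod_arrs C M \<and> n \<in> mod_arrs C N \<and> lt (tgt m) as (src n)
     \<and> deg m + (\<Sum>a\<leftarrow>as. deg a + 1) + deg n = d"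
  by (simp add: bar_deg_def Bar_def bar_gens_iff)

lemma q_deg_iff:
  "(m, c, n) \<in> q_deg d \<longleftrightarrow> m \<in> mod_arrs C M \<and> c \<in> coalg_arrs C \<and> n \<in> mod_arrs C N
     \<and> tgt m = src c \<and> tgt c = src n \<and> deg m + deg c + deg n = d"
  by (auto simp: q_deg_def Qcx_def q_gens_iff)

lemma bar_diff_gen_deg:
  assumes "g \<in> bar_deg d"
  shows "bar_diff_gen C M N g \<in> fsums (bar_deg (d - 1))"
proof -
  obtain m as n where g: "g = (m, as, n)" by (rule prod_cases3)
  then have h: "m \<in> mod_arrs C M" "n \<in> mod_arrs C N" "lt (tgt m) as (src n)"
    and d: "deg m + (\<Sum>a\<leftarrow>as. deg a + 1) + deg n = d"
    using assms by (auto simp: bar_deg_iff)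
  have 1: "(dM m, as, n) \<in> bar_deg (d - 1)" "(m, as, dN n) \<in> bar_deg (d - 1)"
    using h d dM_in[OF h(1)] dN_in[OF h(2)] by (auto simp: bar_deg_iff)
  have 2: "(m, as[i := Da (as ! i)], n) \<in> bar_deg (d - 1)" if "i < length as" for i
    using h d unfolding upd_conv_take_nth_drop[OF that]
    by (subst (asm) (1 2) id_take_nth_drop[OF that]) (auto simp: bar_deg_iff lt_append intro: Da_in)
  have 3: "(m \<lhd> hd as, tl as, n) \<in> bar_deg (d - 1)" if "as \<noteq> []"
    using that h d by (cases as) (auto simp: bar_deg_iff intro: ra_in)
  have 4: "(m, butlast as, last as \<rhd> n) \<in> bar_deg (d - 1)" if "as \<noteq> []"
    using that h d by (cases as rule: rev_cases) (auto simp: bar_deg_iff lt_append intro: la_in)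
  have 5: "(m, take i as @ [(as ! i) \<odot> (as ! Suc i)] @ drop (i + 2) as, n) \<in> bar_deg (d - 1)" if "i < length as - 1" for i
  proof -
    obtain us a b vs where us: "us = take i as" "a = as ! i" "b = as ! Suc i" "vs = drop (i + 2) as" by blast
    have "as = us @ a # b # vs"
      using that unfolding us by (simp add: Cons_nth_drop_Suc)
    then have "lt (tgt m) (us @ a # b # vs) (src n)" "deg m + (\<Sum>a\<leftarrow>us @ a # b # vs. deg a + 1) + deg n = d"
      using h(3) d by simp_all
    then show ?thesis
      unfolding us[symmetric] using h by (auto simp: bar_deg_iff lt_append intro: cc_in)
  qed
  show ?thesis
    unfolding g bar_diff_gen_def bar_theta_def prod.case
    using 1 2 3 4 5 by (intro fsums_add fsums_diff fsums_sum fsums_fscale) (auto intro!: fsums_add fsums_diff fsums_sum fsums_fscale)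
qed

lemma q_diff_gen_deg:
  assumes "g \<in> q_deg d"
  shows "q_diff_gen C M N g \<in> fsums (q_deg (d - 1))"
proof -
  obtain m c n where g: "g = (m, c, n)" by (rule prod_cases3)
  then have h: "m \<in> mod_arrs C M" "c \<in> coalg_arrs C" "n \<in> mod_arrs C N" "tgt m = src c" "tgt c = src n"
    and d: "deg m + deg c + deg n = d"
    using assms by (auto simp: q_deg_iff)
  have 1: "(dM m, c, n) \<in> q_deg (d - 1)" "(m, c, dN n) \<in> q_deg (d - 1)"
    using h d dM_in[OF h(1)] dN_in[OF h(3)] by (auto simp: q_deg_iff)
  have 2: "(m, dC c, n) \<in> q_deg (d - 1)" if "deg c \<noteq> 0"
    using h d that dC_coalg_arrs[OF h(2)] coalg_arrsD(3)[OF h(2)] by (auto simp: q_deg_iff)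
  have 3: "(m \<lhd> br a, b, n) \<in> q_deg (d - 1)" "(m, a, br b \<rhd> n) \<in> q_deg (d - 1)"
    if "(a, b) \<in> Poly_Mapping.keys (sweedler C c)" for a b
    using splitsD[OF fsums_keysD[OF sweedler_spec(1)[OF h(2)] that]] h d
    by (auto simp: q_deg_iff intro: ra_in la_in br_in)
  show ?thesis
    unfolding g q_diff_gen_def prod.case
    using 1 2 3 by (auto intro!: fsums_add fsums_diff fsums_lext fsums_fscale)
qed

lemma letters_deg_split:
  assumes "i < length cs"
  shows "letters_deg cs = letters_deg (take i cs) + (deg (cs ! i) - 1) + letters_deg (drop (Suc i) cs)"
  by (subst id_take_nth_drop[OF assms]) (simp add: letters_deg_def)

lemma pi_gen_deg:
  assumes "g \<in> bar_deg d"
  shows "pi_gen M N g \<in> fsums (q_deg d)"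
proof -
  obtain m as n where g: "g = (m, as, n)" by (rule prod_cases3)
  then have h: "m \<in> mod_arrs C M" "n \<in> mod_arrs C N" "lt (tgt m) as (src n)"
    and d: "deg m + (\<Sum>a\<leftarrow>as. deg a + 1) + deg n = d"
    using assms by (auto simp: bar_deg_iff)
  note mD = mod_arrsD[OF h(1)]
  show ?thesis
  proof (cases as rule: remdups_adj.cases)
    case 1
    then show ?thesis
      using h d pt_coalg_arrs[OF mD(2)] unfolding g pi_gen_def by (auto simp: q_deg_iff)
  next
    case (2 a)
    then have a: "a \<in> cobar_arrs C" "tgt m = src a" "tgt a = src n" using h by auto
    have "pi_word M N m n w \<in> fsums (q_deg d)" if "w \<in> Poly_Mapping.keys (elt a)" for w
    proof -
      obtain x cs where w: "w = (x, cs)" by (rule prod.exhaust)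
      then have cs: "x = tgt m" "wd (tgt m) cs (src n)" "letters_deg cs = deg a"
        using cobar_hom_keysD[OF cobar_arrsD(3)[OF a(1)] that] a by auto
      have "(m \<lhd> mono_arr x (take i cs) (src (cs ! i)), cs ! i,
          mono_arr (tgt (cs ! i)) (drop (Suc i) cs) (src n) \<rhd> n) \<in> q_deg d" if "i < length cs" for i
      proof -
        have "cs ! i \<in> coalg_arrs C"
          using cs(2) that by (auto simp: wd_def cobar_words_def)
        then show ?thesis
          using h d 2 cs wd_take[OF cs(2) that] letters_deg_split[OF that]
          by (auto simp: q_deg_iff intro!: ra_in la_in mono_in)
      qed
      then show ?thesis unfolding w pi_word_def prod.case by (intro fsums_sum) auto
    qed
    then show ?thesis unfolding g pi_gen_def 2 by (auto intro: fsums_lext)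
  next
    case 3
    then show ?thesis unfolding g pi_gen_def by simp
  qed
qed

lemma cuts_deg: "cs \<in> cuts c \<Longrightarrow> (\<Sum>a\<leftarrow>map br cs. deg a + 1) = deg c"
  by (auto simp: cuts_def o_def)

lemma alpha_gen_deg:
  assumes "g \<in> q_deg d"
  shows "alpha_gen C g \<in> fsums (bar_deg d)"
proof -
  obtain m c n where g: "g = (m, c, n)" by (rule prod_cases3)
  then have h: "m \<in> mod_arrs C M" "c \<in> coalg_arrs C" "n \<in> mod_arrs C N" "tgt m = src c" "tgt c = src n"
    and d: "deg m + deg c + deg n = d"
    using assms by (auto simp: q_deg_iff)
  show ?thesis
  proof (cases "deg c = 0")
    case True
    have "fscale (counit C (elt c)) (gen (m, [], n)) \<in> fsums (bar_deg d)"
    proof (cases "src c = tgt c")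
      case eq: True
      then have "(m, [], n) \<in> bar_deg d" using h d True by (auto simp: bar_deg_iff)
      then show ?thesis by simp
    next
      case False
      then have "counit C (elt c) = 0"
        using degree_0_arr[OF h(2) True] lin_0[OF rm.module_axioms counit_lin] by simp
      then show ?thesis by simp
    qed
    then show ?thesis unfolding g alpha_gen_def using True by simp
  next
    case False
    then have c: "1 \<le> deg c" using coalg_arrsD(3)[OF h(2)] by simp
    have "(m, map br cs, n) \<in> bar_deg d" if "cs \<in> Poly_Mapping.keys (red_iter C k c)" for k cs
      using fsums_keysD[OF red_iter_in[OF h(2) c] that] h d cuts_lt(1)[of cs c] cuts_deg[of cs c]
      by (auto simp: bar_deg_iff)
    then show ?thesis
      unfolding g alpha_gen_def using False by (auto intro!: fsums_sum fsums_lext)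
  qed
qed

lemma H_gen_deg:
  assumes "g \<in> bar_deg d"
  shows "H_gen C M g \<in> fsums (bar_deg (d + 1))"
proof -
  obtain m as n where g: "g = (m, as, n)" by (rule prod_cases3)
  then have h: "m \<in> mod_arrs C M" "n \<in> mod_arrs C N" "lt (tgt m) as (src n)"
    and d: "deg m + (\<Sum>a\<leftarrow>as. deg a + 1) + deg n = d"
    using assms by (auto simp: bar_deg_iff)
  show ?thesis
  proof (cases as)
    case Nil
    then show ?thesis unfolding g H_gen_def by simp
  next
    case (Cons a W)
    then have a: "a \<in> cobar_arrs C" "tgt m = src a" "lt (tgt a) W (src n)" using h by auto
    have "H_word C M m (tgt a) W n w \<in> fsums (bar_deg (d + 1))" if "w \<in> Poly_Mapping.keys (elt a)" for w
    proof -
      obtain x cs where w: "w = (x, cs)" by (rule prod.exhaust)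
      then have cs: "x = tgt m" "wd (tgt m) cs (tgt a)" "letters_deg cs = deg a"
        using cobar_hom_keysD[OF cobar_arrsD(3)[OF a(1)] that] a by auto
      have "(m \<lhd> mono_arr x (take i cs) (src (cs ! i)), map br bs @ [mono_arr (tgt (cs ! i)) (drop (Suc i) cs) (tgt a)] @ W, n)
          \<in> bar_deg (d + 1)"
        if i: "i < length cs" and "bs \<in> Poly_Mapping.keys (red_iter C k (cs ! i))" for i k bs
      proof -
        have "cs ! i \<in> coalg_arrs C" "1 \<le> deg (cs ! i)"
          using cs(2) i by (auto simp: wd_def cobar_words_def)
        from fsums_keysD[OF red_iter_in[OF this] that(2)] have "bs \<in> cuts (cs ! i)" .
        then show ?thesis
          using h d Cons cs a wd_take[OF cs(2) i] letters_deg_split[OF i] cuts_lt(1)[of bs "cs ! i"] cuts_deg[of bs "cs ! i"]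
          by (auto simp: bar_deg_iff lt_append intro!: ra_in mono_in)
      qed
      then show ?thesis unfolding w H_word_def prod.case by (intro fsums_sum fsums_fscale fsums_lext fsums_gen) auto
    qed
    then show ?thesis unfolding g H_gen_def Cons by (auto intro: fsums_lext)
  qed
qed

end

theorem proposition16:
  fixes C :: "('k::comm_ring_1, 'c::ab_group_add) coalg"
    and M :: "('k, 'c, 'm::ab_group_add) rmod"
    and N :: "('k, 'c, 'n::ab_group_add) lmod"
  assumes "categorical_coalgebra C"
    and "right_dg_module C M"
    and "left_dg_module C N"
  shows "map_of_degree (-1) (Bar C M N) (Bar C M N) (bar_diff C M N)
    \<and> map_of_degree (-1) (Qcx C M N) (Qcx C M N) (q_diff C M N)
    \<and> map_of_degree 0 (Bar C M N) (Qcx C M N) (pi_map C M N)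
    \<and> map_of_degree 0 (Qcx C M N) (Bar C M N) (alpha_map C M N)
    \<and> map_of_degree 1 (Bar C M N) (Bar C M N) (H_map C M N)
    \<and> (\<forall>X \<in> qcarrier (Bar C M N).
         pi_map C M N (bar_diff C M N X) = q_diff C M N (pi_map C M N X))
    \<and> (\<forall>Y \<in> qcarrier (Qcx C M N).
         alpha_map C M N (q_diff C M N Y) = bar_diff C M N (alpha_map C M N Y))
    \<and> (\<forall>X \<in> qcarrier (Bar C M N).
         qadd (H_map C M N (bar_diff C M N X)) (bar_diff C M N (H_map C M N X))
         = qdiff (alpha_map C M N (pi_map C M N X)) X)"
proof -
  let ?R = "bar_rel_gens C M N" and ?S = "q_rel_gens C M N"
  let ?B = "\<lambda>g. cls ?R (gen g)" and ?Q = "\<lambda>g. cls ?S (gen g)"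
  \<comment> \<open>The identities for \<alpha> and the homotopy take values in classes of bar
    generators, the one for \<pi> in classes of generators of \<Q>; hence two instances with
    different targets.\<close>
  interpret b: bar_context C M N "qscale :: 'k \<Rightarrow> (('k, 'c, 'm, 'n) bar_gen, 'k) quot \<Rightarrow> _"
    by (intro bar_context.intro assms qs.module_axioms)
  interpret q: bar_context C M N "qscale :: 'k \<Rightarrow> (('c, 'm, 'n) q_gen, 'k) quot \<Rightarrow> _"
    by (intro bar_context.intro assms qs.module_axioms)
  \<comment> \<open>From here on the test functions are the universal ones, so the contravariant
    identities read as equations of classes.\<close>
  have B: "b.bml ?B" unfolding b.bml_iff by (rule kills_cls)
  have Q: "q.qml ?Q" unfolding q.qml_iff by (rule kills_cls)
  have v: "cls ?R (bar_diff_gen C M N g) = b.bd ?B g" "cls ?S (q_diff_gen C M N h) = q.qd ?Q h"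
    "cls ?S (pi_gen M N g) = q.BP ?Q g" "cls ?R (alpha_gen C h) = b.AB ?B h" "cls ?R (H_gen C M g) = b.HB ?B g" for g h
    by (cases g, simp only: cls_lext[of _ "bar_diff_gen C M N _"] b.lext_bar_diff)
      (simp_all only: cls_lext[of _ "q_diff_gen C M N _"] cls_lext[of _ "pi_gen M N _"] cls_lext[of _ "alpha_gen C _"]
        cls_lext[of _ "H_gen C M _"] q.lext_q_diff b.lext_alpha q.BP_def b.HB_def)
  have kd: "kills qscale ?R (\<lambda>g. cls ?R (bar_diff_gen C M N g))"
    unfolding v b.bml_iff[symmetric] by (rule b.bml_bd[OF B])
  have kq: "kills qscale ?S (\<lambda>g. cls ?S (q_diff_gen C M N g))"
    unfolding v q.qml_iff[symmetric] by (rule q.qml_qd[OF Q])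
  have kp: "kills qscale ?R (\<lambda>g. cls ?S (pi_gen M N g))"
    unfolding v q.bml_iff[symmetric] by (rule q.bml_BP[OF Q])
  have ka: "kills qscale ?S (\<lambda>g. cls ?R (alpha_gen C g))"
    unfolding v b.qml_iff[symmetric] by (rule b.qml_AB[OF B])
  have kH: "kills qscale ?R (\<lambda>g. cls ?R (H_gen C M g))"
    unfolding v b.bml_iff[symmetric] by (rule b.bml_HB[OF B])
  note maps = bar_diff_def q_diff_def pi_map_def alpha_map_def H_map_def
  note cl = qmap_qclass[OF rels_Bar rels_Bar kd] qmap_qclass[OF rels_Qcx rels_Qcx kq]
    qmap_qclass[OF rels_Bar rels_Qcx kp] qmap_qclass[OF rels_Qcx rels_Bar ka]
    qmap_qclass[OF rels_Bar rels_Bar kH]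
  have lext_diff: "lext qscale F (bar_diff_gen C M N g) = b.bd F g" "lext qscale G (bar_diff_gen C M N g) = q.bd G g" for F G g
    by (cases g; simp only: b.lext_bar_diff q.lext_bar_diff)+
  note ext = qs.hom_lext[OF cls_hom] v qs.lext_lext lext_diff b.lext_q_diff q.lext_q_diff b.lext_alpha
    b.BP_def[symmetric] q.BP_def[symmetric] b.HB_def[symmetric]
  \<comment> \<open>The identities of functions hold at composable generators only, which is why
    \<open>t\<close> has to be supported on the generators; linear extension over its keys then
    gives the congruence.\<close>
  have eqs:
    "cls ?S (fext (pi_gen M N) (fext (bar_diff_gen C M N) t)) = cls ?S (fext (q_diff_gen C M N) (fext (pi_gen M N) t))"
    "cls ?R (fext (H_gen C M) (fext (bar_diff_gen C M N) t) + fext (bar_diff_gen C M N) (fext (H_gen C M) t))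
      = cls ?R (fext (alpha_gen C) (fext (pi_gen M N) t) - t)"
    if "t \<in> fsums (gens (Bar C M N))" for t
  proof -
    have keys: "m \<in> mod_arrs C M" "n \<in> mod_arrs C N" "b.lt (tgt m) as (src n)"
      if "(m, as, n) \<in> Poly_Mapping.keys t" for m as n
      using fsums_keysD[OF \<open>t \<in> _\<close> that] by (auto simp: Bar_def b.bar_gens_iff)
    have "lext qscale (q.bd (q.BP ?Q)) t = lext qscale (q.BP (q.qd ?Q)) t"
      by (rule qs.lext_cong) (use q.BP_bd[OF Q] keys in \<open>auto\<close>)
    then show "cls ?S (fext (pi_gen M N) (fext (bar_diff_gen C M N) t)) = cls ?S (fext (q_diff_gen C M N) (fext (pi_gen M N) t))"
      by (simp only: ext)
    have "lext qscale (\<lambda>g. b.bd (b.HB ?B) g + b.HB (b.bd ?B) g) t = lext qscale (\<lambda>g. b.BP (b.AB ?B) g - ?B g) t"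
      by (rule qs.lext_cong) (use b.homotopy[OF B] keys in \<open>auto\<close>)
    then show "cls ?R (fext (H_gen C M) (fext (bar_diff_gen C M N) t) + fext (bar_diff_gen C M N) (fext (H_gen C M) t))
      = cls ?R (fext (alpha_gen C) (fext (pi_gen M N) t) - t)"
      by (simp only: ext module_hom.add[OF cls_hom] module_hom.diff[OF cls_hom] qs.lext_fun_add qs.lext_fun_diff
        cls_lext[of ?R t])
  qed
  have eq_alpha: "cls ?R (fext (alpha_gen C) (fext (q_diff_gen C M N) t)) = cls ?R (fext (bar_diff_gen C M N) (fext (alpha_gen C) t))"
    if "t \<in> fsums (gens (Qcx C M N))" for t
  proof -
    have "lext qscale (b.qd (b.AB ?B)) t = lext qscale (b.AB (b.bd ?B)) t"
      by (rule qs.lext_cong)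
        (use b.AB_bd[OF B] fsums_keysD[OF that] in \<open>auto simp: Qcx_def b.q_gens_iff\<close>)
    then show ?thesis by (simp only: ext)
  qed
  show ?thesis
    unfolding maps
  proof (intro conjI ballI)
    show "map_of_degree (-1) (Bar C M N) (Bar C M N) (qmap (Bar C M N) (bar_diff_gen C M N))"
      by (rule map_of_degreeI[OF rels_Bar rels_Bar kd])
        (use b.bar_diff_gen_deg in \<open>simp add: b.bar_deg_def\<close>)
    show "map_of_degree (-1) (Qcx C M N) (Qcx C M N) (qmap (Qcx C M N) (q_diff_gen C M N))"
      by (rule map_of_degreeI[OF rels_Qcx rels_Qcx kq])
        (use b.q_diff_gen_deg in \<open>simp add: b.q_deg_def\<close>)
    show "map_of_degree 0 (Bar C M N) (Qcx C M N) (qmap (Qcx C M N) (pi_gen M N))"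
      by (rule map_of_degreeI[OF rels_Bar rels_Qcx kp])
        (use b.pi_gen_deg in \<open>simp add: b.q_deg_def b.bar_deg_def\<close>)
    show "map_of_degree 0 (Qcx C M N) (Bar C M N) (qmap (Bar C M N) (alpha_gen C))"
      by (rule map_of_degreeI[OF rels_Qcx rels_Bar ka])
        (use b.alpha_gen_deg in \<open>simp add: b.q_deg_def b.bar_deg_def\<close>)
    show "map_of_degree 1 (Bar C M N) (Bar C M N) (qmap (Bar C M N) (H_gen C M))"
      by (rule map_of_degreeI[OF rels_Bar rels_Bar kH])
        (use b.H_gen_deg in \<open>simp add: b.bar_deg_def\<close>)
  next
    fix X assume "X \<in> qcarrier (Bar C M N)"
    then obtain t where t: "t \<in> fsums (gens (Bar C M N))" "X = qclass (Bar C M N) t" by (auto simp: qcarrier_def)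
    show "qmap (Qcx C M N) (pi_gen M N) (qmap (Bar C M N) (bar_diff_gen C M N) X)
        = qmap (Qcx C M N) (q_diff_gen C M N) (qmap (Qcx C M N) (pi_gen M N) X)"
      unfolding t(2) cl by (rule qclass_eqI[OF rels_Qcx eqs(1)[OF t(1)]])
    show "qadd (qmap (Bar C M N) (H_gen C M) (qmap (Bar C M N) (bar_diff_gen C M N) X))
          (qmap (Bar C M N) (bar_diff_gen C M N) (qmap (Bar C M N) (H_gen C M) X))
        = qdiff (qmap (Bar C M N) (alpha_gen C) (qmap (Qcx C M N) (pi_gen M N) X)) X"
      unfolding t(2) cl qadd_qclass[OF rels_Bar] qdiff_qclass[OF rels_Bar]
      by (rule qclass_eqI[OF rels_Bar eqs(2)[OF t(1)]])
  next
    fix Y assume "Y \<in> qcarrier (Qcx C M N)"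
    then obtain t where t: "t \<in> fsums (gens (Qcx C M N))" "Y = qclass (Qcx C M N) t" by (auto simp: qcarrier_def)
    show "qmap (Bar C M N) (alpha_gen C) (qmap (Qcx C M N) (q_diff_gen C M N) Y)
        = qmap (Bar C M N) (bar_diff_gen C M N) (qmap (Bar C M N) (alpha_gen C) Y)"
      unfolding t(2) cl by (rule qclass_eqI[OF rels_Bar eq_alpha[OF t(1)]])
  qed
qed

end
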